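(* Assume that, for $j=1,2$, $D_-$, $A_j$, $n_j$ satisfy Condition N (nontrapping bound, defined in the context), and that, for $j=1,2$, $D_-$, $A_j$, $n_j$, $h$ and $p$ satisfy Condition F (accuracy of the finite-element solution, defined in the context). Given $k_0>0$, let $$C_1:=C^{(1)}_{\rm FEM2}+\frac{1}{\min\{A_{1,\min},n_{1,\min}\}}\Big(\frac1{k_0}+2C^{(1)}_{\rm bound}n_{1,\max}\Big),\qquad C_2:=C^{(1)}_{\rm FEM1}+C^{(1)}_{\rm bound},$$ and let $s_+$, $m_\pm$ be the norm-equivalence constants defined in the context (all of these constants are independent of $k$ and $h$). If $$C_1\Big(\frac{s_+}{m_-}\Big)\frac1h\,\|A_1-A_2\|_{L^\infty(D;\mathrm{op})}+C_2\Big(\frac{m_+}{m_-}\Big)k\,\|n_1-n_2\|_{L^\infty(D;\mathbb R)}\le\tfrac12\qquad\text{for all }k\ge k_0,$$ then standard GMRES (working in the Euclidean norm and inner product) applied to either of the equations $$(\mathbf A_1)^{-1}\mathbf A_2\mathbf u=(\mathbf A_1)^{-1}\mathbf f\qquad\text{or}\qquad \mathbf A_2(\mathbf A_1)^{-1}\mathbf v=\mathbf f,$$ with initial guess the zero vector, converges in a $k$-independent number of iterations for all $k\ge k_0$.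
   Context: **Domain and coefficients.** Let $d\in\{2,3\}$ and let $k>0$. $D_-\subset\mathbb R^d$ is a bounded Lipschitz open set (possibly empty) such that $D_+:=\mathbb R^d\setminus\overline{D_-}$ is connected; $\widetilde D$ is a bounded connected Lipschitz open set with $\overline{D_-}\subset\subset\widetilde D$; $D:=\widetilde D\setminus\overline{D_-}$, $\Gamma_D:=\partial D_-$, $\Gamma_I:=\partial\widetilde D$. $\mathsf{SPD}$ is the set of real symmetric positive-definite $d\times d$ matrices and $L^\infty(D;\mathsf{SPD})$ is the set of $\mathsf{SPD}$-valued functions with $L^\infty$ entries. For $j=1,2$: $n_j\in L^\infty(D;\mathbb R)$ with $\operatorname{supp}(1-n_j)\subset\subset\widetilde D$ and $0<n_{j,\min}\le n_j(\mathbf x)\le n_{j,\max}<\infty$ a.e. in $D$; $A_j\in L^\infty(D;\mathsf{SPD})$ with $\operatorname{supp}(I-A_j)\subset\subset\widetilde D$ and $0<A_{j,\min}|\boldsymbol\xi|^2\le (A_j(\mathbf x)\boldsymbol\xi)\cdot\overline{\boldsymbol\xi}\le A_{j,\max}|\boldsymbol\xi|^2$ for all nonzero $\boldsymbol\xi\in\mathbb C^d$ and a.e. $\mathbf x\in D$ ($A_{j,\max}<\infty$). Here $\|A\|_{L^\infty(D;\mathrm{op})}:=\operatorname{ess\,sup}_{\mathbf x\in D}\|A(\mathbf x)\|_2$, with $\|\cdot\|_2$ the spectral norm. **Variational problem.** $\gamma$ is the Dirichlet trace and $H^1_{0,D}(D):=\{v\in H^1(D):\gamma v=0\text{ on }\Gamma_D\}$.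 The operator $T:H^{1/2}(\Gamma_I)\to H^{-1/2}(\Gamma_I)$ is either multiplication by $\mathrm i k$ or the Dirichlet-to-Neumann map $\mathrm{DtN}$ for $\Delta u+k^2u=0$ in the exterior of $\widetilde D$ with the Sommerfeld radiation condition ($\partial u/\partial r-\mathrm iku=o(r^{-(d-1)/2})$ as $r=\|\mathbf x\|_2\to\infty$, uniformly in direction). Set $$a_j(w,v):=\int_D\big((A_j\nabla w)\cdot\overline{\nabla v}-k^2n_jw\overline v\big)-\langle T\gamma w,\gamma v\rangle_{\Gamma_I}.$$ The variational problem with data $F\in(H^1_{0,D}(D))^*$ is: find $u\in H^1_{0,D}(D)$ with $a_j(u,v)=F(v)$ for all $v\in H^1_{0,D}(D)$. Norms: $\|v\|^2_{H^1_k(D)}:=\|\nabla v\|^2_{L^2(D)}+k^2\|v\|^2_{L^2(D)}$ and $\|F\|_{(H^1_k(D))^*}:=\sup_{v\in H^1_{0,D}(D)}|F(v)|/\|v\|_{H^1_k(D)}$. **Finite elements.** $(V_{h,p})_{h>0}$ are the subspaces of continuous piecewise polynomials of fixed degree $p$ on a quasi-uniform family of simplicial meshes of mesh-size $h$ (contained in $H^1_{0,D}(D)$; $h$ may depend on $k$), with real-valued nodal basis $\{\phi_i\}_{i=1}^N$. The finite-element approximation is $u_h\in V_{h,p}$ with $a_j(u_h,v_h)=F(v_h)$ for all $v_h\in V_{h,p}$. Matrices: $(\mathbf S_A)_{ij}:=\int_D(A\nabla\phi_j)\cdot\nabla\phi_i$, $(\mathbf M_n)_{ij}:=\int_Dn\phi_i\phi_j$,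 $(\mathbf N)_{ij}:=\int_{\Gamma_I}T(\gamma\phi_j)\gamma\phi_i$, $\mathbf A_j:=\mathbf S_{A_j}-k^2\mathbf M_{n_j}-\mathbf N$. $\mathbf f$ is the load vector, $(\mathbf f)_i=F(\phi_i)$ (nonzero). **Norm-equivalence constants.** $m_\pm>0$ and $s_+>0$ are constants independent of $h$ (but dependent on $p$) such that for all $v_h=\sum_iv_i\phi_i\in V_{h,p}$ with coefficient vector $\mathbf v$: $m_-h^{d/2}\|\mathbf v\|_2\le\|v_h\|_{L^2(D)}\le m_+h^{d/2}\|\mathbf v\|_2$ and $\|\nabla v_h\|_{L^2(D)}\le s_+h^{d/2-1}\|\mathbf v\|_2$. **Condition N** (for $D_-,A_j,n_j$). For every $f\in L^2(D)$ the solution $u$ of the variational problem with $F(v)=\int_Df\overline v$ exists, is unique, and, given $k_0>0$, satisfies $\|u\|_{H^1_k(D)}\le C^{(j)}_{\rm bound}\|f\|_{L^2(D)}$ for all $k\ge k_0$, where $C_{\rm bound}^{(j)}$ is independent of $k$ (but depends on $A_j,n_j,D,k_0$). **Condition F** (for $D_-,A_j,n_j,h,p$). Given $k_0>0$: Part 1: whenever $f=\widetilde n\sum_i\alpha_i\phi_i$ with $\alpha_i\in\mathbb C$, $\widetilde n\in L^\infty(D;\mathbb R)$, then for all $k\ge k_0$ the finite-element approximation $u_h$ with $F(v)=\int_Df\overline v$ exists and is unique, and $\|u-u_h\|_{H^1_k(D)}\le C^{(j)}_{\rm FEM1}\|f\|_{L^2(D)}$. Part 2: whenever $F(v)=(\widetilde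 A\nabla\widetilde f,\nabla v)_{L^2(D)}$ with $\widetilde A\in L^\infty(D;\mathsf{SPD})$, $\widetilde f=\sum_i\alpha_i\phi_i$, $\alpha_i\in\mathbb C$, then for all $k\ge k_0$ $u_h$ exists and is unique, and $\|u-u_h\|_{H^1_k(D)}\le C^{(j)}_{\rm FEM2}\,k\,\|F\|_{(H^1_k(D))^*}$. The constants $C^{(j)}_{\rm FEM1},C^{(j)}_{\rm FEM2}$ are independent of $k$ and $h$ (but depend on $A_j,n_j,D,k_0,p$). **GMRES.** For $\mathbf C\mathbf x=\mathbf d$ with $\mathbf C\in\mathbb C^{N\times N}$ invertible, initial guess $\mathbf x^0=\mathbf 0$, $\mathbf r^0:=\mathbf C\mathbf x^0-\mathbf d$, $\mathcal K^m:=\operatorname{span}\{\mathbf C^i\mathbf r^0:i=0,\dots,m-1\}$, the $m$th iterate of standard GMRES is the $\mathbf x^m\in\mathcal K^m$ minimising $\|\mathbf C\mathbf x-\mathbf d\|_2$ over $\mathbf x\in\mathcal K^m$. GMRES applied to $\mathbf C\mathbf u=\mathbf f$ with zero starting guess (in the norm $\|\cdot\|=\|\cdot\|_2$) *converges in a $k$-independent number of iterations* if, given $\varepsilon>0$ and $k_0>0$, there exist $c_1(\varepsilon,k_0)>0$ and $c_2(k_0)>0$, both independent of $k,h,p$, such that $m\ge c_1$ implies $\|\mathbf u^m-\mathbf u\|/\|\mathbf u\|\le c_2\varepsilon$ for all $k\ge k_0$. *)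

theory Defs
  imports
    "HOL-Analysis.Analysis"
    "HOL-Probability.Essential_Supremum"
    "Jordan_Normal_Form.Gauss_Jordan_Elimination"
begin

text \<open>
  The ambient space is \<open>real ^ 'n\<close> with \<open>CARD('n) = d\<close>. Equivalence classes of functions are
  represented by their members: elements of Lebesgue and Sobolev spaces are total functions of
  which only the values almost everywhere on the relevant set matter. Finite-element matrices,
  whose size varies with the mesh, are matrices of Jordan_Normal_Form.
\<close>

section \<open>Surface measure\<close>

definition hausdorff_premeasure :: "real \<Rightarrow> real \<Rightarrow> 'a::metric_space set \<Rightarrow> ennreal" where
  "hausdorff_premeasure s \<delta> A =
     (INF U \<in> {U :: nat \<Rightarrow> 'a set. A \<subseteq> (\<Union>i. U i) \<and> (\<forall>i. bounded (U i) \<and> diameter (U i) \<le> \<delta>)}.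
        (\<Sum>i. ennreal (unit_ball_vol s / 2 powr s * diameter (U i) powr s)))"

definition hausdorff_outer :: "real \<Rightarrow> 'a::metric_space set \<Rightarrow> ennreal" where
  "hausdorff_outer s A = (SUP \<delta> \<in> {0<..}. hausdorff_premeasure s \<delta> A)"

definition hausdorff_measure :: "real \<Rightarrow> 'a::metric_space measure" where
  "hausdorff_measure s = measure_of UNIV (sets borel) (hausdorff_outer s)"

text \<open>The normalisation above makes the \<open>(d-1)\<close>-dimensional measure agree with surface area.\<close>

definition surface :: "(real ^ 'n::finite) set \<Rightarrow> (real ^ 'n) measure" where
  "surface \<Gamma> = restrict_space (hausdorff_measure (real CARD('n) - 1)) \<Gamma>"

section \<open>Lipschitz open sets\<close>

text \<open>Near every boundary point the set is, for some unit vector \<open>e\<close>, the part lying below the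
  graph of a Lipschitz function on the hyperplane orthogonal to \<open>e\<close>.\<close>

definition lipschitz_open :: "(real ^ 'n::finite) set \<Rightarrow> bool" where
  "lipschitz_open U \<longleftrightarrow> open U \<and>
     (\<forall>x \<in> frontier U. \<exists>e r L. \<exists>g :: real ^ 'n \<Rightarrow> real.
        norm e = 1 \<and> 0 < r \<and> L-lipschitz_on {z. z \<bullet> e = 0} g \<and>
        U \<inter> ball x r = {y \<in> ball x r. y \<bullet> e < g (y - (y \<bullet> e) *\<^sub>R e)})"

definition compactly_contained :: "'a::topological_space set \<Rightarrow> 'a set \<Rightarrow> bool" where
  "compactly_contained S U \<longleftrightarrow> compact (closure S) \<and> closure S \<subseteq> U"

text \<open>\<open>Dm\<close> is the obstacle and \<open>Dt\<close> the truncating set; the computational domain is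
  \<open>dom_D Dm Dt\<close>, with boundary parts \<open>frontier Dm\<close> and \<open>frontier Dt\<close>.\<close>

definition geometry :: "(real ^ 'n::finite) set \<Rightarrow> (real ^ 'n) set \<Rightarrow> bool" where
  "geometry Dm Dt \<longleftrightarrow>
     bounded Dm \<and> lipschitz_open Dm \<and> connected (- closure Dm) \<and>
     bounded Dt \<and> Dt \<noteq> {} \<and> connected Dt \<and> lipschitz_open Dt \<and>
     compactly_contained Dm Dt"

definition dom_D :: "(real ^ 'n::finite) set \<Rightarrow> (real ^ 'n) set \<Rightarrow> (real ^ 'n) set" where
  "dom_D Dm Dt = Dt - closure Dm"

section \<open>Lebesgue and Sobolev spaces\<close>

definition L2 :: "'a measure \<Rightarrow> ('a \<Rightarrow> 'b::euclidean_space) set" where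
  "L2 M = {f \<in> borel_measurable M. integrable M (\<lambda>x. (norm (f x))\<^sup>2)}"

definition L2_norm :: "'a measure \<Rightarrow> ('a \<Rightarrow> 'b::euclidean_space) \<Rightarrow> real" where
  "L2_norm M f = sqrt (\<integral>x. (norm (f x))\<^sup>2 \<partial>M)"

definition Linf :: "(real ^ 'n::finite) set \<Rightarrow> (real ^ 'n \<Rightarrow> real) set" where
  "Linf U = {f \<in> borel_measurable (lebesgue_on U). \<exists>B. AE x in lebesgue_on U. \<bar>f x\<bar> \<le> B}"

definition Linf_norm :: "(real ^ 'n::finite) set \<Rightarrow> (real ^ 'n \<Rightarrow> real) \<Rightarrow> real" where
  "Linf_norm U f = real_of_ereal (esssup (lebesgue_on U) (\<lambda>x. ereal \<bar>f x\<bar>))"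

primrec Ck_on :: "nat \<Rightarrow> 'a::real_normed_vector set \<Rightarrow> ('a \<Rightarrow> 'b::real_normed_vector) \<Rightarrow> bool" where
  "Ck_on 0 U f \<longleftrightarrow> continuous_on U f"
| "Ck_on (Suc m) U f \<longleftrightarrow> (\<forall>x\<in>U. f differentiable (at x)) \<and>
     (\<forall>v. Ck_on m U (\<lambda>x. frechet_derivative f (at x) v))"

text \<open>Infinitely differentiable functions whose support is a compact subset of the open set \<open>U\<close>.\<close>

definition test_functions ::
  "(real ^ 'n::finite) set \<Rightarrow> (real ^ 'n \<Rightarrow> 'b::real_normed_vector) set" where
  "test_functions U = {\<theta>. (\<forall>m. Ck_on m UNIV \<theta>) \<and> compactly_contained {x. \<theta> x \<noteq> 0} U}"

abbreviation partial :: "'n::finite \<Rightarrow> (real ^ 'n \<Rightarrow> 'b::real_normed_vector) \<Rightarrow> real ^ 'n \<Rightarrow> 'b" where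
  "partial i f x \<equiv> frechet_derivative f (at x) (axis i 1)"

definition is_weak_grad ::
  "(real ^ 'n::finite) set \<Rightarrow> (real ^ 'n \<Rightarrow> complex) \<Rightarrow> (real ^ 'n \<Rightarrow> complex ^ 'n) \<Rightarrow> bool" where
  "is_weak_grad U u g \<longleftrightarrow> g \<in> L2 (lebesgue_on U) \<and>
     (\<forall>\<theta> :: real ^ 'n \<Rightarrow> real. \<theta> \<in> test_functions U \<longrightarrow>
        (\<forall>i. (\<integral>x. u x * complex_of_real (partial i \<theta> x) \<partial>lebesgue_on U) =
             - (\<integral>x. (g x $ i) * complex_of_real (\<theta> x) \<partial>lebesgue_on U)))"

definition H1 :: "(real ^ 'n::finite) set \<Rightarrow> (real ^ 'n \<Rightarrow> complex) set" where
  "H1 U = {u \<in> L2 (lebesgue_on U). \<exists>g. is_weak_grad U u g}"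

definition wgrad :: "(real ^ 'n::finite) set \<Rightarrow> (real ^ 'n \<Rightarrow> complex) \<Rightarrow> real ^ 'n \<Rightarrow> complex ^ 'n" where
  "wgrad U u = (SOME g. is_weak_grad U u g)"

definition H1k_norm :: "real \<Rightarrow> (real ^ 'n::finite) set \<Rightarrow> (real ^ 'n \<Rightarrow> complex) \<Rightarrow> real" where
  "H1k_norm k U v =
     sqrt ((L2_norm (lebesgue_on U) (wgrad U v))\<^sup>2 + k\<^sup>2 * (L2_norm (lebesgue_on U) v)\<^sup>2)"

text \<open>\<open>\<phi>\<close> is the Dirichlet trace of \<open>v\<close> on the part \<open>\<Gamma>\<close> of the boundary of \<open>U\<close>. The trace operator is
  the continuous extension of restriction to \<open>\<Gamma>\<close> from smooth functions, which are dense in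
  \<open>H1 U\<close> for Lipschitz \<open>U\<close>, and this is its graph.\<close>

definition trace_on ::
  "(real ^ 'n::finite) set \<Rightarrow> (real ^ 'n) set \<Rightarrow> (real ^ 'n \<Rightarrow> complex) \<Rightarrow> (real ^ 'n \<Rightarrow> complex) \<Rightarrow> bool"
where
  "trace_on U \<Gamma> v \<phi> \<longleftrightarrow> v \<in> H1 U \<and> \<phi> \<in> L2 (surface \<Gamma>) \<and>
     (\<exists>w :: nat \<Rightarrow> real ^ 'n \<Rightarrow> complex. (\<forall>j. w j \<in> test_functions UNIV) \<and>
        (\<lambda>j. H1k_norm 1 U (\<lambda>x. w j x - v x)) \<longlonglongrightarrow> 0 \<and>
        (\<lambda>j. L2_norm (surface \<Gamma>) (\<lambda>x. w j x - \<phi> x)) \<longlonglongrightarrow> 0)"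

definition dtrace :: "(real ^ 'n::finite) set \<Rightarrow> (real ^ 'n \<Rightarrow> complex) \<Rightarrow> real ^ 'n \<Rightarrow> complex" where
  "dtrace U v = (SOME \<phi>. trace_on U (frontier U) v \<phi>)"

definition H10D :: "(real ^ 'n::finite) set \<Rightarrow> (real ^ 'n) set \<Rightarrow> (real ^ 'n \<Rightarrow> complex) set" where
  "H10D Dm Dt = {v \<in> H1 (dom_D Dm Dt). \<exists>\<phi>. trace_on (dom_D Dm Dt) (frontier (dom_D Dm Dt)) v \<phi> \<and>
     (AE x in surface (frontier Dm). \<phi> x = 0)}"

text \<open>The trace space of \<open>H1 Dt\<close>, that is, \<open>H\<close> to the power \<open>1/2\<close> on \<open>frontier Dt\<close>.\<close>

definition H_half :: "(real ^ 'n::finite) set \<Rightarrow> (real ^ 'n \<Rightarrow> complex) set" where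
  "H_half Dt = {\<phi>. \<exists>w. trace_on Dt (frontier Dt) w \<phi>}"

section \<open>Coefficients\<close>

definition ess_supp :: "(real ^ 'n::finite) set \<Rightarrow> (real ^ 'n \<Rightarrow> 'b::zero) \<Rightarrow> (real ^ 'n) set" where
  "ess_supp D f = {x. \<forall>U. open U \<and> x \<in> U \<longrightarrow> \<not> (AE y in lebesgue_on D. y \<in> U \<longrightarrow> f y = 0)}"

definition cvec_cnj :: "complex ^ 'n::finite \<Rightarrow> complex ^ 'n" where
  "cvec_cnj \<xi> = (\<chi> i. cnj (\<xi> $ i))"

text \<open>The dot product is bilinear; conjugations are written explicitly.\<close>

definition cdot :: "complex ^ 'n::finite \<Rightarrow> complex ^ 'n \<Rightarrow> complex" where
  "cdot \<xi> \<eta> = (\<Sum>i\<in>UNIV. \<xi> $ i * \<eta> $ i)"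

definition cmat :: "real ^ 'n::finite ^ 'n \<Rightarrow> complex ^ 'n ^ 'n" where
  "cmat A = (\<chi> i j. complex_of_real (A $ i $ j))"

definition SPD :: "(real ^ 'n::finite ^ 'n) set" where
  "SPD = {A. Finite_Cartesian_Product.transpose A = A \<and> (\<forall>\<xi>. \<xi> \<noteq> 0 \<longrightarrow> 0 < (A *v \<xi>) \<bullet> \<xi>)}"

definition Linf_SPD :: "(real ^ 'n::finite) set \<Rightarrow> (real ^ 'n \<Rightarrow> real ^ 'n ^ 'n) set" where
  "Linf_SPD U = {A. (\<forall>i j. (\<lambda>x. A x $ i $ j) \<in> Linf U) \<and> (AE x in lebesgue_on U. A x \<in> SPD)}"

definition Linf_op_norm :: "(real ^ 'n::finite) set \<Rightarrow> (real ^ 'n \<Rightarrow> real ^ 'n ^ 'n) \<Rightarrow> real" where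
  "Linf_op_norm U A = Linf_norm U (\<lambda>x. onorm (\<lambda>\<xi>. A x *v \<xi>))"

definition admissible_n ::
  "(real ^ 'n::finite) set \<Rightarrow> (real ^ 'n) set \<Rightarrow> (real ^ 'n \<Rightarrow> real) \<Rightarrow> real \<Rightarrow> real \<Rightarrow> bool" where
  "admissible_n Dm Dt n nmin nmax \<longleftrightarrow>
     n \<in> Linf (dom_D Dm Dt) \<and>
     compactly_contained (ess_supp (dom_D Dm Dt) (\<lambda>x. 1 - n x)) Dt \<and>
     0 < nmin \<and> (AE x in lebesgue_on (dom_D Dm Dt). nmin \<le> n x \<and> n x \<le> nmax)"

definition admissible_A ::
  "(real ^ 'n::finite) set \<Rightarrow> (real ^ 'n) set \<Rightarrow> (real ^ 'n \<Rightarrow> real ^ 'n ^ 'n) \<Rightarrow> real \<Rightarrow> real \<Rightarrow> bool" where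
  "admissible_A Dm Dt A Amin Amax \<longleftrightarrow>
     A \<in> Linf_SPD (dom_D Dm Dt) \<and>
     compactly_contained (ess_supp (dom_D Dm Dt) (\<lambda>x. Finite_Cartesian_Product.mat 1 - A x)) Dt \<and>
     0 < Amin \<and>
     (AE x in lebesgue_on (dom_D Dm Dt). \<forall>\<xi> :: complex ^ 'n. \<xi> \<noteq> 0 \<longrightarrow>
        Amin * (norm \<xi>)\<^sup>2 \<le> Re (cdot (cmat (A x) *v \<xi>) (cvec_cnj \<xi>)) \<and>
        Re (cdot (cmat (A x) *v \<xi>) (cvec_cnj \<xi>)) \<le> Amax * (norm \<xi>)\<^sup>2)"

section \<open>The boundary operator\<close>

text \<open>An operator from \<open>H_half Dt\<close> to its dual is represented by its duality pairing:
  \<open>T \<phi> \<psi>\<close> stands for \<open>\<langle>T \<phi>, \<psi>\<rangle>\<close>, the extension of the integral of \<open>T \<phi>\<close> times the conjugate of \<open>\<psi>\<close>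
  over \<open>frontier Dt\<close>.\<close>

type_synonym 'n boundary_op = "(real ^ 'n \<Rightarrow> complex) \<Rightarrow> (real ^ 'n \<Rightarrow> complex) \<Rightarrow> complex"

definition is_impedance :: "real \<Rightarrow> (real ^ 'n::finite) set \<Rightarrow> 'n boundary_op \<Rightarrow> bool" where
  "is_impedance k Dt T \<longleftrightarrow> (\<forall>\<phi> \<in> H_half Dt. \<forall>\<psi> \<in> H_half Dt.
     T \<phi> \<psi> = (\<integral>x. (\<i> * complex_of_real k * \<phi> x) * cnj (\<psi> x) \<partial>surface (frontier Dt)))"

definition cgrad :: "(real ^ 'n::finite \<Rightarrow> complex) \<Rightarrow> real ^ 'n \<Rightarrow> complex ^ 'n" where
  "cgrad u x = (\<chi> i. partial i u x)"

definition radiating :: "real \<Rightarrow> (real ^ 'n::finite \<Rightarrow> complex) \<Rightarrow> bool" where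
  "radiating k u \<longleftrightarrow> (\<forall>\<epsilon>>0. \<exists>R>0. \<forall>x. R \<le> norm x \<longrightarrow>
     cmod (frechet_derivative u (at x) (x /\<^sub>R norm x) - \<i> * complex_of_real k * u x)
       \<le> \<epsilon> * norm x powr (- (real CARD('n) - 1) / 2))"

text \<open>Helmholtz solutions are smooth, so the equation is imposed classically; the solution is
  \<open>H1\<close> up to \<open>frontier Dt\<close> on bounded parts of the exterior.\<close>

definition exterior_solution ::
  "real \<Rightarrow> (real ^ 'n::finite) set \<Rightarrow> (real ^ 'n \<Rightarrow> complex) \<Rightarrow> (real ^ 'n \<Rightarrow> complex) \<Rightarrow> bool" where
  "exterior_solution k Dt \<phi> u \<longleftrightarrow>
     Ck_on 2 (- closure Dt) u \<and>
     (\<forall>x \<in> - closure Dt. (\<Sum>i\<in>UNIV. partial i (partial i u) x) + (complex_of_real k)\<^sup>2 * u x = 0) \<and>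
     radiating k u \<and>
     (\<forall>R. closure Dt \<subseteq> ball 0 R \<longrightarrow> trace_on (- closure Dt \<inter> ball 0 R) (frontier Dt) u \<phi>)"

text \<open>\<open>T \<phi>\<close> is the normal derivative, with normal pointing out of \<open>Dt\<close>, of the exterior
  solution with trace \<open>\<phi>\<close>. The normal derivative is the usual weak one, given by Green's identity
  with an arbitrary boundedly supported extension \<open>v\<close> of \<open>\<psi>\<close> to the exterior; the
  minus sign appears because the normal points into the exterior.\<close>

definition is_DtN :: "real \<Rightarrow> (real ^ 'n::finite) set \<Rightarrow> 'n boundary_op \<Rightarrow> bool" where
  "is_DtN k Dt T \<longleftrightarrow> (\<forall>\<phi> \<in> H_half Dt. \<exists>u. exterior_solution k Dt \<phi> u \<and>
     (\<forall>\<psi> \<in> H_half Dt. \<forall>v. bounded {x. v x \<noteq> 0} \<and> trace_on (- closure Dt) (frontier Dt) v \<psi> \<longrightarrow>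
        T \<phi> \<psi> = - (\<integral>x. (cdot (cgrad u x) (cvec_cnj (wgrad (- closure Dt) v x))
                        - (complex_of_real k)\<^sup>2 * u x * cnj (v x)) \<partial>lebesgue_on (- closure Dt))))"

section \<open>The variational problem\<close>

definition helmholtz_form ::
  "real \<Rightarrow> (real ^ 'n::finite) set \<Rightarrow> (real ^ 'n) set \<Rightarrow> 'n boundary_op \<Rightarrow>
   (real ^ 'n \<Rightarrow> real ^ 'n ^ 'n) \<Rightarrow> (real ^ 'n \<Rightarrow> real) \<Rightarrow>
   (real ^ 'n \<Rightarrow> complex) \<Rightarrow> (real ^ 'n \<Rightarrow> complex) \<Rightarrow> complex" where
  "helmholtz_form k Dm Dt T A n w v = (let D = dom_D Dm Dt in
     (\<integral>x. (cdot (cmat (A x) *v wgrad D w x) (cvec_cnj (wgrad D v x))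
           - complex_of_real (k\<^sup>2 * n x) * w x * cnj (v x)) \<partial>lebesgue_on D)
     - T (dtrace D w) (dtrace D v))"

text \<open>\<open>W\<close> is either \<open>H10D Dm Dt\<close> or a finite-element space.\<close>

definition solves ::
  "(real ^ 'n::finite \<Rightarrow> complex) set \<Rightarrow>
   ((real ^ 'n \<Rightarrow> complex) \<Rightarrow> (real ^ 'n \<Rightarrow> complex) \<Rightarrow> complex) \<Rightarrow>
   ((real ^ 'n \<Rightarrow> complex) \<Rightarrow> complex) \<Rightarrow> (real ^ 'n \<Rightarrow> complex) \<Rightarrow> bool" where
  "solves W a F u \<longleftrightarrow> u \<in> W \<and> (\<forall>v \<in> W. a u v = F v)"

definition solves_uniquely ::
  "(real ^ 'n::finite) set \<Rightarrow> (real ^ 'n \<Rightarrow> complex) set \<Rightarrow>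
   ((real ^ 'n \<Rightarrow> complex) \<Rightarrow> (real ^ 'n \<Rightarrow> complex) \<Rightarrow> complex) \<Rightarrow>
   ((real ^ 'n \<Rightarrow> complex) \<Rightarrow> complex) \<Rightarrow> (real ^ 'n \<Rightarrow> complex) \<Rightarrow> bool" where
  "solves_uniquely D W a F u \<longleftrightarrow> solves W a F u \<and>
     (\<forall>u'. solves W a F u' \<longrightarrow> (AE x in lebesgue_on D. u' x = u x))"

definition L2_functional ::
  "(real ^ 'n::finite) set \<Rightarrow> (real ^ 'n \<Rightarrow> complex) \<Rightarrow> (real ^ 'n \<Rightarrow> complex) \<Rightarrow> complex" where
  "L2_functional D f v = (\<integral>x. f x * cnj (v x) \<partial>lebesgue_on D)"

definition grad_functional ::
  "(real ^ 'n::finite) set \<Rightarrow> (real ^ 'n \<Rightarrow> real ^ 'n ^ 'n) \<Rightarrow> (real ^ 'n \<Rightarrow> complex) \<Rightarrow>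
   (real ^ 'n \<Rightarrow> complex) \<Rightarrow> complex" where
  "grad_functional D A f v =
     (\<integral>x. cdot (cmat (A x) *v wgrad D f x) (cvec_cnj (wgrad D v x)) \<partial>lebesgue_on D)"

text \<open>As the form is sesquilinear, data are bounded antilinear functionals.\<close>

definition H10D_dual ::
  "(real ^ 'n::finite) set \<Rightarrow> (real ^ 'n) set \<Rightarrow> ((real ^ 'n \<Rightarrow> complex) \<Rightarrow> complex) set" where
  "H10D_dual Dm Dt = {F.
     (\<forall>v \<in> H10D Dm Dt. \<forall>w \<in> H10D Dm Dt. F (\<lambda>x. v x + w x) = F v + F w) \<and>
     (\<forall>c. \<forall>v \<in> H10D Dm Dt. F (\<lambda>x. c * v x) = cnj c * F v) \<and>
     (\<exists>B. \<forall>v \<in> H10D Dm Dt. cmod (F v) \<le> B * H1k_norm 1 (dom_D Dm Dt) v)}"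

definition dual_norm ::
  "real \<Rightarrow> (real ^ 'n::finite) set \<Rightarrow> (real ^ 'n) set \<Rightarrow> ((real ^ 'n \<Rightarrow> complex) \<Rightarrow> complex) \<Rightarrow> real" where
  "dual_norm k Dm Dt F = (SUP v \<in> H10D Dm Dt. cmod (F v) / H1k_norm k (dom_D Dm Dt) v)"

section \<open>Finite elements\<close>

definition poly_fun :: "nat \<Rightarrow> (real ^ 'n::finite \<Rightarrow> complex) set" where
  "poly_fun p = {q. \<exists>c :: ('n \<Rightarrow> nat) \<Rightarrow> complex. \<forall>x.
     q x = (\<Sum>\<alpha> | sum \<alpha> UNIV \<le> p. c \<alpha> * complex_of_real (\<Prod>i\<in>UNIV. (x $ i) ^ \<alpha> i))}"

definition simplicial_mesh :: "(real ^ 'n::finite) set \<Rightarrow> (real ^ 'n) set set \<Rightarrow> bool" where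
  "simplicial_mesh D \<K> \<longleftrightarrow>
     triangulation \<K> \<and> (\<forall>K \<in> \<K>. int CARD('n) simplex K) \<and> \<Union>\<K> = closure D"

text \<open>A family of meshes indexed by the set \<open>H\<close> of mesh-sizes.\<close>

definition quasi_uniform_family ::
  "(real ^ 'n::finite) set \<Rightarrow> real set \<Rightarrow> (real \<Rightarrow> (real ^ 'n) set set) \<Rightarrow> bool" where
  "quasi_uniform_family D H \<K> \<longleftrightarrow>
     H \<subseteq> {0<..} \<and>
     (\<forall>h \<in> H. simplicial_mesh D (\<K> h) \<and> Max (diameter ` \<K> h) = h) \<and>
     (\<exists>\<rho>>0. \<forall>h \<in> H. \<forall>K \<in> \<K> h. \<exists>x. ball x (\<rho> * h) \<subseteq> K)"

definition fe_space ::
  "nat \<Rightarrow> (real ^ 'n::finite) set \<Rightarrow> (real ^ 'n) set \<Rightarrow> (real ^ 'n) set set \<Rightarrow> (real ^ 'n \<Rightarrow> complex) set" where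
  "fe_space p Dm Dt \<K> = {v \<in> H10D Dm Dt. continuous_on (closure (dom_D Dm Dt)) v \<and>
     (\<forall>K \<in> \<K>. \<exists>q \<in> poly_fun p. \<forall>x \<in> K. v x = q x)}"

definition fe_fun :: "nat \<Rightarrow> (nat \<Rightarrow> real ^ 'n::finite \<Rightarrow> real) \<Rightarrow> (nat \<Rightarrow> complex) \<Rightarrow> real ^ 'n \<Rightarrow> complex" where
  "fe_fun N \<phi> c x = (\<Sum>i<N. c i * complex_of_real (\<phi> i x))"

abbreviation cbasis :: "(nat \<Rightarrow> real ^ 'n::finite \<Rightarrow> real) \<Rightarrow> nat \<Rightarrow> real ^ 'n \<Rightarrow> complex" where
  "cbasis \<phi> i \<equiv> (\<lambda>x. complex_of_real (\<phi> i x))"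

definition nodal_basis ::
  "(real ^ 'n::finite) set \<Rightarrow> (real ^ 'n \<Rightarrow> complex) set \<Rightarrow> nat \<Rightarrow> (nat \<Rightarrow> real ^ 'n \<Rightarrow> real) \<Rightarrow> bool" where
  "nodal_basis D V N \<phi> \<longleftrightarrow>
     (\<forall>i<N. cbasis \<phi> i \<in> V) \<and>
     (\<exists>z. (\<forall>j<N. z j \<in> closure D) \<and> (\<forall>i<N. \<forall>j<N. \<phi> i (z j) = (if i = j then 1 else 0))) \<and>
     (\<forall>v \<in> V. \<exists>c. \<forall>x \<in> closure D. v x = fe_fun N \<phi> c x)"

definition stiffness_mat ::
  "(real ^ 'n::finite) set \<Rightarrow> (real ^ 'n \<Rightarrow> real ^ 'n ^ 'n) \<Rightarrow> nat \<Rightarrow> (nat \<Rightarrow> real ^ 'n \<Rightarrow> real) \<Rightarrow> complex mat" where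
  "stiffness_mat D A N \<phi> = Matrix.mat N N (\<lambda>(i, j).
     \<integral>x. cdot (cmat (A x) *v wgrad D (cbasis \<phi> j) x) (wgrad D (cbasis \<phi> i) x) \<partial>lebesgue_on D)"

definition mass_mat ::
  "(real ^ 'n::finite) set \<Rightarrow> (real ^ 'n \<Rightarrow> real) \<Rightarrow> nat \<Rightarrow> (nat \<Rightarrow> real ^ 'n \<Rightarrow> real) \<Rightarrow> complex mat" where
  "mass_mat D n N \<phi> = Matrix.mat N N (\<lambda>(i, j).
     \<integral>x. complex_of_real (n x * \<phi> i x * \<phi> j x) \<partial>lebesgue_on D)"

text \<open>No conjugate is needed in the second argument, the basis functions being real.\<close>

definition boundary_mat ::
  "(real ^ 'n::finite) set \<Rightarrow> 'n boundary_op \<Rightarrow> nat \<Rightarrow> (nat \<Rightarrow> real ^ 'n \<Rightarrow> real) \<Rightarrow> complex mat" where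
  "boundary_mat D T N \<phi> = Matrix.mat N N (\<lambda>(i, j). T (dtrace D (cbasis \<phi> j)) (dtrace D (cbasis \<phi> i)))"

definition galerkin_mat ::
  "real \<Rightarrow> (real ^ 'n::finite) set \<Rightarrow> 'n boundary_op \<Rightarrow> (real ^ 'n \<Rightarrow> real ^ 'n ^ 'n) \<Rightarrow>
   (real ^ 'n \<Rightarrow> real) \<Rightarrow> nat \<Rightarrow> (nat \<Rightarrow> real ^ 'n \<Rightarrow> real) \<Rightarrow> complex mat" where
  "galerkin_mat k D T A n N \<phi> =
     stiffness_mat D A N \<phi> - (complex_of_real k)\<^sup>2 \<cdot>\<^sub>m mass_mat D n N \<phi> - boundary_mat D T N \<phi>"

definition load_vec ::
  "nat \<Rightarrow> (nat \<Rightarrow> real ^ 'n::finite \<Rightarrow> real) \<Rightarrow> ((real ^ 'n \<Rightarrow> complex) \<Rightarrow> complex) \<Rightarrow> complex Matrix.vec" where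
  "load_vec N \<phi> F = Matrix.vec N (\<lambda>i. F (cbasis \<phi> i))"

definition euclid_norm :: "complex Matrix.vec \<Rightarrow> real" where
  "euclid_norm v = sqrt (\<Sum>i<dim_vec v. (cmod (vec_index v i))\<^sup>2)"

definition norm_equivalence ::
  "(real ^ 'n::finite) set \<Rightarrow> real set \<Rightarrow> (real \<Rightarrow> nat) \<Rightarrow> (real \<Rightarrow> nat \<Rightarrow> real ^ 'n \<Rightarrow> real) \<Rightarrow>
   real \<Rightarrow> real \<Rightarrow> real \<Rightarrow> bool" where
  "norm_equivalence D H N \<phi> m_minus m_plus s_plus \<longleftrightarrow>
     0 < m_minus \<and> 0 < m_plus \<and> 0 < s_plus \<and>
     (\<forall>h \<in> H. \<forall>c.
        let vh = fe_fun (N h) (\<phi> h) c; nc = euclid_norm (Matrix.vec (N h) c); d = real CARD('n) in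
        m_minus * h powr (d / 2) * nc \<le> L2_norm (lebesgue_on D) vh \<and>
        L2_norm (lebesgue_on D) vh \<le> m_plus * h powr (d / 2) * nc \<and>
        L2_norm (lebesgue_on D) (wgrad D vh) \<le> s_plus * h powr (d / 2 - 1) * nc)"

section \<open>Conditions N and F\<close>

text \<open>The boundary operator and the coefficients are families in \<open>k\<close>; \<open>C\<close>, \<open>C1\<close>, \<open>C2\<close> are the
  constants of the conditions and do not depend on \<open>k\<close>.\<close>

definition condition_N ::
  "(real ^ 'n::finite) set \<Rightarrow> (real ^ 'n) set \<Rightarrow> (real \<Rightarrow> 'n boundary_op) \<Rightarrow>
   (real \<Rightarrow> real ^ 'n \<Rightarrow> real ^ 'n ^ 'n) \<Rightarrow> (real \<Rightarrow> real ^ 'n \<Rightarrow> real) \<Rightarrow> real \<Rightarrow> real \<Rightarrow> bool" where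
  "condition_N Dm Dt T A n k0 C \<longleftrightarrow> (let D = dom_D Dm Dt in
     \<forall>k\<ge>k0. \<forall>f \<in> L2 (lebesgue_on D). \<exists>u.
       solves_uniquely D (H10D Dm Dt) (helmholtz_form k Dm Dt (T k) (A k) (n k)) (L2_functional D f) u \<and>
       H1k_norm k D u \<le> C * L2_norm (lebesgue_on D) f)"

text \<open>\<open>h k\<close> is the mesh-size used at wavenumber \<open>k\<close>, and \<open>V\<close>, \<open>N\<close>, \<open>\<phi>\<close> are indexed by mesh-size.\<close>

definition condition_F ::
  "(real ^ 'n::finite) set \<Rightarrow> (real ^ 'n) set \<Rightarrow> (real \<Rightarrow> 'n boundary_op) \<Rightarrow>
   (real \<Rightarrow> real ^ 'n \<Rightarrow> real ^ 'n ^ 'n) \<Rightarrow> (real \<Rightarrow> real ^ 'n \<Rightarrow> real) \<Rightarrow>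
   (real \<Rightarrow> (real ^ 'n \<Rightarrow> complex) set) \<Rightarrow> (real \<Rightarrow> nat) \<Rightarrow> (real \<Rightarrow> nat \<Rightarrow> real ^ 'n \<Rightarrow> real) \<Rightarrow>
   (real \<Rightarrow> real) \<Rightarrow> real \<Rightarrow> real \<Rightarrow> real \<Rightarrow> bool" where
  "condition_F Dm Dt T A n V N \<phi> h k0 C1 C2 \<longleftrightarrow> (let D = dom_D Dm Dt in
     (\<forall>k\<ge>k0. \<forall>n' \<in> Linf D. \<forall>\<alpha>.
        let a = helmholtz_form k Dm Dt (T k) (A k) (n k);
            f = (\<lambda>x. complex_of_real (n' x) * fe_fun (N (h k)) (\<phi> (h k)) \<alpha> x);
            F = L2_functional D f in
        \<exists>u uh. solves (H10D Dm Dt) a F u \<and> solves_uniquely D (V (h k)) a F uh \<and>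
          H1k_norm k D (\<lambda>x. u x - uh x) \<le> C1 * L2_norm (lebesgue_on D) f) \<and>
     (\<forall>k\<ge>k0. \<forall>A' \<in> Linf_SPD D. \<forall>\<alpha>.
        let a = helmholtz_form k Dm Dt (T k) (A k) (n k);
            F = grad_functional D A' (fe_fun (N (h k)) (\<phi> (h k)) \<alpha>) in
        \<exists>u uh. solves (H10D Dm Dt) a F u \<and> solves_uniquely D (V (h k)) a F uh \<and>
          H1k_norm k D (\<lambda>x. u x - uh x) \<le> C2 * k * dual_norm k Dm Dt F))"

section \<open>GMRES\<close>

definition krylov :: "complex mat \<Rightarrow> complex Matrix.vec \<Rightarrow> nat \<Rightarrow> complex Matrix.vec set" where
  "krylov C r m = {x. \<exists>c :: nat \<Rightarrow> complex. x =
     Matrix.vec (dim_vec r) (\<lambda>l. \<Sum>i<m. c i * vec_index ((C ^\<^sub>m i) *\<^sub>v r) l)}"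

definition gmres_iterate :: "complex mat \<Rightarrow> complex Matrix.vec \<Rightarrow> nat \<Rightarrow> complex Matrix.vec" where
  "gmres_iterate C d m =
     arg_min_on (\<lambda>x. euclid_norm (C *\<^sub>v x - d)) (krylov C (C *\<^sub>v 0\<^sub>v (dim_col C) - d) m)"

definition gmres_error_le :: "complex mat \<Rightarrow> complex Matrix.vec \<Rightarrow> nat \<Rightarrow> real \<Rightarrow> bool" where
  "gmres_error_le C d m \<tau> \<longleftrightarrow> invertible_mat C \<and>
     (\<forall>u \<in> carrier_vec (dim_col C). C *\<^sub>v u = d \<longrightarrow>
        euclid_norm (gmres_iterate C d m - u) / euclid_norm u \<le> \<tau>)"

abbreviation inv_mat :: "complex mat \<Rightarrow> complex mat" where
  "inv_mat A \<equiv> the (mat_inverse A)"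

end

theory Submission
  imports Defs "Jordan_Normal_Form.Determinant"
begin

text \<open>
  Both preconditioned matrices differ from the identity by a contraction of rate \<open>1 / sqrt 2\<close>, so the
  residual of GMRES, which is at most that of the Richardson iteration, decays geometrically.

  Writing \<open>M1\<close> and \<open>M2\<close> for the two Galerkin matrices, \<open>M1\<close> inverse times \<open>M1 - M2\<close> maps the
  coefficients of a finite-element function \<open>f\<close> to those of the Galerkin solution with coefficients
  \<open>A1\<close>, \<open>n1\<close> and data \<open>div ((A1 - A2) grad f)\<close> and \<open>k\<^sup>2 (n1 - n2) f\<close>. The second datum is covered by
  Condition F, part 1, and Condition N. Part 2 of Condition F requires a positive definite matrix, so
  \<open>A1 - A2\<close> is split into two positive definite parts, at the cost of the factor \<open>sqrt 2\<close>; the exact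
  solution for the resulting data is bounded in \<open>L2\<close> by duality from Condition N. The duality argument,
  and the passage from one preconditioned matrix to the transpose of the other, rest on the
  complex symmetry of the form. For the Dirichlet-to-Neumann map this is Green's identity for two
  exterior solutions: by the radiation condition the flux of \<open>w \<nabla>u - u \<nabla>w\<close> through large spheres
  tends to zero, and it does not depend on the sphere. That the boundary operator may be evaluated on
  traces at all requires their uniqueness, which is proved by integration along the direction
  of a Lipschitz graph.
\<close>

section \<open>Smooth functions and cutoffs\<close>

text \<open>The constant \<open>m_minus\<close> compares coefficient vectors with the L2 norm, so
  Galerkin solutions have to be bounded in L2. For data in the dual space duality bounds the exact
  solution there with the constant of Condition N, and CFEM2 + Cbound is at most the constant in
  front of \<open>A1 - A2\<close> in the hypothesis, because the upper bound of \<open>n1\<close> is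
  at least the minimum in its denominator. The hypothesis leaves the slack 1/2, so the factor sqrt 2
  of the splitting still gives a rate q below one. Passing from residuals to errors costs (1 + q) /
  (1 - q), which is at most 6. No sign is prescribed for the constants of the two conditions. The
  sign of CFEM2 + Cbound is the delicate one: it rests on a finite-element function whose gradient
  is not zero. Weak gradients and traces are chosen representatives, so that linear relations
  between them hold only almost everywhere. The Dirichlet-to-Neumann map is given by pairings with
  extensions of its second argument; its linearity in the first argument is obtained from symmetry
  and from antilinearity in the second.\<close>

abbreviation leb :: "'a::euclidean_space set \<Rightarrow> 'a measure" where
  "leb \<equiv> lebesgue_on"

abbreviation fderiv :: "('a::real_normed_vector \<Rightarrow> 'b::real_normed_vector) \<Rightarrow> 'a \<Rightarrow> 'a \<Rightarrow> 'b" where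
  "fderiv f x \<equiv> frechet_derivative f (at x)"

abbreviation cpx :: "real \<Rightarrow> complex" where
  "cpx \<equiv> complex_of_real"

abbreviation norm2 :: "'a::euclidean_space set \<Rightarrow> ('a \<Rightarrow> 'b::euclidean_space) \<Rightarrow> real" where
  "norm2 U \<equiv> L2_norm (leb U)"

lemma Ck_on_cong:
  assumes "open U" "\<And>x. x \<in> U \<Longrightarrow> f x = g x"
  shows "Ck_on m U f \<Longrightarrow> Ck_on m U g"
  using assms(2)
proof (induction m arbitrary: f g)
  case 0
  then show ?case by (simp cong: continuous_on_cong)
next
  case (Suc m)
  have fd: "fderiv f x = fderiv g x" if "x \<in> U" for x
    using frechet_derivative_transform_within_open[OF _ assms(1) that Suc.prems(2)] Suc.prems(1) that by auto
  have "g differentiable (at x)" if "x \<in> U" for x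
  proof -
    from Suc.prems(1) that obtain D where "(f has_derivative D) (at x)"
      by (auto simp: differentiable_def)
    then have "(g has_derivative D) (at x)"
      by (rule has_derivative_transform_within_open[OF _ assms(1) that]) (use Suc.prems(2) in auto)
    then show ?thesis by (auto simp: differentiable_def)
  qed
  moreover have "Ck_on m U (\<lambda>x. fderiv g x v)" for v
    using Suc.IH[of "\<lambda>x. fderiv f x v" "\<lambda>x. fderiv g x v"] Suc.prems(1) fd by simp
  ultimately show ?case by simp
qed

lemma Ck_on_subset: "Ck_on m U f \<Longrightarrow> V \<subseteq> U \<Longrightarrow> Ck_on m V f"
  by (induction m arbitrary: f) (auto intro: continuous_on_subset)

lemma Ck_on_imp_continuous_on: "open U \<Longrightarrow> Ck_on m U f \<Longrightarrow> continuous_on U f"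
  by (cases m) (auto intro!: continuous_at_imp_continuous_on differentiable_imp_continuous_within)

lemma Ck_on_Suc_imp: "open U \<Longrightarrow> Ck_on (Suc m) U f \<Longrightarrow> Ck_on m U f"
proof (induction m arbitrary: f)
  case 0
  then show ?case using Ck_on_imp_continuous_on[OF 0] by simp
next
  case (Suc m)
  then show ?case by auto
qed

text \<open>\<open>Ck_on\<close> speaks of the chosen \<open>frechet_derivative\<close>. Derivatives
  are unique, so an explicit formula may take its place; most of the closure properties below go
  through this rule.\<close>

lemma Ck_on_SucI:
  assumes "open U" "\<And>x. x \<in> U \<Longrightarrow> (f has_derivative f' x) (at x)" "\<And>v. Ck_on m U (\<lambda>x. f' x v)"
  shows "Ck_on (Suc m) U f"
proof -
  have "fderiv f x = f' x" if "x \<in> U" for x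
    using frechet_derivative_at[OF assms(2)[OF that]] by simp
  then show ?thesis
    using assms Ck_on_cong[OF assms(1), of "\<lambda>x. f' x v" "\<lambda>x. fderiv f x v" m for v]
    by (auto simp: differentiable_def)
qed

lemma Ck_on_SucD:
  assumes "Ck_on (Suc m) U f" "x \<in> U"
  shows "(f has_derivative fderiv f x) (at x)"
  using assms frechet_derivative_works by auto

lemma Ck_on_const: "open U \<Longrightarrow> Ck_on m U (\<lambda>x. c)"
proof (induction m arbitrary: c)
  case (Suc m)
  show ?case by (rule Ck_on_SucI[where f' = "\<lambda>x v. 0"]) (use Suc in auto)
qed simp

lemma Ck_on_bounded_linear:
  assumes "bounded_linear L" "open U" "Ck_on m U f"
  shows "Ck_on m U (\<lambda>x. L (f x))"
  using assms(3)
proof (induction m arbitrary: f)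
  case 0
  then show ?case using assms(1) by (simp add: bounded_linear.continuous_on)
next
  case (Suc m)
  show ?case
  proof (rule Ck_on_SucI[OF assms(2), where f' = "\<lambda>x v. L (fderiv f x v)"])
    fix x assume "x \<in> U"
    then show "((\<lambda>x. L (f x)) has_derivative (\<lambda>v. L (fderiv f x v))) (at x)"
      using bounded_linear.has_derivative[OF assms(1) Ck_on_SucD[OF Suc.prems]] by blast
  next
    fix v show "Ck_on m U (\<lambda>x. L (fderiv f x v))"
      using Suc by simp
  qed
qed

lemma Ck_on_linear:
  assumes "bounded_linear L" "open U"
  shows "Ck_on m U L"
proof (cases m)
  case 0
  then show ?thesis using assms by (simp add: linear_continuous_on)
next
  case (Suc m)
  then show ?thesis using Ck_on_SucI[OF assms(2), where f' = "\<lambda>x. L" and f=L] bounded_linear_imp_has_derivative[OF assms(1)]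
    Ck_on_const[OF assms(2)] by auto
qed

lemma Ck_on_add:
  assumes "open U" "Ck_on m U f" "Ck_on m U g"
  shows "Ck_on m U (\<lambda>x. f x + g x)"
  using assms(2-)
proof (induction m arbitrary: f g)
  case 0
  then show ?case by (simp add: continuous_on_add)
next
  case (Suc m)
  show ?case
    by (rule Ck_on_SucI[OF assms(1), where f' = "\<lambda>x v. fderiv f x v + fderiv g x v"])
      (use Suc in \<open>auto intro!: has_derivative_add Ck_on_SucD\<close>)
qed

lemma Ck_on_sum: "open U \<Longrightarrow> (\<And>i. i \<in> I \<Longrightarrow> Ck_on m U (f i)) \<Longrightarrow> Ck_on m U (\<lambda>x. \<Sum>i\<in>I. f i x)"
  by (induction I rule: infinite_finite_induct) (auto intro!: Ck_on_add Ck_on_const)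

lemma Ck_on_bilinear:
  assumes "bounded_bilinear B" "open U" "Ck_on m U f" "Ck_on m U g"
  shows "Ck_on m U (\<lambda>x. B (f x) (g x))"
  using assms(3-)
proof (induction m arbitrary: f g)
  case 0
  then show ?case using bounded_bilinear.continuous_on[OF assms(1)] by auto
next
  case (Suc m)
  show ?case
  proof (rule Ck_on_SucI[OF assms(2), where f' = "\<lambda>x v. B (f x) (fderiv g x v) + B (fderiv f x v) (g x)"])
    fix x assume "x \<in> U"
    then show "((\<lambda>x. B (f x) (g x)) has_derivative (\<lambda>v. B (f x) (fderiv g x v) + B (fderiv f x v) (g x))) (at x)"
      using bounded_bilinear.FDERIV[OF assms(1) Ck_on_SucD[OF Suc.prems(1)] Ck_on_SucD[OF Suc.prems(2)]] by blast
  next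
    fix v show "Ck_on m U (\<lambda>x. B (f x) (fderiv g x v) + B (fderiv f x v) (g x))"
      using Suc.prems Ck_on_Suc_imp[OF assms(2) Suc.prems(1)] Ck_on_Suc_imp[OF assms(2) Suc.prems(2)]
      by (intro Ck_on_add assms Suc.IH) auto
  qed
qed

lemmas Ck_on_mult = Ck_on_bilinear[OF bounded_bilinear_mult]
lemmas Ck_on_scaleR = Ck_on_bilinear[OF bounded_bilinear_scaleR]
lemmas Ck_on_inner = Ck_on_bilinear[OF bounded_bilinear_inner]

lemma Ck_on_prod:
  fixes f :: "'i \<Rightarrow> 'a::real_normed_vector \<Rightarrow> 'b::{real_normed_algebra,comm_ring_1}"
  shows "open U \<Longrightarrow> (\<And>i. i \<in> I \<Longrightarrow> Ck_on m U (f i)) \<Longrightarrow> Ck_on m U (\<lambda>x. \<Prod>i\<in>I. f i x)"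
  by (induction I rule: infinite_finite_induct) (auto intro!: Ck_on_mult Ck_on_const)

lemma Ck_on_inverse:
  fixes f :: "'a::real_normed_vector \<Rightarrow> real"
  assumes "open U" "Ck_on m U f" "\<And>x. x \<in> U \<Longrightarrow> f x \<noteq> 0"
  shows "Ck_on m U (\<lambda>x. inverse (f x))"
  using assms(2)
proof (induction m)
  case 0
  then show ?case using assms(3) by (auto intro: continuous_on_inverse)
next
  case (Suc m)
  show ?case
  proof (rule Ck_on_SucI[OF assms(1), where f' = "\<lambda>x v. (-1) * (inverse (f x) * fderiv f x v * inverse (f x))"])
    fix x assume "x \<in> U"
    then show "((\<lambda>x. inverse (f x)) has_derivative (\<lambda>v. (-1) * (inverse (f x) * fderiv f x v * inverse (f x)))) (at x)"
      using Deriv.has_derivative_inverse[OF assms(3) Ck_on_SucD[OF Suc.prems], of x] by simp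
  next
    fix v show "Ck_on m U (\<lambda>x. (-1) * (inverse (f x) * fderiv f x v * inverse (f x)))"
      using Suc.prems Suc.IH Ck_on_Suc_imp[OF assms(1) Suc.prems(1)]
      by (intro Ck_on_mult assms Ck_on_const) auto
  qed
qed

section \<open>Smooth transitions and cutoffs\<close>

definition flat_exp :: "nat \<Rightarrow> real \<Rightarrow> real" where
  "flat_exp n t = (if t \<le> 0 then 0 else inverse t ^ n * exp (- inverse t))"

lemma flat_exp_tendsto_0: "(flat_exp n \<longlongrightarrow> 0) (at 0)"
proof -
  have "((\<lambda>t::real. inverse t ^ n * exp (- inverse t)) \<longlongrightarrow> 0) (at_right 0)"
    by real_asymp
  then have "(flat_exp n \<longlongrightarrow> 0) (at_right 0)"
    by (rule Lim_transform_eventually) (auto simp: flat_exp_def eventually_at_filter)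
  moreover have "(flat_exp n \<longlongrightarrow> 0) (at_left 0)"
    by (rule Lim_transform_eventually[OF tendsto_const]) (auto simp: flat_exp_def eventually_at_filter)
  ultimately show ?thesis by (simp add: filterlim_split_at)
qed

text \<open>Indexing by the power of \<open>inverse t\<close> makes the family closed under
  differentiation up to linear combinations, so that one induction with varying n shows all members
  to be smooth.\<close>

lemma flat_exp_deriv:
  "(flat_exp n has_real_derivative flat_exp (n + 2) t - real n * flat_exp (n + 1) t) (at t)"
proof (cases t "0::real" rule: linorder_cases)
  case less
  have "((\<lambda>t. 0) has_real_derivative 0) (at t)" by simp
  then have "(flat_exp n has_real_derivative 0) (at t)"
    by (rule has_field_derivative_transform_within_open[of _ _ _ "{..<0}"]) (use less in \<open>auto simp: flat_exp_def\<close>)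
  then show ?thesis using less by (simp add: flat_exp_def)
next
  case greater
  have i: "((\<lambda>t. inverse t) has_real_derivative - (inverse t * inverse t)) (at t)"
    using DERIV_inverse[of t] greater by (simp add: power2_eq_square)
  have "((\<lambda>t. inverse t ^ n) has_real_derivative - real n * inverse t ^ (n+1)) (at t)"
  proof (cases n)
    case (Suc k)
    show ?thesis
      using DERIV_power_Suc[OF i, of k] Suc by (simp add: algebra_simps)
  qed simp
  from DERIV_mult[OF this DERIV_exp[THEN DERIV_chain2, OF DERIV_minus[OF i]]]
  have "((\<lambda>t. inverse t ^ n * exp (- inverse t)) has_real_derivative
     inverse t ^ (n+2) * exp (- inverse t) - real n * (inverse t ^ (n+1) * exp (- inverse t))) (at t)"
    by (simp add: algebra_simps)
  then have "(flat_exp n has_real_derivative inverse t ^ (n+2) * exp (- inverse t) - real n * (inverse t ^ (n+1) * exp (- inverse t))) (at t)"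
    by (rule has_field_derivative_transform_within_open[of _ _ _ "{0<..}"]) (use greater in \<open>auto simp: flat_exp_def\<close>)
  then show ?thesis using greater by (simp add: flat_exp_def)
next
  case equal
  \<comment> \<open>At zero the difference quotient of \<open>flat_exp n\<close> is
    \<open>flat_exp (Suc n)\<close>, whose limit is known already.\<close>
  have "((\<lambda>h. (flat_exp n (0 + h) - flat_exp n 0) / h) \<longlongrightarrow> 0) (at 0)"
  proof (rule Lim_transform_eventually[OF flat_exp_tendsto_0[of "Suc n"]])
    show "\<forall>\<^sub>F x in at 0. flat_exp (Suc n) x = (flat_exp n (0 + x) - flat_exp n 0) / x"
      by (auto simp: flat_exp_def eventually_at_filter field_simps)
  qed
  then show ?thesis using equal by (simp add: DERIV_def flat_exp_def)
qed

lemma Ck_on_flat_exp: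
  assumes "open U" "\<And>m. Ck_on m U \<rho>"
  shows "Ck_on m U (\<lambda>x. flat_exp n (\<rho> x))"
proof (induction m arbitrary: n)
  case 0
  have "continuous_on UNIV (flat_exp n)"
    by (intro continuous_at_imp_continuous_on ballI DERIV_isCont[OF flat_exp_deriv])
  then have "continuous_on U (\<lambda>x. flat_exp n (\<rho> x))"
    using assms(2)[of 0] continuous_on_compose2[of UNIV "flat_exp n" U \<rho>] by auto
  then show ?case by simp
next
  case (Suc m)
  let ?f = "\<lambda>x v. (flat_exp (n + 2) (\<rho> x) + (- real n) * flat_exp (n + 1) (\<rho> x)) * fderiv \<rho> x v"
  show ?case
  proof (rule Ck_on_SucI[OF assms(1), where f' = ?f])
    fix x assume "x \<in> U"
    then have "(\<rho> has_derivative fderiv \<rho> x) (at x)"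
      using Ck_on_SucD[OF assms(2)] by blast
    from has_derivative_compose[OF this has_field_derivative_imp_has_derivative[OF flat_exp_deriv]]
    show "((\<lambda>x. flat_exp n (\<rho> x)) has_derivative ?f x) (at x)"
      by (simp add: algebra_simps)
  next
    fix v
    have "Ck_on m U (\<lambda>x. fderiv \<rho> x v)" using assms(2)[of "Suc m"] by simp
    then show "Ck_on m U (\<lambda>x. ?f x v)"
      by (intro Ck_on_mult Ck_on_add assms Suc.IH Ck_on_const) 
  qed
qed

text \<open>The usual smooth transition from 0 on t \<le> 0 to 1 on t \<ge> 1. The two summands of
  the denominator never vanish together.\<close>

definition smooth_step :: "real \<Rightarrow> real" where
  "smooth_step t = flat_exp 0 t * inverse (flat_exp 0 t + flat_exp 0 (1 - t))"

lemma flat_exp_0_nonneg: "0 \<le> flat_exp n t" and flat_exp_0_pos: "0 < t \<Longrightarrow> 0 < flat_exp n t"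
  and flat_exp_0_eq: "t \<le> 0 \<Longrightarrow> flat_exp n t = 0"
  by (auto simp: flat_exp_def)

lemma smooth_step_denominator: "0 < flat_exp 0 t + flat_exp 0 (1 - t)"
  using flat_exp_0_nonneg[of 0 t] flat_exp_0_nonneg[of 0 "1-t"] flat_exp_0_pos[of t 0] flat_exp_0_pos[of "1-t" 0]
  by (cases "t > 0") auto

lemma smooth_step_eq_0: "t \<le> 0 \<Longrightarrow> smooth_step t = 0"
  by (simp add: smooth_step_def flat_exp_0_eq)

lemma smooth_step_eq_1: "1 \<le> t \<Longrightarrow> smooth_step t = 1"
  using flat_exp_0_pos[of t 0] by (simp add: smooth_step_def flat_exp_0_eq)

lemma smooth_step_bounds: "0 \<le> smooth_step t" "smooth_step t \<le> 1"
  using smooth_step_denominator[of t] flat_exp_0_nonneg[of 0 t] flat_exp_0_nonneg[of 0 "1-t"]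
  by (auto simp: smooth_step_def field_simps)

lemma Ck_on_smooth_step:
  assumes "open U" "\<And>m. Ck_on m U \<rho>"
  shows "Ck_on m U (\<lambda>x. smooth_step (\<rho> x))"
proof -
  have "Ck_on m U (\<lambda>x. 1 + (-1) * \<rho> x)" for m
    by (intro Ck_on_add Ck_on_mult Ck_on_const assms)
  then have 1: "Ck_on m U (\<lambda>x. flat_exp 0 (1 - \<rho> x))"
    using Ck_on_flat_exp[OF assms(1), of "\<lambda>x. 1 - \<rho> x"] by simp
  have "flat_exp 0 (\<rho> x) + flat_exp 0 (1 - \<rho> x) \<noteq> 0" for x
    using smooth_step_denominator[of "\<rho> x"] by simp
  then show ?thesis
    unfolding smooth_step_def
    by (intro Ck_on_mult Ck_on_inverse Ck_on_add assms Ck_on_flat_exp 1) 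
qed

text \<open>The argument of \<open>smooth_step\<close> is 1 on the sphere of radius r and 0 on the
  sphere of radius 2r. The squared norm keeps the function smooth at the centre and gives its
  gradient the radial form behind \<open>shell\<close>.\<close>

definition ball_step :: "'a::real_inner \<Rightarrow> real \<Rightarrow> 'a \<Rightarrow> real" where
  "ball_step c r y = smooth_step ((4 * r\<^sup>2 - (norm (y - c))\<^sup>2) / (3 * r\<^sup>2))"

lemma Ck_on_norm_square: "open U \<Longrightarrow> Ck_on m U (\<lambda>y. (norm (y - c :: 'a::real_inner))\<^sup>2)"
proof -
  assume U: "open U"
  have "Ck_on m U (\<lambda>y. y - c)"
    using Ck_on_add[OF U Ck_on_linear[OF bounded_linear_ident U] Ck_on_const[OF U], of m "- c"] by simp
  then show ?thesis
    by (simp add: power2_norm_eq_inner Ck_on_inner U)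
qed

lemma Ck_on_ball_step:
  assumes U: "open U"
  shows "Ck_on m U (ball_step c r)"
proof -
  have "Ck_on m U (\<lambda>y. inverse (3 * r\<^sup>2) * (4 * r\<^sup>2 + (- 1) * (norm (y - c))\<^sup>2))" for m
    by (intro Ck_on_mult Ck_on_add Ck_on_const Ck_on_norm_square U)
  from Ck_on_smooth_step[OF U this, of m]
  show ?thesis by (simp add: ball_step_def[abs_def] divide_simps)
qed

lemma ball_step_bounds: "0 \<le> ball_step c r y" "ball_step c r y \<le> 1"
  by (simp_all add: ball_step_def smooth_step_bounds)

lemma ball_step_eq_1: "0 < r \<Longrightarrow> y \<in> cball c r \<Longrightarrow> ball_step c r y = 1"
  unfolding ball_step_def
  by (rule smooth_step_eq_1)
    (use power_mono[of "norm (y - c)" r 2] in \<open>auto simp: dist_norm norm_minus_commute field_simps\<close>)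

lemma ball_step_eq_0: "0 < r \<Longrightarrow> y \<notin> ball c (2 * r) \<Longrightarrow> ball_step c r y = 0"
  unfolding ball_step_def
  by (rule smooth_step_eq_0)
    (use power_mono[of "2 * r" "norm (y - c)" 2] in \<open>auto simp: dist_norm norm_minus_commute field_simps\<close>)

lemma compactly_containedI: "S \<subseteq> K \<Longrightarrow> compact K \<Longrightarrow> K \<subseteq> U \<Longrightarrow> compactly_contained S (U::'a::metric_space set)"
proof -
  assume *: "S \<subseteq> K" "compact K" "K \<subseteq> U"
  then have "closure S \<subseteq> K" by (simp add: closure_minimal compact_imp_closed)
  moreover from this * have "compact (closure S)"
    by (metis closed_closure compact_Int_closed inf.absorb_iff2)
  ultimately show ?thesis using * by (auto simp: compactly_contained_def)
qed

lemma smooth_cutoff: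
  fixes K U :: "(real ^ 'n::finite) set"
  assumes K: "compact K" and U: "open U" and KU: "K \<subseteq> U"
  obtains \<eta> :: "real ^ 'n \<Rightarrow> real" and W
  where "\<eta> \<in> test_functions U" "open W" "K \<subseteq> W" "\<And>x. x \<in> W \<Longrightarrow> \<eta> x = 1" "\<And>x. 0 \<le> \<eta> x" "\<And>x. \<eta> x \<le> 1"
proof -
  have "\<exists>r>0. cball x (2 * r) \<subseteq> U" if "x \<in> K" for x
  proof -
    obtain e where "e > 0" "cball x e \<subseteq> U" using U KU \<open>x \<in> K\<close> open_contains_cball by blast
    then show ?thesis by (intro exI[of _ "e/2"]) auto
  qed
  then obtain r where r: "\<And>x. x \<in> K \<Longrightarrow> 0 < r x" "\<And>x. x \<in> K \<Longrightarrow> cball x (2 * r x) \<subseteq> U" by metis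
  have "K \<subseteq> (\<Union>x\<in>K. ball x (r x))" using r(1) by force
  then obtain C where C: "C \<subseteq> K" "finite C" "K \<subseteq> (\<Union>x\<in>C. ball x (r x))"
    by (rule compactE_image[OF K, rotated]) auto
  \<comment> \<open>This combination of bumps is 1 as soon as one bump is 1, vanishes where all of
    them vanish, and never leaves [0,1].\<close>
  define \<eta> where "\<eta> y = 1 - (\<Prod>x\<in>C. 1 - ball_step x (r x) y)" for y
  have 1: "\<eta> y = 1" if "y \<in> (\<Union>x\<in>C. ball x (r x))" for y
  proof -
    from that obtain x where x: "x \<in> C" "y \<in> ball x (r x)" by blast
    then have "ball_step x (r x) y = 1" using r(1)[of x] C(1) by (intro ball_step_eq_1) auto
    then have "(\<Prod>x\<in>C. 1 - ball_step x (r x) y) = 0" using x C(2) by (auto intro!: prod_zero)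
    then show ?thesis by (simp add: \<eta>_def)
  qed
  have 0: "y \<in> (\<Union>x\<in>C. cball x (2 * r x))" if "\<eta> y \<noteq> 0" for y
  proof (rule ccontr)
    assume *: "y \<notin> (\<Union>x\<in>C. cball x (2 * r x))"
    then have "ball_step x (r x) y = 0" if "x \<in> C" for x
      using that C(1) r(1)[of x] by (intro ball_step_eq_0) auto
    then show False using \<open>\<eta> y \<noteq> 0\<close> by (simp add: \<eta>_def)
  qed
  have "Ck_on m UNIV (\<lambda>y. 1 + (- 1) * (\<Prod>x\<in>C. 1 + (- 1) * ball_step x (r x) y))" for m
    by (intro Ck_on_add Ck_on_mult Ck_on_prod Ck_on_const Ck_on_ball_step open_UNIV)
  then have "\<forall>m. Ck_on m UNIV \<eta>" by (simp add: \<eta>_def[abs_def])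
  moreover have "(\<Union>x\<in>C. cball x (2 * r x)) \<subseteq> U"
    using r(2) C(1) by blast
  then have "compactly_contained {x. \<eta> x \<noteq> 0} U"
    using 0 C(2) by (intro compactly_containedI[of _ "\<Union>x\<in>C. cball x (2 * r x)"]) (auto intro!: compact_UN)
  moreover have "0 \<le> (\<Prod>x\<in>C. 1 - ball_step x (r x) y)" "(\<Prod>x\<in>C. 1 - ball_step x (r x) y) \<le> 1" for y
    using ball_step_bounds by (auto intro!: prod_nonneg prod_le_1)
  ultimately show thesis
    using 1 C(3) by (intro that[of \<eta> "\<Union>x\<in>C. ball x (r x)"]) (auto simp: test_functions_def \<eta>_def)
qed

section \<open>Square-integrable functions\<close>

lemma L2_D:
  assumes "f \<in> L2 M"
  shows "f \<in> borel_measurable M" "integrable M (\<lambda>x. (norm (f x))\<^sup>2)"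
  using assms by (auto simp: L2_def)

lemma L2I:
  fixes f :: "'a \<Rightarrow> 'b::euclidean_space"
  assumes "f \<in> borel_measurable M" "integrable M h" "AE x in M. (norm (f x))\<^sup>2 \<le> h x"
  shows "f \<in> L2 M"
proof -
  have "integrable M (\<lambda>x. (norm (f x))\<^sup>2)"
  proof (rule Bochner_Integration.integrable_bound[OF assms(2)])
    show "AE x in M. norm ((norm (f x))\<^sup>2) \<le> norm (h x)" using assms(3) by eventually_elim auto
  qed (use assms(1) in measurable)
  then show ?thesis using assms(1) by (auto simp: L2_def)
qed

lemma L2_norm_nonneg [simp]: "0 \<le> L2_norm M f"
  by (simp add: L2_norm_def)

lemma L2_norm_sq: "(L2_norm M f)\<^sup>2 = (\<integral>x. (norm (f x))\<^sup>2 \<partial>M)"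
  by (simp add: L2_norm_def)

lemma L2_bound:
  assumes "g \<in> L2 M" "f \<in> borel_measurable M" "AE x in M. norm (f x) \<le> c * norm (g x)" "0 \<le> c"
  shows "f \<in> L2 M" "L2_norm M f \<le> c * L2_norm M g"
proof -
  have *: "AE x in M. (norm (f x))\<^sup>2 \<le> c\<^sup>2 * (norm (g x))\<^sup>2"
    using assms(3) by eventually_elim (metis norm_ge_zero power_mono power_mult_distrib)
  have i: "integrable M (\<lambda>x. c\<^sup>2 * (norm (g x))\<^sup>2)" using L2_D[OF assms(1)] by simp
  show f: "f \<in> L2 M" by (rule L2I[OF assms(2) i *])
  have "(\<integral>x. (norm (f x))\<^sup>2 \<partial>M) \<le> (\<integral>x. c\<^sup>2 * (norm (g x))\<^sup>2 \<partial>M)"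
    by (rule integral_mono_AE[OF L2_D(2)[OF f] i *])
  also have "\<dots> = (c * L2_norm M g)\<^sup>2" by (simp add: power_mult_distrib L2_norm_sq)
  finally show "L2_norm M f \<le> c * L2_norm M g"
    using assms(4) by (simp add: L2_norm_sq[symmetric])
qed

lemma L2_norm_mono:
  assumes "g \<in> L2 M" "f \<in> borel_measurable M" "AE x in M. norm (f x) \<le> norm (g x)"
  shows "f \<in> L2 M" "L2_norm M f \<le> L2_norm M g"
  using L2_bound[OF assms(1,2), of 1] assms(3) by auto

lemma L2_norm_cong_AE:
  assumes "f \<in> borel_measurable M" "g \<in> borel_measurable M" "AE x in M. f x = g x"
  shows "L2_norm M f = L2_norm M g"
proof -
  have "(\<integral>x. (norm (f x))\<^sup>2 \<partial>M) = (\<integral>x. (norm (g x))\<^sup>2 \<partial>M)"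
    by (rule integral_cong_AE) (use assms in auto)
  then show ?thesis by (simp add: L2_norm_def)
qed

lemma L2_cong_AE:
  assumes "f \<in> L2 M" "g \<in> borel_measurable M" "AE x in M. f x = g x"
  shows "g \<in> L2 M"
  using L2_norm_mono(1)[OF assms(1,2)] assms(3) by (metis (mono_tags, lifting) AE_mp AE_I2 order_refl)

lemma L2_scaleR: "f \<in> L2 M \<Longrightarrow> (\<lambda>x. c *\<^sub>R f x) \<in> L2 M"
  by (auto intro!: L2_bound(1)[of f M _ "\<bar>c\<bar>"] dest: L2_D)

lemma L2_cmult:
  fixes f :: "'a \<Rightarrow> complex"
  shows "f \<in> L2 M \<Longrightarrow> (\<lambda>x. c * f x) \<in> L2 M"
  by (auto intro!: L2_bound(1)[of f M _ "norm c"] simp: norm_mult dest: L2_D)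

lemma L2_zero [simp]: "(\<lambda>x. 0) \<in> L2 M"
  by (simp add: L2_def)

lemma L2_add:
  assumes "f \<in> L2 M" "g \<in> L2 M"
  shows "(\<lambda>x. f x + g x) \<in> L2 M"
proof (rule L2I)
  show "integrable M (\<lambda>x. 2 * (norm (f x))\<^sup>2 + 2 * (norm (g x))\<^sup>2)"
    using L2_D[OF assms(1)] L2_D[OF assms(2)] by simp
  show "AE x in M. (norm (f x + g x))\<^sup>2 \<le> 2 * (norm (f x))\<^sup>2 + 2 * (norm (g x))\<^sup>2"
  proof (rule AE_I2)
    fix x
    have "(norm (f x + g x))\<^sup>2 \<le> (norm (f x) + norm (g x))\<^sup>2" by (simp add: norm_triangle_ineq power_mono)
    also have "\<dots> \<le> 2 * (norm (f x))\<^sup>2 + 2 * (norm (g x))\<^sup>2"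
      using sum_squares_bound[of "norm (f x)" "norm (g x)"] by (simp add: power2_sum)
    finally show "(norm (f x + g x))\<^sup>2 \<le> 2 * (norm (f x))\<^sup>2 + 2 * (norm (g x))\<^sup>2" .
  qed
qed (use L2_D[OF assms(1)] L2_D[OF assms(2)] in simp)

lemma L2_minus: "f \<in> L2 M \<Longrightarrow> (\<lambda>x. - f x) \<in> L2 M"
  using L2_scaleR[of f M "-1"] by simp

lemma L2_diff: "f \<in> L2 M \<Longrightarrow> g \<in> L2 M \<Longrightarrow> (\<lambda>x. f x - g x) \<in> L2 M"
  using L2_add[OF _ L2_minus, of f M g] by simp

lemma L2_sum: "(\<And>i. i \<in> I \<Longrightarrow> f i \<in> L2 M) \<Longrightarrow> (\<lambda>x. \<Sum>i\<in>I. f i x) \<in> L2 M"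
  by (induction I rule: infinite_finite_induct) (auto intro: L2_add)

lemma L2_norm_eq_0_AE:
  assumes "f \<in> L2 M" "L2_norm M f = 0"
  shows "AE x in M. f x = 0"
proof -
  have "(\<integral>x. (norm (f x))\<^sup>2 \<partial>M) = 0" using assms(2) L2_norm_sq[of M f] by simp
  then have "AE x in M. (norm (f x))\<^sup>2 = 0"
    using integral_nonneg_eq_0_iff_AE[OF L2_D(2)[OF assms(1)]] by simp
  then show ?thesis by eventually_elim simp
qed

lemma L2_Cauchy_Schwarz:
  assumes f: "f \<in> L2 M" and g: "g \<in> L2 M"
  shows "integrable M (\<lambda>x. norm (f x) * norm (g x))"
    and "(\<integral>x. norm (f x) * norm (g x) \<partial>M) \<le> L2_norm M f * L2_norm M g"
proof -
  note [measurable] = L2_D(1)[OF f] L2_D(1)[OF g]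
  \<comment> \<open>Young's inequality with a free weight t. The choice t = \<open>?B / ?A\<close>
    below balances the two terms and produces the product of the norms; this is why a vanishing norm
    is a separate case.\<close>
  have amgm: "norm (f x) * norm (g x) \<le> t / 2 * (norm (f x))\<^sup>2 + inverse t / 2 * (norm (g x))\<^sup>2" if "0 < t" for t x
  proof -
    have "0 \<le> (t * norm (f x) - norm (g x))\<^sup>2 / (2 * t)" using that by simp
    also have "\<dots> = t / 2 * (norm (f x))\<^sup>2 + inverse t / 2 * (norm (g x))\<^sup>2 - norm (f x) * norm (g x)"
      using that by (simp add: power2_eq_square field_simps)
    finally show ?thesis by simp
  qed
  have i: "integrable M (\<lambda>x. t / 2 * (norm (f x))\<^sup>2 + inverse t / 2 * (norm (g x))\<^sup>2)" for t
    using L2_D[OF f] L2_D[OF g] by simp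
  show I: "integrable M (\<lambda>x. norm (f x) * norm (g x))"
    by (rule Bochner_Integration.integrable_bound[OF i[of 1]])
      (use amgm[of 1] in \<open>auto intro!: order_trans[OF amgm[of 1] abs_ge_self]\<close>)
  let ?A = "L2_norm M f" and ?B = "L2_norm M g"
  show "(\<integral>x. norm (f x) * norm (g x) \<partial>M) \<le> ?A * ?B"
  proof (cases "?A = 0 \<or> ?B = 0")
    case True
    then have "AE x in M. norm (f x) * norm (g x) = 0"
      using L2_norm_eq_0_AE[OF f] L2_norm_eq_0_AE[OF g] by auto
    then have "(\<integral>x. norm (f x) * norm (g x) \<partial>M) = (\<integral>x. 0 \<partial>M)"
      by (intro integral_cong_AE) auto
    then show ?thesis by simp
  next
    case False
    then have pos: "0 < ?A" "0 < ?B" using L2_norm_nonneg[of M f] L2_norm_nonneg[of M g] by linarith+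
    have "(\<integral>x. norm (f x) * norm (g x) \<partial>M) \<le> (\<integral>x. (?B / ?A) / 2 * (norm (f x))\<^sup>2 + inverse (?B / ?A) / 2 * (norm (g x))\<^sup>2 \<partial>M)"
      using amgm[of "?B / ?A"] pos by (intro integral_mono I i) auto
    also have "\<dots> = (?B / ?A) / 2 * ?A\<^sup>2 + inverse (?B / ?A) / 2 * ?B\<^sup>2"
      using L2_D[OF f] L2_D[OF g] by (simp add: L2_norm_sq)
    also have "\<dots> = ?A * ?B" using pos by (simp add: power2_eq_square field_simps)
    finally show ?thesis .
  qed
qed

lemma L2_product:
  fixes B :: "'a \<Rightarrow> 'c::{banach, second_countable_topology}"
  assumes f: "f \<in> L2 M" and g: "g \<in> L2 M" and B: "B \<in> borel_measurable M"
    and le: "AE x in M. norm (B x) \<le> c * (norm (f x) * norm (g x))" and c: "0 \<le> c"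
  shows "integrable M B" "norm (\<integral>x. B x \<partial>M) \<le> c * (L2_norm M f * L2_norm M g)"
proof -
  have i: "integrable M (\<lambda>x. c * (norm (f x) * norm (g x)))" using L2_Cauchy_Schwarz(1)[OF f g] by simp
  show I: "integrable M B"
    by (rule Bochner_Integration.integrable_bound[OF i B]) (use le c in \<open>auto simp: abs_mult\<close>)
  have "norm (\<integral>x. B x \<partial>M) \<le> (\<integral>x. norm (B x) \<partial>M)" by (rule integral_norm_bound)
  also have "\<dots> \<le> (\<integral>x. c * (norm (f x) * norm (g x)) \<partial>M)"
    by (rule integral_mono_AE[OF _ i le]) (use I in simp)
  also have "\<dots> = c * (\<integral>x. norm (f x) * norm (g x) \<partial>M)" by simp
  also have "\<dots> \<le> c * (L2_norm M f * L2_norm M g)"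
    using L2_Cauchy_Schwarz(2)[OF f g] c by (intro mult_left_mono)
  finally show "norm (\<integral>x. B x \<partial>M) \<le> c * (L2_norm M f * L2_norm M g)" .
qed

lemma L2_integrable_mult:
  fixes f g :: "'a \<Rightarrow> complex"
  assumes "f \<in> L2 M" "g \<in> L2 M"
  shows "integrable M (\<lambda>x. f x * g x)" "norm (\<integral>x. f x * g x \<partial>M) \<le> L2_norm M f * L2_norm M g"
  using L2_product[OF assms, of "\<lambda>x. f x * g x" 1] L2_D(1)[OF assms(1)] L2_D(1)[OF assms(2)]
  by (auto simp: norm_mult)

lemma L2_norm_triangle:
  assumes f: "f \<in> L2 M" and g: "g \<in> L2 M"
  shows "L2_norm M (\<lambda>x. f x + g x) \<le> L2_norm M f + L2_norm M g"
proof -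
  have "(L2_norm M (\<lambda>x. f x + g x))\<^sup>2 \<le> (\<integral>x. (norm (f x))\<^sup>2 + 2 * (norm (f x) * norm (g x)) + (norm (g x))\<^sup>2 \<partial>M)"
    unfolding L2_norm_sq
  proof (rule integral_mono)
    show "integrable M (\<lambda>x. (norm (f x + g x))\<^sup>2)" using L2_D(2)[OF L2_add[OF f g]] .
    show "integrable M (\<lambda>x. (norm (f x))\<^sup>2 + 2 * (norm (f x) * norm (g x)) + (norm (g x))\<^sup>2)"
      using L2_D[OF f] L2_D[OF g] L2_Cauchy_Schwarz(1)[OF f g] by (simp add: mult.assoc)
    fix x
    have "(norm (f x + g x))\<^sup>2 \<le> (norm (f x) + norm (g x))\<^sup>2" by (simp add: norm_triangle_ineq power_mono)
    then show "(norm (f x + g x))\<^sup>2 \<le> (norm (f x))\<^sup>2 + 2 * (norm (f x) * norm (g x)) + (norm (g x))\<^sup>2"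
      by (simp add: power2_sum algebra_simps)
  qed
  also have "\<dots> = (L2_norm M f)\<^sup>2 + 2 * (\<integral>x. norm (f x) * norm (g x) \<partial>M) + (L2_norm M g)\<^sup>2"
    using L2_D[OF f] L2_D[OF g] L2_Cauchy_Schwarz(1)[OF f g] by (simp add: L2_norm_sq)
  also have "\<dots> \<le> (L2_norm M f + L2_norm M g)\<^sup>2"
    using L2_Cauchy_Schwarz(2)[OF f g] by (simp add: power2_sum algebra_simps)
  finally show ?thesis by (rule power2_le_imp_le) simp
qed

lemma L2_norm_minus: "L2_norm M (\<lambda>x. - f x) = L2_norm M f"
  by (simp add: L2_norm_def)

lemma L2_norm_triangle_diff:
  assumes f: "f \<in> L2 M" and g: "g \<in> L2 M"
  shows "L2_norm M (\<lambda>x. f x - g x) \<le> L2_norm M f + L2_norm M g"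
  using L2_norm_triangle[OF f L2_minus[OF g]] by (simp add: L2_norm_minus)

text \<open>The squares tend to 0 in L1, and convergence in L1 gives an almost everywhere convergent
  subsequence. With it, limits in L2 can be compared with pointwise limits on the boundary.\<close>

lemma L2_tendsto_AE_subseq:
  fixes w :: "nat \<Rightarrow> 'a \<Rightarrow> 'b::euclidean_space"
  assumes w: "\<And>j. w j \<in> L2 M" and lim: "(\<lambda>j. L2_norm M (w j)) \<longlonglongrightarrow> 0"
  obtains r where "strict_mono r" "AE x in M. (\<lambda>j. w (r j) x) \<longlonglongrightarrow> 0"
proof -
  have "(\<lambda>j. (\<integral>x. norm ((norm (w j x))\<^sup>2) \<partial>M)) \<longlonglongrightarrow> 0"
    using tendsto_power[OF lim, of 2] by (simp add: L2_norm_sq)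
  from tendsto_L1_AE_subseq[OF L2_D(2)[OF w] this]
  obtain r where r: "strict_mono r" "AE x in M. (\<lambda>n. (norm (w (r n) x))\<^sup>2) \<longlonglongrightarrow> 0" by blast
  from r(2) have "AE x in M. (\<lambda>j. w (r j) x) \<longlonglongrightarrow> 0"
  proof eventually_elim
    case (elim x)
    then have "(\<lambda>n. sqrt ((norm (w (r n) x))\<^sup>2)) \<longlonglongrightarrow> sqrt 0" by (rule tendsto_real_sqrt)
    then have "(\<lambda>n. norm (w (r n) x)) \<longlonglongrightarrow> 0" by simp
    then show ?case by (rule tendsto_norm_zero_cancel)
  qed
  with r(1) show thesis by (rule that)
qed

section \<open>Test functions\<close>

lemma test_functions_D:
  assumes "\<theta> \<in> test_functions U"
  shows "Ck_on m UNIV \<theta>" "compact (closure {x. \<theta> x \<noteq> 0})" "closure {x. \<theta> x \<noteq> 0} \<subseteq> U"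
  using assms by (auto simp: test_functions_def compactly_contained_def)

lemma test_functionsI:
  fixes \<theta> :: "real ^ 'n::finite \<Rightarrow> 'b::real_normed_vector"
  assumes "\<And>m. Ck_on m UNIV \<theta>" "compact K" "K \<subseteq> U" "\<And>x. x \<notin> K \<Longrightarrow> \<theta> x = 0"
  shows "\<theta> \<in> test_functions U"
  using assms compactly_containedI[of "{x. \<theta> x \<noteq> 0}" K U] by (auto simp: test_functions_def)

lemma test_functions_outside:
  assumes "\<theta> \<in> test_functions U" "x \<notin> closure {x. \<theta> x \<noteq> 0}"
  shows "\<theta> x = 0"
  using assms(2) closure_subset[of "{x. \<theta> x \<noteq> 0}"] by blast

lemma test_functions_mono: "\<theta> \<in> test_functions U \<Longrightarrow> U \<subseteq> W \<Longrightarrow> \<theta> \<in> test_functions W"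
  by (auto simp: test_functions_def compactly_contained_def)

lemma test_functions_continuous: "\<theta> \<in> test_functions U \<Longrightarrow> continuous_on UNIV \<theta>"
  using test_functions_D(1)[of \<theta> U 0] by simp

lemma test_functions_has_derivative:
  "\<theta> \<in> test_functions U \<Longrightarrow> (\<theta> has_derivative fderiv \<theta> x) (at x)"
  using Ck_on_SucD[OF test_functions_D(1)] by blast

lemma frechet_derivative_zero_outside:
  assumes "x \<notin> closure {x. \<theta> x \<noteq> 0}"
  shows "fderiv \<theta> x = (\<lambda>v. 0)"
proof -
  have "((\<lambda>x. 0) has_derivative (\<lambda>v. 0)) (at x)" by simp
  then have "(\<theta> has_derivative (\<lambda>v. 0)) (at x)"
    by (rule has_derivative_transform_within_open[of _ _ _ _ "- closure {x. \<theta> x \<noteq> 0}"])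
      (use assms closure_subset[of "{x. \<theta> x \<noteq> 0}"] in \<open>auto simp: open_Compl\<close>)
  then show ?thesis using frechet_derivative_at by metis
qed

lemma test_functions_derivative:
  assumes "\<theta> \<in> test_functions U"
  shows "(\<lambda>x. fderiv \<theta> x v) \<in> test_functions U"
proof (rule test_functionsI[OF _ test_functions_D(2,3)[OF assms]])
  show "Ck_on m UNIV (\<lambda>x. fderiv \<theta> x v)" for m
    using test_functions_D(1)[OF assms, of "Suc m"] by simp
qed (simp add: frechet_derivative_zero_outside)

lemma test_functions_bounded:
  assumes "\<theta> \<in> test_functions U"
  obtains B where "0 < B" "\<And>x. norm (\<theta> x) \<le> B"
proof -
  let ?K = "closure {x. \<theta> x \<noteq> 0}"
  have "compact (\<theta> ` ?K)"
    using test_functions_D(2)[OF assms] test_functions_continuous[OF assms]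
    by (intro compact_continuous_image) (auto intro: continuous_on_subset)
  then obtain B where B: "0 < B" "\<forall>y\<in>\<theta> ` ?K. norm y \<le> B"
    using compact_imp_bounded bounded_pos by blast
  have "norm (\<theta> x) \<le> B" for x
    using B test_functions_outside[OF assms, of x] by (cases "x \<in> ?K") auto
  with B(1) show thesis by (rule that)
qed


lemma integrable_on_subset:
  fixes f :: "'a::euclidean_space \<Rightarrow> 'b::{banach, second_countable_topology}"
  assumes "integrable lebesgue f" "W \<in> sets lebesgue"
  shows "integrable (leb W) f"
  using integrable_mult_indicator[OF assms(2,1)] assms(2) by (simp add: integrable_restrict_space)

lemma measurable_on_subset:
  "f \<in> borel_measurable (leb U) \<Longrightarrow> W \<subseteq> U \<Longrightarrow> f \<in> borel_measurable (leb W)"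
  by (rule measurable_restrict_mono)

lemma measurable_continuous:
  fixes f :: "'a::euclidean_space \<Rightarrow> 'b::euclidean_space"
  assumes "continuous_on UNIV f"
  shows "f \<in> borel_measurable (leb W)"
proof -
  have "f \<in> borel_measurable lborel" using borel_measurable_continuous_onI[OF assms] by simp
  then show ?thesis by (intro measurable_restrict_space1 measurable_completion)
qed

lemma integrable_indicator_bounded:
  assumes "bounded (S :: 'a::euclidean_space set)" "S \<in> sets lebesgue" "W \<in> sets lebesgue"
  shows "integrable (leb W) (indicator S :: 'a \<Rightarrow> real)"
proof -
  have "S \<in> lmeasurable" using assms bounded_set_imp_lmeasurable by blast
  then have "integrable lebesgue (indicator S :: 'a \<Rightarrow> real)"
    by (intro integrable_real_indicator fmeasurableD)
      (metis fmeasurableD2 infinity_ennreal_def top.not_eq_extremum)+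
  then show ?thesis using assms(3) by (rule integrable_on_subset)
qed

lemma integrable_compact_support:
  fixes f :: "'a::euclidean_space \<Rightarrow> 'b::euclidean_space"
  assumes "f \<in> borel_measurable (leb W)" "W \<in> sets lebesgue" "bounded S"
    "\<And>x. x \<in> W \<Longrightarrow> norm (f x) \<le> B" "\<And>x. x \<in> W \<Longrightarrow> x \<notin> S \<Longrightarrow> f x = 0"
  shows "integrable (leb W) f"
proof -
  obtain R where R: "S \<subseteq> ball 0 R" using bounded_subset_ballD[OF assms(3), of 0] by blast
  have i: "integrable (leb W) (\<lambda>x. B * indicator (cball 0 R) x)"
    using integrable_indicator_bounded[OF bounded_cball _ assms(2), of 0 R] by simp
  show ?thesis
  proof (rule Bochner_Integration.integrable_bound[OF i assms(1)], rule AE_I2)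
    fix x assume x: "x \<in> space (leb W)"
    then have "norm (f x) \<le> B" using assms(4) by (simp add: space_restrict_space)
    then show "norm (f x) \<le> norm (B * indicator (cball 0 R) x)"
      using assms(5)[of x] x norm_ge_zero[of "f x"] subsetD[OF R, of x]
      by (cases "x \<in> S") (auto simp: space_restrict_space indicator_def)
  qed
qed

lemma test_functions_measurable:
  fixes \<theta> :: "real ^ 'n::finite \<Rightarrow> 'b::euclidean_space"
  shows "\<theta> \<in> test_functions U \<Longrightarrow> \<theta> \<in> borel_measurable (leb W)"
  by (intro measurable_continuous test_functions_continuous)

lemma test_functions_L2:
  fixes \<theta> :: "real ^ 'n::finite \<Rightarrow> 'b::euclidean_space"
  assumes "\<theta> \<in> test_functions U" "W \<in> sets lebesgue"
  shows "\<theta> \<in> L2 (leb W)" "integrable (leb W) \<theta>"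
proof -
  obtain B where B: "\<And>x. norm (\<theta> x) \<le> B" using test_functions_bounded[OF assms(1)] by blast
  have b: "bounded (closure {x. \<theta> x \<noteq> 0})" using test_functions_D(2)[OF assms(1)] compact_imp_bounded by blast
  have m: "\<theta> \<in> borel_measurable (leb W)" by (rule test_functions_measurable[OF assms(1)])
  show "integrable (leb W) \<theta>"
    by (rule integrable_compact_support[OF m assms(2) b B]) (rule test_functions_outside[OF assms(1)])
  have m2: "(\<lambda>x. (norm (\<theta> x))\<^sup>2) \<in> borel_measurable (leb W)"
    using m by measurable
  have "integrable (leb W) (\<lambda>x. (norm (\<theta> x))\<^sup>2)"
  proof (rule integrable_compact_support[OF m2 assms(2) b])
    show "norm ((norm (\<theta> x))\<^sup>2) \<le> B\<^sup>2" for x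
      using power_mono[OF B[of x] norm_ge_zero, of 2] by simp
    show "(norm (\<theta> x))\<^sup>2 = 0" if "x \<notin> closure {x. \<theta> x \<noteq> 0}" for x
      using test_functions_outside[OF assms(1) that] by simp
  qed
  with m show "\<theta> \<in> L2 (leb W)" by (auto simp: L2_def)
qed

lemma L2_bounded_mult:
  fixes f :: "'a \<Rightarrow> 'b::euclidean_space"
  assumes "f \<in> L2 M" "c \<in> borel_measurable M" "AE x in M. \<bar>c x\<bar> \<le> B" "0 \<le> B"
  shows "(\<lambda>x. c x *\<^sub>R f x) \<in> L2 M" "L2_norm M (\<lambda>x. c x *\<^sub>R f x) \<le> B * L2_norm M f"
proof -
  have m: "(\<lambda>x. c x *\<^sub>R f x) \<in> borel_measurable M" using assms(2) L2_D(1)[OF assms(1)] by (rule borel_measurable_scaleR)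
  have "AE x in M. norm (c x *\<^sub>R f x) \<le> B * norm (f x)"
    using assms(3) by eventually_elim (simp add: mult_right_mono)
  from L2_bound[OF assms(1) m this assms(4)]
  show "(\<lambda>x. c x *\<^sub>R f x) \<in> L2 M" "L2_norm M (\<lambda>x. c x *\<^sub>R f x) \<le> B * L2_norm M f" by auto
qed

lemma test_functions_mult:
  fixes \<eta> \<theta> :: "real ^ 'n::finite \<Rightarrow> real"
  assumes \<theta>: "\<theta> \<in> test_functions U" and \<eta>: "\<And>m. Ck_on m UNIV \<eta>"
  shows "(\<lambda>x. \<eta> x * \<theta> x) \<in> test_functions U"
proof (rule test_functionsI[OF _ test_functions_D(2,3)[OF \<theta>]])
  show "Ck_on m UNIV (\<lambda>x. \<eta> x * \<theta> x)" for m
    by (rule Ck_on_mult[OF open_UNIV \<eta> test_functions_D(1)[OF \<theta>]])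
  show "\<eta> x * \<theta> x = 0" if "x \<notin> closure {x. \<theta> x \<noteq> 0}" for x
    using that test_functions_outside[OF \<theta>, of x] by simp
qed

lemma test_functions_scaleR:
  fixes \<eta> :: "real ^ 'n::finite \<Rightarrow> real" and w :: "real ^ 'n \<Rightarrow> complex"
  assumes w: "w \<in> test_functions U" and \<eta>: "\<And>m. Ck_on m UNIV \<eta>"
  shows "(\<lambda>x. \<eta> x *\<^sub>R w x) \<in> test_functions U"
proof (rule test_functionsI[OF _ test_functions_D(2,3)[OF w]])
  show "Ck_on m UNIV (\<lambda>x. \<eta> x *\<^sub>R w x)" for m
    by (rule Ck_on_scaleR[OF open_UNIV \<eta> test_functions_D(1)[OF w]])
  show "\<eta> x *\<^sub>R w x = 0" if "x \<notin> closure {x. w x \<noteq> 0}" for x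
    using that test_functions_outside[OF w, of x] by simp
qed

lemma test_functions_add:
  assumes f: "f \<in> test_functions U" and g: "g \<in> test_functions U"
  shows "(\<lambda>x. f x + g x) \<in> test_functions U"
proof (rule test_functionsI)
  show "Ck_on m UNIV (\<lambda>x. f x + g x)" for m
    by (rule Ck_on_add[OF open_UNIV test_functions_D(1)[OF f] test_functions_D(1)[OF g]])
  show "compact (closure {x. f x \<noteq> 0} \<union> closure {x. g x \<noteq> 0})"
    by (rule compact_Un[OF test_functions_D(2)[OF f] test_functions_D(2)[OF g]])
  show "closure {x. f x \<noteq> 0} \<union> closure {x. g x \<noteq> 0} \<subseteq> U"
    using test_functions_D(3)[OF f] test_functions_D(3)[OF g] by blast
  show "f x + g x = 0" if "x \<notin> closure {x. f x \<noteq> 0} \<union> closure {x. g x \<noteq> 0}" for x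
    using that test_functions_outside[OF f, of x] test_functions_outside[OF g, of x] by simp
qed

lemma test_functions_linear:
  assumes f: "f \<in> test_functions U" and L: "bounded_linear L"
  shows "(\<lambda>x. L (f x)) \<in> test_functions U"
proof (rule test_functionsI[OF _ test_functions_D(2,3)[OF f]])
  show "Ck_on m UNIV (\<lambda>x. L (f x))" for m
    by (rule Ck_on_bounded_linear[OF L open_UNIV test_functions_D(1)[OF f]])
  show "L (f x) = 0" if "x \<notin> closure {x. f x \<noteq> 0}" for x
    using that test_functions_outside[OF f, of x] linear_0[OF bounded_linear.linear[OF L]] by simp
qed

lemma test_functions_zero: "(\<lambda>x. 0) \<in> test_functions U"
  by (rule test_functionsI[of _ "{}"]) (auto intro: Ck_on_const)

section \<open>Integrals of derivatives of compactly supported functions\<close>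

lemma Ck_on_Un:
  assumes "Ck_on m U f" "Ck_on m V f" "open U" "open V"
  shows "Ck_on m (U \<union> V) f"
  using assms(1,2) by (induction m arbitrary: f) (use assms(3,4) in \<open>auto intro: continuous_on_open_Un\<close>)

lemma Ck_on_extend_zero:
  assumes "open U" "Ck_on m U f" "closed K" "K \<subseteq> U" "\<And>x. x \<in> U - K \<Longrightarrow> f x = 0"
  shows "Ck_on m UNIV (\<lambda>x. if x \<in> U then f x else 0)"
proof -
  let ?F = "\<lambda>x. if x \<in> U then f x else 0"
  have "Ck_on m U ?F" using Ck_on_cong[OF assms(1) _ assms(2), of ?F] by simp
  moreover have "Ck_on m (- K) ?F"
    by (rule Ck_on_cong[of "- K" "\<lambda>x. 0"]) (use assms(3,5) in \<open>auto simp: open_Compl intro!: Ck_on_const\<close>)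
  ultimately have "Ck_on m (U \<union> - K) ?F" using assms by (intro Ck_on_Un) (auto simp: open_Compl)
  moreover have "U \<union> - K = UNIV" using assms(4) by auto
  ultimately show ?thesis by simp
qed

lemma has_vector_derivative_at_0:
  assumes "((\<lambda>t. g t) has_vector_derivative d) (at (0::real))"
  shows "((\<lambda>t. (g t - g 0) /\<^sub>R t) \<longlongrightarrow> d) (at 0)"
proof -
  have *: "((\<lambda>t. (g t - g 0 - t *\<^sub>R d) /\<^sub>R norm t) \<longlongrightarrow> 0) (at 0)"
    using assms by (simp add: has_vector_derivative_def has_derivative_at_within has_derivative_at)
  have "((\<lambda>t. norm ((g t - g 0) /\<^sub>R t - d)) \<longlongrightarrow> 0) (at 0)"
  proof (rule Lim_transform_eventually[OF tendsto_norm_zero[OF *]])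
    have "norm ((g t - g 0 - t *\<^sub>R d) /\<^sub>R norm t) = norm ((g t - g 0) /\<^sub>R t - d)" if "t \<noteq> 0" for t
    proof -
      have "(g t - g 0) /\<^sub>R t - d = (g t - g 0 - t *\<^sub>R d) /\<^sub>R t" using that by (simp add: scaleR_diff_right)
      then show ?thesis by simp
    qed
    then show "\<forall>\<^sub>F t in at 0. norm ((g t - g 0 - t *\<^sub>R d) /\<^sub>R norm t) = norm ((g t - g 0) /\<^sub>R t - d)"
      by (auto simp: eventually_at_filter)
  qed
  then show ?thesis by (simp add: tendsto_norm_zero_iff LIM_zero_iff)
qed

lemma integrable_indicator_cball: "integrable lborel (indicator (cball (c::'a::euclidean_space) r) :: 'a \<Rightarrow> real)"
  using emeasure_bounded_finite[OF bounded_cball, of c r] by (intro integrable_real_indicator) simp_all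

text \<open>Difference quotients in the direction v have integral zero, because Lebesgue measure is
  translation invariant, and they converge to the derivative under a common integrable
  bound.\<close>

lemma integral_derivative_compact_support:
  fixes f :: "'a::euclidean_space \<Rightarrow> 'b::euclidean_space"
  assumes C1: "Ck_on 1 UNIV f" and K: "bounded K" "\<And>x. x \<notin> K \<Longrightarrow> f x = 0"
  shows "(\<integral>x. fderiv f x v \<partial>lborel) = 0"
proof -
  obtain R where R: "0 < R" "K \<subseteq> ball 0 R" using bounded_subset_ballD[OF K(1), of 0] by blast
  let ?f' = "\<lambda>x. fderiv f x v"
  have d: "(f has_derivative fderiv f x) (at x)" for x
    using Ck_on_SucD[of 0 UNIV f] C1 by simp
  have cf: "continuous_on UNIV f" using C1 Ck_on_imp_continuous_on open_UNIV by blast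
  have cf': "continuous_on UNIV ?f'" using C1 by simp
  have z: "f x = 0" if "norm x > R" for x by (rule K(2)) (use subsetD[OF R(2), of x] that in auto)
  have z': "?f' x = 0" if "norm x > R" for x
  proof -
    have "((\<lambda>x. 0) has_derivative (\<lambda>v. 0)) (at x)" by simp
    then have "(f has_derivative (\<lambda>v. 0)) (at x)"
      by (rule has_derivative_transform_within_open[of _ _ _ _ "- cball 0 R"]) (use that z in auto)
    then show ?thesis using frechet_derivative_at by metis
  qed
  have "compact (?f' ` cball 0 R)"
    by (intro compact_continuous_image continuous_on_subset[OF cf']) auto
  then obtain B where B: "0 < B" "\<forall>y\<in>?f' ` cball 0 R. norm y \<le> B"
    using compact_imp_bounded bounded_pos by blast
  have bd: "norm (?f' x) \<le> B" for x using B z'[of x] by (cases "norm x \<le> R") auto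
  have fint: "integrable lborel f"
  proof -
    have "compact (f ` cball 0 R)" by (intro compact_continuous_image continuous_on_subset[OF cf]) auto
    then obtain C where C: "0 < C" "\<forall>y\<in>f ` cball 0 R. norm y \<le> C"
      using compact_imp_bounded bounded_pos by blast
    have i: "integrable lborel (\<lambda>x::'a. C * indicator (cball 0 R) x)"
      by (simp add: integrable_indicator_cball)
    have bd: "norm (f x) \<le> norm (C * indicator (cball 0 R) x)" for x
      using C z[of x] by (cases "x \<in> cball 0 R") auto
    show ?thesis
      by (rule Bochner_Integration.integrable_bound[OF i _ AE_I2[OF bd]])
        (use borel_measurable_continuous_onI[OF cf] in simp)
  qed
  define D where "D n x = real (Suc n) *\<^sub>R (f (x + (1 / real (Suc n)) *\<^sub>R v) - f x)" for n x
  have shift: "integrable lborel (\<lambda>x. f (x + a))" "(\<integral>x. f (x + a) \<partial>lborel) = (\<integral>x. f x \<partial>lborel)" for a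
  proof -
    have "f \<in> borel_measurable borel" using borel_measurable_continuous_onI[OF cf] .
    then show "integrable lborel (\<lambda>x. f (x + a))" "(\<integral>x. f (x + a) \<partial>lborel) = (\<integral>x. f x \<partial>lborel)"
      using integrable_distr[of "(+) a" lborel borel f] integral_distr[of "(+) a" lborel borel f] fint
      by (simp_all add: lborel_distr_plus add.commute)
  qed
  have D0: "(\<integral>x. D n x \<partial>lborel) = 0" for n
    unfolding D_def using shift fint by simp
  \<comment> \<open>The mean value theorem bounds all quotients by B. The shifts have length at most
    \<open>norm v\<close>, so all quotients vanish outside the ball enlarged by that amount.\<close>
  let ?h = "\<lambda>x. B * indicator (cball 0 (R + norm v)) x :: real"
  have "(\<lambda>n. \<integral>x. D n x \<partial>lborel) \<longlonglongrightarrow> (\<integral>x. ?f' x \<partial>lborel)"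
  proof (rule integral_dominated_convergence[where w = ?h])
    show "?f' \<in> borel_measurable lborel" using borel_measurable_continuous_onI[OF cf'] by simp
    show "D n \<in> borel_measurable lborel" for n
      unfolding D_def using shift(1)[of "(1 / real (Suc n)) *\<^sub>R v"] fint by (intro borel_measurable_integrable) simp
    show "integrable lborel ?h"
      by (simp add: integrable_indicator_cball)
    show "AE x in lborel. (\<lambda>n. D n x) \<longlonglongrightarrow> ?f' x"
    proof (rule AE_I2)
      fix x
      have "((\<lambda>t. f (x + t *\<^sub>R v)) has_vector_derivative ?f' x) (at 0)"
      proof -
        have "((\<lambda>t. x + t *\<^sub>R v) has_derivative (\<lambda>t. t *\<^sub>R v)) (at 0)"
          by (auto intro!: derivative_eq_intros)
        from has_derivative_compose[OF this, of f "fderiv f x"] d[of x]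
        have "((\<lambda>t. f (x + t *\<^sub>R v)) has_derivative (\<lambda>t. fderiv f x (t *\<^sub>R v))) (at 0)" by simp
        moreover have "(\<lambda>t. fderiv f x (t *\<^sub>R v)) = (\<lambda>t. t *\<^sub>R ?f' x)"
          using linear_scale[OF has_derivative_linear[OF d[of x]]] by auto
        ultimately show ?thesis by (simp add: has_vector_derivative_def)
      qed
      then have "((\<lambda>t. (f (x + t *\<^sub>R v) - f x) /\<^sub>R t) \<longlongrightarrow> ?f' x) (at 0)"
        using has_vector_derivative_at_0 by fastforce
      moreover have "filterlim (\<lambda>n. 1 / real (Suc n)) (at 0) sequentially"
        by (rule filterlim_atI[OF LIMSEQ_Suc[OF lim_1_over_n]]) simp
      ultimately have "(\<lambda>n. (f (x + (1 / real (Suc n)) *\<^sub>R v) - f x) /\<^sub>R (1 / real (Suc n))) \<longlonglongrightarrow> ?f' x"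
        by (rule filterlim_compose)
      then show "(\<lambda>n. D n x) \<longlonglongrightarrow> ?f' x" by (simp add: D_def)
    qed
    show "AE x in lborel. norm (D n x) \<le> ?h x" for n
    proof (rule AE_I2)
      fix x
      let ?s = "1 / real (Suc n)"
      show "norm (D n x) \<le> ?h x"
      proof (cases "x \<in> cball 0 (R + norm v)")
        case True
        have "norm (f (x + ?s *\<^sub>R v) - f (x + 0 *\<^sub>R v)) \<le> B * norm (?s - 0)"
        proof (rule differentiable_bound[where S = UNIV and f' = "\<lambda>t h. h *\<^sub>R fderiv f (x + t *\<^sub>R v) v" and f = "\<lambda>t. f (x + t *\<^sub>R v)"])
          fix t :: real
          have "((\<lambda>t. x + t *\<^sub>R v) has_derivative (\<lambda>t. t *\<^sub>R v)) (at t)"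
            by (auto intro!: derivative_eq_intros)
          from has_derivative_compose[OF this d]
          have "((\<lambda>t. f (x + t *\<^sub>R v)) has_derivative (\<lambda>h. fderiv f (x + t *\<^sub>R v) (h *\<^sub>R v))) (at t)" .
          moreover have "(\<lambda>h. fderiv f (x + t *\<^sub>R v) (h *\<^sub>R v)) = (\<lambda>h. h *\<^sub>R ?f' (x + t *\<^sub>R v))"
            using linear_scale[OF has_derivative_linear[OF d]] by auto
          ultimately show "((\<lambda>t. f (x + t *\<^sub>R v)) has_derivative (\<lambda>h. h *\<^sub>R ?f' (x + t *\<^sub>R v))) (at t within UNIV)" by simp
          have "onorm (\<lambda>h::real. h *\<^sub>R ?f' (x + t *\<^sub>R v)) \<le> norm (?f' (x + t *\<^sub>R v))"
            by (intro onorm_bound) auto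
          then show "onorm (\<lambda>h::real. h *\<^sub>R ?f' (x + t *\<^sub>R v)) \<le> B" using bd order_trans by blast
        qed auto
        then have "real (Suc n) * norm (f (x + ?s *\<^sub>R v) - f x) \<le> B" by (simp add: field_simps)
        then show ?thesis using True by (simp add: D_def)
      next
        case False
        then have x: "norm x > R + norm v" by simp
        have "norm (?s *\<^sub>R v) \<le> norm v" by (simp add: divide_simps algebra_simps)
        then have "norm (x + ?s *\<^sub>R v) > R" using x norm_triangle_ineq4[of "x + ?s *\<^sub>R v" "?s *\<^sub>R v"] by simp
        moreover have "norm x > R" using x norm_ge_zero[of v] by linarith
        ultimately show ?thesis using False z by (simp add: D_def)
      qed
    qed
  qed
  then show ?thesis using D0 by (simp add: LIMSEQ_const_iff)
qed

text \<open>Since f vanishes on U outside the compact set K, its extension by zero is continuously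
  differentiable on the whole space, where the preceding lemma applies.\<close>

lemma integral_derivative_zero:
  fixes f :: "real ^ 'n::finite \<Rightarrow> 'b::euclidean_space"
  assumes U: "open U" and C1: "Ck_on 1 U f" and K: "compact K" "K \<subseteq> U" "\<And>x. x \<in> U - K \<Longrightarrow> f x = 0"
  shows "(\<integral>x. fderiv f x v \<partial>leb U) = 0"
proof -
  let ?F = "\<lambda>x. if x \<in> U then f x else 0"
  have F: "Ck_on 1 UNIV ?F"
    by (rule Ck_on_extend_zero[OF U C1 compact_imp_closed[OF K(1)] K(2,3)])
  have z: "?F x = 0" if "x \<notin> K" for x using K(3)[of x] that by auto
  have "(\<integral>x. fderiv f x v \<partial>leb U) = (\<integral>x. frechet_derivative ?F (at x) v \<partial>leb U)"
  proof (rule Bochner_Integration.integral_cong[OF refl])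
    fix x assume "x \<in> space (leb U)"
    then have "x \<in> U" by simp
    then show "fderiv f x v = frechet_derivative ?F (at x) v"
      using frechet_derivative_transform_within_open[of f x U ?F] C1 U by (simp add: One_nat_def)
  qed
  also have "\<dots> = (\<integral>x. indicator U x *\<^sub>R frechet_derivative ?F (at x) v \<partial>lebesgue)"
    using U by (intro integral_restrict_space) auto
  also have "\<dots> = (\<integral>x. frechet_derivative ?F (at x) v \<partial>lebesgue)"
  proof (rule Bochner_Integration.integral_cong[OF refl])
    fix x
    have "frechet_derivative ?F (at x) v = 0" if "x \<notin> U"
    proof -
      have "((\<lambda>x. 0) has_derivative (\<lambda>v. 0)) (at x)" by simp
      then have "(?F has_derivative (\<lambda>v. 0)) (at x)"
        by (rule has_derivative_transform_within_open[of _ _ _ _ "- K"])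
          (use that z K in \<open>auto simp: open_Compl compact_imp_closed\<close>)
      then show ?thesis using frechet_derivative_at by metis
    qed
    then show "indicator U x *\<^sub>R frechet_derivative ?F (at x) v = frechet_derivative ?F (at x) v"
      by (auto simp: indicator_def)
  qed
  also have "\<dots> = (\<integral>x. frechet_derivative ?F (at x) v \<partial>lborel)"
  proof (rule integral_completion)
    have "continuous_on UNIV (\<lambda>x. frechet_derivative ?F (at x) v)"
      using F by (simp add: One_nat_def)
    then show "(\<lambda>x. frechet_derivative ?F (at x) v) \<in> borel_measurable lborel"
      using borel_measurable_continuous_onI by auto
  qed
  also have "\<dots> = 0"
    by (rule integral_derivative_compact_support[OF F compact_imp_bounded[OF K(1)] z])
  finally show ?thesis .
qed

section \<open>The fundamental lemma of the calculus of variations\<close>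

lemma integral_compact_eq_0:
  fixes h :: "real ^ 'n::finite \<Rightarrow> real"
  assumes U: "open U" and h: "h \<in> L2 (leb U)"
    and z: "\<And>\<theta>. \<theta> \<in> test_functions U \<Longrightarrow> (\<integral>x. h x * \<theta> x \<partial>leb U) = 0"
    and K: "compact K" "K \<subseteq> U"
  shows "integrable (leb U) (\<lambda>x. h x * indicator K x)"
    and "(\<integral>x. h x * indicator K x \<partial>leb U) = 0"
proof -
  have Us: "U \<in> sets lebesgue" using U by auto
  \<comment> \<open>Neighbourhoods shrinking to K. Cutoffs that are 1 on K and supported in
    \<open>V n\<close> converge pointwise to the indicator of K, all of them below the indicator of
    \<open>V 0\<close>.\<close>
  define V where "V n = U \<inter> (\<Union>x\<in>K. ball x (1 / real (Suc n)))" for n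
  have V: "open (V n)" "K \<subseteq> V n" "V n \<subseteq> U" for n using K(2) U by (auto simp: V_def)
  have "\<exists>\<eta>. \<eta> \<in> test_functions (V n) \<and> (\<forall>x\<in>K. \<eta> x = 1) \<and> (\<forall>x. 0 \<le> \<eta> x \<and> \<eta> x \<le> (1::real))" for n
    by (rule smooth_cutoff[OF K(1) V(1,2)[of n]]) blast
  then obtain \<eta> where \<eta>: "\<And>n. \<eta> n \<in> test_functions (V n)" "\<And>n x. x \<in> K \<Longrightarrow> \<eta> n x = 1"
      "\<And>n x. 0 \<le> \<eta> n x" "\<And>n x. \<eta> n x \<le> (1::real)" by metis
  have lim: "(\<lambda>n. \<eta> n x) \<longlonglongrightarrow> indicator K x" for x
  proof (cases "x \<in> K")
    case True then show ?thesis using \<eta>(2) by simp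
  next
    case False
    show ?thesis
    proof (rule tendsto_eventually)
      have "\<forall>\<^sub>F n in sequentially. x \<notin> V n"
      proof -
        obtain e where e: "0 < e" "ball x e \<subseteq> - K"
          using openE[OF open_Compl[OF compact_imp_closed[OF K(1)]], of x] False by blast
        have "\<forall>\<^sub>F n in sequentially. 1 / real (Suc n) < e"
          using order_tendstoD(2)[OF LIMSEQ_Suc[OF lim_1_over_n] e(1)] .
        then show ?thesis
        proof eventually_elim
          case (elim n)
          have "\<not> dist y x < 1 / real (Suc n)" if "y \<in> K" for y
            using elim e(2) that subsetD[OF e(2), of y] by (auto simp: dist_commute)
          then show ?case by (auto simp: V_def)
        qed
      qed
      then show "\<forall>\<^sub>F n in sequentially. \<eta> n x = indicator K x"
      proof eventually_elim
        case (elim n)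
        then have "x \<notin> closure {x. \<eta> n x \<noteq> 0}" using test_functions_D(3)[OF \<eta>(1)[of n]] by blast
        then show ?case using test_functions_outside[OF \<eta>(1)[of n], of x] False by simp
      qed
    qed
  qed
  define S where "S = V 0"
  have S: "bounded S" "open S"
  proof -
    obtain r where r: "K \<subseteq> ball 0 r" using bounded_subset_ballD[OF compact_imp_bounded[OF K(1)], of 0] by blast
    have "norm z < r + 1" if z: "z \<in> S" for z
    proof -
      obtain x where x: "x \<in> K" "dist x z < 1" using z by (auto simp: S_def V_def)
      then have "norm x < r" using r by auto
      then show ?thesis using x(2) norm_triangle_ineq2[of z x] by (simp add: dist_norm norm_minus_commute)
    qed
    then show "bounded S" unfolding bounded_iff by (meson less_imp_le)
  qed (use V in \<open>simp add: S_def\<close>)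
  have "(indicator S :: _ \<Rightarrow> real) \<in> L2 (leb U)"
  proof (rule L2I)
    show "integrable (leb U) (indicator S :: _ \<Rightarrow> real)"
      using S Us by (intro integrable_indicator_bounded) auto
    then show "(indicator S :: _ \<Rightarrow> real) \<in> borel_measurable (leb U)" by (rule borel_measurable_integrable)
  qed (auto simp: indicator_def)
  from L2_Cauchy_Schwarz(1)[OF h this]
  have dom: "integrable (leb U) (\<lambda>x. norm (h x) * norm (indicator S x :: real))" .
  have lim': "(\<lambda>n. \<integral>x. h x * \<eta> n x \<partial>leb U) \<longlonglongrightarrow> (\<integral>x. h x * indicator K x \<partial>leb U)"
    and int: "integrable (leb U) (\<lambda>x. h x * indicator K x)"
  proof -
    have 1: "(\<lambda>x. h x * indicator K x) \<in> borel_measurable (leb U)"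
    proof -
      have "K \<in> sets lebesgue" using K(1) by (simp add: borel_compact)
      then have "(indicator K :: _ \<Rightarrow> real) \<in> borel_measurable (leb U)"
        by (intro measurable_restrict_space1) (simp add: borel_measurable_indicator_iff)
      then show ?thesis using L2_D(1)[OF h] by (rule borel_measurable_times[rotated])
    qed
    have 2: "(\<lambda>x. h x * \<eta> n x) \<in> borel_measurable (leb U)" for n
      by (rule borel_measurable_times[OF L2_D(1)[OF h] test_functions_measurable[OF \<eta>(1)]])
    have 3: "AE x in leb U. (\<lambda>n. h x * \<eta> n x) \<longlonglongrightarrow> h x * indicator K x"
      by (intro AE_I2 tendsto_mult_left lim)
    have 4: "AE x in leb U. norm (h x * \<eta> n x) \<le> norm (h x) * norm (indicator S x :: real)" for n
    proof (rule AE_I2)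
      fix x
      have "\<bar>\<eta> n x\<bar> \<le> indicator S x"
      proof (cases "x \<in> S")
        case True then show ?thesis using \<eta>(3,4)[of n x] by simp
      next
        case False
        have "V n \<subseteq> S" unfolding S_def V_def
          by (intro Int_mono order_refl UN_mono subset_ball) (auto simp: divide_simps)
        then have "x \<notin> closure {x. \<eta> n x \<noteq> 0}" using test_functions_D(3)[OF \<eta>(1)[of n]] False by blast
        then show ?thesis using test_functions_outside[OF \<eta>(1)[of n], of x] by simp
      qed
      then show "norm (h x * \<eta> n x) \<le> norm (h x) * norm (indicator S x :: real)"
        by (simp add: abs_mult mult_left_mono)
    qed
    show "(\<lambda>n. \<integral>x. h x * \<eta> n x \<partial>leb U) \<longlonglongrightarrow> (\<integral>x. h x * indicator K x \<partial>leb U)"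
      by (rule integral_dominated_convergence[OF 1 2 dom 3 4])
    show "integrable (leb U) (\<lambda>x. h x * indicator K x)"
      by (rule integrable_dominated_convergence[OF 1 2 dom 3 4])
  qed
  show "integrable (leb U) (\<lambda>x. h x * indicator K x)" by (rule int)
  have "(\<integral>x. h x * \<eta> n x \<partial>leb U) = 0" for n
    by (rule z[OF test_functions_mono[OF \<eta>(1) V(3)]])
  then show "(\<integral>x. h x * indicator K x \<partial>leb U) = 0"
    using lim' by (simp add: LIMSEQ_const_iff)
qed

text \<open>By inner regularity the set where h is positive is a countable union of compact sets up
  to a null set. On each of them h is positive with integral zero, so each of them is null.\<close>

lemma fundamental_lemma_nonpos:
  fixes h :: "real ^ 'n::finite \<Rightarrow> real"
  assumes U: "open U" and h: "h \<in> L2 (leb U)"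
    and z: "\<And>\<theta>. \<theta> \<in> test_functions U \<Longrightarrow> (\<integral>x. h x * \<theta> x \<partial>leb U) = 0"
  shows "AE x in leb U. h x \<le> 0"
proof -
  let ?A = "{x \<in> U. 0 < h x}"
  have Us: "U \<in> sets lebesgue" using U by auto
  have "{x \<in> space (leb U). 0 < h x} \<in> sets (leb U)"
    using L2_D(1)[OF h] by measurable
  then have A: "?A \<in> sets lebesgue" using Us by (simp add: sets_restrict_space_iff)
  obtain N C where N: "negligible N" and C: "\<And>n::nat. compact (C n)" and eq: "?A = (\<Union>n. C n) \<union> N"
    using lebesgue_regular_inner[OF A] by metis
  have "negligible (C n)" for n
  proof -
    have CA: "C n \<subseteq> ?A" using eq by auto
    then have CU: "C n \<subseteq> U" by auto
    have i1: "integrable (leb U) (\<lambda>x. h x * indicator (C n) x)"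
      by (rule integral_compact_eq_0(1)[OF U h _ C CU]) (rule z)
    have i2: "(\<integral>x. h x * indicator (C n) x \<partial>leb U) = 0"
      by (rule integral_compact_eq_0(2)[OF U h _ C CU]) (rule z)
    have "AE x in leb U. 0 \<le> h x * indicator (C n) x"
      using CA by (intro AE_I2) (auto simp: indicator_def)
    then have "AE x in leb U. h x * indicator (C n) x = 0"
      using integral_nonneg_eq_0_iff_AE[OF i1] i2 by blast
    moreover have "C n \<in> sets lebesgue" using C[of n] by (simp add: borel_compact)
    ultimately have "AE x in lebesgue. x \<notin> C n"
      using CA Us by (auto simp: AE_restrict_space_iff elim!: eventually_mono)
    then show "negligible (C n)"
      using \<open>C n \<in> sets lebesgue\<close> by (simp add: negligible_iff_null_sets AE_iff_null_sets)
  qed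
  then have "negligible ?A" unfolding eq using N by (intro negligible_Un negligible_countable_Union) auto
  then have "AE x in lebesgue. x \<notin> ?A"
    using A by (simp add: negligible_iff_null_sets AE_iff_null_sets)
  then show ?thesis using Us by (auto simp: AE_restrict_space_iff elim!: eventually_mono)
qed

lemma fundamental_lemma_real:
  fixes h :: "real ^ 'n::finite \<Rightarrow> real"
  assumes U: "open U" and h: "h \<in> L2 (leb U)"
    and z: "\<And>\<theta>. \<theta> \<in> test_functions U \<Longrightarrow> (\<integral>x. h x * \<theta> x \<partial>leb U) = 0"
  shows "AE x in leb U. h x = 0"
proof -
  have "AE x in leb U. - h x \<le> 0"
    by (rule fundamental_lemma_nonpos[OF U L2_minus[OF h]]) (simp add: z)
  moreover have "AE x in leb U. h x \<le> 0"
    by (rule fundamental_lemma_nonpos[OF U h]) (rule z)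
  ultimately show ?thesis by eventually_elim simp
qed

lemma fundamental_lemma:
  fixes h :: "real ^ 'n::finite \<Rightarrow> complex"
  assumes U: "open U" and h: "h \<in> L2 (leb U)"
    and z: "\<And>\<theta>. \<theta> \<in> test_functions U \<Longrightarrow> (\<integral>x. h x * cpx (\<theta> x) \<partial>leb U) = 0"
  shows "AE x in leb U. h x = 0"
proof -
  note m = L2_D(1)[OF h]
  have Us: "U \<in> sets lebesgue" using U by auto
  have int: "integrable (leb U) (\<lambda>x. h x * cpx (\<theta> x))" if "\<theta> \<in> test_functions U" for \<theta>
    by (rule L2_integrable_mult(1)[OF h test_functions_L2(1)[OF test_functions_linear[OF that bounded_linear_of_real] Us]])
  have "AE x in leb U. Re (h x) = 0"
  proof (rule fundamental_lemma_real[OF U])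
    show "(\<lambda>x. Re (h x)) \<in> L2 (leb U)"
      by (rule L2_norm_mono(1)[OF h]) (use m abs_Re_le_cmod in auto)
    show "(\<integral>x. Re (h x) * \<theta> x \<partial>leb U) = 0" if "\<theta> \<in> test_functions U" for \<theta>
      using integral_Re[OF int[OF that]] z[OF that] by simp
  qed
  moreover have "AE x in leb U. Im (h x) = 0"
  proof (rule fundamental_lemma_real[OF U])
    show "(\<lambda>x. Im (h x)) \<in> L2 (leb U)"
      by (rule L2_norm_mono(1)[OF h]) (use m abs_Im_le_cmod in auto)
    show "(\<integral>x. Im (h x) * \<theta> x \<partial>leb U) = 0" if "\<theta> \<in> test_functions U" for \<theta>
      using integral_Im[OF int[OF that]] z[OF that] by simp
  qed
  ultimately show ?thesis by eventually_elim (simp add: complex_eq_iff)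
qed

section \<open>Weak gradients\<close>

lemma L2_linear:
  fixes f :: "'a \<Rightarrow> 'b::euclidean_space" and L :: "'b \<Rightarrow> 'c::euclidean_space"
  assumes "bounded_linear L" "f \<in> L2 M"
  shows "(\<lambda>x. L (f x)) \<in> L2 M"
proof -
  obtain B where B: "0 < B" "\<And>y. norm (L y) \<le> norm y * B" using bounded_linear.pos_bounded[OF assms(1)] by blast
  have "L \<in> borel_measurable borel"
    by (intro borel_measurable_continuous_onI linear_continuous_on assms(1))
  then have m: "(\<lambda>x. L (f x)) \<in> borel_measurable M"
    using measurable_compose[OF L2_D(1)[OF assms(2)]] by blast
  show ?thesis
    by (rule L2_bound(1)[OF assms(2) m, of B]) (use B in \<open>auto simp: mult.commute\<close>)
qed

lemma L2_vec_nth: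
  fixes g :: "'a \<Rightarrow> complex ^ 'n::finite"
  assumes "g \<in> L2 M"
  shows "(\<lambda>x. g x $ i) \<in> L2 M"
  by (rule L2_linear[OF bounded_linear_vec_nth assms])

lemma bounded_linear_axis: "bounded_linear (axis i :: complex \<Rightarrow> complex ^ 'n::finite)"
proof -
  have "linear (axis i :: complex \<Rightarrow> complex ^ 'n)"
    by (rule linearI) (simp_all add: axis_def Finite_Cartesian_Product.vec_eq_iff)
  then show ?thesis by (simp add: linear_conv_bounded_linear)
qed

lemma vec_sum_axis: "(\<chi> i. f i) = (\<Sum>i\<in>UNIV. axis i (f i) :: complex ^ 'n::finite)"
  by (simp add: Finite_Cartesian_Product.vec_eq_iff axis_def sum_component if_distrib cong: if_cong)

lemma L2_vecI:
  fixes f :: "'n::finite \<Rightarrow> 'a \<Rightarrow> complex"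
  assumes "\<And>i. f i \<in> L2 M"
  shows "(\<lambda>x. \<chi> i. f i x) \<in> L2 M"
  unfolding vec_sum_axis by (intro L2_sum L2_linear[OF bounded_linear_axis] assms)

lemma is_weak_gradD:
  assumes "is_weak_grad U u g"
  shows "g \<in> L2 (leb U)"
    and "\<theta> \<in> test_functions U \<Longrightarrow> (\<integral>x. u x * cpx (partial i \<theta> x) \<partial>leb U) =
             - (\<integral>x. (g x $ i) * cpx (\<theta> x) \<partial>leb U)"
  using assms unfolding is_weak_grad_def by blast+

lemma test_functions_of_real_L2:
  fixes \<theta> :: "real ^ 'n::finite \<Rightarrow> real"
  assumes "\<theta> \<in> test_functions U" "W \<in> sets lebesgue"
  shows "(\<lambda>x. cpx (\<theta> x)) \<in> L2 (leb W)"
  by (rule test_functions_L2(1)[OF test_functions_linear[OF assms(1) bounded_linear_of_real] assms(2)])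

text \<open>\<open>wgrad\<close> is a choice among weak gradients; the fundamental lemma shows that
  the choice matters only on a null set, so the integrals formed with it are well defined.\<close>

lemma weak_grad_unique:
  fixes U :: "(real ^ 'n::finite) set"
  assumes U: "open U" and g: "is_weak_grad U u g" and g': "is_weak_grad U u g'"
  shows "AE x in leb U. g x = g' x"
proof -
  have Us: "U \<in> sets lebesgue" using U by auto
  have "AE x in leb U. g x $ i - g' x $ i = 0" for i
  proof (rule fundamental_lemma[OF U])
    note l = L2_vec_nth[OF is_weak_gradD(1)[OF g], of i] L2_vec_nth[OF is_weak_gradD(1)[OF g'], of i]
    show "(\<lambda>x. g x $ i - g' x $ i) \<in> L2 (leb U)" by (rule L2_diff[OF l])
    fix \<theta> :: "real ^ 'n \<Rightarrow> real" assume \<theta>: "\<theta> \<in> test_functions U"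
    note t = test_functions_of_real_L2[OF \<theta> Us]
    show "(\<integral>x. (g x $ i - g' x $ i) * cpx (\<theta> x) \<partial>leb U) = 0"
      using is_weak_gradD(2)[OF g \<theta>, of i] is_weak_gradD(2)[OF g' \<theta>, of i]
        L2_integrable_mult(1)[OF l(1) t] L2_integrable_mult(1)[OF l(2) t]
      by (simp add: left_diff_distrib)
  qed
  then have "AE x in leb U. \<forall>i\<in>UNIV. g x $ i - g' x $ i = 0"
    by (intro AE_finite_allI) auto
  then show ?thesis by eventually_elim (simp add: Finite_Cartesian_Product.vec_eq_iff)
qed

lemma weak_grad_cong:
  assumes "\<And>x. x \<in> U \<Longrightarrow> u x = u' x"
  shows "is_weak_grad U u = is_weak_grad U u'"
proof -
  have "(\<integral>x. u x * h x \<partial>leb U) = (\<integral>x. u' x * h x \<partial>leb U)" for h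
    by (rule Bochner_Integration.integral_cong) (use assms in auto)
  then show ?thesis by (auto simp: is_weak_grad_def fun_eq_iff)
qed

text \<open>Elements of function spaces on U are total functions; this lemma and the congruences
  after it discard their values outside U.\<close>

lemma L2_cong_on:
  assumes "\<And>x. x \<in> U \<Longrightarrow> u x = u' x"
  shows "u \<in> L2 (leb U) \<longleftrightarrow> u' \<in> L2 (leb U)"
    and "norm2 U u = norm2 U u'"
proof -
  have "u \<in> borel_measurable (leb U) \<longleftrightarrow> u' \<in> borel_measurable (leb U)"
    by (rule measurable_cong) (use assms in simp)
  moreover have "integrable (leb U) (\<lambda>x. (norm (u x))\<^sup>2) \<longleftrightarrow> integrable (leb U) (\<lambda>x. (norm (u' x))\<^sup>2)"
    by (rule Bochner_Integration.integrable_cong) (use assms in auto)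
  ultimately show "u \<in> L2 (leb U) \<longleftrightarrow> u' \<in> L2 (leb U)" by (simp add: L2_def)
  have "(\<integral>x. (norm (u x))\<^sup>2 \<partial>leb U) = (\<integral>x. (norm (u' x))\<^sup>2 \<partial>leb U)"
    by (rule Bochner_Integration.integral_cong) (use assms in auto)
  then show "norm2 U u = norm2 U u'" by (simp add: L2_norm_def)
qed

lemma H1_cong: "(\<And>x. x \<in> U \<Longrightarrow> u x = u' x) \<Longrightarrow> u \<in> H1 U \<longleftrightarrow> u' \<in> H1 U"
  using L2_cong_on(1)[of U u u'] weak_grad_cong[of U u u'] by (simp add: H1_def)

lemma wgrad_cong: "(\<And>x. x \<in> U \<Longrightarrow> u x = u' x) \<Longrightarrow> wgrad U u = wgrad U u'"
  using weak_grad_cong[of U u u'] by (simp add: wgrad_def)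

lemma H1k_norm_cong: "(\<And>x. x \<in> U \<Longrightarrow> u x = u' x) \<Longrightarrow> H1k_norm k U u = H1k_norm k U u'"
  using wgrad_cong[of U u u'] L2_cong_on(2)[of U u u'] by (simp add: H1k_norm_def)

lemma H1_L2: "u \<in> H1 U \<Longrightarrow> u \<in> L2 (leb U)"
  by (simp add: H1_def)

lemma H1I: "u \<in> L2 (leb U) \<Longrightarrow> is_weak_grad U u g \<Longrightarrow> u \<in> H1 U"
  by (auto simp: H1_def)

lemma is_weak_grad_wgrad: "u \<in> H1 U \<Longrightarrow> is_weak_grad U u (wgrad U u)"
  unfolding wgrad_def H1_def by (auto intro: someI_ex[of "is_weak_grad U u"])

lemma wgrad_L2: "u \<in> H1 U \<Longrightarrow> wgrad U u \<in> L2 (leb U)"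
  using is_weak_gradD(1)[OF is_weak_grad_wgrad] .

lemma wgrad_AE:
  assumes "open U" "is_weak_grad U u g"
  shows "AE x in leb U. wgrad U u x = g x"
proof -
  have "is_weak_grad U u (wgrad U u)" unfolding wgrad_def by (rule someI[of _ g]) (rule assms(2))
  from weak_grad_unique[OF assms(1) this assms(2)] show ?thesis .
qed

lemma weak_grad_add:
  fixes U :: "(real ^ 'n::finite) set"
  assumes U: "open U" and u: "u \<in> L2 (leb U)" "is_weak_grad U u g"
    and v: "v \<in> L2 (leb U)" "is_weak_grad U v h"
  shows "is_weak_grad U (\<lambda>x. u x + v x) (\<lambda>x. g x + h x)"
  unfolding is_weak_grad_def
proof (intro conjI allI impI)
  have Us: "U \<in> sets lebesgue" using U by auto
  show "(\<lambda>x. g x + h x) \<in> L2 (leb U)"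
    by (rule L2_add[OF is_weak_gradD(1)[OF u(2)] is_weak_gradD(1)[OF v(2)]])
  fix \<theta> :: "real ^ 'n \<Rightarrow> real" and i assume \<theta>: "\<theta> \<in> test_functions U"
  note t = test_functions_of_real_L2[OF \<theta> Us]
    test_functions_of_real_L2[OF test_functions_derivative[OF \<theta>] Us, of "axis i 1"]
  show "(\<integral>x. (u x + v x) * cpx (partial i \<theta> x) \<partial>leb U) =
             - (\<integral>x. ((g x + h x) $ i) * cpx (\<theta> x) \<partial>leb U)"
    using is_weak_gradD(2)[OF u(2) \<theta>, of i] is_weak_gradD(2)[OF v(2) \<theta>, of i]
      L2_integrable_mult(1)[OF u(1) t(2)] L2_integrable_mult(1)[OF v(1) t(2)]
      L2_integrable_mult(1)[OF L2_vec_nth[OF is_weak_gradD(1)[OF u(2)], of i] t(1)]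
      L2_integrable_mult(1)[OF L2_vec_nth[OF is_weak_gradD(1)[OF v(2)], of i] t(1)]
    by (simp add: distrib_right)
qed

lemma weak_grad_cmult:
  fixes U :: "(real ^ 'n::finite) set"
  assumes "is_weak_grad U u g"
  shows "is_weak_grad U (\<lambda>x. c * u x) (\<lambda>x. c *s g x)"
  unfolding is_weak_grad_def
proof (intro conjI allI impI)
  have "(\<lambda>x. \<chi> i. c * g x $ i) \<in> L2 (leb U)"
    by (intro L2_vecI L2_cmult L2_vec_nth is_weak_gradD(1)[OF assms])
  then show "(\<lambda>x. c *s g x) \<in> L2 (leb U)" by (simp add: vector_scalar_mult_def)
  fix \<theta> :: "real ^ 'n \<Rightarrow> real" and i assume \<theta>: "\<theta> \<in> test_functions U"
  show "(\<integral>x. (c * u x) * cpx (partial i \<theta> x) \<partial>leb U) =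
             - (\<integral>x. ((c *s g x) $ i) * cpx (\<theta> x) \<partial>leb U)"
    using is_weak_gradD(2)[OF assms \<theta>, of i] by (simp add: mult.assoc)
qed

lemma weak_grad_zero: "is_weak_grad U (\<lambda>x. 0) (\<lambda>x. 0)"
  by (simp add: is_weak_grad_def)

lemma weak_grad_sum:
  fixes U :: "(real ^ 'n::finite) set"
  assumes U: "open U" and u: "\<And>j. j \<in> I \<Longrightarrow> u j \<in> L2 (leb U)" "\<And>j. j \<in> I \<Longrightarrow> is_weak_grad U (u j) (g j)"
  shows "is_weak_grad U (\<lambda>x. \<Sum>j\<in>I. c j * u j x) (\<lambda>x. \<Sum>j\<in>I. c j *s g j x)"
  using u
proof (induction I rule: infinite_finite_induct)
  case (insert j I)
  have "(\<lambda>x. \<Sum>j\<in>I. c j * u j x) \<in> L2 (leb U)" by (intro L2_sum L2_cmult insert.prems) simp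
  moreover have "(\<lambda>x. c j * u j x) \<in> L2 (leb U)" by (intro L2_cmult insert.prems) simp
  ultimately show ?case
    using weak_grad_add[OF U _ weak_grad_cmult[OF insert.prems(2)[of j], of "c j"] _ insert.IH] insert by simp
qed (simp_all add: weak_grad_zero)

lemma cvec_cnj_nth [simp]: "cvec_cnj \<xi> $ i = cnj (\<xi> $ i)"
  by (simp add: cvec_cnj_def)

lemma L2_cnj: "f \<in> L2 M \<Longrightarrow> (\<lambda>x. cnj (f x)) \<in> L2 M"
  by (rule L2_linear[OF bounded_linear_cnj])

lemma L2_cvec_cnj:
  fixes g :: "'a \<Rightarrow> complex ^ 'n::finite"
  assumes "g \<in> L2 M"
  shows "(\<lambda>x. cvec_cnj (g x)) \<in> L2 M"
  unfolding cvec_cnj_def by (intro L2_vecI L2_cnj L2_vec_nth assms)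

lemma weak_grad_cnj:
  fixes U :: "(real ^ 'n::finite) set"
  assumes "is_weak_grad U u g"
  shows "is_weak_grad U (\<lambda>x. cnj (u x)) (\<lambda>x. cvec_cnj (g x))"
  unfolding is_weak_grad_def
proof (intro conjI allI impI)
  show "(\<lambda>x. cvec_cnj (g x)) \<in> L2 (leb U)"
    by (rule L2_cvec_cnj[OF is_weak_gradD(1)[OF assms]])
  fix \<theta> :: "real ^ 'n \<Rightarrow> real" and i assume \<theta>: "\<theta> \<in> test_functions U"
  have c: "cnj (\<integral>x. f x * cpx (h x) \<partial>leb U) = (\<integral>x. cnj (f x) * cpx (h x) \<partial>leb U)" for f h
    using Bochner_Integration.integral_cnj[of "leb U" "\<lambda>x. f x * cpx (h x)"] by simp
  show "(\<integral>x. cnj (u x) * cpx (partial i \<theta> x) \<partial>leb U) =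
             - (\<integral>x. (cvec_cnj (g x) $ i) * cpx (\<theta> x) \<partial>leb U)"
    using arg_cong[OF is_weak_gradD(2)[OF assms \<theta>, of i], of cnj] by (simp only: c complex_cnj_minus cvec_cnj_nth)
qed

section \<open>Extension by zero and products with cutoffs\<close>

lemma on_superset:
  fixes f :: "'a::euclidean_space \<Rightarrow> 'b::{banach,second_countable_topology}"
  assumes "U \<subseteq> W" "U \<in> sets lebesgue" "W \<in> sets lebesgue" "\<And>x. x \<in> W - U \<Longrightarrow> f x = 0"
  shows "f \<in> borel_measurable (leb W) \<longleftrightarrow> f \<in> borel_measurable (leb U)"
    and "integrable (leb W) f \<longleftrightarrow> integrable (leb U) f"
    and "(\<integral>x. f x \<partial>leb W) = (\<integral>x. f x \<partial>leb U)"
proof -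
  have *: "(\<lambda>x. indicator W x *\<^sub>R f x) = (\<lambda>x. indicator U x *\<^sub>R f x)"
    using assms(1,4) by (auto simp: indicator_def fun_eq_iff)
  show "f \<in> borel_measurable (leb W) \<longleftrightarrow> f \<in> borel_measurable (leb U)"
    using assms(2,3) * by (simp add: borel_measurable_restrict_space_iff)
  show "integrable (leb W) f \<longleftrightarrow> integrable (leb U) f"
    using assms(2,3) * by (simp add: integrable_restrict_space)
  show "(\<integral>x. f x \<partial>leb W) = (\<integral>x. f x \<partial>leb U)"
    using assms(2,3) * by (simp add: integral_restrict_space)
qed

lemma L2_on_superset:
  fixes f :: "'a::euclidean_space \<Rightarrow> 'b::euclidean_space"
  assumes "U \<subseteq> W" "U \<in> sets lebesgue" "W \<in> sets lebesgue" "\<And>x. x \<in> W - U \<Longrightarrow> f x = 0"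
  shows "f \<in> L2 (leb W) \<longleftrightarrow> f \<in> L2 (leb U)" "norm2 W f = norm2 U f"
  using on_superset[OF assms(1-3), of f] on_superset[OF assms(1-3), of "\<lambda>x. (norm (f x))\<^sup>2"] assms(4)
  by (auto simp: L2_def L2_norm_def)

lemma frechet_derivative_eq: "(f has_derivative D) (at x) \<Longrightarrow> fderiv f x = D"
  by (rule frechet_derivative_at[symmetric])

lemma frechet_derivative_mult_of_real:
  fixes u :: "'a::real_normed_vector \<Rightarrow> complex" and \<theta> :: "'a \<Rightarrow> real"
  assumes "u differentiable (at x)" "\<theta> differentiable (at x)"
  shows "fderiv (\<lambda>x. u x * cpx (\<theta> x)) x v =
    fderiv u x v * cpx (\<theta> x) + u x * cpx (fderiv \<theta> x v)"
proof -
  have "((\<lambda>x. cpx (\<theta> x)) has_derivative (\<lambda>v. cpx (fderiv \<theta> x v))) (at x)"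
    using has_derivative_of_real assms(2) frechet_derivative_works by blast
  from has_derivative_mult[OF frechet_derivative_works[THEN iffD1, OF assms(1)] this]
  show ?thesis by (subst frechet_derivative_eq) (auto simp: algebra_simps)
qed

lemma frechet_derivative_mult_real:
  fixes u \<theta> :: "'a::real_normed_vector \<Rightarrow> real"
  assumes "u differentiable (at x)" "\<theta> differentiable (at x)"
  shows "fderiv (\<lambda>x. u x * \<theta> x) x v =
    fderiv u x v * \<theta> x + u x * fderiv \<theta> x v"
  using has_derivative_mult[OF frechet_derivative_works[THEN iffD1, OF assms(1)] frechet_derivative_works[THEN iffD1, OF assms(2)]]
  by (subst frechet_derivative_eq) (auto simp: algebra_simps)

lemma test_functions_differentiable: "\<theta> \<in> test_functions U \<Longrightarrow> \<theta> differentiable (at x)"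
  using test_functions_has_derivative differentiable_def by blast

lemma Ck_on_mult_of_real:
  fixes u :: "'a::real_normed_vector \<Rightarrow> complex" and \<theta> :: "'a \<Rightarrow> real"
  assumes "open U" "Ck_on m U u" "Ck_on m U \<theta>"
  shows "Ck_on m U (\<lambda>x. u x * cpx (\<theta> x))"
  by (rule Ck_on_mult[OF assms(1,2) Ck_on_bounded_linear[OF bounded_linear_of_real assms(1,3)]])

text \<open>The product of u with a test function has compact support in U, so its derivative
  integrates to zero; the product rule turns this into the defining identity of a weak
  gradient.\<close>

lemma weak_grad_classical:
  fixes U :: "(real ^ 'n::finite) set"
  assumes U: "open U" and u: "Ck_on 1 U u" "u \<in> L2 (leb U)" "cgrad u \<in> L2 (leb U)"
  shows "is_weak_grad U u (cgrad u)"
  unfolding is_weak_grad_def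
proof (intro conjI allI impI)
  have Us: "U \<in> sets lebesgue" using U by auto
  fix \<theta> :: "real ^ 'n \<Rightarrow> real" and i assume \<theta>: "\<theta> \<in> test_functions U"
  note t = test_functions_of_real_L2[OF \<theta> Us]
    test_functions_of_real_L2[OF test_functions_derivative[OF \<theta>] Us, of "axis i 1"]
  let ?f = "\<lambda>x. u x * cpx (\<theta> x)"
  have "(\<integral>x. partial i ?f x \<partial>leb U) = 0"
  proof (rule integral_derivative_zero[OF U _ test_functions_D(2,3)[OF \<theta>]])
    show "Ck_on 1 U ?f"
      by (rule Ck_on_mult_of_real[OF U u(1) Ck_on_subset[OF test_functions_D(1)[OF \<theta>] subset_UNIV]])
    show "?f x = 0" if "x \<in> U - closure {x. \<theta> x \<noteq> 0}" for x
      using test_functions_outside[OF \<theta>, of x] that by simp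
  qed
  moreover have "(\<integral>x. partial i ?f x \<partial>leb U) =
     (\<integral>x. (cgrad u x $ i) * cpx (\<theta> x) + u x * cpx (partial i \<theta> x) \<partial>leb U)"
  proof (rule Bochner_Integration.integral_cong[OF refl])
    fix x assume "x \<in> space (leb U)"
    then have "u differentiable (at x)" using u(1) by (simp add: One_nat_def)
    from frechet_derivative_mult_of_real[OF this test_functions_differentiable[OF \<theta>]]
    show "partial i ?f x = (cgrad u x $ i) * cpx (\<theta> x) + u x * cpx (partial i \<theta> x)"
      by (simp add: cgrad_def)
  qed
  ultimately show "(\<integral>x. u x * cpx (partial i \<theta> x) \<partial>leb U) =
             - (\<integral>x. (cgrad u x $ i) * cpx (\<theta> x) \<partial>leb U)"
    using L2_integrable_mult(1)[OF L2_vec_nth[OF u(3), of i] t(1)] L2_integrable_mult(1)[OF u(2) t(2)]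
    by (simp add: eq_neg_iff_add_eq_0 add.commute)
qed (rule u(3))

lemma test_functions_H1:
  fixes w :: "real ^ 'n::finite \<Rightarrow> complex"
  assumes w: "w \<in> test_functions S" and U: "open U"
  shows "w \<in> L2 (leb U)" "is_weak_grad U w (cgrad w)" "w \<in> H1 U"
proof -
  have Us: "U \<in> sets lebesgue" using U by auto
  show 1: "w \<in> L2 (leb U)" by (rule test_functions_L2(1)[OF w Us])
  have "cgrad w \<in> L2 (leb U)"
    unfolding cgrad_def by (rule L2_vecI[OF test_functions_L2(1)[OF test_functions_derivative[OF w] Us]])
  from weak_grad_classical[OF U Ck_on_subset[OF test_functions_D(1)[OF w] subset_UNIV] 1 this]
  show 2: "is_weak_grad U w (cgrad w)" .
  from 1 2 show "w \<in> H1 U" by (rule H1I)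
qed

definition cutoff_grad ::
  "(real ^ 'n::finite \<Rightarrow> real) \<Rightarrow> (real ^ 'n \<Rightarrow> complex) \<Rightarrow> (real ^ 'n \<Rightarrow> complex ^ 'n) \<Rightarrow> real ^ 'n \<Rightarrow> complex ^ 'n" where
  "cutoff_grad \<eta> v g x = (\<chi> i. cpx (\<eta> x) * g x $ i + v x * cpx (partial i \<eta> x))"

lemma L2_bounded_cmult:
  fixes f :: "'a \<Rightarrow> complex"
  assumes f: "f \<in> L2 M" and c: "c \<in> borel_measurable M" and B: "\<And>x. \<bar>c x\<bar> \<le> B"
  shows "(\<lambda>x. cpx (c x) * f x) \<in> L2 M"
    and "L2_norm M (\<lambda>x. cpx (c x) * f x) \<le> B * L2_norm M f"
proof -
  have "0 \<le> B" using B[of undefined] by simp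
  from L2_bounded_mult[OF f c _ this] B
  show "(\<lambda>x. cpx (c x) * f x) \<in> L2 M"
    and "L2_norm M (\<lambda>x. cpx (c x) * f x) \<le> B * L2_norm M f"
    by (simp_all add: scaleR_conv_of_real)
qed

lemma L2_norm_vec_le:
  fixes f :: "'n::finite \<Rightarrow> 'a \<Rightarrow> complex"
  assumes f: "\<And>i. f i \<in> L2 M" and B: "\<And>i. L2_norm M (f i) \<le> B"
  shows "L2_norm M (\<lambda>x. \<chi> i. f i x) \<le> real CARD('n) * B"
proof -
  have sum: "L2_norm M (\<lambda>x. \<Sum>i\<in>I. axis i (f i x) :: complex ^ 'n) \<le> (\<Sum>i\<in>I. L2_norm M (f i))" if "finite I" for I
    using that
  proof (induction I)
    case empty then show ?case by (simp add: L2_norm_def)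
  next
    case (insert i I)
    have "L2_norm M (\<lambda>x. axis i (f i x) + (\<Sum>i\<in>I. axis i (f i x)) :: complex ^ 'n)
      \<le> L2_norm M (\<lambda>x. axis i (f i x) :: complex ^ 'n) + L2_norm M (\<lambda>x. \<Sum>i\<in>I. axis i (f i x) :: complex ^ 'n)"
      by (intro L2_norm_triangle L2_sum L2_linear[OF bounded_linear_axis] f)
    moreover have "norm (axis i z :: complex ^ 'n) = norm z" for z
    proof -
      have "(norm (axis i z :: complex ^ 'n))\<^sup>2 = (norm z)\<^sup>2"
        by (simp add: norm_vec_def L2_set_def axis_def if_distrib[of norm] if_distrib[of "\<lambda>x. x\<^sup>2"] cong: if_cong)
      then show ?thesis by simp
    qed
    ultimately show ?case using insert by (simp add: L2_norm_def)
  qed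
  have "L2_norm M (\<lambda>x. \<chi> i. f i x) \<le> (\<Sum>i\<in>UNIV. L2_norm M (f i))"
    unfolding vec_sum_axis by (rule sum) simp
  also have "\<dots> \<le> (\<Sum>i\<in>(UNIV::'n set). B)" by (rule sum_mono[OF B])
  finally show ?thesis by simp
qed

lemma L2_norm_vec_nth:
  fixes g :: "'a \<Rightarrow> complex ^ 'n::finite"
  assumes "g \<in> L2 M"
  shows "L2_norm M (\<lambda>x. g x $ i) \<le> L2_norm M g"
  using L2_norm_mono(2)[OF assms L2_D(1)[OF L2_vec_nth[OF assms]], of i] Finite_Cartesian_Product.norm_nth_le by auto

text \<open>Inside W the support of \<eta> stays in U, so the product makes sense on W whatever v is
  outside U. The constant is fixed before v, so the estimate carries convergent sequences, and hence
  traces, from U to W.\<close>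

lemma cutoff_mult:
  fixes \<eta> :: "real ^ 'n::finite \<Rightarrow> real"
  assumes \<eta>: "\<eta> \<in> test_functions UNIV" and U: "open U" and W: "open W" and UW: "U \<subseteq> W"
    and supp: "closure {x. \<eta> x \<noteq> 0} \<inter> W \<subseteq> U"
  obtains C where "0 < C"
    "\<And>v g. v \<in> L2 (leb U) \<Longrightarrow> is_weak_grad U v g \<Longrightarrow>
       (\<lambda>x. cpx (\<eta> x) * v x) \<in> L2 (leb W) \<and>
       is_weak_grad W (\<lambda>x. cpx (\<eta> x) * v x) (cutoff_grad \<eta> v g) \<and>
       norm2 W (\<lambda>x. cpx (\<eta> x) * v x) \<le> C * norm2 U v \<and>
       norm2 W (cutoff_grad \<eta> v g) \<le> C * (norm2 U g + norm2 U v)"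
proof -
  have Us: "U \<in> sets lebesgue" "W \<in> sets lebesgue" using U W by auto
  obtain B0 where B0: "0 < B0" "\<And>x. norm (\<eta> x) \<le> B0" using test_functions_bounded[OF \<eta>] by blast
  have "\<exists>B. \<forall>x. norm (partial i \<eta> x) \<le> B" for i
    using test_functions_bounded[OF test_functions_derivative[OF \<eta>], of "axis i 1"] by metis
  then obtain B1 where B1: "\<And>i x. norm (partial i \<eta> x) \<le> B1 i" by metis
  define B where "B = B0 + (\<Sum>i\<in>UNIV. \<bar>B1 i\<bar>)"
  have "\<bar>B1 i\<bar> \<le> (\<Sum>i\<in>UNIV. \<bar>B1 i\<bar>)" for i
    by (rule member_le_sum) auto
  then have S: "\<bar>B1 i\<bar> \<le> (\<Sum>i\<in>UNIV. \<bar>B1 i\<bar>)" for i .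
  have S0: "0 \<le> (\<Sum>i\<in>UNIV. \<bar>B1 i\<bar>)" by (rule sum_nonneg) simp
  have B: "0 < B" "\<bar>\<eta> x\<bar> \<le> B" "\<bar>partial i \<eta> x\<bar> \<le> B" for i x
  proof -
    show "0 < B" using B0(1) S0 unfolding B_def by linarith
    show "\<bar>\<eta> x\<bar> \<le> B" using B0(2)[of x] S0 unfolding B_def real_norm_def by linarith
    have "\<bar>partial i \<eta> x\<bar> \<le> B1 i" using B1[of x i] by simp
    then show "\<bar>partial i \<eta> x\<bar> \<le> B" using S[of i] B0(1) unfolding B_def by linarith
  qed
  have m: "\<eta> \<in> borel_measurable (leb S)" "(\<lambda>x. partial i \<eta> x) \<in> borel_measurable (leb S)" for S i
    using test_functions_measurable[OF \<eta>] test_functions_measurable[OF test_functions_derivative[OF \<eta>]] by auto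
  have z: "\<eta> x = 0" "partial i \<eta> x = 0" if "x \<in> W - U" for x i
  proof -
    have n: "x \<notin> closure {x. \<eta> x \<noteq> 0}" using that supp by blast
    show "\<eta> x = 0" by (rule test_functions_outside[OF \<eta> n])
    show "partial i \<eta> x = 0" by (simp only: frechet_derivative_zero_outside[OF n])
  qed
  show thesis
  proof (rule that[of "real CARD('n) * B + B"])
    show "0 < real CARD('n) * B + B" using B(1) by (simp add: add_nonneg_pos)
    fix v g assume v: "v \<in> L2 (leb U)" and g: "is_weak_grad U v g"
    let ?v = "\<lambda>x. cpx (\<eta> x) * v x"
    note gi = L2_vec_nth[OF is_weak_gradD(1)[OF g]]
    note vU = L2_bounded_cmult[OF v m(1) B(2)]
    have vW: "?v \<in> L2 (leb W)" "norm2 W ?v = norm2 U ?v"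
      using L2_on_superset[OF UW Us, of ?v] vU(1) z(1) by auto
    have Zi: "(\<lambda>x. cpx (\<eta> x) * g x $ i + v x * cpx (partial i \<eta> x)) \<in> L2 (leb U)"
        "norm2 U (\<lambda>x. cpx (\<eta> x) * g x $ i + v x * cpx (partial i \<eta> x))
           \<le> B * (norm2 U g + norm2 U v)" for i
    proof -
      note 1 = L2_bounded_cmult[OF gi m(1) B(2), of i]
      note 2 = L2_bounded_cmult[OF v m(2) B(3), of i]
      show "(\<lambda>x. cpx (\<eta> x) * g x $ i + v x * cpx (partial i \<eta> x)) \<in> L2 (leb U)"
        using L2_add[OF 1(1) 2(1)] by (simp add: mult.commute)
      have "B * norm2 U (\<lambda>x. g x $ i) \<le> B * norm2 U g"
        using B(1) L2_norm_vec_nth[OF is_weak_gradD(1)[OF g], of i] by (intro mult_left_mono) auto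
      then show "norm2 U (\<lambda>x. cpx (\<eta> x) * g x $ i + v x * cpx (partial i \<eta> x))
           \<le> B * (norm2 U g + norm2 U v)"
        using L2_norm_triangle[OF 1(1) 2(1)] 1(2) 2(2) by (simp add: mult.commute distrib_left)
    qed
    have ZU: "cutoff_grad \<eta> v g \<in> L2 (leb U)"
      unfolding cutoff_grad_def by (rule L2_vecI[OF Zi(1)])
    have z0: "cutoff_grad \<eta> v g x = 0" if "x \<in> W - U" for x
      using z[OF that] by (simp add: cutoff_grad_def Finite_Cartesian_Product.vec_eq_iff)
    note ZW = L2_on_superset[OF UW Us, of "cutoff_grad \<eta> v g", OF z0]
    have "is_weak_grad W ?v (cutoff_grad \<eta> v g)"
      unfolding is_weak_grad_def
    proof (intro conjI allI impI)
      show "cutoff_grad \<eta> v g \<in> L2 (leb W)" using ZW ZU by simp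
      fix \<theta> :: "real ^ 'n \<Rightarrow> real" and i assume \<theta>: "\<theta> \<in> test_functions W"
      \<comment> \<open>Multiplication by \<eta> turns a test function of W into one of U, which
        makes the weak derivative of v in U available.\<close>
      have \<eta>\<theta>: "(\<lambda>x. \<eta> x * \<theta> x) \<in> test_functions U"
      proof (rule test_functionsI)
        show "Ck_on m UNIV (\<lambda>x. \<eta> x * \<theta> x)" for m
          by (rule Ck_on_mult[OF open_UNIV test_functions_D(1)[OF \<eta>] test_functions_D(1)[OF \<theta>]])
        show "compact (closure {x. \<eta> x \<noteq> 0} \<inter> closure {x. \<theta> x \<noteq> 0})"
          by (rule compact_Int[OF test_functions_D(2)[OF \<eta>] test_functions_D(2)[OF \<theta>]])
        show "closure {x. \<eta> x \<noteq> 0} \<inter> closure {x. \<theta> x \<noteq> 0} \<subseteq> U"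
          using supp test_functions_D(3)[OF \<theta>] by blast
        show "\<eta> x * \<theta> x = 0" if "x \<notin> closure {x. \<eta> x \<noteq> 0} \<inter> closure {x. \<theta> x \<noteq> 0}" for x
          using that test_functions_outside[OF \<eta>, of x] test_functions_outside[OF \<theta>, of x] by auto
      qed
      have p: "partial i (\<lambda>x. \<eta> x * \<theta> x) x = partial i \<eta> x * \<theta> x + \<eta> x * partial i \<theta> x" for x
        by (rule frechet_derivative_mult_real[OF test_functions_differentiable[OF \<eta>] test_functions_differentiable[OF \<theta>]])
      note t = test_functions_of_real_L2[OF \<theta> Us(1)]
        test_functions_of_real_L2[OF test_functions_derivative[OF \<theta>] Us(1), of "axis i 1"]
      note 1 = L2_bounded_cmult[OF gi m(1) B(2), of i]
      note 2 = L2_bounded_cmult[OF v m(2) B(3), of i]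
      note i1 = L2_integrable_mult(1)[OF 1(1) t(1)]
      note i2 = L2_integrable_mult(1)[OF 2(1) t(1)]
      note i3 = L2_integrable_mult(1)[OF vU(1) t(2)]
      have "(\<integral>x. ?v x * cpx (partial i \<theta> x) \<partial>leb W) =
            (\<integral>x. ?v x * cpx (partial i \<theta> x) \<partial>leb U)"
        by (rule on_superset(3)[OF UW Us]) (simp add: z)
      also have "\<dots> = (\<integral>x. v x * cpx (partial i (\<lambda>x. \<eta> x * \<theta> x) x) -
            cpx (partial i \<eta> x) * v x * cpx (\<theta> x) \<partial>leb U)"
        by (rule Bochner_Integration.integral_cong[OF refl]) (simp add: p algebra_simps)
      also have "\<dots> = (\<integral>x. v x * cpx (partial i (\<lambda>x. \<eta> x * \<theta> x) x) \<partial>leb U) -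
            (\<integral>x. cpx (partial i \<eta> x) * v x * cpx (\<theta> x) \<partial>leb U)"
        by (rule Bochner_Integration.integral_diff[OF L2_integrable_mult(1)[OF v test_functions_of_real_L2[OF test_functions_derivative[OF \<eta>\<theta>] Us(1)]] i2])
      also have "\<dots> = - (\<integral>x. cpx (\<eta> x) * g x $ i * cpx (\<theta> x) \<partial>leb U) -
            (\<integral>x. cpx (partial i \<eta> x) * v x * cpx (\<theta> x) \<partial>leb U)"
        using is_weak_gradD(2)[OF g \<eta>\<theta>, of i] by (simp add: mult_ac)
      also have "\<dots> = - (\<integral>x. cpx (\<eta> x) * g x $ i * cpx (\<theta> x) +
            cpx (partial i \<eta> x) * v x * cpx (\<theta> x) \<partial>leb U)"
        using i1 i2 by simp
      also have "\<dots> = - (\<integral>x. (cutoff_grad \<eta> v g x $ i) * cpx (\<theta> x) \<partial>leb U)"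
        by (rule arg_cong[of _ _ uminus], rule Bochner_Integration.integral_cong[OF refl]) (simp add: cutoff_grad_def algebra_simps)
      also have "\<dots> = - (\<integral>x. (cutoff_grad \<eta> v g x $ i) * cpx (\<theta> x) \<partial>leb W)"
        by (rule arg_cong[of _ _ uminus], rule on_superset(3)[OF UW Us, symmetric]) (simp add: z0)
      finally show "(\<integral>x. ?v x * cpx (partial i \<theta> x) \<partial>leb W) =
             - (\<integral>x. (cutoff_grad \<eta> v g x $ i) * cpx (\<theta> x) \<partial>leb W)" .
    qed
    moreover have "norm2 W ?v \<le> (real CARD('n) * B + B) * norm2 U v"
    proof -
      have "B * norm2 U v \<le> (real CARD('n) * B + B) * norm2 U v"
        using B(1) by (intro mult_right_mono) auto
      then show ?thesis using vU(2) vW(2) by linarith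
    qed
    moreover have "norm2 W (cutoff_grad \<eta> v g) \<le> real CARD('n) * (B * (norm2 U g + norm2 U v))"
      using L2_norm_vec_le[OF Zi] ZW(2) by (simp add: cutoff_grad_def[abs_def])
    moreover have "\<dots> \<le> (real CARD('n) * B + B) * (norm2 U g + norm2 U v)"
      using B(1) by (simp add: distrib_right mult.assoc)
    ultimately show "?v \<in> L2 (leb W) \<and> is_weak_grad W ?v (cutoff_grad \<eta> v g) \<and>
       norm2 W ?v \<le> (real CARD('n) * B + B) * norm2 U v \<and>
       norm2 W (cutoff_grad \<eta> v g) \<le> (real CARD('n) * B + B) * (norm2 U g + norm2 U v)"
      using vW(1) by linarith
  qed
qed

section \<open>Traces\<close>

lemma H1k_norm_bounds:
  "norm2 U (wgrad U v) \<le> H1k_norm k U v"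
  "\<bar>k\<bar> * norm2 U v \<le> H1k_norm k U v"
  "H1k_norm k U v \<le> norm2 U (wgrad U v) + \<bar>k\<bar> * norm2 U v"
proof -
  let ?a = "norm2 U (wgrad U v)" and ?b = "\<bar>k\<bar> * norm2 U v"
  have H: "H1k_norm k U v = sqrt (?a\<^sup>2 + ?b\<^sup>2)" by (simp add: H1k_norm_def power_mult_distrib)
  have nn: "0 \<le> ?a" "0 \<le> ?b" by auto
  show "?a \<le> H1k_norm k U v" unfolding H by (rule real_le_rsqrt) simp
  show "?b \<le> H1k_norm k U v" unfolding H by (rule real_le_rsqrt) simp
  show "H1k_norm k U v \<le> ?a + ?b" unfolding H by (rule sqrt_sum_squares_le_sum[OF nn])
qed

lemma H1k_norm_nonneg [simp]: "0 \<le> H1k_norm k U v"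
  by (simp add: H1k_norm_def)

lemma H1_weak_grad:
  assumes "open U" "v \<in> L2 (leb U)" "is_weak_grad U v g"
  shows "v \<in> H1 U" "norm2 U (wgrad U v) = norm2 U g"
proof -
  show v: "v \<in> H1 U" by (rule H1I[OF assms(2,3)])
  show "norm2 U (wgrad U v) = norm2 U g"
    by (rule L2_norm_cong_AE[OF L2_D(1)[OF wgrad_L2[OF v]] L2_D(1)[OF is_weak_gradD(1)[OF assms(3)]] wgrad_AE[OF assms(1,3)]])
qed

lemma H1_sum:
  fixes U :: "(real ^ 'n::finite) set"
  assumes "open U" "\<And>j. j \<in> I \<Longrightarrow> u j \<in> H1 U"
  shows "(\<lambda>x. \<Sum>j\<in>I. c j * u j x) \<in> H1 U"
    and "is_weak_grad U (\<lambda>x. \<Sum>j\<in>I. c j * u j x) (\<lambda>x. \<Sum>j\<in>I. c j *s wgrad U (u j) x)"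
proof -
  show g: "is_weak_grad U (\<lambda>x. \<Sum>j\<in>I. c j * u j x) (\<lambda>x. \<Sum>j\<in>I. c j *s wgrad U (u j) x)"
    by (rule weak_grad_sum[OF assms(1)]) (auto intro: H1_L2 is_weak_grad_wgrad assms(2))
  have "(\<lambda>x. \<Sum>j\<in>I. c j * u j x) \<in> L2 (leb U)"
    by (intro L2_sum L2_cmult H1_L2 assms(2))
  then show "(\<lambda>x. \<Sum>j\<in>I. c j * u j x) \<in> H1 U" using g by (rule H1I)
qed

lemma H1_add:
  fixes U :: "(real ^ 'n::finite) set"
  assumes "open U" "u \<in> H1 U" "v \<in> H1 U"
  shows "(\<lambda>x. u x + v x) \<in> H1 U"
    and "is_weak_grad U (\<lambda>x. u x + v x) (\<lambda>x. wgrad U u x + wgrad U v x)"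
    and "H1k_norm 1 U (\<lambda>x. u x + v x) \<le> 2 * (H1k_norm 1 U u + H1k_norm 1 U v)"
proof -
  show g: "is_weak_grad U (\<lambda>x. u x + v x) (\<lambda>x. wgrad U u x + wgrad U v x)"
    by (intro weak_grad_add assms H1_L2 is_weak_grad_wgrad)
  have L: "(\<lambda>x. u x + v x) \<in> L2 (leb U)" by (intro L2_add H1_L2 assms)
  show "(\<lambda>x. u x + v x) \<in> H1 U" by (rule H1I[OF L g])
  show "H1k_norm 1 U (\<lambda>x. u x + v x) \<le> 2 * (H1k_norm 1 U u + H1k_norm 1 U v)"
    using H1k_norm_bounds(3)[of 1 U "\<lambda>x. u x + v x"] H1_weak_grad(2)[OF assms(1) L g]
      L2_norm_triangle[OF wgrad_L2[OF assms(2)] wgrad_L2[OF assms(3)]] L2_norm_triangle[OF H1_L2[OF assms(2)] H1_L2[OF assms(3)]]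
      H1k_norm_bounds(1)[of U u 1] H1k_norm_bounds(1)[of U v 1] H1k_norm_bounds(2)[of 1 U u] H1k_norm_bounds(2)[of 1 U v]
    by simp
qed

lemma L2_norm_cmult:
  fixes f :: "'a \<Rightarrow> complex"
  shows "L2_norm M (\<lambda>x. c * f x) = cmod c * L2_norm M f"
  by (simp add: L2_norm_def norm_mult power_mult_distrib real_sqrt_mult)

lemma norm_vector_smult:
  fixes z :: "complex ^ 'n::finite"
  shows "norm (c *s z) = cmod c * norm z"
  by (simp add: norm_vec_def L2_set_def norm_mult power_mult_distrib real_sqrt_mult sum_distrib_left[symmetric])

lemma H1_cmult:
  fixes U :: "(real ^ 'n::finite) set"
  assumes "open U" "u \<in> H1 U"
  shows "(\<lambda>x. c * u x) \<in> H1 U"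
    and "is_weak_grad U (\<lambda>x. c * u x) (\<lambda>x. c *s wgrad U u x)"
    and "H1k_norm k U (\<lambda>x. c * u x) = cmod c * H1k_norm k U u"
proof -
  show g: "is_weak_grad U (\<lambda>x. c * u x) (\<lambda>x. c *s wgrad U u x)"
    by (intro weak_grad_cmult assms is_weak_grad_wgrad)
  have L: "(\<lambda>x. c * u x) \<in> L2 (leb U)" by (intro L2_cmult H1_L2 assms)
  show "(\<lambda>x. c * u x) \<in> H1 U" by (rule H1I[OF L g])
  have "norm2 U (\<lambda>x. c *s wgrad U u x) = cmod c * norm2 U (wgrad U u)"
    by (simp add: L2_norm_def norm_vector_smult power_mult_distrib real_sqrt_mult)
  then have "H1k_norm k U (\<lambda>x. c * u x) = sqrt ((cmod c)\<^sup>2 * ((norm2 U (wgrad U u))\<^sup>2 + k\<^sup>2 * (norm2 U u)\<^sup>2))"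
    by (simp add: H1k_norm_def H1_weak_grad(2)[OF assms(1) L g] L2_norm_cmult power_mult_distrib distrib_left mult_ac)
  then show "H1k_norm k U (\<lambda>x. c * u x) = cmod c * H1k_norm k U u"
    by (simp add: H1k_norm_def real_sqrt_mult)
qed

lemma norm_cvec_cnj [simp]: "norm (cvec_cnj z) = norm z"
  by (simp add: norm_vec_def L2_set_def)

lemma H1_cnj:
  fixes U :: "(real ^ 'n::finite) set"
  assumes "open U" "u \<in> H1 U"
  shows "(\<lambda>x. cnj (u x)) \<in> H1 U"
    and "is_weak_grad U (\<lambda>x. cnj (u x)) (\<lambda>x. cvec_cnj (wgrad U u x))"
    and "H1k_norm k U (\<lambda>x. cnj (u x)) = H1k_norm k U u"
proof -
  show g: "is_weak_grad U (\<lambda>x. cnj (u x)) (\<lambda>x. cvec_cnj (wgrad U u x))"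
    by (intro weak_grad_cnj assms is_weak_grad_wgrad)
  have L: "(\<lambda>x. cnj (u x)) \<in> L2 (leb U)" by (intro L2_cnj H1_L2 assms)
  show "(\<lambda>x. cnj (u x)) \<in> H1 U" by (rule H1I[OF L g])
  show "H1k_norm k U (\<lambda>x. cnj (u x)) = H1k_norm k U u"
    unfolding H1k_norm_def H1_weak_grad(2)[OF assms(1) L g] by (simp add: L2_norm_def)
qed

section \<open>Surface measure and the algebra of traces\<close>

lemma sets_hausdorff_measure [simp]: "sets (hausdorff_measure s) = sets borel"
  unfolding hausdorff_measure_def by (simp add: sets.sigma_sets_eq[of borel, simplified])

lemma space_hausdorff_measure [simp]: "space (hausdorff_measure s) = UNIV"
  unfolding hausdorff_measure_def by simp

lemma space_surface [simp]: "space (surface \<Gamma>) = \<Gamma>"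
  by (simp add: surface_def space_restrict_space)

text \<open>Closed sets are Borel, and on a set of finite measure bounded functions are
  square-integrable. Thus the smooth functions that approximate a trace belong to L2 of the surface,
  as the triangle inequality there requires.\<close>

definition finite_surface :: "(real ^ 'n::finite) set \<Rightarrow> bool" where
  "finite_surface \<Gamma> \<longleftrightarrow> closed \<Gamma> \<and> emeasure (hausdorff_measure (real CARD('n) - 1)) \<Gamma> < \<infinity>"

lemma surface_measurable:
  fixes f :: "real ^ 'n::finite \<Rightarrow> 'b::topological_space"
  assumes "f \<in> borel_measurable borel"
  shows "f \<in> borel_measurable (surface \<Gamma>)"
  unfolding surface_def
  by (rule measurable_restrict_space1) (use assms in \<open>simp add: measurable_cong_sets[OF sets_hausdorff_measure refl]\<close>)

lemma test_functions_L2_surface: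
  fixes w :: "real ^ 'n::finite \<Rightarrow> complex"
  assumes w: "w \<in> test_functions S" and \<Gamma>: "finite_surface \<Gamma>"
  shows "w \<in> L2 (surface \<Gamma>)"
proof -
  obtain B where B: "\<And>x. norm (w x) \<le> B" using test_functions_bounded[OF w] by blast
  have m: "w \<in> borel_measurable (surface \<Gamma>)"
    by (intro surface_measurable borel_measurable_continuous_onI test_functions_continuous[OF w])
  have "emeasure (surface \<Gamma>) (space (surface \<Gamma>)) < \<infinity>"
    using \<Gamma> unfolding finite_surface_def surface_def
    by (simp add: space_restrict_space emeasure_restrict_space borel_closed)
  then have "finite_measure (surface \<Gamma>)" by (intro finite_measureI) simp
  then have i: "integrable (surface \<Gamma>) (\<lambda>x. B\<^sup>2)"
    by (intro finite_measure.integrable_const)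
  show ?thesis
    by (rule L2I[OF m i]) (use B in \<open>auto intro!: AE_I2 power_mono\<close>)
qed

lemma surface_subset:
  fixes f :: "real ^ 'n::finite \<Rightarrow> 'b::euclidean_space"
  assumes \<Gamma>: "closed \<Gamma>" "closed \<Gamma>'" "\<Gamma>' \<subseteq> \<Gamma>" and f: "f \<in> L2 (surface \<Gamma>)"
  shows "f \<in> L2 (surface \<Gamma>')" "L2_norm (surface \<Gamma>') f \<le> L2_norm (surface \<Gamma>) f"
proof -
  let ?M = "hausdorff_measure (real CARD('n) - 1) :: (real ^ 'n) measure"
  have G: "\<Gamma> \<in> sets borel" "\<Gamma>' \<in> sets borel" using \<Gamma> by auto
  have m: "f \<in> borel_measurable (surface \<Gamma>')"
    using L2_D(1)[OF f] \<Gamma>(3) unfolding surface_def by (rule measurable_restrict_mono)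
  have i: "integrable ?M (\<lambda>x. indicator \<Gamma> x *\<^sub>R (norm (f x))\<^sup>2)"
    using L2_D(2)[OF f] G unfolding surface_def by (simp add: integrable_restrict_space)
  have i': "integrable ?M (\<lambda>x. indicator \<Gamma>' x *\<^sub>R (norm (f x))\<^sup>2)"
  proof -
    have "integrable ?M (\<lambda>x. indicator \<Gamma>' x *\<^sub>R (indicator \<Gamma> x *\<^sub>R (norm (f x))\<^sup>2))"
      using G by (intro integrable_mult_indicator i) simp
    also have "(\<lambda>x. indicator \<Gamma>' x *\<^sub>R (indicator \<Gamma> x *\<^sub>R (norm (f x))\<^sup>2)) = (\<lambda>x. indicator \<Gamma>' x *\<^sub>R (norm (f x))\<^sup>2)"
      using \<Gamma>(3) by (auto simp: indicator_def fun_eq_iff)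
    finally show ?thesis .
  qed
  show "f \<in> L2 (surface \<Gamma>')"
    using m i' G by (simp add: L2_def surface_def integrable_restrict_space)
  have "(\<integral>x. indicator \<Gamma>' x *\<^sub>R (norm (f x))\<^sup>2 \<partial>?M) \<le> (\<integral>x. indicator \<Gamma> x *\<^sub>R (norm (f x))\<^sup>2 \<partial>?M)"
    using \<Gamma>(3) by (intro integral_mono i i') (auto simp: indicator_def)
  then show "L2_norm (surface \<Gamma>') f \<le> L2_norm (surface \<Gamma>) f"
    using G by (simp add: L2_norm_def surface_def integral_restrict_space)
qed

lemma trace_onD:
  assumes "trace_on U \<Gamma> v \<phi>"
  shows "v \<in> H1 U" "\<phi> \<in> L2 (surface \<Gamma>)"
    and "\<exists>w. (\<forall>j. w j \<in> test_functions UNIV) \<and> (\<lambda>j. H1k_norm 1 U (\<lambda>x. w j x - v x)) \<longlonglongrightarrow> 0 \<and>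
        (\<lambda>j. L2_norm (surface \<Gamma>) (\<lambda>x. w j x - \<phi> x)) \<longlonglongrightarrow> 0"
  using assms by (auto simp: trace_on_def)

lemma H1_diff_test:
  fixes U :: "(real ^ 'n::finite) set"
  assumes "open U" "w \<in> test_functions S" "v \<in> H1 U"
  shows "(\<lambda>x. w x - v x) \<in> H1 U"
  using H1_add(1)[OF assms(1) test_functions_H1(3)[OF assms(2,1)] H1_cmult(1)[OF assms(1,3), of "-1"]] by simp

lemma trace_on_add:
  fixes U :: "(real ^ 'n::finite) set"
  assumes U: "open U" and \<Gamma>: "finite_surface \<Gamma>" and v: "trace_on U \<Gamma> v \<phi>" and v': "trace_on U \<Gamma> v' \<phi>'"
  shows "trace_on U \<Gamma> (\<lambda>x. v x + v' x) (\<lambda>x. \<phi> x + \<phi>' x)"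
proof -
  obtain w where w: "\<And>j. w j \<in> test_functions UNIV" "(\<lambda>j. H1k_norm 1 U (\<lambda>x. w j x - v x)) \<longlonglongrightarrow> 0"
      "(\<lambda>j. L2_norm (surface \<Gamma>) (\<lambda>x. w j x - \<phi> x)) \<longlonglongrightarrow> 0"
    using trace_onD(3)[OF v] by blast
  obtain w' where w': "\<And>j. w' j \<in> test_functions UNIV" "(\<lambda>j. H1k_norm 1 U (\<lambda>x. w' j x - v' x)) \<longlonglongrightarrow> 0"
      "(\<lambda>j. L2_norm (surface \<Gamma>) (\<lambda>x. w' j x - \<phi>' x)) \<longlonglongrightarrow> 0"
    using trace_onD(3)[OF v'] by blast
  have r: "(w j x + w' j x) - (a + b) = (w j x - a) + (w' j x - b)" for j x a b by simp
  have "(\<lambda>j. H1k_norm 1 U (\<lambda>x. (w j x + w' j x) - (v x + v' x))) \<longlonglongrightarrow> 0"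
  proof (rule tendsto_sandwich[OF _ _ tendsto_const])
    show "(\<lambda>j. 2 * (H1k_norm 1 U (\<lambda>x. w j x - v x) + H1k_norm 1 U (\<lambda>x. w' j x - v' x))) \<longlonglongrightarrow> 0"
      using tendsto_mult_left[OF tendsto_add[OF w(2) w'(2)], of 2] by simp
    show "\<forall>\<^sub>F j in sequentially. H1k_norm 1 U (\<lambda>x. (w j x + w' j x) - (v x + v' x)) \<le>
        2 * (H1k_norm 1 U (\<lambda>x. w j x - v x) + H1k_norm 1 U (\<lambda>x. w' j x - v' x))"
      unfolding r using H1_add(3)[OF U H1_diff_test[OF U w(1) trace_onD(1)[OF v]] H1_diff_test[OF U w'(1) trace_onD(1)[OF v']]]
      by (intro always_eventually allI)
  qed simp
  moreover have "(\<lambda>j. L2_norm (surface \<Gamma>) (\<lambda>x. (w j x + w' j x) - (\<phi> x + \<phi>' x))) \<longlonglongrightarrow> 0"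
  proof (rule tendsto_sandwich[OF _ _ tendsto_const])
    show "(\<lambda>j. L2_norm (surface \<Gamma>) (\<lambda>x. w j x - \<phi> x) + L2_norm (surface \<Gamma>) (\<lambda>x. w' j x - \<phi>' x)) \<longlonglongrightarrow> 0"
      using tendsto_add[OF w(3) w'(3)] by simp
    show "\<forall>\<^sub>F j in sequentially. L2_norm (surface \<Gamma>) (\<lambda>x. (w j x + w' j x) - (\<phi> x + \<phi>' x)) \<le>
        L2_norm (surface \<Gamma>) (\<lambda>x. w j x - \<phi> x) + L2_norm (surface \<Gamma>) (\<lambda>x. w' j x - \<phi>' x)"
      unfolding r by (intro always_eventually allI L2_norm_triangle L2_diff test_functions_L2_surface[OF w(1) \<Gamma>]
        test_functions_L2_surface[OF w'(1) \<Gamma>] trace_onD(2)[OF v] trace_onD(2)[OF v'])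
  qed simp
  moreover have "\<forall>j. (\<lambda>x. w j x + w' j x) \<in> test_functions UNIV" using test_functions_add[OF w(1) w'(1)] by blast
  ultimately show ?thesis
    unfolding trace_on_def
    using H1_add(1)[OF U trace_onD(1)[OF v] trace_onD(1)[OF v']] L2_add[OF trace_onD(2)[OF v] trace_onD(2)[OF v']]
    by (intro conjI exI[of _ "\<lambda>j x. w j x + w' j x"]) auto
qed

lemma trace_on_cmult:
  fixes U :: "(real ^ 'n::finite) set"
  assumes U: "open U" and v: "trace_on U \<Gamma> v \<phi>"
  shows "trace_on U \<Gamma> (\<lambda>x. c * v x) (\<lambda>x. c * \<phi> x)"
proof -
  obtain w where w: "\<And>j. w j \<in> test_functions UNIV" "(\<lambda>j. H1k_norm 1 U (\<lambda>x. w j x - v x)) \<longlonglongrightarrow> 0"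
      "(\<lambda>j. L2_norm (surface \<Gamma>) (\<lambda>x. w j x - \<phi> x)) \<longlonglongrightarrow> 0"
    using trace_onD(3)[OF v] by blast
  have r: "c * w j x - c * a = c * (w j x - a)" for j x a by (simp add: right_diff_distrib)
  have "(\<lambda>j. H1k_norm 1 U (\<lambda>x. c * w j x - c * v x)) \<longlonglongrightarrow> 0"
    unfolding r H1_cmult(3)[OF U H1_diff_test[OF U w(1) trace_onD(1)[OF v]]]
    using tendsto_mult_left[OF w(2), of "cmod c"] by simp
  moreover have "(\<lambda>j. L2_norm (surface \<Gamma>) (\<lambda>x. c * w j x - c * \<phi> x)) \<longlonglongrightarrow> 0"
    unfolding r L2_norm_cmult using tendsto_mult_left[OF w(3), of "cmod c"] by simp
  moreover have "\<forall>j. (\<lambda>x. c * w j x) \<in> test_functions UNIV"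
    using test_functions_linear[OF w(1) bounded_linear_mult_right] by blast
  ultimately show ?thesis
    unfolding trace_on_def
    using H1_cmult(1)[OF U trace_onD(1)[OF v]] L2_cmult[OF trace_onD(2)[OF v]]
    by (intro conjI exI[of _ "\<lambda>j x. c * w j x"]) auto
qed

lemma trace_on_cnj:
  fixes U :: "(real ^ 'n::finite) set"
  assumes U: "open U" and v: "trace_on U \<Gamma> v \<phi>"
  shows "trace_on U \<Gamma> (\<lambda>x. cnj (v x)) (\<lambda>x. cnj (\<phi> x))"
proof -
  obtain w where w: "\<And>j. w j \<in> test_functions UNIV" "(\<lambda>j. H1k_norm 1 U (\<lambda>x. w j x - v x)) \<longlonglongrightarrow> 0"
      "(\<lambda>j. L2_norm (surface \<Gamma>) (\<lambda>x. w j x - \<phi> x)) \<longlonglongrightarrow> 0"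
    using trace_onD(3)[OF v] by blast
  have r: "cnj (w j x) - cnj a = cnj (w j x - a)" for j x a by simp
  have "(\<lambda>j. H1k_norm 1 U (\<lambda>x. cnj (w j x) - cnj (v x))) \<longlonglongrightarrow> 0"
    unfolding r H1_cnj(3)[OF U H1_diff_test[OF U w(1) trace_onD(1)[OF v]]] by (rule w(2))
  moreover have "(\<lambda>j. L2_norm (surface \<Gamma>) (\<lambda>x. cnj (w j x) - cnj (\<phi> x))) \<longlonglongrightarrow> 0"
    using w(3) unfolding r L2_norm_def complex_mod_cnj .
  moreover have "\<forall>j. (\<lambda>x. cnj (w j x)) \<in> test_functions UNIV"
    using test_functions_linear[OF w(1) bounded_linear_cnj] by blast
  ultimately show ?thesis
    unfolding trace_on_def
    using H1_cnj(1)[OF U trace_onD(1)[OF v]] L2_cnj[OF trace_onD(2)[OF v]]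
    by (intro conjI exI[of _ "\<lambda>j x. cnj (w j x)"]) auto
qed

lemma trace_on_zero: "open U \<Longrightarrow> trace_on U \<Gamma> (\<lambda>x. 0) (\<lambda>x. 0)"
  unfolding trace_on_def
proof (intro conjI exI[of _ "\<lambda>j x. 0"])
  assume U: "open U"
  have g: "is_weak_grad U (\<lambda>x. 0) (\<lambda>x. 0)" by (rule weak_grad_zero)
  show "(\<lambda>x. 0) \<in> H1 U" by (rule H1I[OF L2_zero g])
  show "(\<lambda>j. H1k_norm 1 U (\<lambda>x. 0 - 0)) \<longlonglongrightarrow> 0"
    using H1_weak_grad(2)[OF U L2_zero g] by (simp add: H1k_norm_def L2_norm_def)
qed (simp_all add: test_functions_zero L2_norm_def)

lemma trace_on_sum:
  fixes U :: "(real ^ 'n::finite) set"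
  assumes U: "open U" and \<Gamma>: "finite_surface \<Gamma>" and v: "\<And>j. j \<in> I \<Longrightarrow> trace_on U \<Gamma> (v j) (\<phi> j)"
  shows "trace_on U \<Gamma> (\<lambda>x. \<Sum>j\<in>I. c j * v j x) (\<lambda>x. \<Sum>j\<in>I. c j * \<phi> j x)"
  using v
proof (induction I rule: infinite_finite_induct)
  case (insert j I)
  then show ?case
    using trace_on_add[OF U \<Gamma> trace_on_cmult[OF U insert.prems[of j], of "c j"] insert.IH] by simp
qed (simp_all add: trace_on_zero[OF U])

text \<open>A trace is a class of functions, whereas a boundary operator acts on single functions.
  Representatives therefore have to be exchanged before the operator can be evaluated.\<close>

lemma trace_on_AE_cong:
  assumes v: "trace_on U \<Gamma> v \<phi>" and \<phi>: "finite_surface \<Gamma>" "\<phi>' \<in> borel_measurable (surface \<Gamma>)" "AE x in surface \<Gamma>. \<phi> x = \<phi>' x"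
  shows "trace_on U \<Gamma> v \<phi>'"
proof -
  obtain w where w: "\<And>j. w j \<in> test_functions UNIV" "(\<lambda>j. H1k_norm 1 U (\<lambda>x. w j x - v x)) \<longlonglongrightarrow> 0"
      "(\<lambda>j. L2_norm (surface \<Gamma>) (\<lambda>x. w j x - \<phi> x)) \<longlonglongrightarrow> 0"
    using trace_onD(3)[OF v] by blast
  have L: "\<phi>' \<in> L2 (surface \<Gamma>)" by (rule L2_cong_AE[OF trace_onD(2)[OF v] \<phi>(2,3)])
  have "L2_norm (surface \<Gamma>) (\<lambda>x. w j x - \<phi> x) = L2_norm (surface \<Gamma>) (\<lambda>x. w j x - \<phi>' x)" for j
  proof (rule L2_norm_cong_AE)
    note m = L2_D(1)[OF test_functions_L2_surface[OF w(1)[of j] \<phi>(1)]]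
    show "(\<lambda>x. w j x - \<phi> x) \<in> borel_measurable (surface \<Gamma>)" "(\<lambda>x. w j x - \<phi>' x) \<in> borel_measurable (surface \<Gamma>)"
      using m L2_D(1)[OF trace_onD(2)[OF v]] \<phi>(2) by (auto intro: borel_measurable_diff)
    show "AE x in surface \<Gamma>. w j x - \<phi> x = w j x - \<phi>' x" using \<phi>(3) by eventually_elim simp
  qed
  then show ?thesis using w L trace_onD(1)[OF v] unfolding trace_on_def by auto
qed

text \<open>This serves to carry a function across the obstacle by zero into all of
  \<open>Dt\<close>, to carry an exterior solution from a bounded region to the whole exterior, and
  to multiply by a coordinate. Allowing a smaller \<open>\<Gamma>'\<close> drops the boundary of the
  obstacle.\<close>

lemma trace_on_cutoff:
  fixes \<eta> :: "real ^ 'n::finite \<Rightarrow> real"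
  assumes \<eta>: "\<eta> \<in> test_functions UNIV" and U: "open U" and W: "open W" and UW: "U \<subseteq> W"
    and supp: "closure {x. \<eta> x \<noteq> 0} \<inter> W \<subseteq> U"
    and \<Gamma>: "finite_surface \<Gamma>" "closed \<Gamma>'" "\<Gamma>' \<subseteq> \<Gamma>"
    and v: "trace_on U \<Gamma> v \<phi>"
  shows "trace_on W \<Gamma>' (\<lambda>x. cpx (\<eta> x) * v x) (\<lambda>x. cpx (\<eta> x) * \<phi> x)"
proof -
  obtain w where w: "\<And>j. w j \<in> test_functions UNIV" "(\<lambda>j. H1k_norm 1 U (\<lambda>x. w j x - v x)) \<longlonglongrightarrow> 0"
      "(\<lambda>j. L2_norm (surface \<Gamma>) (\<lambda>x. w j x - \<phi> x)) \<longlonglongrightarrow> 0"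
    using trace_onD(3)[OF v] by blast
  obtain C where C: "0 < C"
    "\<And>v g. v \<in> L2 (leb U) \<Longrightarrow> is_weak_grad U v g \<Longrightarrow>
       (\<lambda>x. cpx (\<eta> x) * v x) \<in> L2 (leb W) \<and>
       is_weak_grad W (\<lambda>x. cpx (\<eta> x) * v x) (cutoff_grad \<eta> v g) \<and>
       norm2 W (\<lambda>x. cpx (\<eta> x) * v x) \<le> C * norm2 U v \<and>
       norm2 W (cutoff_grad \<eta> v g) \<le> C * (norm2 U g + norm2 U v)"
    by (rule cutoff_mult[OF \<eta> U W UW supp]) blast
  obtain B where B: "0 < B" "\<And>x. norm (\<eta> x) \<le> B" using test_functions_bounded[OF \<eta>] by blast
  have m: "\<eta> \<in> borel_measurable (surface S)" for S
    by (intro surface_measurable borel_measurable_continuous_onI test_functions_continuous[OF \<eta>])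
  have clo: "closed \<Gamma>" using \<Gamma>(1) by (simp add: finite_surface_def)
  have r: "cpx (\<eta> x) * w j x - cpx (\<eta> x) * a = cpx (\<eta> x) * (w j x - a)" for j x a
    by (simp add: right_diff_distrib)
  have bd: "H1k_norm 1 W (\<lambda>x. cpx (\<eta> x) * u x) \<le> 3 * C * H1k_norm 1 U u"
    and H1: "(\<lambda>x. cpx (\<eta> x) * u x) \<in> H1 W" if u: "u \<in> H1 U" for u
  proof -
    note c = C(2)[OF H1_L2[OF u] is_weak_grad_wgrad[OF u]]
    show "(\<lambda>x. cpx (\<eta> x) * u x) \<in> H1 W" using c by (auto intro: H1I)
    have "H1k_norm 1 W (\<lambda>x. cpx (\<eta> x) * u x) \<le>
        C * (norm2 U (wgrad U u) + norm2 U u) + C * norm2 U u"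
      using H1k_norm_bounds(3)[of 1 W "\<lambda>x. cpx (\<eta> x) * u x"] H1_weak_grad(2)[OF W conjunct1[OF c] conjunct1[OF conjunct2[OF c]]] c
      by simp
    also have "\<dots> = C * (norm2 U (wgrad U u) + norm2 U u + norm2 U u)"
      by (simp add: distrib_left)
    also have "\<dots> \<le> C * (3 * H1k_norm 1 U u)"
      using H1k_norm_bounds(1)[of U u 1] H1k_norm_bounds(2)[of 1 U u] C(1) by (intro mult_left_mono) auto
    finally show "H1k_norm 1 W (\<lambda>x. cpx (\<eta> x) * u x) \<le> 3 * C * H1k_norm 1 U u" by simp
  qed
  have "(\<lambda>j. H1k_norm 1 W (\<lambda>x. cpx (\<eta> x) * w j x - cpx (\<eta> x) * v x)) \<longlonglongrightarrow> 0"
  proof (rule tendsto_sandwich[OF _ _ tendsto_const])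
    show "(\<lambda>j. 3 * C * H1k_norm 1 U (\<lambda>x. w j x - v x)) \<longlonglongrightarrow> 0"
      using tendsto_mult_left[OF w(2), of "3 * C"] by simp
    show "\<forall>\<^sub>F j in sequentially. H1k_norm 1 W (\<lambda>x. cpx (\<eta> x) * w j x - cpx (\<eta> x) * v x)
        \<le> 3 * C * H1k_norm 1 U (\<lambda>x. w j x - v x)"
      unfolding r using bd[OF H1_diff_test[OF U w(1) trace_onD(1)[OF v]]] by (intro always_eventually allI)
  qed simp
  moreover
  have d: "(\<lambda>x. w j x - \<phi> x) \<in> L2 (surface \<Gamma>)" for j
    by (intro L2_diff test_functions_L2_surface[OF w(1) \<Gamma>(1)] trace_onD(2)[OF v])
  note d' = surface_subset[OF clo \<Gamma>(2,3) d]
  have "(\<lambda>j. L2_norm (surface \<Gamma>') (\<lambda>x. cpx (\<eta> x) * w j x - cpx (\<eta> x) * \<phi> x)) \<longlonglongrightarrow> 0"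
  proof (rule tendsto_sandwich[OF _ _ tendsto_const])
    show "(\<lambda>j. B * L2_norm (surface \<Gamma>) (\<lambda>x. w j x - \<phi> x)) \<longlonglongrightarrow> 0"
      using tendsto_mult_left[OF w(3), of B] by simp
    have "L2_norm (surface \<Gamma>') (\<lambda>x. cpx (\<eta> x) * (w j x - \<phi> x)) \<le> B * L2_norm (surface \<Gamma>') (\<lambda>x. w j x - \<phi> x)" for j
      by (rule L2_bounded_cmult(2)[OF d'(1) m]) (use B in simp)
    also have "B * L2_norm (surface \<Gamma>') (\<lambda>x. w j x - \<phi> x) \<le> B * L2_norm (surface \<Gamma>) (\<lambda>x. w j x - \<phi> x)" for j
      using d'(2)[of j] B(1) by (intro mult_left_mono) auto
    finally show "\<forall>\<^sub>F j in sequentially. L2_norm (surface \<Gamma>') (\<lambda>x. cpx (\<eta> x) * w j x - cpx (\<eta> x) * \<phi> x)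
        \<le> B * L2_norm (surface \<Gamma>) (\<lambda>x. w j x - \<phi> x)"
      unfolding r by (intro always_eventually allI)
  qed simp
  moreover have "\<forall>j. (\<lambda>x. cpx (\<eta> x) * w j x) \<in> test_functions UNIV"
    using test_functions_scaleR[OF w(1) test_functions_D(1)[OF \<eta>]] by (simp add: scaleR_conv_of_real)
  moreover have "(\<lambda>x. cpx (\<eta> x) * \<phi> x) \<in> L2 (surface \<Gamma>')"
    by (rule L2_bounded_cmult(1)[OF surface_subset(1)[OF clo \<Gamma>(2,3) trace_onD(2)[OF v]] m]) (use B in simp)
  ultimately show ?thesis
    unfolding trace_on_def using H1[OF trace_onD(1)[OF v]]
    by (intro conjI exI[of _ "\<lambda>j x. cpx (\<eta> x) * w j x"]) auto
qed

lemma trace_on_cong: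
  assumes "\<And>x. x \<in> U \<Longrightarrow> v x = v' x" "\<And>x. x \<in> \<Gamma> \<Longrightarrow> \<phi> x = \<phi>' x"
  shows "trace_on U \<Gamma> v \<phi> \<longleftrightarrow> trace_on U \<Gamma> v' \<phi>'"
proof -
  have 1: "H1k_norm 1 U (\<lambda>x. w x - v x) = H1k_norm 1 U (\<lambda>x. w x - v' x)" for w
    by (rule H1k_norm_cong) (simp add: assms)
  have 2: "L2_norm (surface \<Gamma>) (\<lambda>x. w x - \<phi> x) = L2_norm (surface \<Gamma>) (\<lambda>x. w x - \<phi>' x)" for w
    unfolding L2_norm_def by (intro arg_cong[of _ _ sqrt] Bochner_Integration.integral_cong) (simp_all add: assms)
  have "\<phi> \<in> borel_measurable (surface \<Gamma>) \<longleftrightarrow> \<phi>' \<in> borel_measurable (surface \<Gamma>)"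
    by (rule measurable_cong) (simp add: assms)
  moreover have "integrable (surface \<Gamma>) (\<lambda>x. (norm (\<phi> x))\<^sup>2) \<longleftrightarrow> integrable (surface \<Gamma>) (\<lambda>x. (norm (\<phi>' x))\<^sup>2)"
    by (rule Bochner_Integration.integrable_cong) (simp_all add: assms)
  ultimately have 3: "\<phi> \<in> L2 (surface \<Gamma>) \<longleftrightarrow> \<phi>' \<in> L2 (surface \<Gamma>)" by (simp add: L2_def)
  have 4: "v \<in> H1 U \<longleftrightarrow> v' \<in> H1 U" by (rule H1_cong) (simp add: assms)
  show ?thesis unfolding trace_on_def 1 2 3 4 ..
qed

section \<open>Surface measure of Lipschitz boundaries\<close>

definition orth_part :: "'a::real_inner \<Rightarrow> 'a \<Rightarrow> 'a" where
  "orth_part e y = y - (y \<bullet> e) *\<^sub>R e"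

lemma orth_part_linear: "linear (orth_part e)"
  by (rule linearI) (simp_all add: orth_part_def inner_add_left algebra_simps)

lemma orth_part_inner: "norm e = 1 \<Longrightarrow> orth_part e y \<bullet> e = 0"
  by (simp add: orth_part_def inner_diff_left dot_square_norm)

lemma orth_part_norm: "norm e = 1 \<Longrightarrow> norm (orth_part e y) \<le> norm y"
proof -
  assume e: "norm e = 1"
  have "(norm (orth_part e y))\<^sup>2 = (norm y)\<^sup>2 - (y \<bullet> e)\<^sup>2"
  proof -
    have "e \<bullet> e = 1" using e by (simp add: norm_eq_1)
    then show ?thesis
      unfolding power2_norm_eq_inner orth_part_def
      by (simp add: inner_diff_left inner_diff_right inner_commute power2_eq_square del: dot_square_norm)
  qed
  then have "(norm (orth_part e y))\<^sup>2 \<le> (norm y)\<^sup>2" by simp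
  then show ?thesis by (rule power2_le_imp_le) simp
qed

lemma orth_part_e: "norm e = 1 \<Longrightarrow> orth_part e (y + t *\<^sub>R e) = orth_part e y"
  by (simp add: orth_part_def inner_add_left algebra_simps dot_square_norm)

text \<open>A Lipschitz graph \<open>B\<close> over the hyperplane orthogonal to \<open>e\<close> is moved along \<open>e\<close> through a set
  covered by small pieces \<open>Q i\<close>. Each piece meets the moving graph only for times in an interval
  comparable to its diameter, so at some time the pieces which are met have small total
  \<open>(d-1)\<close>-dimensional size, and they cover the graph.\<close>

lemma hausdorff_premeasure_graph:
  fixes B :: "(real ^ 'n::finite) set" and Q :: "nat \<Rightarrow> (real ^ 'n) set"
  assumes d: "2 \<le> CARD('n)" and e: "norm e = 1" and L: "0 \<le> L"
    and graph: "\<And>x y. x \<in> B \<Longrightarrow> y \<in> B \<Longrightarrow> \<bar>(x - y) \<bullet> e\<bar> \<le> L * norm (orth_part e (x - y))"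
    and s0: "0 < s0" and M: "0 < M"
    and Q: "\<And>i. bounded (Q i)" "\<And>i. diameter (Q i) \<le> \<delta>"
    and sum: "(\<Sum>i. ennreal (diameter (Q i) ^ CARD('n))) \<le> ennreal M"
    and cover: "\<And>x s. x \<in> B \<Longrightarrow> 0 < s \<Longrightarrow> s < s0 \<Longrightarrow> x - s *\<^sub>R e \<in> (\<Union>i. Q i)"
  shows "hausdorff_premeasure (real CARD('n) - 1) \<delta> B
    \<le> ennreal (unit_ball_vol (real CARD('n) - 1) / 2 powr (real CARD('n) - 1)) * ennreal (4 * (L + 1) * M / s0)"
proof -
  define q where "q i = diameter (Q i)" for i
  have q0: "0 \<le> q i" for i unfolding q_def by (rule diameter_ge_0[OF Q(1)])
  \<comment> \<open>The times at which the graph, moved against e, meets \<open>Q i\<close>. Two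
    such times differ by at most L + 1 diameters: L for the variation of the graph and one for the
    distance of the two points inside the piece.\<close>
  define J where "J i = {s. \<exists>x\<in>B. x - s *\<^sub>R e \<in> Q i}" for i
  have J: "\<bar>s - t\<bar> \<le> (L + 1) * q i" if s: "s \<in> J i" and t: "t \<in> J i" for s t i
  proof -
    obtain x y where x: "x \<in> B" "x - s *\<^sub>R e \<in> Q i" and y: "y \<in> B" "y - t *\<^sub>R e \<in> Q i"
      using s t by (auto simp: J_def)
    define p where "p = (x - s *\<^sub>R e) - (y - t *\<^sub>R e)"
    have p: "norm p \<le> q i"
      using diameter_bounded_bound[OF Q(1) x(2) y(2)] by (simp add: p_def q_def dist_norm)
    have xy: "x - y = p + (s - t) *\<^sub>R e" by (simp add: p_def algebra_simps)
    have "(x - y) \<bullet> e = p \<bullet> e + (s - t)" using e by (simp add: xy inner_add_left dot_square_norm)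
    moreover have "\<bar>p \<bullet> e\<bar> \<le> q i" using Cauchy_Schwarz_ineq2[of p e] e p by simp
    moreover have "\<bar>(x - y) \<bullet> e\<bar> \<le> L * q i"
    proof -
      have "norm (orth_part e (x - y)) \<le> q i"
        unfolding xy orth_part_e[OF e] using orth_part_norm[OF e, of p] p by simp
      from order_trans[OF graph[OF x(1) y(1)] mult_left_mono[OF this L]] show ?thesis .
    qed
    ultimately show ?thesis by (simp add: distrib_right abs_le_iff)
  qed
  define I where "I i = (if J i = {} then {} else {(SOME t. t \<in> J i) - (L + 1) * q i .. (SOME t. t \<in> J i) + (L + 1) * q i})" for i
  have JI: "J i \<subseteq> I i" for i
  proof
    fix s assume s: "s \<in> J i"
    then have "(SOME t. t \<in> J i) \<in> J i" by (rule someI)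
    from J[OF s this] s show "s \<in> I i" by (auto simp: I_def abs_le_iff)
  qed
  have Is[measurable]: "I i \<in> sets borel" for i by (simp add: I_def)
  have Im: "emeasure lborel (I i) \<le> ennreal (2 * (L + 1) * q i)" for i
    using q0[of i] L by (cases "J i = {}") (auto simp: I_def algebra_simps intro!: ennreal_leI)
  \<comment> \<open>\<open>F s\<close> dominates the total (d-1)-dimensional size of the pieces met
    at time s. Its integral over all times is at most 2 (L + 1) M, so it cannot exceed twice the
    resulting mean throughout the time interval: this is the origin of the factor 4.\<close>
  define F where "F s = (\<Sum>i. ennreal (q i ^ (CARD('n) - 1)) * indicator (I i) s)" for s
  have "\<exists>s. 0 < s \<and> s < s0 \<and> F s \<le> ennreal (4 * (L + 1) * M / s0)"
  proof (rule ccontr)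
    let ?c = "4 * (L + 1) * M / s0"
    have c: "0 < ?c" using L M s0 by simp
    assume "\<not> ?thesis"
    then have F: "ennreal ?c \<le> F s" if "0 < s" "s < s0" for s using that by (meson linear)
    have "ennreal (4 * (L + 1) * M) = ennreal ?c * ennreal s0"
      using c s0 by (simp add: ennreal_mult[symmetric])
    also have "\<dots> = (\<integral>\<^sup>+s. ennreal ?c * indicator {0<..<s0} s \<partial>lborel)"
      using s0 by (simp add: nn_integral_cmult_indicator)
    also have "\<dots> \<le> (\<integral>\<^sup>+s. F s \<partial>lborel)"
      by (rule nn_integral_mono) (use F in \<open>auto simp: indicator_def\<close>)
    also have "\<dots> = (\<Sum>i. \<integral>\<^sup>+s. ennreal (q i ^ (CARD('n) - 1)) * indicator (I i) s \<partial>lborel)"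
      unfolding F_def by (rule nn_integral_suminf) measurable
    also have "\<dots> = (\<Sum>i. ennreal (q i ^ (CARD('n) - 1)) * emeasure lborel (I i))"
      using Is by (simp add: nn_integral_cmult_indicator)
    also have "\<dots> \<le> (\<Sum>i. ennreal (2 * (L + 1)) * ennreal (q i ^ CARD('n)))"
    proof (rule suminf_le)
      fix i
      have "ennreal (q i ^ (CARD('n) - 1)) * emeasure lborel (I i) \<le> ennreal (q i ^ (CARD('n) - 1)) * ennreal (2 * (L + 1) * q i)"
        by (rule mult_left_mono[OF Im]) simp
      also have "\<dots> = ennreal (q i ^ (CARD('n) - 1) * (2 * (L + 1) * q i))"
        using q0 L by (intro ennreal_mult[symmetric]) auto
      also have "q i ^ (CARD('n) - 1) * (2 * (L + 1) * q i) = 2 * (L + 1) * q i ^ CARD('n)"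
        using d by (cases "CARD('n)") (auto simp: algebra_simps)
      also have "ennreal (2 * (L + 1) * q i ^ CARD('n)) = ennreal (2 * (L + 1)) * ennreal (q i ^ CARD('n))"
        using q0 L by (intro ennreal_mult) auto
      finally show "ennreal (q i ^ (CARD('n) - 1)) * emeasure lborel (I i) \<le> ennreal (2 * (L + 1)) * ennreal (q i ^ CARD('n))" .
    qed auto
    also have "\<dots> = ennreal (2 * (L + 1)) * (\<Sum>i. ennreal (q i ^ CARD('n)))" by simp
    also have "\<dots> \<le> ennreal (2 * (L + 1)) * ennreal M"
      using sum unfolding q_def by (rule mult_left_mono) simp
    also have "\<dots> = ennreal (2 * (L + 1) * M)" using L M by (intro ennreal_mult[symmetric]) auto
    finally have le: "ennreal (4 * (L + 1) * M) \<le> ennreal (2 * (L + 1) * M)" .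
    have z: "0 < (L + 1) * M" using L M by simp
    have "0 \<le> 2 * (L + 1) * M" using L M by (intro mult_nonneg_nonneg) auto
    from ennreal_le_iff[THEN iffD1, OF this le] have "4 * ((L + 1) * M) \<le> 2 * ((L + 1) * M)"
      by (simp only: mult.assoc)
    then show False using z by linarith
  qed
  then obtain s where s: "0 < s" "s < s0" "F s \<le> ennreal (4 * (L + 1) * M / s0)" by blast
  \<comment> \<open>At the favourable time s the pieces are moved back by
    \<open>s *\<^sub>R e\<close>, so that they cover B itself.\<close>
  define U where "U i = {x \<in> B. x - s *\<^sub>R e \<in> Q i}" for i
  have UQ: "U i \<subseteq> (\<lambda>z. s *\<^sub>R e + z) ` Q i" for i
  proof
    fix x assume "x \<in> U i"
    then show "x \<in> (\<lambda>z. s *\<^sub>R e + z) ` Q i" by (intro image_eqI[of _ _ "x - s *\<^sub>R e"]) (auto simp: U_def)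
  qed
  have Ub: "bounded (U i)" for i by (rule bounded_subset[OF bounded_translation[OF Q(1)] UQ])
  have Ud: "diameter (U i) \<le> q i" for i
  proof (rule diameter_le)
    fix x y assume "x \<in> U i" "y \<in> U i"
    then have "dist (x - s *\<^sub>R e) (y - s *\<^sub>R e) \<le> q i"
      unfolding q_def by (intro diameter_bounded_bound[OF Q(1)]) (auto simp: U_def)
    then show "norm (x - y) \<le> q i" by (simp add: dist_norm)
  qed (use q0 in simp)
  have Ucov: "B \<subseteq> (\<Union>i. U i)"
    using cover[OF _ s(1,2)] by (auto simp: U_def)
  let ?k = "unit_ball_vol (real CARD('n) - 1) / 2 powr (real CARD('n) - 1)"
  have k: "0 \<le> ?k" using d by simp
  have piece: "ennreal (?k * diameter (U i) powr (real CARD('n) - 1)) \<le> ennreal ?k * (ennreal (q i ^ (CARD('n) - 1)) * indicator (I i) s)" for i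
  proof (cases "U i = {}")
    case True
    then show ?thesis using d by simp
  next
    case False
    then have "s \<in> J i" by (auto simp: U_def J_def)
    then have sI: "s \<in> I i" using JI by blast
    have du: "0 \<le> diameter (U i)" by (rule diameter_ge_0[OF Ub])
    have "diameter (U i) powr (real CARD('n) - 1) = diameter (U i) ^ (CARD('n) - 1)"
    proof (cases "diameter (U i) = 0")
      case True
      then show ?thesis using d by (simp add: power_0_left)
    next
      case False
      then show ?thesis using du d by (subst powr_realpow[symmetric]) (auto simp: of_nat_diff)
    qed
    also have "\<dots> \<le> q i ^ (CARD('n) - 1)" by (rule power_mono[OF Ud du])
    finally have "?k * diameter (U i) powr (real CARD('n) - 1) \<le> ?k * q i ^ (CARD('n) - 1)"
      using k by (intro mult_left_mono)
    then have "ennreal (?k * diameter (U i) powr (real CARD('n) - 1)) \<le> ennreal (?k * q i ^ (CARD('n) - 1))"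
      by (rule ennreal_leI)
    also have "\<dots> = ennreal ?k * ennreal (q i ^ (CARD('n) - 1))" using k q0 by (intro ennreal_mult) auto
    finally show ?thesis using sI by simp
  qed
  have "hausdorff_premeasure (real CARD('n) - 1) \<delta> B \<le> (\<Sum>i. ennreal (?k * diameter (U i) powr (real CARD('n) - 1)))"
    unfolding hausdorff_premeasure_def
    by (rule INF_lower) (intro CollectI conjI allI Ucov Ub order_trans[OF Ud[unfolded q_def] Q(2)])
  also have "\<dots> \<le> (\<Sum>i. ennreal ?k * (ennreal (q i ^ (CARD('n) - 1)) * indicator (I i) s))"
    by (intro suminf_le piece) auto
  also have "\<dots> = ennreal ?k * F s" by (simp add: F_def)
  also have "\<dots> \<le> ennreal ?k * ennreal (4 * (L + 1) * M / s0)" by (rule mult_left_mono[OF s(3)]) simp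
  finally show ?thesis .
qed

text \<open>The cubes of \<open>covering_lemma\<close> have disjoint interiors in G, and the
  diameter of a cube is at most d times its side. The d-th powers of the diameters are thus
  controlled by volumes that add up to at most the volume of G.\<close>

lemma small_cube_cover:
  fixes S :: "'a::euclidean_space set"
  assumes S: "bounded S" and G: "open G" "S \<subseteq> G" and \<delta>: "0 < \<delta>"
  obtains Q :: "nat \<Rightarrow> 'a set" where
    "\<And>i. bounded (Q i)" "\<And>i. diameter (Q i) \<le> \<delta>" "S \<subseteq> (\<Union>i. Q i)"
    "(\<Sum>i. ennreal (diameter (Q i) ^ DIM('a))) \<le> ennreal (real DIM('a) ^ DIM('a)) * emeasure lborel G"
proof -
  obtain r where r: "0 < r" "S \<subseteq> ball 0 r" using bounded_subset_ballD[OF S, of 0] by blast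
  let ?a = "- r *\<^sub>R One :: 'a" and ?b = "r *\<^sub>R One :: 'a"
  have ab: "?b \<bullet> i - ?a \<bullet> i = 2 * r" if "i \<in> Basis" for i using that by simp
  have Sab: "S \<subseteq> cbox ?a ?b"
  proof
    fix x assume "x \<in> S"
    then have "norm x < r" using r(2) by auto
    then have "- r \<le> x \<bullet> i \<and> x \<bullet> i \<le> r" if "i \<in> Basis" for i
      using Basis_le_norm[OF that, of x] by (simp add: abs_le_iff)
    then show "x \<in> cbox ?a ?b" by (auto simp: mem_box)
  qed
  have ne: "box ?a ?b \<noteq> {}" using r(1) by (simp add: box_ne_empty)
  \<comment> \<open>A cube subordinate to this gauge lies in a ball of radius \<delta>/2 and in G,
    which gives at once the bound on its diameter and its place.\<close>
  define g where "g x = (if x \<in> S then ball x (\<delta> / 2) \<inter> G else ball x 1)" for x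
  have gauge: "gauge g" unfolding gauge_def g_def using G \<delta> by auto
  obtain D where D: "countable D" "\<And>K. K \<in> D \<Longrightarrow> interior K \<noteq> {} \<and> (\<exists>c d. K = cbox c d)"
    "pairwise (\<lambda>A B. interior A \<inter> interior B = {}) D"
    "\<And>K. K \<in> D \<Longrightarrow> \<exists>x \<in> S \<inter> K. K \<subseteq> g x"
    "\<And>u v. cbox u v \<in> D \<Longrightarrow> \<exists>n. \<forall>i \<in> Basis. v \<bullet> i - u \<bullet> i = (?b \<bullet> i - ?a \<bullet> i) / 2^n"
    "S \<subseteq> \<Union>D"
    by (rule covering_lemma[OF Sab ne gauge]) blast
  \<comment> \<open>The countable, possibly finite family is written as a sequence and padded with
    empty sets, whose diameter is 0.\<close>
  define Q where "Q i = (if i \<in> to_nat_on D ` D then from_nat_into D i else {})" for i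
  have QD: "Q i = {} \<or> Q i \<in> D" for i
    using D(1) by (auto simp: Q_def)
  have Qinj: "disjoint_family (\<lambda>i. interior (Q i))"
  proof (unfold disjoint_family_on_def, intro ballI impI)
    fix i j :: nat assume "i \<noteq> j"
    show "interior (Q i) \<inter> interior (Q j) = {}"
    proof (cases "i \<in> to_nat_on D ` D \<and> j \<in> to_nat_on D ` D")
      case True
      then obtain K K' where K: "K \<in> D" "i = to_nat_on D K" "K' \<in> D" "j = to_nat_on D K'" by blast
      then have "Q i = K" "Q j = K'" using D(1) by (auto simp: Q_def)
      moreover have "K \<noteq> K'" using K \<open>i \<noteq> j\<close> by auto
      ultimately show ?thesis using D(3) K by (auto simp: pairwise_def)
    qed (auto simp: Q_def)
  qed
  have Qcov: "S \<subseteq> (\<Union>i. Q i)"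
  proof
    fix x assume "x \<in> S"
    then obtain K where "K \<in> D" "x \<in> K" using D(6) by blast
    then have "x \<in> Q (to_nat_on D K)" using D(1) by (simp add: Q_def)
    then show "x \<in> (\<Union>i. Q i)" by blast
  qed
  have Qprop: "bounded (Q i) \<and> diameter (Q i) \<le> \<delta> \<and> interior (Q i) \<subseteq> G \<and>
      ennreal (diameter (Q i) ^ DIM('a)) \<le> ennreal (real DIM('a) ^ DIM('a)) * emeasure lborel (interior (Q i))" for i
  proof (cases "Q i = {}")
    case True
    then show ?thesis using \<delta> by (simp add: power_0_left)
  next
    case False
    then have QiD: "Q i \<in> D" using QD by blast
    obtain u v where uv: "Q i = cbox u v" using D(2)[OF QiD] by blast
    obtain n where n: "\<And>j. j \<in> Basis \<Longrightarrow> v \<bullet> j - u \<bullet> j = 2 * r / 2 ^ n"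
      using D(5)[of u v] QiD ab unfolding uv by auto
    define \<sigma> where "\<sigma> = 2 * r / 2 ^ n"
    have \<sigma>: "0 < \<sigma>" "\<And>j. j \<in> Basis \<Longrightarrow> v \<bullet> j - u \<bullet> j = \<sigma>" using n r(1) by (auto simp: \<sigma>_def)
    obtain x where x: "x \<in> S" "Q i \<subseteq> g x" using D(4)[OF QiD] by blast
    then have sub: "Q i \<subseteq> ball x (\<delta> / 2)" "Q i \<subseteq> G" by (auto simp: g_def)
    have d1: "diameter (Q i) \<le> \<delta>"
    proof (rule diameter_le)
      fix y z assume "y \<in> Q i" "z \<in> Q i"
      then have "dist x y < \<delta> / 2" "dist x z < \<delta> / 2" using sub(1) by auto
      then have "dist y z < \<delta>" by (rule dist_triangle_half_r)
      then show "norm (y - z) \<le> \<delta>" by (simp add: dist_norm)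
    qed (use \<delta> in simp)
    have d2: "diameter (Q i) \<le> real DIM('a) * \<sigma>"
    proof (rule diameter_le)
      fix y z assume yz: "y \<in> Q i" "z \<in> Q i"
      have "norm (y - z) \<le> (\<Sum>j\<in>Basis. \<bar>(y - z) \<bullet> j\<bar>)" by (rule norm_le_l1)
      also have "\<dots> \<le> (\<Sum>j\<in>(Basis::'a set). \<sigma>)"
      proof (rule sum_mono)
        fix j :: 'a assume j: "j \<in> Basis"
        have "u \<bullet> j \<le> y \<bullet> j" "y \<bullet> j \<le> v \<bullet> j" "u \<bullet> j \<le> z \<bullet> j" "z \<bullet> j \<le> v \<bullet> j"
          using yz j unfolding uv by (auto simp: mem_box)
        then show "\<bar>(y - z) \<bullet> j\<bar> \<le> \<sigma>" using \<sigma>(2)[OF j] by (simp add: inner_diff_left abs_le_iff)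
      qed
      finally show "norm (y - z) \<le> real DIM('a) * \<sigma>" by simp
    qed (use \<sigma> in simp)
    have em: "emeasure lborel (interior (Q i)) = ennreal (\<sigma> ^ DIM('a))"
    proof -
      have "emeasure lborel (box u v) = ennreal (\<Prod>j\<in>Basis. (v - u) \<bullet> j)"
        using \<sigma> by (intro emeasure_lborel_box) (auto simp: algebra_simps dest!: \<sigma>(2))
      also have "(\<Prod>j\<in>Basis. (v - u) \<bullet> j) = (\<Prod>j\<in>(Basis::'a set). \<sigma>)"
        by (rule prod.cong) (auto simp: inner_diff_left \<sigma>(2))
      finally show ?thesis by (simp add: uv)
    qed
    have "diameter (Q i) ^ DIM('a) \<le> (real DIM('a) * \<sigma>) ^ DIM('a)"
      by (rule power_mono[OF d2]) (simp add: uv diameter_ge_0)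
    then have "ennreal (diameter (Q i) ^ DIM('a)) \<le> ennreal (real DIM('a) ^ DIM('a) * \<sigma> ^ DIM('a))"
      by (simp add: power_mult_distrib ennreal_leI)
    also have "\<dots> = ennreal (real DIM('a) ^ DIM('a)) * emeasure lborel (interior (Q i))"
      unfolding em using \<sigma>(1) by (intro ennreal_mult) auto
    finally show ?thesis using d1 sub(2) interior_subset[of "Q i"] by (auto simp: uv)
  qed
  have "(\<Sum>i. ennreal (diameter (Q i) ^ DIM('a))) \<le> (\<Sum>i. ennreal (real DIM('a) ^ DIM('a)) * emeasure lborel (interior (Q i)))"
    using Qprop by (intro suminf_le) auto
  also have "\<dots> = ennreal (real DIM('a) ^ DIM('a)) * (\<Sum>i. emeasure lborel (interior (Q i)))" by simp
  also have "(\<Sum>i. emeasure lborel (interior (Q i))) = emeasure lborel (\<Union>i. interior (Q i))"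
    by (rule suminf_emeasure[OF _ Qinj]) auto
  also have "\<dots> \<le> emeasure lborel G"
    using Qprop G(1) by (intro emeasure_mono) auto
  finally have "(\<Sum>i. ennreal (diameter (Q i) ^ DIM('a))) \<le> ennreal (real DIM('a) ^ DIM('a)) * emeasure lborel G"
    by (simp add: mult_left_mono)
  with Qprop Qcov show thesis by (intro that[of Q]) auto
qed

text \<open>A measure built by \<open>measure_of\<close> has the prescribed value or else the value
  zero, so the outer measure is an upper bound in either case. Finiteness and null sets of surfaces
  are deduced from this bound.\<close>

lemma emeasure_hausdorff_le: "emeasure (hausdorff_measure s) A \<le> hausdorff_outer s A"
  unfolding hausdorff_measure_def by (simp add: emeasure_measure_of_conv)

text \<open>The factor of \<open>hausdorff_premeasure_graph\<close> together with the d^d of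
  \<open>small_cube_cover\<close>. The volume M and the time s0 stay outside, as they are varied
  separately.\<close>

definition graph_constant :: "nat \<Rightarrow> real \<Rightarrow> real" where
  "graph_constant d L = unit_ball_vol (real d - 1) / 2 powr (real d - 1) * (4 * (L + 1) * real d ^ d)"

lemma graph_constant_nonneg: "2 \<le> d \<Longrightarrow> 0 \<le> L \<Longrightarrow> 0 \<le> graph_constant d L"
  by (simp add: graph_constant_def)

text \<open>The cover of the swept region can be made as fine as desired while the volume of G stays
  fixed. The resulting bound does not depend on \<delta>, so it survives the supremum.\<close>

lemma hausdorff_outer_graph:
  fixes B :: "(real ^ 'n::finite) set"
  assumes d: "2 \<le> CARD('n)" and e: "norm e = 1" and L: "0 \<le> L"
    and graph: "\<And>x y. x \<in> B \<Longrightarrow> y \<in> B \<Longrightarrow> \<bar>(x - y) \<bullet> e\<bar> \<le> L * norm (orth_part e (x - y))"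
    and B: "bounded B" and s0: "0 < s0" and M: "0 < M"
    and G: "open G" "\<And>x s. x \<in> B \<Longrightarrow> 0 < s \<Longrightarrow> s < s0 \<Longrightarrow> x - s *\<^sub>R e \<in> G" "emeasure lborel G \<le> ennreal M"
  shows "hausdorff_outer (real CARD('n) - 1) B \<le> ennreal (graph_constant CARD('n) L * M / s0)"
  unfolding hausdorff_outer_def
proof (rule SUP_least)
  fix \<delta> :: real assume "\<delta> \<in> {0<..}"
  then have \<delta>: "0 < \<delta>" by simp
  let ?S = "(\<lambda>(x, s). x - s *\<^sub>R e) ` (B \<times> {0<..<s0})"
  have bS: "bounded ?S"
  proof -
    obtain R where R: "\<And>x. x \<in> B \<Longrightarrow> norm x \<le> R" using B by (auto simp: bounded_iff)
    have "norm (x - s *\<^sub>R e) \<le> R + s0" if "x \<in> B" "0 < s" "s < s0" for x s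
      using norm_triangle_ineq4[of x "s *\<^sub>R e"] R[OF that(1)] that e by simp
    then show ?thesis by (auto simp: bounded_iff intro!: exI[of _ "R + s0"])
  qed
  have SG: "?S \<subseteq> G" using G(2) by auto
  obtain Q :: "nat \<Rightarrow> (real ^ 'n) set" where Q:
    "\<And>i. bounded (Q i)" "\<And>i. diameter (Q i) \<le> \<delta>" "?S \<subseteq> (\<Union>i. Q i)"
    "(\<Sum>i. ennreal (diameter (Q i) ^ DIM(real ^ 'n))) \<le> ennreal (real DIM(real ^ 'n) ^ DIM(real ^ 'n)) * emeasure lborel G"
    by (rule small_cube_cover[OF bS G(1) SG \<delta>]) blast
  have M': "0 < real CARD('n) ^ CARD('n) * M" using M by simp
  have sum: "(\<Sum>i. ennreal (diameter (Q i) ^ CARD('n))) \<le> ennreal (real CARD('n) ^ CARD('n) * M)"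
  proof -
    have "(\<Sum>i. ennreal (diameter (Q i) ^ CARD('n))) \<le> ennreal (real CARD('n) ^ CARD('n)) * emeasure lborel G"
      using Q(4) by simp
    also have "\<dots> \<le> ennreal (real CARD('n) ^ CARD('n)) * ennreal M"
      by (rule mult_left_mono[OF G(3)]) simp
    also have "\<dots> = ennreal (real CARD('n) ^ CARD('n) * M)" using M by (intro ennreal_mult[symmetric]) auto
    finally show ?thesis .
  qed
  have "hausdorff_premeasure (real CARD('n) - 1) \<delta> B
    \<le> ennreal (unit_ball_vol (real CARD('n) - 1) / 2 powr (real CARD('n) - 1)) *
       ennreal (4 * (L + 1) * (real CARD('n) ^ CARD('n) * M) / s0)"
  proof (rule hausdorff_premeasure_graph[OF d e L _ s0 M' Q(1,2) sum])
    show "\<bar>(x - y) \<bullet> e\<bar> \<le> L * norm (orth_part e (x - y))" if "x \<in> B" "y \<in> B" for x y by (rule graph[OF that])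
    show "x - s *\<^sub>R e \<in> (\<Union>i. Q i)" if "x \<in> B" "0 < s" "s < s0" for x s
      by (rule subsetD[OF Q(3)], rule image_eqI[where x = "(x, s)"]) (use that in auto)
  qed
  also have "\<dots> = ennreal (unit_ball_vol (real CARD('n) - 1) / 2 powr (real CARD('n) - 1) *
        (4 * (L + 1) * (real CARD('n) ^ CARD('n) * M) / s0))"
    using d L s0 M by (intro ennreal_mult[symmetric]) auto
  also have "unit_ball_vol (real CARD('n) - 1) / 2 powr (real CARD('n) - 1) *
        (4 * (L + 1) * (real CARD('n) ^ CARD('n) * M) / s0) = graph_constant CARD('n) L * M / s0"
    by (simp add: graph_constant_def)
  finally show "hausdorff_premeasure (real CARD('n) - 1) \<delta> B \<le> ennreal (graph_constant CARD('n) L * M / s0)" .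
qed

text \<open>If the moving graph sweeps only a null set, G may be an open neighbourhood of that set
  with arbitrarily small measure. In this way exceptional sets in the volume produce null sets on
  the boundary.\<close>

lemma hausdorff_outer_graph_null:
  fixes B :: "(real ^ 'n::finite) set"
  assumes d: "2 \<le> CARD('n)" and e: "norm e = 1" and L: "0 \<le> L"
    and graph: "\<And>x y. x \<in> B \<Longrightarrow> y \<in> B \<Longrightarrow> \<bar>(x - y) \<bullet> e\<bar> \<le> L * norm (orth_part e (x - y))"
    and B: "bounded B" and s0: "0 < s0"
    and N: "negligible N" "\<And>x s. x \<in> B \<Longrightarrow> 0 < s \<Longrightarrow> s < s0 \<Longrightarrow> x - s *\<^sub>R e \<in> N"
  shows "hausdorff_outer (real CARD('n) - 1) B = 0"
proof -
  define C where "C = graph_constant CARD('n) L / s0"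
  have C: "0 \<le> C" using graph_constant_nonneg[OF d L] s0 by (simp add: C_def)
  have le: "hausdorff_outer (real CARD('n) - 1) B \<le> 0 + ennreal \<epsilon>" if \<epsilon>: "0 < \<epsilon>" for \<epsilon> :: real
  proof -
    \<comment> \<open>With this volume the bound of \<open>hausdorff_outer_graph\<close> is C M
      \<le> \<epsilon>; the summand 1 keeps the quotient meaningful when C is 0.\<close>
    define M where "M = \<epsilon> / (C + 1)"
    have M: "0 < M" using \<epsilon> C by (simp add: M_def)
    have Ns: "N \<in> sets lebesgue" using N(1) by (rule negligible_imp_sets)
    obtain G where G: "open G" "N \<subseteq> G" "G - N \<in> lmeasurable" "emeasure lebesgue (G - N) < ennreal M"
      using sets_lebesgue_outer_open[OF Ns M] by blast
    have "emeasure lebesgue G \<le> emeasure lebesgue (N \<union> (G - N))"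
      using Ns G by (intro emeasure_mono) auto
    also have "\<dots> \<le> emeasure lebesgue N + emeasure lebesgue (G - N)"
      using Ns G by (intro emeasure_subadditive) (auto simp: fmeasurableD)
    also have "emeasure lebesgue N = 0" using N(1) by (simp add: negligible_iff_null_sets null_setsD1)
    finally have "emeasure lebesgue G \<le> ennreal M" using G(4) by simp
    then have em: "emeasure lborel G \<le> ennreal M" using G(1) by simp
    have "hausdorff_outer (real CARD('n) - 1) B \<le> ennreal (graph_constant CARD('n) L * M / s0)"
    proof (rule hausdorff_outer_graph[OF d e L _ B s0 M G(1) _ em])
      show "\<bar>(x - y) \<bullet> e\<bar> \<le> L * norm (orth_part e (x - y))" if "x \<in> B" "y \<in> B" for x y by (rule graph[OF that])
      show "x - s *\<^sub>R e \<in> G" if "x \<in> B" "0 < s" "s < s0" for x s using N(2)[OF that] G(2) by blast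
    qed
    also have "\<dots> \<le> ennreal \<epsilon>"
    proof (rule ennreal_leI)
      have "graph_constant CARD('n) L * M / s0 = \<epsilon> * (C / (C + 1))" by (simp add: M_def C_def mult.commute)
      also have "\<dots> \<le> \<epsilon> * 1" using \<epsilon> C by (intro mult_left_mono) (auto simp: divide_le_eq)
      finally show "graph_constant CARD('n) L * M / s0 \<le> \<epsilon>" by simp
    qed
    finally show ?thesis by simp
  qed
  have "hausdorff_outer (real CARD('n) - 1) B \<le> 0" by (rule ennreal_le_epsilon) (rule le)
  then show ?thesis by simp
qed

text \<open>\<open>lipschitz_open\<close> describes only U near a boundary point. A boundary point
  is not below the graph, since U is open, and not above it, since points of U come arbitrarily
  close and the graph is Lipschitz. Composition with \<open>orth_part\<close> makes g a function of
  all points.\<close>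

lemma lipschitz_chart:
  fixes U :: "(real ^ 'n::finite) set"
  assumes U: "lipschitz_open U" and x0: "x0 \<in> frontier U"
  obtains e r L and g :: "real ^ 'n \<Rightarrow> real" where "norm e = 1" "0 < r" "0 \<le> L"
    "\<And>y z. \<bar>g (orth_part e y) - g (orth_part e z)\<bar> \<le> L * norm (orth_part e (y - z))"
    "\<And>y. y \<in> ball x0 r \<Longrightarrow> y \<in> U \<longleftrightarrow> y \<bullet> e < g (orth_part e y)"
    "\<And>x. x \<in> frontier U \<Longrightarrow> x \<in> ball x0 r \<Longrightarrow> x \<bullet> e = g (orth_part e x)"
proof -
  obtain e r L and g :: "real ^ 'n \<Rightarrow> real" where e: "norm e = 1" and r: "0 < r"
    and lip: "L-lipschitz_on {z. z \<bullet> e = 0} g"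
    and eq: "U \<inter> ball x0 r = {y \<in> ball x0 r. y \<bullet> e < g (y - (y \<bullet> e) *\<^sub>R e)}"
    using U x0 unfolding lipschitz_open_def by blast
  have L: "0 \<le> L" using lip by (rule lipschitz_on_nonneg)
  have g: "\<bar>g (orth_part e y) - g (orth_part e z)\<bar> \<le> L * norm (orth_part e (y - z))" for y z
    using lipschitz_onD[OF lip, of "orth_part e y" "orth_part e z"] orth_part_inner[OF e]
    by (simp add: dist_norm linear_diff[OF orth_part_linear])
  have inU: "y \<in> U \<longleftrightarrow> y \<bullet> e < g (orth_part e y)" if "y \<in> ball x0 r" for y
  proof -
    have "y \<in> U \<inter> ball x0 r \<longleftrightarrow> y \<in> {y \<in> ball x0 r. y \<bullet> e < g (y - (y \<bullet> e) *\<^sub>R e)}" by (simp only: eq)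
    then show ?thesis using that by (simp add: orth_part_def)
  qed
  have fr: "x \<bullet> e = g (orth_part e x)" if x: "x \<in> frontier U" "x \<in> ball x0 r" for x
  proof (rule antisym)
    have "open U" using U by (simp add: lipschitz_open_def)
    then have "x \<notin> U" using x(1) by (simp add: frontier_def interior_open)
    then show "g (orth_part e x) \<le> x \<bullet> e" using inU[OF x(2)] by simp
    show "x \<bullet> e \<le> g (orth_part e x)"
    proof (rule field_le_epsilon)
      fix \<epsilon> :: real assume \<epsilon>: "0 < \<epsilon>"
      obtain \<rho> where \<rho>: "0 < \<rho>" "ball x \<rho> \<subseteq> ball x0 r" using x(2) openE[OF open_ball] by blast
      define \<mu> where "\<mu> = min \<rho> (\<epsilon> / (L + 1))"
      have "0 < \<mu>" using \<epsilon> L \<rho> by (simp add: \<mu>_def)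
      moreover have "x \<in> closure U" using x(1) by (simp add: frontier_def)
      ultimately obtain z where z: "z \<in> U" "dist z x < \<mu>" using closure_approachable[of x U] by blast
      then have "z \<in> ball x \<rho>" by (simp add: \<mu>_def dist_commute)
      then have zU: "z \<bullet> e < g (orth_part e z)" using inU[of z] z(1) \<rho>(2) by blast
      have nz: "norm (x - z) < \<epsilon> / (L + 1)" using z(2) by (simp add: \<mu>_def dist_norm norm_minus_commute)
      have "(x - z) \<bullet> e \<le> norm (x - z)" using Cauchy_Schwarz_ineq2[of "x - z" e] e by simp
      then have "x \<bullet> e \<le> z \<bullet> e + norm (x - z)" by (simp add: inner_diff_left)
      moreover have "g (orth_part e z) \<le> g (orth_part e x) + L * norm (x - z)"
        using g[of z x] mult_left_mono[OF orth_part_norm[OF e, of "z - x"] L] by (simp add: norm_minus_commute abs_le_iff)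
      moreover have "(L + 1) * norm (x - z) \<le> \<epsilon>"
        using nz L by (simp add: less_divide_eq mult.commute)
      ultimately show "x \<bullet> e \<le> g (orth_part e x) + \<epsilon>" using zU by (simp add: distrib_right)
    qed
  qed
  show thesis by (rule that[OF e r L g inU fr])
qed

text \<open>By compactness finitely many charts cover the boundary. In each chart the graph, moved
  by less than 1, stays in a ball of radius r + 1, and the volume of that ball bounds the surface
  measure.\<close>

lemma finite_surface_frontier:
  fixes U :: "(real ^ 'n::finite) set"
  assumes d: "2 \<le> CARD('n)" and U: "lipschitz_open U" "bounded U"
  shows "finite_surface (frontier U)"
proof -
  let ?M = "hausdorff_measure (real CARD('n) - 1) :: (real ^ 'n) measure"
  have "\<exists>r>0. emeasure ?M (frontier U \<inter> ball x r) < \<infinity>" if x: "x \<in> frontier U" for x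
  proof -
    obtain e r L and g :: "real ^ 'n \<Rightarrow> real" where e: "norm e = 1" and r: "0 < r" and L: "0 \<le> L"
      and g: "\<And>y z. \<bar>g (orth_part e y) - g (orth_part e z)\<bar> \<le> L * norm (orth_part e (y - z))"
      and fr: "\<And>z. z \<in> frontier U \<Longrightarrow> z \<in> ball x r \<Longrightarrow> z \<bullet> e = g (orth_part e z)"
      by (rule lipschitz_chart[OF U(1) x]) blast
    let ?B = "frontier U \<inter> ball x r"
    define M where "M = measure lborel (ball x (r + 1)) + 1"
    have em: "emeasure lborel (ball x (r + 1)) \<le> ennreal M"
      using emeasure_lborel_ball_finite[of x "r + 1"] by (simp add: M_def emeasure_eq_ennreal_measure ennreal_leI)
    have "hausdorff_outer (real CARD('n) - 1) ?B \<le> ennreal (graph_constant CARD('n) L * M / 1)"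
    proof (rule hausdorff_outer_graph[OF d e L _ _ _ _ _ _ em])
      show "\<bar>(y - z) \<bullet> e\<bar> \<le> L * norm (orth_part e (y - z))" if "y \<in> ?B" "z \<in> ?B" for y z
        using g[of y z] fr[of y] fr[of z] that by (simp add: inner_diff_left)
      show "bounded ?B" by (rule bounded_subset[OF bounded_ball]) auto
      show "0 < M" unfolding M_def by (simp add: add_nonneg_pos)
      show "y - s *\<^sub>R e \<in> ball x (r + 1)" if "y \<in> ?B" "0 < s" "s < 1" for y s
      proof -
        have "dist x (y - s *\<^sub>R e) \<le> dist x y + norm (s *\<^sub>R e)"
          using norm_triangle_ineq[of "x - y" "s *\<^sub>R e"] by (simp add: dist_norm algebra_simps)
        then show ?thesis using that e by simp
      qed
    qed auto
    then have "emeasure ?M ?B \<le> ennreal (graph_constant CARD('n) L * M / 1)"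
      by (rule order_trans[OF emeasure_hausdorff_le])
    also have "\<dots> < \<infinity>" by simp
    finally have "emeasure ?M ?B < \<infinity>" .
    then show ?thesis using r by blast
  qed
  then obtain r where r: "\<And>x. x \<in> frontier U \<Longrightarrow> 0 < r x" "\<And>x. x \<in> frontier U \<Longrightarrow> emeasure ?M (frontier U \<inter> ball x (r x)) < \<infinity>"
    by metis
  have comp: "compact (frontier U)" using U(2) by (rule compact_frontier_bounded)
  have "frontier U \<subseteq> (\<Union>x\<in>frontier U. ball x (r x))" using r(1) by force
  then obtain C where C: "C \<subseteq> frontier U" "finite C" "frontier U \<subseteq> (\<Union>x\<in>C. ball x (r x))"
    by (rule compactE_image[OF comp, rotated]) auto
  have "emeasure ?M (frontier U) \<le> emeasure ?M (\<Union>x\<in>C. frontier U \<inter> ball x (r x))"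
  proof (rule emeasure_mono)
    show "frontier U \<subseteq> (\<Union>x\<in>C. frontier U \<inter> ball x (r x))" using C(3) by blast
    have "open (\<Union>x\<in>C. ball x (r x))" by blast
    then have "(\<Union>x\<in>C. ball x (r x)) \<in> sets borel" by (rule borel_open)
    moreover have "frontier U \<in> sets borel" by (rule borel_closed) simp
    ultimately have "frontier U \<inter> (\<Union>x\<in>C. ball x (r x)) \<in> sets borel" by (rule sets.Int[rotated])
    then show "(\<Union>x\<in>C. frontier U \<inter> ball x (r x)) \<in> sets ?M" by simp
  qed
  also have "\<dots> \<le> (\<Sum>x\<in>C. emeasure ?M (frontier U \<inter> ball x (r x)))"
    using C(2) by (intro emeasure_subadditive_finite) (simp_all add: image_subset_iff sets.Int)
  also have "\<dots> < \<infinity>" using r(2) C(1,2) by (simp add: ennreal_sum_less_top subset_iff)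
  finally show ?thesis by (simp add: finite_surface_def)
qed

lemma finite_surface_subset:
  fixes \<Gamma> :: "(real ^ 'n::finite) set"
  assumes "finite_surface \<Gamma>" "closed \<Gamma>'" "\<Gamma>' \<subseteq> \<Gamma>"
  shows "finite_surface \<Gamma>'"
proof -
  have "emeasure (hausdorff_measure (real CARD('n) - 1)) \<Gamma>' \<le> emeasure (hausdorff_measure (real CARD('n) - 1)) \<Gamma>"
    using assms by (intro emeasure_mono) (auto simp: finite_surface_def borel_closed)
  then show ?thesis using assms unfolding finite_surface_def by (auto intro: order_le_less_trans)
qed

lemma finite_surface_Un:
  fixes \<Gamma> \<Gamma>' :: "(real ^ 'n::finite) set"
  assumes "finite_surface \<Gamma>" "finite_surface \<Gamma>'"
  shows "finite_surface (\<Gamma> \<union> \<Gamma>')"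
proof -
  let ?M = "hausdorff_measure (real CARD('n) - 1) :: (real ^ 'n) measure"
  have "emeasure ?M (\<Gamma> \<union> \<Gamma>') \<le> emeasure ?M \<Gamma> + emeasure ?M \<Gamma>'"
    using assms by (intro emeasure_subadditive) (auto simp: finite_surface_def borel_closed)
  also have "\<dots> < \<infinity>" using assms by (simp add: finite_surface_def)
  finally show ?thesis using assms by (simp add: finite_surface_def closed_Un)
qed

section \<open>Uniqueness of the trace\<close>

text \<open>The fundamental theorem of calculus and Cauchy-Schwarz on one segment. The right-hand
  side is a nonnegative integral so that it can afterwards be integrated over the starting points by
  Tonelli.\<close>

lemma norm_increment_square_le:
  fixes F :: "real \<Rightarrow> complex"
  assumes b: "0 \<le> b" and d: "\<And>t. 0 \<le> t \<Longrightarrow> t \<le> b \<Longrightarrow> (F has_vector_derivative f t) (at t)"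
    and c: "continuous_on UNIV f"
  shows "ennreal ((cmod (F b - F 0))\<^sup>2) \<le> ennreal b * (\<integral>\<^sup>+t. ennreal ((cmod (f t))\<^sup>2) * indicator {0..b} t \<partial>lborel)"
proof -
  let ?M = "restrict_space lborel {0..b}"
  have f: "f \<in> borel_measurable ?M"
    by (intro measurable_restrict_space1) (use borel_measurable_continuous_onI[OF c] in simp)
  have "compact (f ` {0..b})" by (intro compact_continuous_image continuous_on_subset[OF c]) auto
  then obtain B where B: "\<forall>y\<in>f ` {0..b}. norm y \<le> B" using compact_imp_bounded bounded_pos by blast
  have fin: "emeasure lborel {0..b} < \<infinity>" using b by simp
  have i1: "integrable ?M (\<lambda>x. c :: real)" for c
  proof -
    have "finite_measure ?M"
      by (rule finite_measureI) (use b in \<open>simp add: emeasure_restrict_space space_restrict_space\<close>)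
    then show ?thesis by (rule finite_measure.integrable_const)
  qed
  have fL: "f \<in> L2 ?M"
    by (rule L2I[OF f i1[of "B\<^sup>2"]]) (use B in \<open>auto simp: space_restrict_space intro!: AE_I2 power_mono\<close>)
  have gL: "(\<lambda>t. 1::real) \<in> L2 ?M" by (rule L2I[OF _ i1[of 1]]) auto
  have "(\<integral>t. indicator {0..b} t *\<^sub>R f t \<partial>lborel) = F b - F 0"
    by (rule integral_FTC_Icc[OF b]) (use d in \<open>auto intro: has_vector_derivative_at_within continuous_on_subset[OF c]\<close>)
  then have "F b - F 0 = (\<integral>t. f t \<partial>?M)" by (simp add: integral_restrict_space)
  then have "cmod (F b - F 0) \<le> (\<integral>t. norm (f t) * norm (1::real) \<partial>?M)"
    by (simp add: integral_norm_bound)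
  also have "\<dots> \<le> L2_norm ?M f * L2_norm ?M (\<lambda>t. 1::real)" by (rule L2_Cauchy_Schwarz(2)[OF fL gL])
  finally have "(cmod (F b - F 0))\<^sup>2 \<le> (L2_norm ?M f * L2_norm ?M (\<lambda>t. 1::real))\<^sup>2"
    by (rule power_mono) simp
  also have "\<dots> = b * (L2_norm ?M f)\<^sup>2"
  proof -
    have "(L2_norm ?M (\<lambda>t. 1::real))\<^sup>2 = b"
      using b by (simp add: L2_norm_sq measure_restrict_space space_restrict_space)
    then show ?thesis by (simp add: power_mult_distrib)
  qed
  also have "(L2_norm ?M f)\<^sup>2 = (\<integral>t. (cmod (f t))\<^sup>2 \<partial>?M)" by (rule L2_norm_sq)
  finally have "ennreal ((cmod (F b - F 0))\<^sup>2) \<le> ennreal (b * (\<integral>t. (cmod (f t))\<^sup>2 \<partial>?M))" by (rule ennreal_leI)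
  also have "\<dots> = ennreal b * ennreal (\<integral>t. (cmod (f t))\<^sup>2 \<partial>?M)" using b by (intro ennreal_mult) auto
  also have "ennreal (\<integral>t. (cmod (f t))\<^sup>2 \<partial>?M) = (\<integral>\<^sup>+t. ennreal ((cmod (f t))\<^sup>2) \<partial>?M)"
    using L2_D(2)[OF fL] by (intro nn_integral_eq_integral[symmetric]) auto
  also have "\<dots> = (\<integral>\<^sup>+t. ennreal ((cmod (f t))\<^sup>2) * indicator {0..b} t \<partial>lborel)"
    by (rule nn_integral_restrict_space) simp
  finally show ?thesis .
qed

lemma frechet_derivative_components:
  fixes w :: "real ^ 'n::finite \<Rightarrow> complex"
  assumes "w differentiable (at x)"
  shows "fderiv w x v = (\<Sum>i\<in>UNIV. (v $ i) *\<^sub>R partial i w x)"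
proof -
  have lin: "linear (fderiv w x)"
    using assms frechet_derivative_works has_derivative_linear by blast
  have "v = (\<Sum>i\<in>UNIV. (v $ i) *\<^sub>R axis i 1)"
    by (simp add: Finite_Cartesian_Product.vec_eq_iff axis_def sum_component if_distrib cong: if_cong)
  from arg_cong[OF this, of "fderiv w x"]
  show ?thesis unfolding linear_sum[OF lin] linear_scale[OF lin] .
qed

lemma directional_derivative_le_cgrad:
  fixes w :: "real ^ 'n::finite \<Rightarrow> complex"
  assumes "w differentiable (at x)" "norm e = 1"
  shows "cmod (fderiv w x e) \<le> real CARD('n) * norm (cgrad w x)"
proof -
  have "cmod (fderiv w x e) = cmod (\<Sum>i\<in>UNIV. (e $ i) *\<^sub>R partial i w x)"
    by (rule arg_cong[OF frechet_derivative_components[OF assms(1)]])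
  also have "\<dots> \<le> (\<Sum>i\<in>(UNIV::'n set). norm (cgrad w x))"
  proof (rule sum_norm_le)
    fix i
    have "\<bar>e $ i\<bar> \<le> 1" using component_le_norm_cart[of e i] assms(2) by simp
    moreover have "cmod (partial i w x) \<le> norm (cgrad w x)"
      using Finite_Cartesian_Product.norm_nth_le[of "cgrad w x" i] by (simp add: cgrad_def)
    ultimately show "cmod ((e $ i) *\<^sub>R partial i w x) \<le> norm (cgrad w x)"
      using mult_mono[of "\<bar>e $ i\<bar>" 1 "cmod (partial i w x)" "norm (cgrad w x)"] by simp
  qed
  finally show ?thesis by simp
qed

lemma L2_norm_nn_integral:
  fixes g :: "real ^ 'n::finite \<Rightarrow> 'b::euclidean_space"
  assumes g: "g \<in> borel_measurable borel" and E: "E \<in> sets borel" and gL: "g \<in> L2 (leb E)"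
  shows "ennreal ((norm2 E g)\<^sup>2) = (\<integral>\<^sup>+x. ennreal ((norm (g x))\<^sup>2) * indicator E x \<partial>lborel)"
proof -
  have "ennreal ((norm2 E g)\<^sup>2) = (\<integral>\<^sup>+x. ennreal ((norm (g x))\<^sup>2) \<partial>leb E)"
    unfolding L2_norm_sq using L2_D(2)[OF gL] by (intro nn_integral_eq_integral[symmetric]) auto
  also have "\<dots> = (\<integral>\<^sup>+x. ennreal ((norm (g x))\<^sup>2) * indicator E x \<partial>lebesgue)"
    using E by (intro nn_integral_restrict_space) auto
  also have "\<dots> = (\<integral>\<^sup>+x. ennreal ((norm (g x))\<^sup>2) * indicator E x \<partial>lborel)"
    by (rule nn_integral_completion) (use g E in measurable)
  finally show ?thesis .
qed

lemma nn_integral_lborel_shift: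
  fixes f :: "'a::euclidean_space \<Rightarrow> ennreal"
  assumes "f \<in> borel_measurable borel"
  shows "(\<integral>\<^sup>+y. f (y + a) \<partial>lborel) = (\<integral>\<^sup>+y. f y \<partial>lborel)"
proof -
  have "(\<integral>\<^sup>+y. f y \<partial>lborel) = (\<integral>\<^sup>+y. f y \<partial>distr lborel borel ((+) a))"
    by (simp add: lborel_distr_plus)
  also have "\<dots> = (\<integral>\<^sup>+y. f (a + y) \<partial>lborel)"
    using assms by (intro nn_integral_distr) auto
  finally show ?thesis by (simp add: add.commute)
qed

text \<open>Each point y of E is joined to its boundary point \<open>y + s y *\<^sub>R e\<close>,
  and the increment of w on the segment is controlled by its derivative. Tonelli and translation
  invariance then give the bound. Boundary values are measured by the volume of the points from
  which they are reached, so that only volume integrals occur.\<close>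

lemma graph_boundary_estimate:
  fixes w :: "real ^ 'n::finite \<Rightarrow> complex" and s :: "real ^ 'n \<Rightarrow> real"
  assumes w: "w \<in> test_functions UNIV" and D: "open D" and E: "open E" "bounded E" "E \<subseteq> D" and e: "norm e = 1" and r: "0 < r"
    and s: "continuous_on UNIV s" "\<And>y. y \<in> E \<Longrightarrow> 0 \<le> s y" "\<And>y. y \<in> E \<Longrightarrow> s y \<le> r"
    and seg: "\<And>y t. y \<in> E \<Longrightarrow> 0 \<le> t \<Longrightarrow> t < s y \<Longrightarrow> y + t *\<^sub>R e \<in> D"
  shows "(\<lambda>y. w (y + s y *\<^sub>R e)) \<in> L2 (leb E)"
    and "norm2 E (\<lambda>y. w (y + s y *\<^sub>R e)) \<le> (r * real CARD('n) + 1) * H1k_norm 1 D w"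
proof -
  let ?W = "\<lambda>y. w (y + s y *\<^sub>R e)"
  have Es: "E \<in> sets borel" "D \<in> sets borel" using E D by auto
  have El: "E \<in> sets lebesgue" "D \<in> sets lebesgue" using E D by auto
  have cw: "continuous_on UNIV w" by (rule test_functions_continuous[OF w])
  have cW: "continuous_on UNIV ?W"
    by (rule continuous_on_compose2[OF cw]) (auto intro!: continuous_intros s(1))
  obtain B where B: "\<And>x. norm (w x) \<le> B" using test_functions_bounded[OF w] by blast
  have WL: "?W \<in> L2 (leb E)"
  proof (rule L2I)
    show "?W \<in> borel_measurable (leb E)" by (rule measurable_continuous[OF cW])
    show "integrable (leb E) (\<lambda>x. B\<^sup>2 * indicator E x)"
      using integrable_indicator_bounded[OF E(2) El(1) El(1)] by simp
    show "AE x in leb E. (norm (?W x))\<^sup>2 \<le> B\<^sup>2 * indicator E x"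
      using B by (intro AE_I2) (auto intro!: power_mono)
  qed
  then show "?W \<in> L2 (leb E)" .
  have wD: "w \<in> L2 (leb D)" "is_weak_grad D w (cgrad w)" "w \<in> H1 D"
    by (rule test_functions_H1[OF w D])+
  have wE: "w \<in> L2 (leb E)" by (rule test_functions_L2(1)[OF w El(1)])
  have wb: "w \<in> borel_measurable borel" by (rule borel_measurable_continuous_onI[OF cw])
  let ?f' = "\<lambda>z. fderiv w z e"
  have f'T: "?f' \<in> test_functions UNIV" by (rule test_functions_derivative[OF w])
  have cf': "continuous_on UNIV ?f'" by (rule test_functions_continuous[OF f'T])
  then have f'b[measurable]: "?f' \<in> borel_measurable borel" by (rule borel_measurable_continuous_onI)
  define f where "f z = ennreal ((cmod (?f' z))\<^sup>2) * indicator D z" for z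
  have fb[measurable]: "f \<in> borel_measurable borel" unfolding f_def using Es by measurable
  have step: "ennreal ((cmod (?W y - w y))\<^sup>2) * indicator E y \<le> ennreal r * (\<integral>\<^sup>+t. f (y + t *\<^sub>R e) * indicator {0..r} t \<partial>lborel)" for y
  proof (cases "y \<in> E")
    case True
    have d: "((\<lambda>t. w (y + t *\<^sub>R e)) has_vector_derivative ?f' (y + t *\<^sub>R e)) (at t)" for t
    proof -
      have "((\<lambda>t. y + t *\<^sub>R e) has_derivative (\<lambda>h. h *\<^sub>R e)) (at t)"
        by (auto intro!: derivative_eq_intros)
      from has_derivative_compose[OF this test_functions_has_derivative[OF w]]
      have "((\<lambda>t. w (y + t *\<^sub>R e)) has_derivative (\<lambda>h. fderiv w (y + t *\<^sub>R e) (h *\<^sub>R e))) (at t)" .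
      moreover have "(\<lambda>h. fderiv w (y + t *\<^sub>R e) (h *\<^sub>R e)) = (\<lambda>h. h *\<^sub>R ?f' (y + t *\<^sub>R e))"
        using linear_scale[OF has_derivative_linear[OF test_functions_has_derivative[OF w]]] by auto
      ultimately show ?thesis by (simp add: has_vector_derivative_def)
    qed
    have c: "continuous_on UNIV (\<lambda>t. ?f' (y + t *\<^sub>R e))"
      by (rule continuous_on_compose2[OF cf']) (auto intro!: continuous_intros)
    have "ennreal ((cmod (?W y - w y))\<^sup>2) \<le> ennreal (s y) * (\<integral>\<^sup>+t. ennreal ((cmod (?f' (y + t *\<^sub>R e)))\<^sup>2) * indicator {0..s y} t \<partial>lborel)"
      using norm_increment_square_le[OF s(2)[OF True] d c] by simp
    also have "\<dots> \<le> ennreal r * (\<integral>\<^sup>+t. f (y + t *\<^sub>R e) * indicator {0..r} t \<partial>lborel)"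
    proof (rule mult_mono)
      show "ennreal (s y) \<le> ennreal r" using s(3)[OF True] by (rule ennreal_leI)
      \<comment> \<open>The segment condition leaves out the endpoint t = s y, which may lie outside
        D; a single time is a null set.\<close>
      have "AE t in lborel. t \<noteq> s y" by (rule AE_lborel_singleton)
      then show "(\<integral>\<^sup>+t. ennreal ((cmod (?f' (y + t *\<^sub>R e)))\<^sup>2) * indicator {0..s y} t \<partial>lborel)
          \<le> (\<integral>\<^sup>+t. f (y + t *\<^sub>R e) * indicator {0..r} t \<partial>lborel)"
      proof (intro nn_integral_mono_AE, eventually_elim)
        fix t assume "t \<noteq> s y"
        then show "ennreal ((cmod (?f' (y + t *\<^sub>R e)))\<^sup>2) * indicator {0..s y} t \<le> f (y + t *\<^sub>R e) * indicator {0..r} t"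
          using seg[OF True, of t] s(3)[OF True] by (auto simp: f_def indicator_def)
      qed
    qed auto
    finally show ?thesis using True by simp
  qed simp
  have "(\<integral>\<^sup>+y. ennreal ((cmod (?W y - w y))\<^sup>2) * indicator E y \<partial>lborel)
      \<le> (\<integral>\<^sup>+y. ennreal r * (\<integral>\<^sup>+t. f (y + t *\<^sub>R e) * indicator {0..r} t \<partial>lborel) \<partial>lborel)"
    by (rule nn_integral_mono) (rule step)
  also have "\<dots> = ennreal r * (\<integral>\<^sup>+y. (\<integral>\<^sup>+t. f (y + t *\<^sub>R e) * indicator {0..r} t \<partial>lborel) \<partial>lborel)"
    by (rule nn_integral_cmult) measurable
  also have "(\<integral>\<^sup>+y. (\<integral>\<^sup>+t. f (y + t *\<^sub>R e) * indicator {0..r} t \<partial>lborel) \<partial>lborel) =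
      (\<integral>\<^sup>+t. (\<integral>\<^sup>+y. f (y + t *\<^sub>R e) * indicator {0..r} t \<partial>lborel) \<partial>lborel)"
    by (rule lborel_pair.Fubini') measurable
  also have "\<dots> = (\<integral>\<^sup>+t. (\<integral>\<^sup>+z. f z \<partial>lborel) * indicator {0..r} t \<partial>lborel)"
    by (rule nn_integral_cong) (simp add: nn_integral_multc nn_integral_lborel_shift)
  also have "\<dots> = (\<integral>\<^sup>+z. f z \<partial>lborel) * ennreal r"
    using r by (simp add: nn_integral_cmult_indicator)
  finally have 1: "(\<integral>\<^sup>+y. ennreal ((cmod (?W y - w y))\<^sup>2) * indicator E y \<partial>lborel)
      \<le> ennreal r * ((\<integral>\<^sup>+z. f z \<partial>lborel) * ennreal r)" .
  have f'L: "?f' \<in> L2 (leb D)" by (rule test_functions_L2(1)[OF f'T El(2)])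
  have f'le: "norm2 D ?f' \<le> real CARD('n) * H1k_norm 1 D w"
  proof -
    have "norm2 D ?f' \<le> real CARD('n) * norm2 D (cgrad w)"
      by (rule L2_bound(2)[OF is_weak_gradD(1)[OF wD(2)] L2_D(1)[OF f'L]])
        (use directional_derivative_le_cgrad[OF test_functions_differentiable[OF w] e] in auto)
    also have "norm2 D (cgrad w) = norm2 D (wgrad D w)"
      using H1_weak_grad(2)[OF D wD(1,2)] by simp
    also have "real CARD('n) * \<dots> \<le> real CARD('n) * H1k_norm 1 D w"
      by (intro mult_left_mono H1k_norm_bounds) auto
    finally show ?thesis .
  qed
  have "(\<integral>\<^sup>+z. f z \<partial>lborel) = ennreal ((norm2 D ?f')\<^sup>2)"
    unfolding f_def by (rule L2_norm_nn_integral[OF f'b Es(2) f'L, symmetric])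
  then have "ennreal r * ((\<integral>\<^sup>+z. f z \<partial>lborel) * ennreal r) = ennreal ((r * norm2 D ?f')\<^sup>2)"
    using r by (simp add: ennreal_mult[symmetric] power_mult_distrib power2_eq_square mult_ac)
  with 1 have 2: "(\<integral>\<^sup>+y. ennreal ((cmod (?W y - w y))\<^sup>2) * indicator E y \<partial>lborel) \<le> ennreal ((r * norm2 D ?f')\<^sup>2)"
    by simp
  have WwL: "(\<lambda>y. ?W y - w y) \<in> L2 (leb E)" by (rule L2_diff[OF WL wE])
  have "(\<lambda>y. ?W y - w y) \<in> borel_measurable borel"
    using borel_measurable_continuous_onI[OF cW] wb by (rule borel_measurable_diff)
  from L2_norm_nn_integral[OF this Es(1) WwL] 2
  have "ennreal ((norm2 E (\<lambda>y. ?W y - w y))\<^sup>2) \<le> ennreal ((r * norm2 D ?f')\<^sup>2)" by simp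
  then have "(norm2 E (\<lambda>y. ?W y - w y))\<^sup>2 \<le> (r * norm2 D ?f')\<^sup>2" by simp
  then have 3: "norm2 E (\<lambda>y. ?W y - w y) \<le> r * norm2 D ?f'"
    by (rule power2_le_imp_le) (use r in simp)
  have "ennreal ((norm2 E w)\<^sup>2) \<le> ennreal ((norm2 D w)\<^sup>2)"
    unfolding L2_norm_nn_integral[OF wb Es(1) wE] L2_norm_nn_integral[OF wb Es(2) wD(1)]
    using E(3) by (intro nn_integral_mono) (auto simp: indicator_def)
  then have "(norm2 E w)\<^sup>2 \<le> (norm2 D w)\<^sup>2" by simp
  then have 4: "norm2 E w \<le> norm2 D w" by (rule power2_le_imp_le) simp
  have 5: "norm2 D w \<le> H1k_norm 1 D w" using H1k_norm_bounds(2)[of 1 D w] by simp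
  have "norm2 E ?W \<le> norm2 E (\<lambda>y. ?W y - w y) + norm2 E w"
    using L2_norm_triangle[OF WwL wE] by simp
  also have "\<dots> \<le> r * (real CARD('n) * H1k_norm 1 D w) + H1k_norm 1 D w"
    using 3 4 5 mult_left_mono[OF f'le, of r] r by linarith
  finally show "norm2 E ?W \<le> (r * real CARD('n) + 1) * H1k_norm 1 D w"
    by (simp add: distrib_right mult.assoc)
qed

text \<open>By the estimate above, a subsequence of the boundary values tends to zero for almost
  every point from which they are reached. A boundary point where this fails is reached from a whole
  segment of exceptional points, so \<open>hausdorff_outer_graph_null\<close> applies to the set of
  such boundary points.\<close>

lemma trace_vanish_local:
  fixes Dt D :: "(real ^ 'n::finite) set"
  assumes d: "2 \<le> CARD('n)" and Dt: "lipschitz_open Dt" and x0: "x0 \<in> frontier Dt" and D: "open D"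
    and R0: "0 < R0" "D \<inter> ball x0 R0 = Dt \<inter> ball x0 R0"
  shows "\<exists>\<rho>>0. \<forall>w. (\<forall>j. w j \<in> test_functions UNIV) \<longrightarrow> (\<lambda>j. H1k_norm 1 D (w j)) \<longlonglongrightarrow> 0 \<longrightarrow>
    (\<exists>q. strict_mono (q::nat\<Rightarrow>nat) \<and>
      hausdorff_outer (real CARD('n) - 1) {x \<in> frontier Dt \<inter> ball x0 \<rho>. \<not> (\<lambda>j. w (q j) x) \<longlonglongrightarrow> 0} = 0)"
proof -
  obtain e r0 L and g :: "real ^ 'n \<Rightarrow> real" where e: "norm e = 1" and r0: "0 < r0" and L: "0 \<le> L"
    and g: "\<And>y z. \<bar>g (orth_part e y) - g (orth_part e z)\<bar> \<le> L * norm (orth_part e (y - z))"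
    and inDt: "\<And>y. y \<in> ball x0 r0 \<Longrightarrow> y \<in> Dt \<longleftrightarrow> y \<bullet> e < g (orth_part e y)"
    and fr: "\<And>z. z \<in> frontier Dt \<Longrightarrow> z \<in> ball x0 r0 \<Longrightarrow> z \<bullet> e = g (orth_part e z)"
    by (rule lipschitz_chart[OF Dt x0]) blast
  define r where "r = min r0 R0"
  have r: "0 < r" using r0 R0 by (simp add: r_def)
  \<comment> \<open>From a point of the ball of radius \<rho> the graph is at most (L + 1) \<rho>
    away along e: L \<rho> for its variation and \<rho> for the position of the point. The segments
    therefore stay within (L + 2) \<rho>, inside the chart.\<close>
  define \<rho> where "\<rho> = r / (L + 3)"
  have \<rho>: "0 < \<rho>" "(L + 3) * \<rho> = r" using r L by (auto simp: \<rho>_def)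
  have Lp: "0 \<le> L * \<rho>" using L \<rho>(1) by simp
  have \<rho>r: "\<rho> < r" using \<rho> Lp unfolding distrib_right by linarith
  define s where "s y = g (orth_part e y) - y \<bullet> e" for y
  define E where "E = Dt \<inter> ball x0 \<rho>"
  have oDt: "open Dt" using Dt by (simp add: lipschitz_open_def)
  have E: "open E" "bounded E" using oDt by (auto simp: E_def intro: bounded_subset[OF bounded_ball])
  have inD: "y \<in> D \<longleftrightarrow> y \<bullet> e < g (orth_part e y)" if "y \<in> ball x0 r" for y
  proof -
    have "y \<in> D \<inter> ball x0 R0 \<longleftrightarrow> y \<in> Dt \<inter> ball x0 R0" by (simp only: R0(2))
    then show ?thesis using inDt[of y] that by (simp add: r_def)
  qed
  have ED: "E \<subseteq> D"
  proof
    fix y assume "y \<in> E"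
    then have "y \<in> Dt \<inter> ball x0 R0" using \<rho>r by (simp add: E_def r_def)
    then have "y \<in> D \<inter> ball x0 R0" by (simp only: R0(2))
    then show "y \<in> D" by simp
  qed
  have gle: "\<bar>g (orth_part e y) - g (orth_part e z)\<bar> \<le> L * norm (y - z)" for y z
    using g[of y z] mult_left_mono[OF orth_part_norm[OF e, of "y - z"] L] by linarith
  have cg: "continuous_on UNIV (\<lambda>y. g (orth_part e y))"
    by (rule lipschitz_on_continuous_on[of L]) (use gle L in \<open>auto simp: lipschitz_on_def dist_norm\<close>)
  have cs: "continuous_on UNIV s" unfolding s_def by (intro continuous_intros cg)
  have sE: "0 \<le> s y" "s y \<le> (L + 1) * \<rho>" if y: "y \<in> E" for y
  proof -
    have yb: "y \<in> ball x0 r" "norm (y - x0) < \<rho>" using y \<rho>r by (auto simp: E_def dist_norm norm_minus_commute)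
    have "y \<in> D" using ED y by blast
    then show "0 \<le> s y" using inD[OF yb(1)] by (simp add: s_def)
    have "g (orth_part e y) \<le> g (orth_part e x0) + L * norm (y - x0)" using gle[of y x0] by linarith
    moreover have "L * norm (y - x0) \<le> L * \<rho>" using yb(2) L by (intro mult_left_mono) auto
    moreover have "g (orth_part e x0) = x0 \<bullet> e" using fr[OF x0] r0 by simp
    moreover have "(x0 - y) \<bullet> e \<le> \<rho>" using Cauchy_Schwarz_ineq2[of "x0 - y" e] e yb(2) by (simp add: norm_minus_commute)
    ultimately show "s y \<le> (L + 1) * \<rho>" by (simp add: s_def inner_diff_left distrib_right)
  qed
  have srE: "s y \<le> r" if "y \<in> E" for y
  proof -
    have "(L + 1) * \<rho> \<le> (L + 3) * \<rho>" using \<rho>(1) by (intro mult_right_mono) auto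
    then show ?thesis using sE(2)[OF that] \<rho>(2) by linarith
  qed
  have seg: "y + t *\<^sub>R e \<in> D" if y: "y \<in> E" and t: "0 \<le> t" "t < s y" for y t
  proof -
    have "dist x0 (y + t *\<^sub>R e) \<le> dist x0 y + norm (t *\<^sub>R e)"
      using norm_triangle_ineq4[of "x0 - y" "t *\<^sub>R e"] by (simp add: dist_norm algebra_simps)
    also have "\<dots> < \<rho> + (L + 1) * \<rho>" using y t sE(2)[OF y] e by (simp add: E_def)
    also have "\<dots> \<le> r" using \<rho> by (simp add: distrib_right flip: \<rho>(2))
    finally have "y + t *\<^sub>R e \<in> ball x0 r" by simp
    from inD[OF this] show ?thesis
      using t(2) e by (simp add: s_def orth_part_e[OF e] inner_add_left dot_square_norm)
  qed
  show ?thesis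
  proof (intro exI[of _ "\<rho> / 2"] conjI allI impI)
    show "0 < \<rho> / 2" using \<rho> by simp
    fix w :: "nat \<Rightarrow> real ^ 'n \<Rightarrow> complex"
    assume w: "\<forall>j. w j \<in> test_functions UNIV" and lim: "(\<lambda>j. H1k_norm 1 D (w j)) \<longlonglongrightarrow> 0"
    let ?W = "\<lambda>j y. w j (y + s y *\<^sub>R e)"
    note est = graph_boundary_estimate[OF _ D E ED e r cs sE(1) srE seg]
    have WL: "?W j \<in> L2 (leb E)" for j
      by (rule est(1)) (use w in auto)
    have Wle: "norm2 E (?W j) \<le> (r * real CARD('n) + 1) * H1k_norm 1 D (w j)" for j
      by (rule est(2)) (use w in auto)
    have "(\<lambda>j. norm2 E (?W j)) \<longlonglongrightarrow> 0"
    proof (rule tendsto_sandwich[OF _ _ tendsto_const])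
      show "(\<lambda>j. (r * real CARD('n) + 1) * H1k_norm 1 D (w j)) \<longlonglongrightarrow> 0"
        using tendsto_mult_left[OF lim, of "r * real CARD('n) + 1"] by simp
      show "\<forall>\<^sub>F j in sequentially. norm2 E (?W j) \<le> (r * real CARD('n) + 1) * H1k_norm 1 D (w j)"
        using Wle by (intro always_eventually allI)
    qed simp
    from L2_tendsto_AE_subseq[OF WL this]
    obtain q where q: "strict_mono q" "AE y in leb E. (\<lambda>j. ?W (q j) y) \<longlonglongrightarrow> 0" by blast
    define N where "N = {y \<in> E. \<not> (\<lambda>j. ?W (q j) y) \<longlonglongrightarrow> 0}"
    have "AE y in lebesgue. y \<notin> N"
      using q(2) E(1) by (auto simp: AE_restrict_space_iff N_def elim!: eventually_mono)
    then obtain N' where N': "{y \<in> space lebesgue. \<not> y \<notin> N} \<subseteq> N'" "emeasure lebesgue N' = 0" "N' \<in> sets lebesgue"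
      by (rule AE_E)
    then have "negligible N'" by (simp add: negligible_iff_null_sets null_setsI)
    then have N: "negligible N" by (rule negligible_subset) (use N'(1) in auto)
    let ?B = "{x \<in> frontier Dt \<inter> ball x0 (\<rho> / 2). \<not> (\<lambda>j. w (q j) x) \<longlonglongrightarrow> 0}"
    have "hausdorff_outer (real CARD('n) - 1) ?B = 0"
    proof (rule hausdorff_outer_graph_null[OF d e L _ _ _ N])
      have Bb: "x \<in> ball x0 r0" if "x \<in> ?B" for x using that \<rho>r \<rho>(1) by (auto simp: r_def)
      show "\<bar>(x - y) \<bullet> e\<bar> \<le> L * norm (orth_part e (x - y))" if "x \<in> ?B" "y \<in> ?B" for x y
        using g[of x y] fr[OF _ Bb[OF that(1)]] fr[OF _ Bb[OF that(2)]] that by (simp add: inner_diff_left)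
      show "bounded ?B" by (rule bounded_subset[OF bounded_ball[of x0 "\<rho> / 2"]]) auto
      show "0 < \<rho> / 2" using \<rho> by simp
      fix x t assume x: "x \<in> ?B" and t: "0 < t" "t < \<rho> / 2"
      have xe: "x \<bullet> e = g (orth_part e x)" using fr[OF _ Bb[OF x]] x by simp
      define y where "y = x - t *\<^sub>R e"
      have Py: "orth_part e y = orth_part e x" using orth_part_e[OF e, of x "- t"] by (simp add: y_def)
      have ye: "y \<bullet> e = x \<bullet> e - t" using e by (simp add: y_def inner_diff_left dot_square_norm)
      have "dist x0 y \<le> dist x0 x + norm (t *\<^sub>R e)"
        using norm_triangle_ineq[of "x0 - x" "t *\<^sub>R e"] by (simp add: dist_norm y_def algebra_simps)
      also have "\<dots> < \<rho>" using x t e by simp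
      finally have yb: "y \<in> ball x0 \<rho>" by simp
      have "y \<in> Dt" using inDt[of y] yb \<rho>r ye t xe Py by (simp add: r_def)
      then have "y \<in> E" using yb by (simp add: E_def)
      \<comment> \<open>Every point of the segment below x leads to x itself, so the failure at x is
        inherited by all of them.\<close>
      moreover have "y + s y *\<^sub>R e = x" using xe ye Py by (simp add: s_def y_def)
      ultimately show "x - t *\<^sub>R e \<in> N" using x by (simp add: N_def flip: y_def)
    qed
    with q(1) show "\<exists>q. strict_mono q \<and> hausdorff_outer (real CARD('n) - 1) {x \<in> frontier Dt \<inter> ball x0 (\<rho> / 2). \<not> (\<lambda>j. w (q j) x) \<longlonglongrightarrow> 0} = 0"
      by blast
  qed
qed

lemma tendsto_0_measurable:
  fixes f :: "nat \<Rightarrow> 'a \<Rightarrow> complex"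
  assumes [measurable]: "\<And>j. f j \<in> borel_measurable M"
  shows "Measurable.pred M (\<lambda>x. (\<lambda>j. f j x) \<longlonglongrightarrow> 0)"
proof -
  have "(\<lambda>j. f j x) \<longlonglongrightarrow> 0 \<longleftrightarrow> (\<forall>k. \<exists>N. \<forall>n. n \<ge> N \<longrightarrow> norm (f n x) < inverse (real (Suc k)))" for x
    unfolding LIMSEQ_iff
  proof safe
    fix e :: real assume H: "\<forall>k. \<exists>N. \<forall>n\<ge>N. norm (f n x) < inverse (real (Suc k))" and e: "0 < e"
    obtain k where "inverse (real (Suc k)) < e" using reals_Archimedean[OF e] by blast
    with H show "\<exists>no. \<forall>n\<ge>no. norm (f n x - 0) < e" by (metis diff_zero order_less_trans)
  next
    fix k assume "\<forall>r>0. \<exists>no. \<forall>n\<ge>no. norm (f n x - 0) < r"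
    then show "\<exists>N. \<forall>n\<ge>N. norm (f n x) < inverse (real (Suc k))" by simp
  qed
  then show ?thesis by simp
qed

section \<open>Traces on the computational domain\<close>

context
  fixes Dm Dt :: "(real ^ 'n::finite) set"
  assumes dim2: "2 \<le> CARD('n)" and geo: "geometry Dm Dt"
begin

lemma open_Dt: "open Dt" and lipschitz_Dt: "lipschitz_open Dt" and closure_Dm: "compact (closure Dm)" "closure Dm \<subseteq> Dt"
  and bounded_Dt: "bounded Dt"
  using geo by (auto simp: geometry_def lipschitz_open_def compactly_contained_def)

lemma open_dom: "open (dom_D Dm Dt)"
  unfolding dom_D_def using open_Dt by (intro open_Diff) auto

lemma bounded_dom: "bounded (dom_D Dm Dt)"
  using bounded_Dt by (rule bounded_subset) (auto simp: dom_D_def)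

lemma frontier_Dt_outside: "x \<in> frontier Dt \<Longrightarrow> x \<notin> Dt \<and> x \<notin> closure Dm"
  using open_Dt closure_Dm by (auto simp: frontier_def interior_open)

lemma dom_local:
  assumes "x0 \<in> frontier Dt"
  obtains R where "0 < R" "dom_D Dm Dt \<inter> ball x0 R = Dt \<inter> ball x0 R"
proof -
  have "x0 \<in> - closure Dm" using frontier_Dt_outside[OF assms] by blast
  then obtain R where R: "0 < R" "ball x0 R \<subseteq> - closure Dm" by (rule openE[rotated]) auto
  then have "dom_D Dm Dt \<inter> ball x0 R = Dt \<inter> ball x0 R" by (auto simp: dom_D_def)
  with R(1) show thesis by (rule that)
qed

lemma frontier_subset: "frontier Dt \<subseteq> frontier (dom_D Dm Dt)"
proof
  fix x assume x: "x \<in> frontier Dt"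
  obtain R where R: "0 < R" "dom_D Dm Dt \<inter> ball x R = Dt \<inter> ball x R" by (rule dom_local[OF x])
  have "x \<in> closure (dom_D Dm Dt)"
    unfolding closure_approachable
  proof (intro allI impI)
    fix e :: real assume e: "0 < e"
    have "x \<in> closure Dt" using x by (simp add: frontier_def)
    then obtain y where y: "y \<in> Dt" "dist y x < min e R" using e R(1) closure_approachable[of x Dt] by (meson min_less_iff_conj)
    then have "y \<in> dom_D Dm Dt \<inter> ball x R" unfolding R(2) by (simp add: dist_commute)
    then show "\<exists>y\<in>dom_D Dm Dt. dist y x < e" using y(2) by auto
  qed
  moreover have "x \<notin> dom_D Dm Dt" using frontier_Dt_outside[OF x] by (simp add: dom_D_def)
  ultimately show "x \<in> frontier (dom_D Dm Dt)" using open_dom by (simp add: frontier_def interior_open)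
qed

lemma finite_surface_Dt: "finite_surface (frontier Dt)"
  by (rule finite_surface_frontier[OF dim2 lipschitz_Dt bounded_Dt])

lemma finite_surface_dom: "finite_surface (frontier (dom_D Dm Dt))"
proof (rule finite_surface_subset)
  have "finite_surface (frontier Dm)"
    using geo by (intro finite_surface_frontier[OF dim2]) (auto simp: geometry_def)
  then show "finite_surface (frontier Dt \<union> frontier Dm)" using finite_surface_Dt by (rule finite_surface_Un[rotated])
  have "frontier (dom_D Dm Dt) = frontier (Dt \<inter> - closure Dm)" by (simp add: dom_D_def Diff_eq)
  also have "\<dots> \<subseteq> frontier Dt \<union> frontier (- closure Dm)" by (rule frontier_Int_subset)
  also have "frontier (- closure Dm) \<subseteq> frontier Dm"
    unfolding frontier_complement using interior_mono[OF closure_subset[of Dm]] by (auto simp: frontier_def)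
  finally show "frontier (dom_D Dm Dt) \<subseteq> frontier Dt \<union> frontier Dm" by blast
qed simp

text \<open>One sequence has two limits: it tends to \<delta> in L2 of the surface, hence almost
  everywhere along a subsequence, and a further subsequence tends to 0 off a Hausdorff null set. The
  neighbourhoods where this works are local, and compactness leaves finitely many.\<close>

lemma trace_zero_imp:
  assumes tr: "trace_on (dom_D Dm Dt) (frontier (dom_D Dm Dt)) (\<lambda>x. 0) \<delta>"
  shows "AE x in surface (frontier Dt). \<delta> x = 0"
proof -
  let ?D = "dom_D Dm Dt" and ?\<Gamma> = "frontier Dt"
  let ?H = "hausdorff_measure (real CARD('n) - 1) :: (real ^ 'n) measure"
  obtain w where w: "\<And>j. w j \<in> test_functions UNIV" "(\<lambda>j. H1k_norm 1 ?D (\<lambda>x. w j x - 0)) \<longlonglongrightarrow> 0"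
      "(\<lambda>j. L2_norm (surface (frontier ?D)) (\<lambda>x. w j x - \<delta> x)) \<longlonglongrightarrow> 0"
    using trace_onD(3)[OF tr] by blast
  have dL: "(\<lambda>x. w j x - \<delta> x) \<in> L2 (surface (frontier ?D))" for j
    by (intro L2_diff test_functions_L2_surface[OF w(1) finite_surface_dom] trace_onD(2)[OF tr])
  note sub = surface_subset[OF frontier_closed frontier_closed frontier_subset dL]
  have "(\<lambda>j. L2_norm (surface ?\<Gamma>) (\<lambda>x. w j x - \<delta> x)) \<longlonglongrightarrow> 0"
    by (rule tendsto_sandwich[OF _ _ tendsto_const w(3)]) (use sub(2) in \<open>auto intro!: always_eventually\<close>)
  then obtain q where q: "strict_mono q" "AE x in surface ?\<Gamma>. (\<lambda>j. w (q j) x - \<delta> x) \<longlonglongrightarrow> 0"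
    by (rule L2_tendsto_AE_subseq[OF sub(1)])
  have "\<exists>\<rho>>0. AE x in surface ?\<Gamma>. x \<in> ball x0 \<rho> \<longrightarrow> \<delta> x = 0" if x0: "x0 \<in> ?\<Gamma>" for x0
  proof -
    obtain R where R: "0 < R" "?D \<inter> ball x0 R = Dt \<inter> ball x0 R" by (rule dom_local[OF x0])
    obtain \<rho> where \<rho>: "0 < \<rho>" "\<And>w. (\<forall>j. w j \<in> test_functions UNIV) \<Longrightarrow> (\<lambda>j. H1k_norm 1 ?D (w j)) \<longlonglongrightarrow> 0 \<Longrightarrow>
      (\<exists>q. strict_mono (q::nat\<Rightarrow>nat) \<and>
        hausdorff_outer (real CARD('n) - 1) {x \<in> ?\<Gamma> \<inter> ball x0 \<rho>. \<not> (\<lambda>j. w (q j) x) \<longlonglongrightarrow> 0} = 0)"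
      using trace_vanish_local[OF dim2 lipschitz_Dt x0 open_dom R] by blast
    have "(\<lambda>j. H1k_norm 1 ?D (w (q j))) \<longlonglongrightarrow> 0"
      using LIMSEQ_subseq_LIMSEQ[OF w(2) q(1)] by (simp add: o_def)
    then obtain q' :: "nat \<Rightarrow> nat" where q': "strict_mono q'"
        "hausdorff_outer (real CARD('n) - 1) {x \<in> ?\<Gamma> \<inter> ball x0 \<rho>. \<not> (\<lambda>j. w (q (q' j)) x) \<longlonglongrightarrow> 0} = 0"
      using \<rho>(2)[of "\<lambda>j. w (q j)"] w(1) by blast
    let ?B = "{x \<in> ?\<Gamma> \<inter> ball x0 \<rho>. \<not> (\<lambda>j. w (q (q' j)) x) \<longlonglongrightarrow> 0}"
    have "w j \<in> borel_measurable borel" for j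
      by (intro borel_measurable_continuous_onI test_functions_continuous[OF w(1)])
    then have [measurable]: "Measurable.pred borel (\<lambda>x. (\<lambda>j. w (q (q' j)) x) \<longlonglongrightarrow> 0)"
      by (intro tendsto_0_measurable) simp
    have [measurable]: "?\<Gamma> \<inter> ball x0 \<rho> \<in> sets borel" by (intro sets.Int borel_closed borel_open) auto
    have "{x \<in> space borel. x \<in> ?\<Gamma> \<inter> ball x0 \<rho> \<and> \<not> (\<lambda>j. w (q (q' j)) x) \<longlonglongrightarrow> 0} \<in> sets borel"
      by measurable
    then have Bs: "?B \<in> sets ?H" by simp
    moreover have "emeasure ?H ?B = 0"
      using emeasure_hausdorff_le[of "real CARD('n) - 1" ?B] q'(2) by simp
    ultimately have "AE x in ?H. x \<notin> ?B" by (intro AE_not_in null_setsI)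
    then have "AE x in surface ?\<Gamma>. x \<notin> ?B"
      unfolding surface_def by (subst AE_restrict_space_iff) (auto simp: borel_closed)
    moreover have "AE x in surface ?\<Gamma>. x \<in> ?\<Gamma>" by (rule AE_I2) simp
    ultimately have "AE x in surface ?\<Gamma>. x \<in> ball x0 \<rho> \<longrightarrow> \<delta> x = 0" using q(2)
    proof eventually_elim
      case (elim x)
      show ?case
      proof
        assume xb: "x \<in> ball x0 \<rho>"
        have "(\<lambda>j. w (q (q' j)) x) \<longlonglongrightarrow> 0" using elim(1,2) xb by blast
        moreover have "(\<lambda>j. w (q (q' j)) x) \<longlonglongrightarrow> \<delta> x"
          using LIMSEQ_subseq_LIMSEQ[OF LIM_zero_cancel[OF elim(3)] q'(1)] by (simp add: o_def)
        ultimately show "\<delta> x = 0" by (rule LIMSEQ_unique[rotated])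
      qed
    qed
    with \<rho>(1) show ?thesis by blast
  qed
  then have "\<forall>x0\<in>?\<Gamma>. \<exists>\<rho>. 0 < \<rho> \<and> (AE x in surface ?\<Gamma>. x \<in> ball x0 \<rho> \<longrightarrow> \<delta> x = 0)" by blast
  then obtain \<rho> where "\<forall>x0\<in>?\<Gamma>. 0 < \<rho> x0 \<and> (AE x in surface ?\<Gamma>. x \<in> ball x0 (\<rho> x0) \<longrightarrow> \<delta> x = 0)"
    by (rule bchoice[THEN exE])
  then have \<rho>: "\<And>x. x \<in> ?\<Gamma> \<Longrightarrow> 0 < \<rho> x" "\<And>x0. x0 \<in> ?\<Gamma> \<Longrightarrow> AE x in surface ?\<Gamma>. x \<in> ball x0 (\<rho> x0) \<longrightarrow> \<delta> x = 0"
    by blast+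
  have comp: "compact ?\<Gamma>" using bounded_Dt by (rule compact_frontier_bounded)
  have "?\<Gamma> \<subseteq> (\<Union>x\<in>?\<Gamma>. ball x (\<rho> x))" using \<rho>(1) by force
  then obtain C where C: "C \<subseteq> ?\<Gamma>" "finite C" "?\<Gamma> \<subseteq> (\<Union>x\<in>C. ball x (\<rho> x))"
    by (rule compactE_image[OF comp, rotated]) auto
  have "AE x in surface ?\<Gamma>. \<forall>c\<in>C. x \<in> ball c (\<rho> c) \<longrightarrow> \<delta> x = 0"
    by (rule AE_finite_allI[OF C(2)]) (use \<rho>(2) C(1) in blast)
  then show ?thesis
    by (rule AE_mp) (rule AE_I2, use C(3) in auto)
qed

lemma trace_unique:
  assumes "trace_on (dom_D Dm Dt) (frontier (dom_D Dm Dt)) v \<phi>" "trace_on (dom_D Dm Dt) (frontier (dom_D Dm Dt)) v \<phi>'"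
  shows "AE x in surface (frontier Dt). \<phi> x = \<phi>' x"
proof -
  have "trace_on (dom_D Dm Dt) (frontier (dom_D Dm Dt)) (\<lambda>x. 0) (\<lambda>x. \<phi> x - \<phi>' x)"
    using trace_on_add[OF open_dom finite_surface_dom assms(1) trace_on_cmult[OF open_dom assms(2), of "-1"]] by simp
  from trace_zero_imp[OF this] show ?thesis by eventually_elim simp
qed

lemma H10D_D:
  assumes "v \<in> H10D Dm Dt"
  shows "v \<in> H1 (dom_D Dm Dt)" "trace_on (dom_D Dm Dt) (frontier (dom_D Dm Dt)) v (dtrace (dom_D Dm Dt) v)"
proof -
  show "v \<in> H1 (dom_D Dm Dt)" using assms by (simp add: H10D_def)
  obtain \<phi> where "trace_on (dom_D Dm Dt) (frontier (dom_D Dm Dt)) v \<phi>" using assms by (auto simp: H10D_def)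
  then show "trace_on (dom_D Dm Dt) (frontier (dom_D Dm Dt)) v (dtrace (dom_D Dm Dt) v)"
    unfolding dtrace_def by (rule someI[of "\<lambda>\<phi>. trace_on (dom_D Dm Dt) (frontier (dom_D Dm Dt)) v \<phi>"])
qed

text \<open>\<open>dtrace\<close> is a choice; uniqueness of the trace makes it linear almost
  everywhere on \<open>frontier Dt\<close>, the part of the boundary on which the boundary operator
  acts.\<close>

lemma H10D_sum:
  assumes v: "\<And>j. j \<in> I \<Longrightarrow> v j \<in> H10D Dm Dt" and I: "finite I"
  shows "(\<lambda>x. \<Sum>j\<in>I. c j * v j x) \<in> H10D Dm Dt"
    and "AE x in surface (frontier Dt). dtrace (dom_D Dm Dt) (\<lambda>x. \<Sum>j\<in>I. c j * v j x) x = (\<Sum>j\<in>I. c j * dtrace (dom_D Dm Dt) (v j) x)"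
proof -
  have "\<exists>\<phi>. trace_on (dom_D Dm Dt) (frontier (dom_D Dm Dt)) (v j) \<phi> \<and> (AE x in surface (frontier Dm). \<phi> x = 0)" if "j \<in> I" for j
    using v[OF that] by (auto simp: H10D_def)
  then obtain \<phi> where \<phi>: "\<And>j. j \<in> I \<Longrightarrow> trace_on (dom_D Dm Dt) (frontier (dom_D Dm Dt)) (v j) (\<phi> j)"
    "\<And>j. j \<in> I \<Longrightarrow> AE x in surface (frontier Dm). \<phi> j x = 0" by metis
  have "AE x in surface (frontier Dm). \<forall>j\<in>I. \<phi> j x = 0" by (rule AE_finite_allI[OF I \<phi>(2)])
  then have "AE x in surface (frontier Dm). (\<Sum>j\<in>I. c j * \<phi> j x) = 0" by eventually_elim simp
  moreover have "trace_on (dom_D Dm Dt) (frontier (dom_D Dm Dt)) (\<lambda>x. \<Sum>j\<in>I. c j * v j x) (\<lambda>x. \<Sum>j\<in>I. c j * \<phi> j x)"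
    by (rule trace_on_sum[OF open_dom finite_surface_dom \<phi>(1)])
  ultimately show S: "(\<lambda>x. \<Sum>j\<in>I. c j * v j x) \<in> H10D Dm Dt"
    unfolding H10D_def using trace_onD(1) by blast
  show "AE x in surface (frontier Dt). dtrace (dom_D Dm Dt) (\<lambda>x. \<Sum>j\<in>I. c j * v j x) x = (\<Sum>j\<in>I. c j * dtrace (dom_D Dm Dt) (v j) x)"
    by (rule trace_unique[OF H10D_D(2)[OF S]], rule trace_on_sum[OF open_dom finite_surface_dom], rule H10D_D(2)[OF v])
qed

lemma H10D_cnj:
  assumes v: "v \<in> H10D Dm Dt"
  shows "(\<lambda>x. cnj (v x)) \<in> H10D Dm Dt"
    and "AE x in surface (frontier Dt). dtrace (dom_D Dm Dt) (\<lambda>x. cnj (v x)) x = cnj (dtrace (dom_D Dm Dt) v x)"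
proof -
  obtain \<phi> where \<phi>: "trace_on (dom_D Dm Dt) (frontier (dom_D Dm Dt)) v \<phi>" "AE x in surface (frontier Dm). \<phi> x = 0"
    using v by (auto simp: H10D_def)
  have "AE x in surface (frontier Dm). cnj (\<phi> x) = 0" using \<phi>(2) by eventually_elim simp
  with trace_on_cnj[OF open_dom \<phi>(1)] show S: "(\<lambda>x. cnj (v x)) \<in> H10D Dm Dt"
    unfolding H10D_def using trace_onD(1) by blast
  show "AE x in surface (frontier Dt). dtrace (dom_D Dm Dt) (\<lambda>x. cnj (v x)) x = cnj (dtrace (dom_D Dm Dt) v x)"
    by (rule trace_unique[OF H10D_D(2)[OF S] trace_on_cnj[OF open_dom H10D_D(2)[OF v]]])
qed

text \<open>\<open>H_half\<close> consists of traces from all of \<open>Dt\<close>, obstacle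
  included. A cutoff that is 1 near \<open>frontier Dt\<close> and vanishes near the obstacle
  extends v by zero across it without changing the outer trace.\<close>

lemma trace_H_half:
  assumes "trace_on (dom_D Dm Dt) (frontier (dom_D Dm Dt)) v \<phi>"
  shows "\<phi> \<in> H_half Dt"
proof -
  have comp: "compact (frontier Dt)" using bounded_Dt by (rule compact_frontier_bounded)
  have "open (- closure Dm)" by auto
  moreover have "frontier Dt \<subseteq> - closure Dm" using frontier_Dt_outside by blast
  ultimately obtain \<eta> :: "real ^ 'n \<Rightarrow> real" and W where \<eta>: "\<eta> \<in> test_functions (- closure Dm)" "open W" "frontier Dt \<subseteq> W" "\<And>x. x \<in> W \<Longrightarrow> \<eta> x = 1"
    by (rule smooth_cutoff[OF comp]) blast
  have "trace_on Dt (frontier Dt) (\<lambda>x. cpx (\<eta> x) * v x) (\<lambda>x. cpx (\<eta> x) * \<phi> x)"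
  proof (rule trace_on_cutoff[OF test_functions_mono[OF \<eta>(1) subset_UNIV] open_dom open_Dt _ _ finite_surface_dom frontier_closed frontier_subset assms])
    show "dom_D Dm Dt \<subseteq> Dt" by (auto simp: dom_D_def)
    show "closure {x. \<eta> x \<noteq> 0} \<inter> Dt \<subseteq> dom_D Dm Dt"
      using test_functions_D(3)[OF \<eta>(1)] by (auto simp: dom_D_def)
  qed
  then have "trace_on Dt (frontier Dt) (\<lambda>x. cpx (\<eta> x) * v x) \<phi>"
    by (rule trace_on_cong[THEN iffD1, rotated -1]) (use \<eta>(3,4) in auto)
  then show ?thesis by (auto simp: H_half_def)
qed

lemma H_half_L2: "\<phi> \<in> H_half Dt \<Longrightarrow> \<phi> \<in> L2 (surface (frontier Dt))"
  unfolding H_half_def using trace_onD(2) by blast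

end

section \<open>Radiating solutions\<close>

definition smooth_step_deriv :: "real \<Rightarrow> real" where
  "smooth_step_deriv t = (flat_exp 2 t * flat_exp 0 (1 - t) + flat_exp 0 t * flat_exp 2 (1 - t)) / (flat_exp 0 t + flat_exp 0 (1 - t))\<^sup>2"

lemma smooth_step_has_deriv: "(smooth_step has_real_derivative smooth_step_deriv t) (at t)"
proof -
  have f: "(flat_exp 0 has_real_derivative flat_exp 2 t) (at t)" for t
    using flat_exp_deriv[of 0 t] by (simp add: numeral_2_eq_2)
  have g: "((\<lambda>t. flat_exp 0 (1 - t)) has_real_derivative - flat_exp 2 (1 - t)) (at t)"
  proof -
    have "((\<lambda>t::real. 1 - t) has_real_derivative - 1) (at t)" by (auto intro!: derivative_eq_intros)
    from DERIV_chain2[OF f this] show ?thesis by simp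
  qed
  have nz: "flat_exp 0 t + flat_exp 0 (1 - t) \<noteq> 0" using smooth_step_denominator[of t] by simp
  from DERIV_divide[OF f DERIV_add[OF f g] nz]
  have "((\<lambda>t. flat_exp 0 t / (flat_exp 0 t + flat_exp 0 (1 - t))) has_real_derivative smooth_step_deriv t) (at t)"
    by (simp add: smooth_step_deriv_def algebra_simps power2_eq_square)
  then show ?thesis by (simp add: smooth_step_def[abs_def] divide_inverse)
qed

lemma smooth_step_deriv_nonneg: "0 \<le> smooth_step_deriv t"
  unfolding smooth_step_deriv_def by (intro divide_nonneg_nonneg add_nonneg_nonneg mult_nonneg_nonneg flat_exp_0_nonneg) simp

lemma smooth_step_deriv_eq_0: "t \<le> 0 \<or> 1 \<le> t \<Longrightarrow> smooth_step_deriv t = 0"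
  by (auto simp: smooth_step_deriv_def flat_exp_0_eq)

lemma continuous_flat_exp: "continuous_on S (flat_exp n)"
  by (intro continuous_at_imp_continuous_on ballI DERIV_isCont[OF flat_exp_deriv])

lemma continuous_smooth_step_deriv: "continuous_on S smooth_step_deriv"
proof -
  have g: "continuous_on S (\<lambda>t. flat_exp n (1 - t))" for n
    by (rule continuous_on_compose2[OF continuous_flat_exp[of UNIV]]) (auto intro!: continuous_intros)
  have "flat_exp 0 t + flat_exp 0 (1 - t) \<noteq> 0" for t using smooth_step_denominator[of t] by simp
  then show ?thesis
    unfolding smooth_step_deriv_def by (intro continuous_intros continuous_flat_exp g) auto
qed

lemma smooth_step_deriv_bounded: obtains C where "0 < C" "\<And>t. smooth_step_deriv t \<le> C"
proof -
  have "compact (smooth_step_deriv ` {0..1})"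
    by (intro compact_continuous_image continuous_smooth_step_deriv) auto
  then obtain C where C: "0 < C" "\<forall>y\<in>smooth_step_deriv ` {0..1}. norm y \<le> C"
    using compact_imp_bounded bounded_pos by blast
  have "smooth_step_deriv t \<le> C" for t
  proof (cases "t \<in> {0..1}")
    case True
    then have "norm (smooth_step_deriv t) \<le> C" using C(2) by blast
    then show ?thesis by simp
  next
    case False
    then show ?thesis using smooth_step_deriv_eq_0[of t] C(1) by auto
  qed
  with C(1) show thesis by (rule that)
qed

text \<open>Chosen so that the gradient of \<open>ball_step 0 R\<close> at x is
  \<open>- shell R x\<close> times x. The weight is nonnegative and lives between the spheres of
  radii R and 2 R.\<close>

definition shell :: "real \<Rightarrow> 'a::real_inner \<Rightarrow> real" where
  "shell R x = 2 / (3 * R\<^sup>2) * smooth_step_deriv ((4 * R\<^sup>2 - (norm x)\<^sup>2) / (3 * R\<^sup>2))"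

lemma shell_nonneg: "0 \<le> shell R x"
  unfolding shell_def by (intro mult_nonneg_nonneg smooth_step_deriv_nonneg) simp

lemma ball_step_derivative:
  fixes x :: "'a::real_inner"
  shows "fderiv (ball_step 0 R) x v = - shell R x * (x \<bullet> v)"
proof -
  have "((\<lambda>y. (norm y)\<^sup>2) has_derivative (\<lambda>v. 2 * (x \<bullet> v))) (at x)"
    unfolding power2_norm_eq_inner
    by (rule has_derivative_eq_rhs[OF has_derivative_inner[OF has_derivative_ident has_derivative_ident]])
      (auto simp: fun_eq_iff inner_commute)
  from has_derivative_diff[OF has_derivative_const this]
  have "((\<lambda>y. 4 * R\<^sup>2 - (norm y)\<^sup>2) has_derivative (\<lambda>v. - (2 * (x \<bullet> v)))) (at x)" by simp
  from has_derivative_mult_right[OF this, of "inverse (3 * R\<^sup>2)"]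
  have d: "((\<lambda>y. inverse (3 * R\<^sup>2) * (4 * R\<^sup>2 - (norm y)\<^sup>2)) has_derivative (\<lambda>v. inverse (3 * R\<^sup>2) * - (2 * (x \<bullet> v)))) (at x)" .
  have bs: "ball_step 0 R = (\<lambda>y::'a. smooth_step (inverse (3 * R\<^sup>2) * (4 * R\<^sup>2 - (norm y)\<^sup>2)))"
    by (rule ext) (simp only: ball_step_def diff_zero divide_inverse mult.commute)
  have sh: "shell R x = 2 * inverse (3 * R\<^sup>2) * smooth_step_deriv (inverse (3 * R\<^sup>2) * (4 * R\<^sup>2 - (norm x)\<^sup>2))"
    by (simp only: shell_def divide_inverse mult.commute)
  show ?thesis
    unfolding bs frechet_derivative_eq[OF DERIV_compose_FDERIV[OF smooth_step_has_deriv d]] sh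
    by (simp only: mult_minus_left mult_minus_right mult_ac)
qed

lemma shell_eq_0:
  assumes "0 < R" "norm x \<le> R \<or> 2 * R \<le> norm x"
  shows "shell R x = 0"
proof -
  have "(4 * R\<^sup>2 - (norm x)\<^sup>2) / (3 * R\<^sup>2) \<le> 0 \<or> 1 \<le> (4 * R\<^sup>2 - (norm x)\<^sup>2) / (3 * R\<^sup>2)"
    using assms(2)
  proof
    assume "norm x \<le> R"
    then have "(norm x)\<^sup>2 \<le> R\<^sup>2" by (intro power_mono) auto
    then show ?thesis using assms(1) by (simp add: field_simps)
  next
    assume "2 * R \<le> norm x"
    then have "(2 * R)\<^sup>2 \<le> (norm x)\<^sup>2" using assms(1) by (intro power_mono) auto
    then show ?thesis using assms(1) by (simp add: field_simps)
  qed
  then show ?thesis by (simp add: shell_def smooth_step_deriv_eq_0)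
qed

text \<open>The weight is of order R^-2 and \<open>norm x\<close> is at most 2 R wherever it does
  not vanish.\<close>

lemma shell_bound:
  obtains C where "0 < C" "\<And>R x::'a::real_inner. 0 < R \<Longrightarrow> shell R x * norm x \<le> C / R"
proof -
  obtain C where C: "0 < C" "\<And>t. smooth_step_deriv t \<le> C" by (rule smooth_step_deriv_bounded) blast
  show thesis
  proof (rule that[of "4 / 3 * C"])
    fix R :: real and x :: 'a assume R: "0 < R"
    show "shell R x * norm x \<le> 4 / 3 * C / R"
    proof (cases "norm x \<le> 2 * R")
      case True
      have "shell R x * norm x \<le> (2 / (3 * R\<^sup>2) * C) * (2 * R)"
        unfolding shell_def using True R C by (intro mult_mono mult_left_mono C(2)) auto
      also have "\<dots> = 4 / 3 * C / R" using R by (simp add: power2_eq_square)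
      finally show ?thesis .
    next
      case False
      then have "shell R x = 0" using R by (intro shell_eq_0) auto
      then show ?thesis using R C(1) by simp
    qed
  qed (use C in simp)
qed

lemma continuous_shell: "0 < R \<Longrightarrow> continuous_on UNIV (shell R)"
  unfolding shell_def
  by (intro continuous_on_mult continuous_on_const continuous_on_compose2[OF continuous_smooth_step_deriv[of UNIV]] continuous_intros) auto

lemma ball_step_test:
  fixes R :: real
  assumes "0 < R"
  shows "ball_step (0::real ^ 'n::finite) R \<in> test_functions UNIV"
  by (rule test_functionsI[of _ "cball 0 (2 * R)"]) (use assms in \<open>auto intro!: Ck_on_ball_step ball_step_eq_0\<close>)

lemma ball_step_support:
  fixes R :: real
  assumes "0 < R"
  shows "closure {x. ball_step (0::real ^ 'n::finite) R x \<noteq> 0} \<subseteq> cball 0 (2 * R)"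
proof (rule closure_minimal)
  show "{x. ball_step (0::real ^ 'n) R x \<noteq> 0} \<subseteq> cball 0 (2 * R)"
  proof
    fix x :: "real ^ 'n" assume "x \<in> {x. ball_step 0 R x \<noteq> 0}"
    then have "x \<in> ball 0 (2 * R)" using ball_step_eq_0[OF assms, of x 0] by blast
    then show "x \<in> cball 0 (2 * R)" by simp
  qed
qed simp

lemma integrable_continuous_compact:
  fixes h :: "real ^ 'n::finite \<Rightarrow> 'b::euclidean_space"
  assumes E: "open E" and h: "continuous_on E h" and K: "compact K" "K \<subseteq> E" "\<And>x. x \<in> E \<Longrightarrow> x \<notin> K \<Longrightarrow> h x = 0"
  shows "integrable (leb E) h"
proof -
  have El: "E \<in> sets lebesgue" using E by auto
  have "compact (h ` K)" by (intro compact_continuous_image continuous_on_subset[OF h] K)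
  then obtain B where B: "0 < B" "\<forall>y\<in>h ` K. norm y \<le> B" using compact_imp_bounded bounded_pos by blast
  show ?thesis
  proof (rule integrable_compact_support[OF _ El compact_imp_bounded[OF K(1)], where B=B])
    show "h \<in> borel_measurable (leb E)" by (rule continuous_imp_measurable_on_sets_lebesgue[OF h El])
    show "norm (h x) \<le> B" if "x \<in> E" for x using B K(3)[OF that] by (cases "x \<in> K") auto
    show "h x = 0" if "x \<in> E" "x \<notin> K" for x using K(3)[OF that] .
  qed
qed

section \<open>Green's identity and the flux through shells\<close>

definition helmholtz_on :: "real \<Rightarrow> (real ^ 'n::finite) set \<Rightarrow> (real ^ 'n \<Rightarrow> complex) \<Rightarrow> bool" where
  "helmholtz_on k E u \<longleftrightarrow> Ck_on 2 E u \<and> (\<forall>x\<in>E. (\<Sum>i\<in>UNIV. partial i (partial i u) x) + (cpx k)\<^sup>2 * u x = 0)"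

lemma Ck_on_2D:
  assumes "Ck_on 2 E u" "open E"
  shows "Ck_on 1 E u" "Ck_on 1 E (\<lambda>x. fderiv u x v)" "continuous_on E u"
    "continuous_on E (\<lambda>x. fderiv u x v)" "\<And>x. x \<in> E \<Longrightarrow> u differentiable (at x)"
    "\<And>x. x \<in> E \<Longrightarrow> (\<lambda>x. fderiv u x v) differentiable (at x)"
proof -
  have 2: "Ck_on (Suc 1) E u" using assms(1) by (simp add: numeral_2_eq_2)
  show 1: "Ck_on 1 E u" by (rule Ck_on_Suc_imp[OF assms(2) 2])
  show 3: "Ck_on 1 E (\<lambda>x. fderiv u x v)" using 2 by simp
  show "continuous_on E u" by (rule Ck_on_imp_continuous_on[OF assms(2) 1])
  show "continuous_on E (\<lambda>x. fderiv u x v)" by (rule Ck_on_imp_continuous_on[OF assms(2) 3])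
  show "\<And>x. x \<in> E \<Longrightarrow> u differentiable (at x)" using 1 by (simp add: One_nat_def)
  show "\<And>x. x \<in> E \<Longrightarrow> (\<lambda>x. fderiv u x v) differentiable (at x)" using 3 by (simp add: One_nat_def)
qed

lemma frechet_derivative_mult_complex:
  fixes u w :: "'a::real_normed_vector \<Rightarrow> complex"
  assumes "u differentiable (at x)" "w differentiable (at x)"
  shows "fderiv (\<lambda>x. u x * w x) x v = fderiv u x v * w x + u x * fderiv w x v"
  using has_derivative_mult[OF frechet_derivative_works[THEN iffD1, OF assms(1)] frechet_derivative_works[THEN iffD1, OF assms(2)]]
  by (subst frechet_derivative_eq) (auto simp: algebra_simps)

text \<open>The terms with k^2 cancel in the divergence of w \<nabla>u - u \<nabla>w, so this field
  is divergence-free. The divergence of its product with \<zeta> integrates to zero, and only the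
  gradient of \<zeta> is left.\<close>

lemma green_identity:
  fixes u w :: "real ^ 'n::finite \<Rightarrow> complex"
  assumes E: "open E" and u: "helmholtz_on k E u" and w: "helmholtz_on k E w" and \<zeta>: "\<zeta> \<in> test_functions E"
  shows "(\<integral>x. (\<Sum>i\<in>UNIV. cpx (partial i \<zeta> x) * (w x * partial i u x - u x * partial i w x)) \<partial>leb E) = 0"
proof -
  have u2: "Ck_on 2 E u" and w2: "Ck_on 2 E w" using u w by (auto simp: helmholtz_on_def)
  let ?X = "\<lambda>i x. w x * partial i u x - u x * partial i w x"
  let ?K = "closure {x. \<zeta> x \<noteq> 0}"
  note K = test_functions_D(2,3)[OF \<zeta>]
  have X1: "Ck_on 1 E (?X i)" for i
  proof -
    have "Ck_on 1 E (\<lambda>x. w x * partial i u x + (- 1) * (u x * partial i w x))"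
      by (intro Ck_on_add Ck_on_mult Ck_on_const E Ck_on_2D(1)[OF u2 E] Ck_on_2D(1)[OF w2 E] Ck_on_2D(2)[OF u2 E] Ck_on_2D(2)[OF w2 E])
    then show ?thesis by simp
  qed
  have f1: "Ck_on 1 E (\<lambda>x. ?X i x * cpx (\<zeta> x))" for i
    by (rule Ck_on_mult_of_real[OF E X1 Ck_on_subset[OF test_functions_D(1)[OF \<zeta>] subset_UNIV]])
  have z: "?X i x * cpx (\<zeta> x) = 0" if "x \<in> E - ?K" for i x
    using test_functions_outside[OF \<zeta>, of x] that by simp
  have I0: "(\<integral>x. partial i (\<lambda>x. ?X i x * cpx (\<zeta> x)) x \<partial>leb E) = 0" for i
    by (rule integral_derivative_zero[OF E f1 K z])
  have cont: "continuous_on E (\<lambda>x. partial i (\<lambda>x. ?X i x * cpx (\<zeta> x)) x)" for i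
    using f1[of i] by (simp add: One_nat_def)
  have Xd: "?X i differentiable (at x)" if "x \<in> E" for i x using X1[of i] that by (simp add: One_nat_def)
  have int: "integrable (leb E) (\<lambda>x. partial i (\<lambda>x. ?X i x * cpx (\<zeta> x)) x)" for i
  proof (rule integrable_continuous_compact[OF E cont K])
    fix x assume x: "x \<in> E" "x \<notin> ?K"
    have "partial i \<zeta> x = 0" using frechet_derivative_zero_outside[OF x(2)] by simp
    then show "partial i (\<lambda>x. ?X i x * cpx (\<zeta> x)) x = 0"
      using frechet_derivative_mult_of_real[OF Xd[OF x(1)] test_functions_differentiable[OF \<zeta>]] test_functions_outside[OF \<zeta> x(2)]
      by simp
  qed
  have eq: "(\<Sum>i\<in>UNIV. partial i (\<lambda>x. ?X i x * cpx (\<zeta> x)) x) = (\<Sum>i\<in>UNIV. cpx (partial i \<zeta> x) * ?X i x)"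
    if x: "x \<in> E" for x
  proof -
    have dX: "partial i (?X i) x = w x * partial i (partial i u) x - u x * partial i (partial i w) x" for i
    proof -
      note du = Ck_on_2D(5)[OF u2 E x] and dw = Ck_on_2D(5)[OF w2 E x]
      note ddu = Ck_on_2D(6)[OF u2 E x, of "axis i 1"] and ddw = Ck_on_2D(6)[OF w2 E x, of "axis i 1"]
      have "((\<lambda>x. w x * partial i u x) has_derivative fderiv (\<lambda>x. w x * partial i u x) x) (at x)"
        "((\<lambda>x. u x * partial i w x) has_derivative fderiv (\<lambda>x. u x * partial i w x) x) (at x)"
        using differentiable_mult[OF dw ddu] differentiable_mult[OF du ddw] frechet_derivative_works by blast+
      from frechet_derivative_eq[OF has_derivative_diff[OF this]]
      show ?thesis
        by (simp add: frechet_derivative_mult_complex[OF dw ddu] frechet_derivative_mult_complex[OF du ddw])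
    qed
    have "(\<Sum>i\<in>UNIV. partial i (?X i) x) = w x * (\<Sum>i\<in>UNIV. partial i (partial i u) x) - u x * (\<Sum>i\<in>UNIV. partial i (partial i w) x)"
      by (simp add: dX sum_subtractf sum_distrib_left)
    also have "\<dots> = 0"
    proof -
      have "(\<Sum>i\<in>UNIV. partial i (partial i u) x) = - ((cpx k)\<^sup>2 * u x)"
        "(\<Sum>i\<in>UNIV. partial i (partial i w) x) = - ((cpx k)\<^sup>2 * w x)"
        using u w x by (auto simp: helmholtz_on_def eq_neg_iff_add_eq_0)
      then show ?thesis by simp
    qed
    finally have "(\<Sum>i\<in>UNIV. partial i (?X i) x * cpx (\<zeta> x)) = 0"
      by (simp flip: sum_distrib_right)
    then show ?thesis
      unfolding frechet_derivative_mult_of_real[OF Xd[OF x] test_functions_differentiable[OF \<zeta>]] sum.distrib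
      by (simp add: mult.commute)
  qed
  have "(\<integral>x. (\<Sum>i\<in>UNIV. cpx (partial i \<zeta> x) * ?X i x) \<partial>leb E) =
      (\<integral>x. (\<Sum>i\<in>UNIV. partial i (\<lambda>x. ?X i x * cpx (\<zeta> x)) x) \<partial>leb E)"
    by (rule Bochner_Integration.integral_cong[OF refl]) (simp add: eq)
  also have "\<dots> = (\<Sum>i\<in>UNIV. \<integral>x. partial i (\<lambda>x. ?X i x * cpx (\<zeta> x)) x \<partial>leb E)"
    by (rule Bochner_Integration.integral_sum[OF int])
  finally show ?thesis by (simp add: I0)
qed

text \<open>The wavenumber is real, so conjugation preserves the equation. The conjugate is the
  second solution in the energy argument of \<open>shell_energy\<close>.\<close>

lemma helmholtz_on_cnj:
  fixes u :: "real ^ 'n::finite \<Rightarrow> complex"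
  assumes E: "open E" and u: "helmholtz_on k E u"
  shows "helmholtz_on k E (\<lambda>x. cnj (u x))"
    and "\<And>x v. x \<in> E \<Longrightarrow> fderiv (\<lambda>x. cnj (u x)) x v = cnj (fderiv u x v)"
proof -
  have u2: "Ck_on 2 E u" using u by (simp add: helmholtz_on_def)
  have d: "fderiv (\<lambda>x. cnj (f x)) x v = cnj (fderiv f x v)"
    if "f differentiable (at x)" for f :: "real ^ 'n \<Rightarrow> complex" and x v
    using frechet_derivative_eq[OF bounded_linear.has_derivative[OF bounded_linear_cnj frechet_derivative_works[THEN iffD1, OF that]]]
    by simp
  show 1: "fderiv (\<lambda>x. cnj (u x)) x v = cnj (fderiv u x v)" if "x \<in> E" for x v
    by (rule d[OF Ck_on_2D(5)[OF u2 E that]])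
  have C: "Ck_on 2 E (\<lambda>x. cnj (u x))" by (rule Ck_on_bounded_linear[OF bounded_linear_cnj E u2])
  have 2: "partial i (partial i (\<lambda>x. cnj (u x))) x = cnj (partial i (partial i u) x)" if x: "x \<in> E" for i x
  proof -
    have "frechet_derivative (partial i (\<lambda>x. cnj (u x))) (at x) = fderiv (\<lambda>x. cnj (partial i u x)) x"
      by (rule frechet_derivative_transform_within_open[OF Ck_on_2D(6)[OF C E x] E x]) (simp add: 1)
    then show ?thesis using d[OF Ck_on_2D(6)[OF u2 E x]] by simp
  qed
  show "helmholtz_on k E (\<lambda>x. cnj (u x))"
    unfolding helmholtz_on_def
  proof (intro conjI ballI C)
    fix x assume x: "x \<in> E"
    have "(\<Sum>i\<in>UNIV. partial i (partial i (\<lambda>x. cnj (u x))) x) + (cpx k)\<^sup>2 * cnj (u x) =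
       cnj ((\<Sum>i\<in>UNIV. partial i (partial i u) x) + (cpx k)\<^sup>2 * u x)"
      by (simp add: 2[OF x])
    also have "\<dots> = cnj 0" using u x unfolding helmholtz_on_def by (intro arg_cong[of _ _ cnj]) blast
    finally show "(\<Sum>i\<in>UNIV. partial i (partial i (\<lambda>x. cnj (u x))) x) + (cpx k)\<^sup>2 * cnj (u x) = 0" by simp
  qed
qed

text \<open>The flux of \<open>w \<nabla>u - u \<nabla>w\<close> through spheres, averaged over radii between \<open>R\<close> and \<open>2 R\<close>: the weight
  \<open>shell R\<close> comes from the gradient of the cutoff \<open>ball_step 0 R\<close>.\<close>

definition shell_wronskian ::
  "(real ^ 'n::finite) set \<Rightarrow> real \<Rightarrow> (real ^ 'n \<Rightarrow> complex) \<Rightarrow> (real ^ 'n \<Rightarrow> complex) \<Rightarrow> complex" where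
  "shell_wronskian E R u w = (\<integral>x. cpx (shell R x) *
     (w x * fderiv u x x - u x * fderiv w x x) \<partial>leb E)"

lemma shell_wronskian_integrand:
  fixes u w :: "real ^ 'n::finite \<Rightarrow> complex"
  assumes "u differentiable (at x)" "w differentiable (at x)"
  shows "(\<Sum>i\<in>UNIV. cpx (partial i (ball_step 0 R) x) * (w x * partial i u x - u x * partial i w x)) =
    - (cpx (shell R x) * (w x * fderiv u x x - u x * fderiv w x x))"
  unfolding frechet_derivative_components[OF assms(1), of x] frechet_derivative_components[OF assms(2), of x] ball_step_derivative
  by (simp add: inner_axis sum_distrib_left sum_negf sum_subtractf scaleR_conv_of_real algebra_simps)

lemma integrable_shell:
  fixes h :: "real ^ 'n::finite \<Rightarrow> 'b::euclidean_space"
  assumes E: "open E" and R: "0 < R" "- E \<subseteq> ball 0 R" and h: "continuous_on E h"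
  shows "integrable (leb E) (\<lambda>x. shell R x *\<^sub>R h x)"
proof (rule integrable_continuous_compact[OF E])
  show "continuous_on E (\<lambda>x. shell R x *\<^sub>R h x)"
    by (intro continuous_on_scaleR h continuous_on_subset[OF continuous_shell[OF R(1)]]) simp
  show "compact (cball 0 (2 * R) - ball 0 R :: (real ^ 'n) set)" by (intro compact_diff) auto
  show "cball 0 (2 * R) - ball 0 R \<subseteq> E" using R(2) by blast
  show "shell R x *\<^sub>R h x = 0" if "x \<notin> cball 0 (2 * R) - ball 0 R" for x
    using that R(1) by (subst shell_eq_0) auto
qed

lemma continuous_on_radial_derivative:
  fixes u :: "real ^ 'n::finite \<Rightarrow> complex"
  assumes E: "open E" and u: "helmholtz_on k E u"
  shows "continuous_on E (\<lambda>x. fderiv u x x)"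
proof -
  have u2: "Ck_on 2 E u" using u by (simp add: helmholtz_on_def)
  have "continuous_on E (\<lambda>x. \<Sum>i\<in>UNIV. (x $ i) *\<^sub>R partial i u x)"
    by (intro continuous_intros Ck_on_2D(4)[OF u2 E])
  then show ?thesis
    by (rule continuous_on_eq) (rule frechet_derivative_components[OF Ck_on_2D(5)[OF u2 E], symmetric])
qed

lemma helmholtz_on_continuous: "open E \<Longrightarrow> helmholtz_on k E u \<Longrightarrow> continuous_on E u"
  using Ck_on_2D(3) by (auto simp: helmholtz_on_def)

text \<open>Both cutoffs are 1 near the complement of E, so their difference has compact support in
  E and is admissible in Green's identity; its gradient is the difference of the two
  weights.\<close>

lemma shell_wronskian_const:
  fixes u w :: "real ^ 'n::finite \<Rightarrow> complex"
  assumes E: "open E" and u: "helmholtz_on k E u" and w: "helmholtz_on k E w"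
    and R: "0 < R0" "- E \<subseteq> ball 0 R0" "R0 \<le> R"
  shows "shell_wronskian E R u w = shell_wronskian E R0 u w"
proof -
  have R': "0 < R" "- E \<subseteq> ball 0 R" using R by auto
  have u2: "Ck_on 2 E u" and w2: "Ck_on 2 E w" using u w by (auto simp: helmholtz_on_def)
  define \<zeta> where "\<zeta> x = ball_step 0 R x - ball_step (0::real ^ 'n) R0 x" for x
  have d: "ball_step (0::real ^ 'n) R differentiable (at x)" if "0 < R" for R x
    by (rule test_functions_differentiable[OF ball_step_test[OF that]])
  have \<zeta>: "\<zeta> \<in> test_functions E"
  proof (rule test_functionsI)
    have "Ck_on m UNIV (\<lambda>x::real ^ 'n. ball_step 0 R x + (- 1) * ball_step 0 R0 x)" for m
      by (intro Ck_on_add Ck_on_mult Ck_on_const Ck_on_ball_step open_UNIV)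
    then show "Ck_on m UNIV \<zeta>" for m by (simp add: \<zeta>_def[abs_def])
    show "compact (cball 0 (2 * R) - ball 0 R0 :: (real ^ 'n) set)" by (intro compact_diff) auto
    show "cball 0 (2 * R) - ball 0 R0 \<subseteq> E" using R(2) by blast
    fix x :: "real ^ 'n" assume "x \<notin> cball 0 (2 * R) - ball 0 R0"
    then consider "norm x < R0" | "2 * R < norm x" by (auto simp: not_le)
    then show "\<zeta> x = 0"
    proof cases
      case 1
      then show ?thesis using R R'(1) by (simp add: \<zeta>_def ball_step_eq_1)
    next
      case 2
      then show ?thesis using R R'(1) by (simp add: \<zeta>_def ball_step_eq_0)
    qed
  qed
  have p\<zeta>: "partial i \<zeta> x = partial i (ball_step 0 R) x - partial i (ball_step 0 R0) x" for i x
  proof -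
    have "(\<zeta> has_derivative (\<lambda>v. fderiv (ball_step 0 R) x v - fderiv (ball_step 0 R0) x v)) (at x)"
      unfolding \<zeta>_def[abs_def]
      by (intro has_derivative_diff frechet_derivative_works[THEN iffD1] d R R')
    from frechet_derivative_eq[OF this] show ?thesis by simp
  qed
  let ?h = "\<lambda>x. w x * fderiv u x x - u x * fderiv w x x"
  have h: "continuous_on E ?h"
    by (intro continuous_intros continuous_on_radial_derivative[OF E u] continuous_on_radial_derivative[OF E w]
        helmholtz_on_continuous[OF E u] helmholtz_on_continuous[OF E w])
  have i: "integrable (leb E) (\<lambda>x. cpx (shell R x) * ?h x)" "integrable (leb E) (\<lambda>x. cpx (shell R0 x) * ?h x)"
    using integrable_shell[OF E R' h] integrable_shell[OF E R(1,2) h] by (simp_all add: scaleR_conv_of_real)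
  have "0 = (\<integral>x. (\<Sum>i\<in>UNIV. cpx (partial i \<zeta> x) * (w x * partial i u x - u x * partial i w x)) \<partial>leb E)"
    by (rule green_identity[OF E u w \<zeta>, symmetric])
  also have "\<dots> = (\<integral>x. cpx (shell R0 x) * ?h x - cpx (shell R x) * ?h x \<partial>leb E)"
  proof (rule Bochner_Integration.integral_cong[OF refl])
    fix x assume "x \<in> space (leb E)"
    then have x: "x \<in> E" by simp
    have "(\<Sum>i\<in>UNIV. cpx (partial i \<zeta> x) * (w x * partial i u x - u x * partial i w x)) =
      (\<Sum>i\<in>UNIV. cpx (partial i (ball_step 0 R) x) * (w x * partial i u x - u x * partial i w x)) -
      (\<Sum>i\<in>UNIV. cpx (partial i (ball_step 0 R0) x) * (w x * partial i u x - u x * partial i w x))"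
      by (simp only: p\<zeta> of_real_diff left_diff_distrib sum_subtractf)
    then show "(\<Sum>i\<in>UNIV. cpx (partial i \<zeta> x) * (w x * partial i u x - u x * partial i w x)) =
        cpx (shell R0 x) * ?h x - cpx (shell R x) * ?h x"
      unfolding shell_wronskian_integrand[OF Ck_on_2D(5)[OF u2 E x] Ck_on_2D(5)[OF w2 E x]] by simp
  qed
  also have "\<dots> = shell_wronskian E R0 u w - shell_wronskian E R u w"
    unfolding shell_wronskian_def by (rule Bochner_Integration.integral_diff[OF i(2,1)])
  finally show ?thesis by simp
qed

section \<open>Consequences of the radiation condition\<close>

definition decay :: "nat \<Rightarrow> real \<Rightarrow> real" where
  "decay d R = R powr (- (real d - 1) / 2)"

text \<open>The weight times \<open>norm x\<close> is of order 1/R on a ball of volume of order R^d,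
  and the square of \<open>decay\<close> is R^(1-d), so the powers of R cancel.\<close>

lemma shell_mass:
  obtains M where "0 < M" "\<And>(E::(real ^ 'n::finite) set) R. open E \<Longrightarrow> 0 < R \<Longrightarrow> - E \<subseteq> ball 0 R \<Longrightarrow>
    (\<integral>x. shell R x * norm x * (decay CARD('n) R)\<^sup>2 \<partial>leb E) \<le> M"
proof -
  obtain C where C: "0 < C" "\<And>R x::real ^ 'n. 0 < R \<Longrightarrow> shell R x * norm x \<le> C / R"
    by (rule shell_bound) blast
  let ?M = "C * unit_ball_vol (real CARD('n)) * 2 ^ CARD('n)"
  show thesis
  proof (rule that[of "?M"])
    show "0 < ?M" using C by (simp add: unit_ball_vol_pos)
    fix E :: "(real ^ 'n) set" and R :: real assume E: "open E" and R: "0 < R" "- E \<subseteq> ball 0 R"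
    have El: "E \<in> sets lebesgue" using E by auto
    define P where "P = (decay CARD('n) R)\<^sup>2"
    have P: "P * R ^ CARD('n) = R" "0 \<le> P"
    proof -
      have "P = R powr (- (real CARD('n) - 1))" using R(1) by (simp add: P_def decay_def power2_eq_square flip: powr_add)
      then have "P * R powr (real CARD('n)) = R powr 1" by (simp flip: powr_add)
      then show "P * R ^ CARD('n) = R" using R(1) by (simp add: powr_realpow)
    qed (simp add: P_def)
    have bd: "shell R x * norm x * P \<le> C / R * P * indicator (cball 0 (2 * R)) x" for x :: "real ^ 'n"
    proof (cases "x \<in> cball 0 (2 * R)")
      case True
      then show ?thesis using mult_right_mono[OF C(2)[OF R(1), of x] P(2)] by simp
    next
      case False
      then show ?thesis using R(1) by (subst shell_eq_0) auto
    qed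
    have i1: "integrable (leb E) (\<lambda>x. shell R x * norm x * P)"
      using integrable_shell[OF E R, of "\<lambda>x. norm x * P"] by (simp add: continuous_intros mult.assoc)
    have ind: "integrable lebesgue (indicator (cball 0 (2 * R)) :: real ^ 'n \<Rightarrow> real)"
      using integrable_indicator_bounded[of "cball 0 (2 * R) :: (real ^ 'n) set" UNIV] by (simp add: lebesgue_on_UNIV_eq)
    have i2: "integrable (leb E) (\<lambda>x. C / R * P * indicator (cball 0 (2 * R)) x)"
      using integrable_on_subset[OF ind El] by simp
    let ?I = "indicator (cball 0 (2 * R)) :: real ^ 'n \<Rightarrow> real"
    have "(\<integral>x. shell R x * norm x * P \<partial>leb E) \<le> (\<integral>x. C / R * P * ?I x \<partial>leb E)"
      by (rule integral_mono[OF i1 i2 bd])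
    also have "\<dots> = C / R * P * (\<integral>x. ?I x \<partial>leb E)" by (rule integral_mult_right_zero)
    also have "\<dots> \<le> C / R * P * (\<integral>x. ?I x \<partial>lebesgue)"
    proof (rule mult_left_mono)
      have "(\<integral>x. ?I x \<partial>leb E) = (\<integral>x. indicator E x *\<^sub>R ?I x \<partial>lebesgue)"
        using El by (intro integral_restrict_space) auto
      also have "\<dots> \<le> (\<integral>x. ?I x \<partial>lebesgue)"
        by (rule integral_mono[OF integrable_mult_indicator[OF El ind] ind]) (auto simp: indicator_def)
      finally show "(\<integral>x. ?I x \<partial>leb E) \<le> (\<integral>x. ?I x \<partial>lebesgue)" .
    qed (use C R P in simp)
    also have "(\<integral>x. ?I x \<partial>lebesgue) = unit_ball_vol (real CARD('n)) * (2 * R) ^ CARD('n)"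
      using R(1) content_cball[of "2 * R" "0::real ^ 'n"] by simp
    also have "C / R * P * (unit_ball_vol (real CARD('n)) * (2 * R) ^ CARD('n)) = ?M * (P * R ^ CARD('n)) / R"
      by (simp add: power_mult_distrib mult_ac)
    also have "\<dots> = ?M" using R(1) by (simp add: P(1))
    finally show "(\<integral>x. shell R x * norm x * (decay CARD('n) R)\<^sup>2 \<partial>leb E) \<le> ?M" unfolding P_def .
  qed
qed

text \<open>The derivative is taken along x instead of the unit vector, as in
  \<open>shell_wronskian\<close>; this brings out the factor \<open>norm x\<close>. The decay at
  \<open>norm x\<close> is estimated by the decay at R, so that the error is uniform on the
  shell.\<close>

lemma radiating_bound:
  fixes u :: "real ^ 'n::finite \<Rightarrow> complex"
  assumes E: "open E" and u: "helmholtz_on k E u" and rad: "radiating k u" and R0: "0 < R0" "- E \<subseteq> ball 0 R0" and \<epsilon>: "0 < \<epsilon>"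
  obtains R1 where "R0 \<le> R1" "\<And>R x. R1 \<le> R \<Longrightarrow> R \<le> norm x \<Longrightarrow>
    cmod (fderiv u x x - cpx (norm x) * (\<i> * cpx k * u x)) \<le> norm x * (\<epsilon> * decay CARD('n) R)"
proof -
  have u2: "Ck_on 2 E u" using u by (simp add: helmholtz_on_def)
  obtain R2 where R2: "0 < R2" "\<And>x. R2 \<le> norm x \<Longrightarrow>
     cmod (fderiv u x (x /\<^sub>R norm x) - \<i> * cpx k * u x)
       \<le> \<epsilon> * norm x powr (- (real CARD('n) - 1) / 2)"
    using rad \<epsilon> unfolding radiating_def by blast
  show thesis
  proof (rule that[of "max R0 R2"])
    show "R0 \<le> max R0 R2" by simp
    fix R and x :: "real ^ 'n" assume R: "max R0 R2 \<le> R" "R \<le> norm x"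
    have Rp: "0 < R" using R(1) R0(1) by linarith
    then have x0: "0 < norm x" using R(2) by linarith
    have "x \<in> E" using R0(2) R by auto
    then have "linear (fderiv u x)"
      using Ck_on_2D(5)[OF u2 E] frechet_derivative_works has_derivative_linear by blast
    then have "fderiv u x (x /\<^sub>R norm x) = fderiv u x x /\<^sub>R norm x" by (rule linear_scale)
    then have "fderiv u x x - cpx (norm x) * (\<i> * cpx k * u x) =
      cpx (norm x) * (fderiv u x (x /\<^sub>R norm x) - \<i> * cpx k * u x)"
      using x0 by (simp add: right_diff_distrib scaleR_conv_of_real)
    then have "cmod (fderiv u x x - cpx (norm x) * (\<i> * cpx k * u x)) =
      norm x * cmod (fderiv u x (x /\<^sub>R norm x) - \<i> * cpx k * u x)"
      by (simp add: norm_mult)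
    also have "\<dots> \<le> norm x * (\<epsilon> * norm x powr (- (real CARD('n) - 1) / 2))"
      using R by (intro mult_left_mono R2(2)) auto
    also have "\<dots> \<le> norm x * (\<epsilon> * decay CARD('n) R)"
    proof -
      have "norm x powr (- (real CARD('n) - 1) / 2) \<le> decay CARD('n) R"
        unfolding decay_def using Rp R(2) by (intro powr_mono2') auto
      then show ?thesis using \<epsilon> by (intro mult_left_mono) auto
    qed
    finally show "cmod (fderiv u x x - cpx (norm x) * (\<i> * cpx k * u x)) \<le> norm x * (\<epsilon> * decay CARD('n) R)" .
  qed
qed

text \<open>The radiation condition controls a combination of u and its derivative, not u itself.
  The flux formed with u and its conjugate does not depend on R, and the radiation condition
  identifies it with k times the weighted mass of |u|^2 up to a controlled error; hence this mass
  stays bounded.\<close>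

lemma shell_energy:
  fixes u :: "real ^ 'n::finite \<Rightarrow> complex"
  assumes k: "0 < k" and E: "open E" and u: "helmholtz_on k E u" and rad: "radiating k u" and R0: "0 < R0" "- E \<subseteq> ball 0 R0"
  obtains C R1 where "R0 \<le> R1" "\<And>R. R1 \<le> R \<Longrightarrow> (\<integral>x. shell R x * (norm x * (cmod (u x))\<^sup>2) \<partial>leb E) \<le> C"
proof -
  have one: "(0::real) < 1" by simp
  obtain R1 where R1: "R0 \<le> R1" "\<And>R x. R1 \<le> R \<Longrightarrow> R \<le> norm x \<Longrightarrow>
    cmod (fderiv u x x - cpx (norm x) * (\<i> * cpx k * u x)) \<le> norm x * (1 * decay CARD('n) R)"
    by (rule radiating_bound[OF E u rad R0 one]) blast
  obtain M where M: "0 < M" "\<And>(E::(real ^ 'n) set) R. open E \<Longrightarrow> 0 < R \<Longrightarrow> - E \<subseteq> ball 0 R \<Longrightarrow>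
    (\<integral>x. shell R x * norm x * (decay CARD('n) R)\<^sup>2 \<partial>leb E) \<le> M"
    by (rule shell_mass) blast
  define j where "j x = Im (cnj (u x) * fderiv u x x)" for x
  have cj: "continuous_on E j"
    unfolding j_def by (intro continuous_intros continuous_on_radial_derivative[OF E u] helmholtz_on_continuous[OF E u])
  have cu: "continuous_on E (\<lambda>x. norm x * (cmod (u x))\<^sup>2)"
    by (intro continuous_intros helmholtz_on_continuous[OF E u])
  \<comment> \<open>For w = \<open>cnj u\<close> the integrand is a number minus its conjugate, so
    only the imaginary part j remains.\<close>
  have W: "shell_wronskian E R u (\<lambda>x. cnj (u x)) = 2 * \<i> * cpx (\<integral>x. shell R x * j x \<partial>leb E)" for R
  proof -
    have "shell_wronskian E R u (\<lambda>x. cnj (u x)) = (\<integral>x. 2 * \<i> * cpx (shell R x * j x) \<partial>leb E)"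
      unfolding shell_wronskian_def
    proof (rule Bochner_Integration.integral_cong[OF refl])
      fix x assume "x \<in> space (leb E)"
      then have x: "x \<in> E" by simp
      have "cnj (u x) * d - u x * cnj d = 2 * \<i> * cpx (Im (cnj (u x) * d))" for d
        using complex_diff_cnj[of "cnj (u x) * d"] by (simp add: mult_ac)
      then show "cpx (shell R x) * (cnj (u x) * fderiv u x x - u x * fderiv (\<lambda>x. cnj (u x)) x x)
        = 2 * \<i> * cpx (shell R x * j x)"
        unfolding helmholtz_on_cnj(2)[OF E u x] j_def by simp
    qed
    then show ?thesis by (simp del: of_real_mult)
  qed
  define A where "A = (\<integral>x. shell R0 x * j x \<partial>leb E)"
  show thesis
  proof (rule that[OF R1(1)])
    fix R assume R: "R1 \<le> R"
    then have RR: "0 < R" "- E \<subseteq> ball 0 R" "R0 \<le> R" using R1(1) R0 by auto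
    have "shell_wronskian E R u (\<lambda>x. cnj (u x)) = shell_wronskian E R0 u (\<lambda>x. cnj (u x))"
      by (rule shell_wronskian_const[OF E u helmholtz_on_cnj(1)[OF E u] R0 RR(3)])
    then have J: "(\<integral>x. shell R x * j x \<partial>leb E) = A" unfolding W A_def by simp
    define P where "P = decay CARD('n) R"
    \<comment> \<open>The derivative along x is \<i> k |x| u up to an error of size |x| P. Young's
      inequality absorbs half of the main term into the left-hand side; the remaining P^2 is the
      mass of \<open>shell_mass\<close>.\<close>
    have pw: "k / 2 * (shell R x * (norm x * (cmod (u x))\<^sup>2)) \<le> shell R x * j x + 1 / (2 * k) * (shell R x * norm x * P\<^sup>2)" for x
    proof (cases "R \<le> norm x")
      case True
      define \<rho> where "\<rho> = fderiv u x x - cpx (norm x) * (\<i> * cpx k * u x)"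
      have \<rho>: "cmod \<rho> \<le> norm x * P" using R1(2)[OF R True] by (simp add: \<rho>_def P_def)
      have "cnj (u x) * fderiv u x x = \<i> * cpx (norm x * k * (cmod (u x))\<^sup>2) + cnj (u x) * \<rho>"
      proof -
        have "cpx (norm x * k * (cmod (u x))\<^sup>2) = cpx (norm x) * cpx k * (u x * cnj (u x))"
          by (simp only: of_real_mult complex_norm_square)
        then show ?thesis by (simp only: \<rho>_def) (simp add: algebra_simps)
      qed
      then have "j x = norm x * k * (cmod (u x))\<^sup>2 + Im (cnj (u x) * \<rho>)" by (simp add: j_def)
      moreover have "- Im (cnj (u x) * \<rho>) \<le> cmod (u x) * (norm x * P)"
      proof -
        have "- Im (cnj (u x) * \<rho>) \<le> cmod (cnj (u x) * \<rho>)" using abs_Im_le_cmod[of "cnj (u x) * \<rho>"] by linarith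
        also have "\<dots> = cmod (u x) * cmod \<rho>" by (simp add: norm_mult)
        also have "\<dots> \<le> cmod (u x) * (norm x * P)" by (rule mult_left_mono[OF \<rho>]) simp
        finally show ?thesis .
      qed
      moreover have "cmod (u x) * P \<le> k / 2 * (cmod (u x))\<^sup>2 + 1 / (2 * k) * P\<^sup>2"
      proof -
        have "0 \<le> (k * cmod (u x) - P)\<^sup>2 / (2 * k)" using k by simp
        also have "\<dots> = k / 2 * (cmod (u x))\<^sup>2 + 1 / (2 * k) * P\<^sup>2 - cmod (u x) * P"
          using k by (simp add: power2_eq_square field_simps)
        finally show ?thesis by simp
      qed
      then have "norm x * (cmod (u x) * P) \<le> norm x * (k / 2 * (cmod (u x))\<^sup>2 + 1 / (2 * k) * P\<^sup>2)"
        by (rule mult_left_mono) simp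
      ultimately have "k / 2 * (norm x * (cmod (u x))\<^sup>2) \<le> j x + 1 / (2 * k) * (norm x * P\<^sup>2)"
        by (simp add: algebra_simps)
      then have "shell R x * (k / 2 * (norm x * (cmod (u x))\<^sup>2)) \<le> shell R x * (j x + 1 / (2 * k) * (norm x * P\<^sup>2))"
        by (rule mult_left_mono[OF _ shell_nonneg])
      then show ?thesis by (simp add: algebra_simps)
    next
      case False
      then have "shell R x = 0" using RR by (intro shell_eq_0) auto
      then show ?thesis by simp
    qed
    have i1: "integrable (leb E) (\<lambda>x. shell R x * (norm x * (cmod (u x))\<^sup>2))"
      using integrable_shell[OF E RR(1,2) cu] by simp
    have i2: "integrable (leb E) (\<lambda>x. shell R x * j x)"
      using integrable_shell[OF E RR(1,2) cj] by simp
    have i3: "integrable (leb E) (\<lambda>x. shell R x * norm x * P\<^sup>2)"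
      using integrable_shell[OF E RR(1,2), of "\<lambda>x. norm x * P\<^sup>2"] by (simp add: continuous_intros mult.assoc)
    have "k / 2 * (\<integral>x. shell R x * (norm x * (cmod (u x))\<^sup>2) \<partial>leb E)
      = (\<integral>x. k / 2 * (shell R x * (norm x * (cmod (u x))\<^sup>2)) \<partial>leb E)" by simp
    also have "\<dots> \<le> (\<integral>x. shell R x * j x + 1 / (2 * k) * (shell R x * norm x * P\<^sup>2) \<partial>leb E)"
      by (rule integral_mono) (use i1 i2 i3 pw in auto)
    also have "\<dots> = A + 1 / (2 * k) * (\<integral>x. shell R x * norm x * P\<^sup>2 \<partial>leb E)"
      using i2 i3 J by simp
    also have "\<dots> \<le> A + 1 / (2 * k) * M"
      using M(2)[OF E RR(1,2)] k unfolding P_def by (intro add_left_mono mult_left_mono) auto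
    finally show "(\<integral>x. shell R x * (norm x * (cmod (u x))\<^sup>2) \<partial>leb E) \<le> (A + 1 / (2 * k) * M) * (2 / k)"
      using k by (simp add: field_simps)
  qed
qed

text \<open>For two radiating solutions the terms with \<i> k cancel. What remains are products of
  one solution with the error of the other, at most \<epsilon> times the bounded energies of the
  shell. The flux is the same for all large R, so it is zero.\<close>

lemma shell_wronskian_zero:
  fixes u w :: "real ^ 'n::finite \<Rightarrow> complex"
  assumes k: "0 < k" and E: "open E" and u: "helmholtz_on k E u" "radiating k u" and w: "helmholtz_on k E w" "radiating k w"
    and R0: "0 < R0" "- E \<subseteq> ball 0 R0"
  shows "shell_wronskian E R0 u w = 0"
proof -
  obtain Cu Ru where Cu: "R0 \<le> Ru" "\<And>R. Ru \<le> R \<Longrightarrow> (\<integral>x. shell R x * (norm x * (cmod (u x))\<^sup>2) \<partial>leb E) \<le> Cu"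
    by (rule shell_energy[OF k E u R0]) (rule that)
  obtain Cw Rw where Cw: "R0 \<le> Rw" "\<And>R. Rw \<le> R \<Longrightarrow> (\<integral>x. shell R x * (norm x * (cmod (w x))\<^sup>2) \<partial>leb E) \<le> Cw"
    by (rule shell_energy[OF k E w R0]) (rule that)
  obtain M where M: "0 < M" "\<And>(E::(real ^ 'n) set) R. open E \<Longrightarrow> 0 < R \<Longrightarrow> - E \<subseteq> ball 0 R \<Longrightarrow>
    (\<integral>x. shell R x * norm x * (decay CARD('n) R)\<^sup>2 \<partial>leb E) \<le> M"
    by (rule shell_mass) blast
  \<comment> \<open>The two energies and the mass of the decay; absolute values are taken because
    \<open>shell_energy\<close> does not fix the signs of its bounds.\<close>
  define K where "K = \<bar>Cu\<bar> + \<bar>Cw\<bar> + M"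
  have K: "0 < K" using M(1) by (simp add: K_def add_nonneg_pos)
  have bound: "cmod (shell_wronskian E R0 u w) \<le> \<epsilon> * K" if \<epsilon>: "0 < \<epsilon>" for \<epsilon>
  proof -
    obtain R1 where R1: "R0 \<le> R1" "\<And>R x. R1 \<le> R \<Longrightarrow> R \<le> norm x \<Longrightarrow>
      cmod (fderiv u x x - cpx (norm x) * (\<i> * cpx k * u x)) \<le> norm x * (\<epsilon> * decay CARD('n) R)"
      by (rule radiating_bound[OF E u R0 \<epsilon>]) blast
    obtain R2 where R2: "R0 \<le> R2" "\<And>R x. R2 \<le> R \<Longrightarrow> R \<le> norm x \<Longrightarrow>
      cmod (fderiv w x x - cpx (norm x) * (\<i> * cpx k * w x)) \<le> norm x * (\<epsilon> * decay CARD('n) R)"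
      by (rule radiating_bound[OF E w R0 \<epsilon>]) blast
    define R where "R = max (max R1 R2) (max Ru Rw)"
    have Rge: "R1 \<le> R" "R2 \<le> R" "Ru \<le> R" "Rw \<le> R" by (auto simp: R_def)
    have RR: "0 < R" "- E \<subseteq> ball 0 R" "R0 \<le> R" using Rge(1) R1(1) R0 by auto
    define P where "P = decay CARD('n) R"
    let ?f = "\<lambda>x. cpx (shell R x) * (w x * fderiv u x x - u x * fderiv w x x)"
    let ?b = "\<lambda>x. \<epsilon> * (shell R x * (norm x * (cmod (u x))\<^sup>2) + shell R x * (norm x * (cmod (w x))\<^sup>2) + shell R x * norm x * P\<^sup>2)"
    have pw: "cmod (?f x) \<le> ?b x" for x
    proof (cases "R \<le> norm x")
      case True
      define \<rho> where "\<rho> = fderiv u x x - cpx (norm x) * (\<i> * cpx k * u x)"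
      define \<sigma> where "\<sigma> = fderiv w x x - cpx (norm x) * (\<i> * cpx k * w x)"
      have \<rho>: "cmod \<rho> \<le> norm x * (\<epsilon> * P)" using R1(2)[OF Rge(1) True] by (simp add: \<rho>_def P_def)
      have \<sigma>: "cmod \<sigma> \<le> norm x * (\<epsilon> * P)" using R2(2)[OF Rge(2) True] by (simp add: \<sigma>_def P_def)
      have "w x * fderiv u x x - u x * fderiv w x x = w x * \<rho> - u x * \<sigma>"
        by (simp add: \<rho>_def \<sigma>_def algebra_simps)
      then have "cmod (w x * fderiv u x x - u x * fderiv w x x) \<le> cmod (w x) * cmod \<rho> + cmod (u x) * cmod \<sigma>"
        using norm_triangle_ineq4[of "w x * \<rho>" "u x * \<sigma>"] by (simp add: norm_mult)
      also have "\<dots> \<le> cmod (w x) * (norm x * (\<epsilon> * P)) + cmod (u x) * (norm x * (\<epsilon> * P))"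
        by (intro add_mono mult_left_mono \<rho> \<sigma>) auto
      also have "\<dots> = \<epsilon> * norm x * (cmod (w x) * P + cmod (u x) * P)" by (simp add: algebra_simps)
      also have "\<dots> \<le> \<epsilon> * norm x * ((cmod (u x))\<^sup>2 + (cmod (w x))\<^sup>2 + P\<^sup>2)"
      proof (rule mult_left_mono)
        show "cmod (w x) * P + cmod (u x) * P \<le> (cmod (u x))\<^sup>2 + (cmod (w x))\<^sup>2 + P\<^sup>2"
          using sum_squares_bound[of "cmod (w x)" P] sum_squares_bound[of "cmod (u x)" P]
            zero_le_power2[of "cmod (u x)"] zero_le_power2[of "cmod (w x)"] by linarith
      qed (use \<epsilon> in simp)
      finally have "shell R x * cmod (w x * fderiv u x x - u x * fderiv w x x)
          \<le> shell R x * (\<epsilon> * norm x * ((cmod (u x))\<^sup>2 + (cmod (w x))\<^sup>2 + P\<^sup>2))"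
        by (rule mult_left_mono[OF _ shell_nonneg])
      moreover have "cmod (?f x) = shell R x * cmod (w x * fderiv u x x - u x * fderiv w x x)"
        by (simp only: norm_mult norm_of_real abs_of_nonneg[OF shell_nonneg])
      ultimately show ?thesis by (simp only: algebra_simps)
    next
      case False
      then have "shell R x = 0" using RR by (intro shell_eq_0) auto
      then show ?thesis by simp
    qed
    have i1: "integrable (leb E) (\<lambda>x. shell R x * (norm x * (cmod (u x))\<^sup>2))"
      using integrable_shell[OF E RR(1,2), of "\<lambda>x. norm x * (cmod (u x))\<^sup>2"] helmholtz_on_continuous[OF E u(1)] by (simp add: continuous_intros)
    have i2: "integrable (leb E) (\<lambda>x. shell R x * (norm x * (cmod (w x))\<^sup>2))"
      using integrable_shell[OF E RR(1,2), of "\<lambda>x. norm x * (cmod (w x))\<^sup>2"] helmholtz_on_continuous[OF E w(1)] by (simp add: continuous_intros)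
    have i3: "integrable (leb E) (\<lambda>x. shell R x * norm x * P\<^sup>2)"
      using integrable_shell[OF E RR(1,2), of "\<lambda>x. norm x * P\<^sup>2"] by (simp add: continuous_intros mult.assoc)
    have cf: "continuous_on E (\<lambda>x. w x * fderiv u x x - u x * fderiv w x x)"
      by (intro continuous_intros continuous_on_radial_derivative[OF E u(1)] continuous_on_radial_derivative[OF E w(1)]
        helmholtz_on_continuous[OF E u(1)] helmholtz_on_continuous[OF E w(1)])
    have i4: "integrable (leb E) ?f"
      using integrable_shell[OF E RR(1,2) cf] by (simp add: scaleR_conv_of_real)
    have ib: "integrable (leb E) ?b" using i1 i2 i3 by simp
    have "cmod (shell_wronskian E R0 u w) = cmod (shell_wronskian E R u w)"
      using shell_wronskian_const[OF E u(1) w(1) R0 RR(3)] by simp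
    also have "\<dots> \<le> (\<integral>x. cmod (?f x) \<partial>leb E)"
      unfolding shell_wronskian_def by (rule integral_norm_bound)
    also have "\<dots> \<le> (\<integral>x. ?b x \<partial>leb E)"
      by (rule integral_mono[OF integrable_norm[OF i4] ib pw])
    also have "\<dots> = \<epsilon> * ((\<integral>x. shell R x * (norm x * (cmod (u x))\<^sup>2) \<partial>leb E) +
        (\<integral>x. shell R x * (norm x * (cmod (w x))\<^sup>2) \<partial>leb E) + (\<integral>x. shell R x * norm x * P\<^sup>2 \<partial>leb E))"
      using i1 i2 i3 by simp
    also have "\<dots> \<le> \<epsilon> * K"
      using Cu(2)[OF Rge(3)] Cw(2)[OF Rge(4)] M(2)[OF E RR(1,2)] \<epsilon> unfolding K_def P_def
      by (intro mult_left_mono) linarith+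
    finally show ?thesis .
  qed
  have "cmod (shell_wronskian E R0 u w) \<le> 0"
  proof (rule field_le_epsilon)
    fix e :: real assume "0 < e"
    then show "cmod (shell_wronskian E R0 u w) \<le> 0 + e" using bound[of "e / K"] K by simp
  qed
  then show ?thesis by simp
qed

section \<open>Symmetry of the Dirichlet-to-Neumann map\<close>

lemma AE_lebesgue_on_iff_negligible:
  fixes W :: "'a::euclidean_space set"
  assumes W: "W \<in> sets lebesgue"
  shows "(AE x in leb W. Q x) \<longleftrightarrow> negligible {x \<in> W. \<not> Q x}"
proof -
  have "(AE x in leb W. Q x) \<longleftrightarrow> (AE x in lebesgue. x \<notin> {x \<in> W. \<not> Q x})"
    using W by (auto simp: AE_restrict_space_iff)
  also have "\<dots> \<longleftrightarrow> negligible {x \<in> W. \<not> Q x}"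
  proof
    assume "AE x in lebesgue. x \<notin> {x \<in> W. \<not> Q x}"
    then obtain N where N: "{y \<in> space lebesgue. \<not> y \<notin> {x \<in> W. \<not> Q x}} \<subseteq> N" "emeasure lebesgue N = 0" "N \<in> sets lebesgue"
      by (rule AE_E)
    then have "negligible N" by (simp add: negligible_iff_null_sets null_setsI)
    then show "negligible {x \<in> W. \<not> Q x}" by (rule negligible_subset) (use N(1) in auto)
  next
    assume "negligible {x \<in> W. \<not> Q x}"
    then show "AE x in lebesgue. x \<notin> {x \<in> W. \<not> Q x}"
      unfolding negligible_iff_null_sets by (rule AE_not_in)
  qed
  finally show ?thesis .
qed

lemma L2_subset:
  fixes f :: "'a::euclidean_space \<Rightarrow> 'b::euclidean_space"
  assumes f: "f \<in> L2 (leb U)" and W: "W \<subseteq> U" "W \<in> sets lebesgue" "U \<in> sets lebesgue"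
  shows "f \<in> L2 (leb W)"
proof -
  have "set_integrable lebesgue U (\<lambda>x. (norm (f x))\<^sup>2)"
    using L2_D(2)[OF f] W(3) by (simp add: set_integrable_def integrable_restrict_space)
  then have "set_integrable lebesgue W (\<lambda>x. (norm (f x))\<^sup>2)" by (rule set_integrable_subset) (use W in auto)
  then have "integrable (leb W) (\<lambda>x. (norm (f x))\<^sup>2)"
    using W(2) by (simp add: set_integrable_def integrable_restrict_space)
  then show ?thesis using measurable_on_subset[OF L2_D(1)[OF f] W(1)] by (simp add: L2_def)
qed

lemma weak_grad_subset:
  fixes U :: "(real ^ 'n::finite) set"
  assumes g: "is_weak_grad U u g" and W: "W \<subseteq> U" "W \<in> sets lebesgue" "U \<in> sets lebesgue"
  shows "is_weak_grad W u g"
  unfolding is_weak_grad_def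
proof (intro conjI allI impI)
  show "g \<in> L2 (leb W)" by (rule L2_subset[OF is_weak_gradD(1)[OF g] W])
  fix \<theta> :: "real ^ 'n \<Rightarrow> real" and i assume \<theta>: "\<theta> \<in> test_functions W"
  have z: "\<theta> x = 0" "partial i \<theta> x = 0" if "x \<in> U - W" for x
  proof -
    have x: "x \<notin> closure {x. \<theta> x \<noteq> 0}" using that test_functions_D(3)[OF \<theta>] by auto
    show "\<theta> x = 0" by (rule test_functions_outside[OF \<theta> x])
    show "partial i \<theta> x = 0" by (simp add: frechet_derivative_zero_outside[OF x])
  qed
  have "(\<integral>x. u x * cpx (partial i \<theta> x) \<partial>leb W) = (\<integral>x. u x * cpx (partial i \<theta> x) \<partial>leb U)"
    by (rule on_superset(3)[symmetric]) (use W z in auto)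
  also have "\<dots> = - (\<integral>x. (g x $ i) * cpx (\<theta> x) \<partial>leb U)"
    by (rule is_weak_gradD(2)[OF g test_functions_mono[OF \<theta> W(1)]])
  also have "(\<integral>x. (g x $ i) * cpx (\<theta> x) \<partial>leb U) = (\<integral>x. (g x $ i) * cpx (\<theta> x) \<partial>leb W)"
    by (rule on_superset(3)) (use W z in auto)
  finally show "(\<integral>x. u x * cpx (partial i \<theta> x) \<partial>leb W) =
      - (\<integral>x. (g x $ i) * cpx (\<theta> x) \<partial>leb W)" .
qed

lemma continuous_on_cball_L2:
  fixes f :: "'a::euclidean_space \<Rightarrow> 'b::euclidean_space"
  assumes "continuous_on U f" "open U" "cball x r \<subseteq> U"
  shows "f \<in> L2 (leb (ball x r))"
proof -
  have "compact (f ` cball x r)" by (intro compact_continuous_image continuous_on_subset[OF assms(1)] assms compact_cball)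
  then obtain B where "\<forall>z \<in> f ` cball x r. norm z \<le> B" using compact_imp_bounded bounded_iff by metis
  then have B: "\<And>y. y \<in> cball x r \<Longrightarrow> norm (f y) \<le> B" by blast
  have m: "f \<in> borel_measurable (leb (ball x r))"
    by (rule continuous_imp_measurable_on_sets_lebesgue) (use continuous_on_subset[OF assms(1) order_trans[OF ball_subset_cball assms(3)]] in auto)
  have "integrable (leb (ball x r)) (\<lambda>y. (norm (f y))\<^sup>2)"
  proof (rule integrable_compact_support[of _ _ "ball x r" "B\<^sup>2"])
    show "(\<lambda>y. (norm (f y))\<^sup>2) \<in> borel_measurable (leb (ball x r))" using m by measurable
    show "norm ((norm (f y))\<^sup>2) \<le> B\<^sup>2" if "y \<in> ball x r" for y
      using power_mono[OF B[of y] norm_ge_zero, of 2] that by simp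
  qed auto
  with m show ?thesis by (simp add: L2_def)
qed

text \<open>The classical gradient is not known to be square-integrable on U, but it is on every
  ball whose closure lies in U. There the two gradients agree almost everywhere, and a locally
  negligible set is negligible.\<close>

lemma weak_grad_classical_AE:
  fixes U :: "(real ^ 'n::finite) set"
  assumes U: "open U" and u: "Ck_on 1 U u" and g: "is_weak_grad U u g"
  shows "AE x in leb U. g x = cgrad u x"
proof -
  let ?P = "{x \<in> U. \<not> g x = cgrad u x}"
  have cu: "continuous_on U u" by (rule Ck_on_imp_continuous_on[OF U u])
  have cg: "continuous_on U (cgrad u)"
    unfolding cgrad_def using u by (intro continuous_on_vec_lambda) simp
  have "negligible ?P"
  proof (rule iffD2[OF locally_negligible_alt], rule)
    fix x assume "x \<in> ?P"
    then obtain r where r: "0 < r" "cball x r \<subseteq> U" by (metis (lifting) U mem_Collect_eq open_contains_cball)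
    let ?B = "ball x r"
    have B: "?B \<subseteq> U" using r(2) ball_subset_cball by blast
    have "is_weak_grad ?B u (cgrad u)"
      by (rule weak_grad_classical[OF open_ball Ck_on_subset[OF u B] continuous_on_cball_L2[OF cu U r(2)] continuous_on_cball_L2[OF cg U r(2)]])
    moreover have "is_weak_grad ?B u g" by (rule weak_grad_subset[OF g B]) (use U in auto)
    ultimately have "AE x in leb ?B. g x = cgrad u x" by (intro weak_grad_unique[OF open_ball])
    then have "negligible {x \<in> ?B. \<not> g x = cgrad u x}" by (simp add: AE_lebesgue_on_iff_negligible)
    moreover have "?P \<inter> ?B = {x \<in> ?B. \<not> g x = cgrad u x}" using B by auto
    moreover have "openin (top_of_set ?P) (?P \<inter> ?B)" by (simp add: openin_open_Int)
    ultimately show "\<exists>V. openin (top_of_set ?P) V \<and> x \<in> V \<and> negligible V"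
      using \<open>x \<in> ?P\<close> r(1) by (intro exI[of _ "?P \<inter> ?B"] conjI) simp_all
  qed
  then show ?thesis using U by (simp add: AE_lebesgue_on_iff_negligible)
qed

lemma cdot_measurable:
  fixes f g :: "'a \<Rightarrow> complex ^ 'n::finite"
  assumes "f \<in> borel_measurable M" "g \<in> borel_measurable M"
  shows "(\<lambda>x. cdot (f x) (g x)) \<in> borel_measurable M"
proof -
  have "(\<lambda>x. h x $ i) \<in> borel_measurable M" if "h \<in> borel_measurable M" for h :: "'a \<Rightarrow> complex ^ 'n" and i
    by (rule measurable_compose[OF that borel_measurable_continuous_onI]) (intro linear_continuous_on bounded_linear_vec_nth)
  then show ?thesis unfolding cdot_def using assms by (intro borel_measurable_sum borel_measurable_times) auto
qed

lemma cvec_cnj_measurable: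
  fixes g :: "'a \<Rightarrow> complex ^ 'n::finite"
  assumes "g \<in> borel_measurable M"
  shows "(\<lambda>x. cvec_cnj (g x)) \<in> borel_measurable M"
proof (rule measurable_compose[OF assms borel_measurable_continuous_onI])
  show "continuous_on UNIV (cvec_cnj :: complex ^ 'n \<Rightarrow> _)"
    unfolding cvec_cnj_def by (intro continuous_intros)
qed

lemma norm_cdot_le: "cmod (cdot \<xi> \<zeta>) \<le> norm \<xi> * norm \<zeta>"
proof -
  have "cmod (cdot \<xi> \<zeta>) \<le> (\<Sum>i\<in>UNIV. cmod (\<xi> $ i) * cmod (\<zeta> $ i))"
    unfolding cdot_def by (rule order_trans[OF norm_sum]) (simp add: norm_mult)
  also have "\<dots> \<le> L2_set (\<lambda>i. cmod (\<xi> $ i)) UNIV * L2_set (\<lambda>i. cmod (\<zeta> $ i)) UNIV"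
    using L2_set_mult_ineq[of "\<lambda>i. cmod (\<xi> $ i)" "\<lambda>i. cmod (\<zeta> $ i)" UNIV] by simp
  finally show ?thesis by (simp add: norm_vec_def)
qed

lemma cdot_sum_right: "cdot \<xi> (\<Sum>j\<in>I. \<zeta> j) = (\<Sum>j\<in>I. cdot \<xi> (\<zeta> j))"
  unfolding cdot_def by (simp add: sum_component sum_distrib_left) (rule sum.swap)

lemma cdot_smult_right: "cdot \<xi> (c *s \<zeta>) = c * cdot \<xi> \<zeta>"
  by (simp add: cdot_def sum_distrib_left algebra_simps)

lemma cdot_commute: "cdot \<xi> \<zeta> = cdot \<zeta> \<xi>"
  by (simp add: cdot_def mult.commute)

lemma cvec_cnj_sum: "cvec_cnj (\<Sum>j\<in>I. \<zeta> j) = (\<Sum>j\<in>I. cvec_cnj (\<zeta> j))"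
  by (simp add: Finite_Cartesian_Product.vec_eq_iff sum_component)

lemma cvec_cnj_smult: "cvec_cnj (c *s \<zeta>) = cnj c *s cvec_cnj \<zeta>"
  by (simp add: Finite_Cartesian_Product.vec_eq_iff)

lemma cvec_cnj_cvec_cnj [simp]: "cvec_cnj (cvec_cnj \<zeta>) = \<zeta>"
  by (simp add: Finite_Cartesian_Product.vec_eq_iff)

lemma exterior_solution_helmholtz:
  assumes "exterior_solution k Dt \<phi> u"
  shows "helmholtz_on k (- closure Dt) u" "radiating k u"
  using assms by (auto simp: exterior_solution_def helmholtz_on_def)

text \<open>The inner clause of \<open>is_DtN\<close>, isolated because the arguments below have to
  name the exterior solution that belongs to a boundary datum.\<close>

definition DtN_represents ::
  "real \<Rightarrow> (real ^ 'n::finite) set \<Rightarrow> 'n boundary_op \<Rightarrow> (real ^ 'n \<Rightarrow> complex) \<Rightarrow> (real ^ 'n \<Rightarrow> complex) \<Rightarrow> bool" where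
  "DtN_represents k Dt T \<phi> u \<longleftrightarrow> (\<forall>\<psi> \<in> H_half Dt. \<forall>v. bounded {x. v x \<noteq> 0} \<and> trace_on (- closure Dt) (frontier Dt) v \<psi> \<longrightarrow>
        T \<phi> \<psi> = - (\<integral>x. (cdot (cgrad u x) (cvec_cnj (wgrad (- closure Dt) v x))
                        - (cpx k)\<^sup>2 * u x * cnj (v x)) \<partial>leb (- closure Dt)))"

lemma continuous_on_cgrad:
  assumes "Ck_on 1 E u"
  shows "continuous_on E (cgrad u)"
  unfolding cgrad_def using assms by (intro continuous_on_vec_lambda) simp

section \<open>Pairings of the Dirichlet-to-Neumann map\<close>

context
  fixes Dm Dt :: "(real ^ 'n::finite) set"
  assumes dim2: "2 \<le> CARD('n)" and geo: "geometry Dm Dt"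
begin

lemma exterior_radius: obtains R :: real where "0 < R" "closure Dt \<subseteq> ball 0 R"
proof -
  have "bounded (closure Dt)" by (rule bounded_closure[OF bounded_Dt[OF dim2 geo]])
  then obtain b where b: "0 < b" "\<And>x. x \<in> closure Dt \<Longrightarrow> norm x \<le> b" by (meson bounded_pos)
  then have "closure Dt \<subseteq> ball 0 (b + 1)" by (force dest: b(2))
  then show thesis using b(1) by (intro that[of "b + 1"]) simp_all
qed

text \<open>\<open>is_DtN\<close> is tested with extensions of bounded support. Cutting off the
  exterior solution of a second datum provides such an extension, with an explicit gradient.\<close>

lemma exterior_extension:
  assumes w: "exterior_solution k Dt \<psi> w" and R: "0 < R" "closure Dt \<subseteq> ball 0 R"
  shows "trace_on (- closure Dt) (frontier Dt) (\<lambda>x. cpx (ball_step 0 R x) * w x) \<psi>"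
    and "bounded {x. cpx (ball_step 0 R x) * w x \<noteq> 0}"
    and "AE x in leb (- closure Dt). wgrad (- closure Dt) (\<lambda>x. cpx (ball_step 0 R x) * w x) x =
      cutoff_grad (ball_step 0 R) w (cgrad w) x"
proof -
  let ?E = "- closure Dt" and ?\<eta> = "ball_step (0::real ^ 'n) R" and ?R = "2 * R + 1"
  let ?U = "?E \<inter> ball 0 ?R"
  note \<eta> = ball_step_test[where 'n='n, OF R(1)] and supp = ball_step_support[where 'n='n, OF R(1)]
  note fin = finite_surface_Dt[OF dim2 geo]
  have E: "open ?E" by (rule open_Compl[OF closed_closure])
  have U: "open ?U" by (intro open_Int E open_ball)
  have "ball 0 R \<subseteq> ball (0::real ^ 'n) ?R" using R(1) by (intro subset_ball) simp
  then have "closure Dt \<subseteq> ball 0 ?R" using R(2) by (rule order_trans[rotated])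
  then have "trace_on ?U (frontier Dt) w \<psi>" using w by (simp add: exterior_solution_def)
  then have "trace_on ?E (frontier Dt) (\<lambda>x. cpx (?\<eta> x) * w x) (\<lambda>x. cpx (?\<eta> x) * \<psi> x)"
    by (intro trace_on_cutoff[OF \<eta> U E _ _ fin _ order_refl]) (use supp in \<open>auto dest!: subsetD\<close>)
  moreover have "?\<eta> x = 1" if "x \<in> frontier Dt" for x
  proof -
    have "x \<in> ball 0 R" using that R(2) by (auto simp: frontier_def simp del: mem_ball)
    then have "x \<in> cball 0 R" by simp
    then show ?thesis using R(1) by (intro ball_step_eq_1)
  qed
  ultimately show tr: "trace_on ?E (frontier Dt) (\<lambda>x. cpx (?\<eta> x) * w x) \<psi>"
    using trace_on_cong[of ?E "\<lambda>x. cpx (?\<eta> x) * w x" "\<lambda>x. cpx (?\<eta> x) * w x" "frontier Dt" "\<lambda>x. cpx (?\<eta> x) * \<psi> x" \<psi>] by simp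
  have "{x. cpx (?\<eta> x) * w x \<noteq> 0} \<subseteq> cball 0 (2 * R)"
    using supp closure_subset[of "{x. ?\<eta> x \<noteq> 0}"] by auto
  then show "bounded {x. cpx (?\<eta> x) * w x \<noteq> 0}" using bounded_subset[OF bounded_cball] by blast
  have w1: "Ck_on 1 ?E w" and wd: "\<And>x. x \<in> ?E \<Longrightarrow> w differentiable (at x)"
    using Ck_on_2D[OF _ E, of w] w by (auto simp: exterior_solution_def)
  have C1: "Ck_on 1 ?E (\<lambda>x. w x * cpx (?\<eta> x))"
    by (rule Ck_on_mult_of_real[OF E w1]) (rule Ck_on_subset[OF test_functions_D(1)[OF \<eta>]], simp)
  have "is_weak_grad ?E (\<lambda>x. cpx (?\<eta> x) * w x) (wgrad ?E (\<lambda>x. cpx (?\<eta> x) * w x))"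
    by (rule is_weak_grad_wgrad[OF trace_onD(1)[OF tr]])
  then have "AE x in leb ?E. wgrad ?E (\<lambda>x. cpx (?\<eta> x) * w x) x = cgrad (\<lambda>x. cpx (?\<eta> x) * w x) x"
    using C1 by (intro weak_grad_classical_AE[OF E]) (simp_all only: mult.commute)
  moreover have "cgrad (\<lambda>x. cpx (?\<eta> x) * w x) x = cutoff_grad ?\<eta> w (cgrad w) x" if "x \<in> ?E" for x
    using frechet_derivative_mult_of_real[OF wd[OF that] test_functions_differentiable[OF \<eta>]]
    by (simp add: cgrad_def cutoff_grad_def Finite_Cartesian_Product.vec_eq_iff mult.commute)
  ultimately show "AE x in leb ?E. wgrad ?E (\<lambda>x. cpx (?\<eta> x) * w x) x = cutoff_grad ?\<eta> w (cgrad w) x"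
    by (auto simp: AE_restrict_space_iff elim!: eventually_mono)
qed

lemma DtN_pairing:
  assumes u: "exterior_solution k Dt \<phi> u" and v: "trace_on (- closure Dt) (frontier Dt) v \<psi>"
    and G: "AE x in leb (- closure Dt). wgrad (- closure Dt) v x = G x" "G \<in> borel_measurable (leb (- closure Dt))"
  shows "(\<integral>x. (cdot (cgrad u x) (cvec_cnj (wgrad (- closure Dt) v x)) - (cpx k)\<^sup>2 * u x * cnj (v x)) \<partial>leb (- closure Dt)) =
    (\<integral>x. (cdot (cgrad u x) (cvec_cnj (G x)) - (cpx k)\<^sup>2 * u x * cnj (v x)) \<partial>leb (- closure Dt))"
proof (rule integral_cong_AE)
  let ?E = "- closure Dt"
  have E: "open ?E" by (rule open_Compl[OF closed_closure])
  have u2: "Ck_on 2 ?E u" using u by (simp add: exterior_solution_def)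
  have E': "?E \<in> sets lebesgue" using E by auto
  have mu: "cgrad u \<in> borel_measurable (leb ?E)"
    by (rule continuous_imp_measurable_on_sets_lebesgue[OF continuous_on_cgrad[OF Ck_on_2D(1)[OF u2 E]] E'])
  have mu': "u \<in> borel_measurable (leb ?E)"
    by (rule continuous_imp_measurable_on_sets_lebesgue[OF Ck_on_2D(3)[OF u2 E] E'])
  have mv: "(\<lambda>x. cnj (v x)) \<in> borel_measurable (leb ?E)"
    by (rule L2_D(1)[OF L2_cnj[OF H1_L2[OF trace_onD(1)[OF v]]]])
  have m: "(\<lambda>x. cdot (cgrad u x) (cvec_cnj (G x)) - (cpx k)\<^sup>2 * u x * cnj (v x)) \<in> borel_measurable (leb ?E)"
    if "G \<in> borel_measurable (leb ?E)" for G
    by (intro borel_measurable_diff cdot_measurable cvec_cnj_measurable that mu borel_measurable_times mu' mv borel_measurable_const)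
  show "(\<lambda>x. cdot (cgrad u x) (cvec_cnj (wgrad ?E v x)) - (cpx k)\<^sup>2 * u x * cnj (v x)) \<in> borel_measurable (leb ?E)"
    by (rule m[OF L2_D(1)[OF wgrad_L2[OF trace_onD(1)[OF v]]]])
  show "(\<lambda>x. cdot (cgrad u x) (cvec_cnj (G x)) - (cpx k)\<^sup>2 * u x * cnj (v x)) \<in> borel_measurable (leb ?E)"
    by (rule m[OF G(2)])
  show "AE x in leb ?E. cdot (cgrad u x) (cvec_cnj (wgrad ?E v x)) - (cpx k)\<^sup>2 * u x * cnj (v x) =
      cdot (cgrad u x) (cvec_cnj (G x)) - (cpx k)\<^sup>2 * u x * cnj (v x)"
    using G(1) by eventually_elim simp
qed

lemma cutoff_grad_measurable:
  assumes w: "exterior_solution k Dt \<psi> w" and R: "0 < R"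
  shows "cutoff_grad (ball_step 0 R) w (cgrad w) \<in> borel_measurable (leb (- closure Dt))"
proof (rule continuous_imp_measurable_on_sets_lebesgue)
  let ?E = "- closure Dt"
  have E: "open ?E" by (rule open_Compl[OF closed_closure])
  then show "?E \<in> sets lebesgue" by auto
  have w2: "Ck_on 2 ?E w" using w by (simp add: exterior_solution_def)
  note \<eta> = ball_step_test[where 'n='n, OF R]
  have c: "continuous_on ?E (ball_step (0::real ^ 'n) R)" "continuous_on ?E (partial i (ball_step (0::real ^ 'n) R))" for i
    using test_functions_continuous[OF \<eta>] test_functions_continuous[OF test_functions_derivative[OF \<eta>]]
    by (blast intro: continuous_on_subset)+
  show "continuous_on ?E (cutoff_grad (ball_step 0 R) w (cgrad w))"
    unfolding cutoff_grad_def cgrad_def using c Ck_on_2D(3,4)[OF w2 E]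
    by (intro continuous_on_vec_lambda) (simp add: continuous_intros)
qed

text \<open>Each datum is paired with the conjugate of the cut-off solution of the other one. The
  two integrands differ by the gradient of the cutoff times w \<nabla>u - u \<nabla>w, that is, by
  the integrand of \<open>shell_wronskian\<close>, and this integrates to zero. The primed functions
  are arbitrary representatives of the conjugate traces.\<close>

lemma DtN_symmetric:
  assumes k: "0 < k" and T: "is_DtN k Dt T"
    and H: "\<phi> \<in> H_half Dt" "\<psi> \<in> H_half Dt" "\<phi>' \<in> H_half Dt" "\<psi>' \<in> H_half Dt"
    and cn: "AE x in surface (frontier Dt). \<phi>' x = cnj (\<phi> x)" "AE x in surface (frontier Dt). \<psi>' x = cnj (\<psi> x)"
  shows "T \<phi> \<psi>' = T \<psi> \<phi>'"
proof -
  let ?E = "- closure Dt"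
  have E: "open ?E" by (rule open_Compl[OF closed_closure])
  note fin = finite_surface_Dt[OF dim2 geo]
  obtain R where R: "0 < R" "closure Dt \<subseteq> ball 0 R" by (rule exterior_radius)
  let ?\<eta> = "ball_step (0::real ^ 'n) R"
  let ?I = "\<lambda>u w x. cdot (cgrad u x) (cutoff_grad ?\<eta> w (cgrad w) x) - (cpx k)\<^sup>2 * u x * (cpx (?\<eta> x) * w x)"
  have pair: "T \<phi> \<psi>' = - (\<integral>x. ?I u w x \<partial>leb ?E)"
    if u: "exterior_solution k Dt \<phi> u" "DtN_represents k Dt T \<phi> u"
      and w: "exterior_solution k Dt \<psi> w" and \<psi>': "\<psi>' \<in> H_half Dt" "AE x in surface (frontier Dt). \<psi>' x = cnj (\<psi> x)"
    for \<phi> \<psi> \<psi>' u w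
  proof -
    note ext = exterior_extension[OF w R]
    let ?v = "\<lambda>x. cnj (cpx (?\<eta> x) * w x)"
    have "trace_on ?E (frontier Dt) ?v (\<lambda>x. cnj (\<psi> x))" by (rule trace_on_cnj[OF E ext(1)])
    then have v: "trace_on ?E (frontier Dt) ?v \<psi>'"
      by (rule trace_on_AE_cong[OF _ fin L2_D(1)[OF H_half_L2[OF dim2 geo \<psi>'(1)]]]) (use \<psi>'(2) in eventually_elim, simp)
    have b: "bounded {x. ?v x \<noteq> 0}" using ext(2) by simp
    have "T \<phi> \<psi>' = - (\<integral>x. (cdot (cgrad u x) (cvec_cnj (wgrad ?E ?v x)) - (cpx k)\<^sup>2 * u x * cnj (?v x)) \<partial>leb ?E)"
      by (rule u(2)[unfolded DtN_represents_def, THEN bspec, THEN spec, THEN mp, OF \<psi>'(1) conjI[OF b v]])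
    also have "(\<integral>x. (cdot (cgrad u x) (cvec_cnj (wgrad ?E ?v x)) - (cpx k)\<^sup>2 * u x * cnj (?v x)) \<partial>leb ?E) =
        (\<integral>x. (cdot (cgrad u x) (cvec_cnj (cvec_cnj (cutoff_grad ?\<eta> w (cgrad w) x))) - (cpx k)\<^sup>2 * u x * cnj (?v x)) \<partial>leb ?E)"
    proof (rule DtN_pairing[OF u(1) v])
      have "AE x in leb ?E. wgrad ?E ?v x = cvec_cnj (wgrad ?E (\<lambda>x. cpx (?\<eta> x) * w x) x)"
        by (rule wgrad_AE[OF E H1_cnj(2)[OF E trace_onD(1)[OF ext(1)]]])
      then show "AE x in leb ?E. wgrad ?E ?v x = cvec_cnj (cutoff_grad ?\<eta> w (cgrad w) x)"
        using ext(3) by eventually_elim simp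
      show "(\<lambda>x. cvec_cnj (cutoff_grad ?\<eta> w (cgrad w) x)) \<in> borel_measurable (leb ?E)"
        by (rule cvec_cnj_measurable[OF cutoff_grad_measurable[OF w R(1)]])
    qed
    finally show ?thesis by simp
  qed
  obtain u where u: "exterior_solution k Dt \<phi> u" "DtN_represents k Dt T \<phi> u"
    using T H(1) unfolding is_DtN_def DtN_represents_def by blast
  obtain w where w: "exterior_solution k Dt \<psi> w" "DtN_represents k Dt T \<psi> w"
    using T H(2) unfolding is_DtN_def DtN_represents_def by blast
  note hu = exterior_solution_helmholtz[OF u(1)] and hw = exterior_solution_helmholtz[OF w(1)]
  let ?S = "\<lambda>x. cpx (shell R x) * (w x * fderiv u x x - u x * fderiv w x x)"
  have R': "- ?E \<subseteq> ball 0 R" using R(2) by simp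
  have cf: "continuous_on ?E (\<lambda>x. w x * fderiv u x x - u x * fderiv w x x)"
    by (intro continuous_intros continuous_on_radial_derivative[OF E hu(1)] continuous_on_radial_derivative[OF E hw(1)]
      helmholtz_on_continuous[OF E hu(1)] helmholtz_on_continuous[OF E hw(1)])
  have S: "integrable (leb ?E) ?S" using integrable_shell[OF E R(1) R' cf] by (simp add: scaleR_conv_of_real)
  have S0: "(\<integral>x. ?S x \<partial>leb ?E) = 0"
    using shell_wronskian_zero[OF k E hu hw R(1) R'] by (simp add: shell_wronskian_def)
  have eq: "?I u w x = ?I w u x - ?S x" if x: "x \<in> ?E" for x
  proof -
    have d: "u differentiable (at x)" "w differentiable (at x)"
      using Ck_on_2D(5)[OF _ E x] hu(1) hw(1) by (auto simp: helmholtz_on_def)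
    have "?I u w x - ?I w u x = (\<Sum>i\<in>UNIV. cpx (partial i ?\<eta> x) * (w x * partial i u x - u x * partial i w x))"
      by (simp add: cdot_def cutoff_grad_def cgrad_def algebra_simps sum.distrib sum_subtractf)
    also have "\<dots> = - ?S x" by (rule shell_wronskian_integrand[OF d])
    finally show ?thesis by (simp add: algebra_simps)
  qed
  have "(\<integral>x. ?I u w x \<partial>leb ?E) = (\<integral>x. ?I w u x - ?S x \<partial>leb ?E)"
    by (rule Bochner_Integration.integral_cong) (use eq in auto)
  also have "\<dots> = (\<integral>x. ?I w u x \<partial>leb ?E)"
  \<comment> \<open>The shell term is integrable, so both sides are integrable or neither is; in the
    latter case both integrals have the default value 0.\<close>
  proof (cases "integrable (leb ?E) (?I w u)")
    case True
    show ?thesis unfolding Bochner_Integration.integral_diff[OF True S] S0 by simp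
  next
    case False
    have ni: "\<not> integrable (leb ?E) (\<lambda>x. ?I w u x - ?S x)"
    proof
      assume "integrable (leb ?E) (\<lambda>x. ?I w u x - ?S x)"
      from Bochner_Integration.integrable_add[OF this S] show False using False by simp
    qed
    show ?thesis by (rule trans[OF not_integrable_integral_eq[OF ni] not_integrable_integral_eq[OF False, symmetric]])
  qed
  finally show ?thesis using pair[OF u w(1) H(4) cn(2)] pair[OF w u(1) H(3) cn(1)] by simp
qed

text \<open>The extension of the second argument may be chosen freely, so a combination of cut-off
  exterior solutions is admissible for a combination of data. Splitting the integral requires each
  piece to be integrable.\<close>

lemma DtN_antilinear:
  assumes T: "is_DtN k Dt T" and H: "\<phi> \<in> H_half Dt" "\<And>j. j \<in> I \<Longrightarrow> \<psi> j \<in> H_half Dt" "\<chi>' \<in> H_half Dt" and I: "finite I"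
    and eq: "AE x in surface (frontier Dt). \<chi>' x = (\<Sum>j\<in>I. c j * \<psi> j x)"
  shows "T \<phi> \<chi>' = (\<Sum>j\<in>I. cnj (c j) * T \<phi> (\<psi> j))"
proof -
  let ?E = "- closure Dt"
  have E: "open ?E" by (rule open_Compl[OF closed_closure])
  have Es: "?E \<in> sets lebesgue" using E by auto
  note fin = finite_surface_Dt[OF dim2 geo]
  obtain R where R: "0 < R" "closure Dt \<subseteq> ball 0 R" by (rule exterior_radius)
  let ?\<eta> = "ball_step (0::real ^ 'n) R" and ?R = "2 * R + 1"
  let ?U = "?E \<inter> ball 0 ?R"
  have U: "open ?U" by (intro open_Int E open_ball)
  have Us: "?U \<in> sets lebesgue" using U by auto
  have supp: "closure {x. ?\<eta> x \<noteq> 0} \<subseteq> ball 0 ?R"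
    using ball_step_support[where 'n='n, OF R(1)] by (auto dest!: subsetD)
  obtain u where u: "exterior_solution k Dt \<phi> u" and Tu: "DtN_represents k Dt T \<phi> u"
    using T H(1) unfolding is_DtN_def DtN_represents_def by blast
  have "\<forall>j\<in>I. \<exists>w. exterior_solution k Dt (\<psi> j) w" using T H(2) unfolding is_DtN_def DtN_represents_def by blast
  then obtain w where w: "\<And>j. j \<in> I \<Longrightarrow> exterior_solution k Dt (\<psi> j) (w j)" by metis
  have "ball 0 R \<subseteq> ball (0::real ^ 'n) ?R" using R(1) by (intro subset_ball) simp
  then have tu: "trace_on ?U (frontier Dt) u \<phi>" using u R(2) by (auto simp: exterior_solution_def)
  define v where "v j x = cpx (?\<eta> x) * w j x" for j x
  define G where "G j = cutoff_grad ?\<eta> (w j) (cgrad (w j))" for j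
  note ext = exterior_extension[OF w R, folded v_def G_def]
  have Gm: "G j \<in> borel_measurable (leb ?E)" if "j \<in> I" for j
    unfolding G_def by (rule cutoff_grad_measurable[OF w[OF that] R(1)])
  have G2: "G j \<in> L2 (leb ?E)" if "j \<in> I" for j
    by (rule L2_cong_AE[OF wgrad_L2[OF trace_onD(1)[OF ext(1)[OF that]]] Gm[OF that] ext(3)[OF that]])
  let ?J = "\<lambda>j x. cdot (cgrad u x) (cvec_cnj (G j x)) - (cpx k)\<^sup>2 * u x * cnj (v j x)"
  \<comment> \<open>\<open>exterior_solution\<close> puts u in H1 on bounded parts of the exterior,
    up to the boundary. Its weak gradient there is the classical one, which is therefore
    square-integrable on the support of the cutoff.\<close>
  have cu: "cgrad u \<in> L2 (leb ?U)"
  proof (rule L2_cong_AE[OF wgrad_L2[OF trace_onD(1)[OF tu]]])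
    have u2: "Ck_on 2 ?U u" by (rule Ck_on_subset[of _ ?E]) (use u in \<open>auto simp: exterior_solution_def\<close>)
    show "AE x in leb ?U. wgrad ?U u x = cgrad u x"
      by (rule weak_grad_classical_AE[OF U Ck_on_2D(1)[OF u2 U] is_weak_grad_wgrad[OF trace_onD(1)[OF tu]]])
    show "cgrad u \<in> borel_measurable (leb ?U)"
      by (rule continuous_imp_measurable_on_sets_lebesgue[OF continuous_on_cgrad[OF Ck_on_2D(1)[OF u2 U]] Us])
  qed
  have J: "integrable (leb ?E) (?J j)" if j: "j \<in> I" for j
  proof -
    have "integrable (leb ?U) (\<lambda>x. cdot (cgrad u x) (cvec_cnj (G j x)))"
    proof (rule L2_product(1)[OF cu _ _ _ zero_le_one])
      show g: "G j \<in> L2 (leb ?U)" by (rule L2_subset[OF G2[OF j]]) (use Us Es in auto)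
      show "(\<lambda>x. cdot (cgrad u x) (cvec_cnj (G j x))) \<in> borel_measurable (leb ?U)"
        by (intro cdot_measurable cvec_cnj_measurable L2_D(1)[OF g] L2_D(1)[OF cu])
      show "AE x in leb ?U. cmod (cdot (cgrad u x) (cvec_cnj (G j x))) \<le> 1 * (norm (cgrad u x) * norm (G j x))"
        using norm_cdot_le[of "cgrad u x" "cvec_cnj (G j x)" for x] by simp
    qed
    moreover have "(\<lambda>x. cnj (v j x)) \<in> L2 (leb ?U)"
      by (rule L2_cnj[OF L2_subset[OF H1_L2[OF trace_onD(1)[OF ext(1)[OF j]]]]]) (use Us Es in auto)
    then have "integrable (leb ?U) (\<lambda>x. (cpx k)\<^sup>2 * u x * cnj (v j x))"
      by (intro L2_integrable_mult(1) L2_cmult H1_L2[OF trace_onD(1)[OF tu]])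
    ultimately have "integrable (leb ?U) (?J j)" by (rule Bochner_Integration.integrable_diff)
    moreover have "?J j x = 0" if "x \<in> ?E - ?U" for x
    proof -
      have x: "x \<notin> closure {x. ?\<eta> x \<noteq> 0}" using that supp by blast
      have "?\<eta> x = 0" by (rule test_functions_outside[OF ball_step_test[OF R(1)] x])
      then show ?thesis
        by (simp add: v_def G_def cutoff_grad_def cdot_def frechet_derivative_zero_outside[OF x])
    qed
    ultimately show ?thesis by (subst on_superset(2)[of ?U ?E]) (use Us Es in auto)
  qed
  have TJ: "T \<phi> (\<psi> j) = - (\<integral>x. ?J j x \<partial>leb ?E)" if j: "j \<in> I" for j
  proof -
    have "bounded {x. v j x \<noteq> 0}" using ext(2)[OF j] unfolding v_def .
    from Tu[unfolded DtN_represents_def, THEN bspec, THEN spec, THEN mp, OF H(2)[OF j] conjI[OF this ext(1)[OF j]]]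
    show ?thesis unfolding DtN_pairing[OF u ext(1)[OF j] ext(3)[OF j] Gm[OF j]] .
  qed
  let ?v = "\<lambda>x. \<Sum>j\<in>I. c j * v j x" and ?G = "\<lambda>x. \<Sum>j\<in>I. c j *s G j x"
  have tv: "trace_on ?E (frontier Dt) ?v \<chi>'"
    by (rule trace_on_AE_cong[OF trace_on_sum[OF E fin ext(1)] fin L2_D(1)[OF H_half_L2[OF dim2 geo H(3)]]])
      (use eq in \<open>simp_all add: eq_commute\<close>)
  have bv: "bounded {x. ?v x \<noteq> 0}"
  proof (rule bounded_subset)
    show "bounded (\<Union>j\<in>I. {x. v j x \<noteq> 0})" using ext(2) I unfolding v_def by (intro bounded_UN) auto
    show "{x. ?v x \<noteq> 0} \<subseteq> (\<Union>j\<in>I. {x. v j x \<noteq> 0})"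
    proof (rule subsetI, rule ccontr)
      fix x assume x: "x \<in> {x. ?v x \<noteq> 0}" "x \<notin> (\<Union>j\<in>I. {x. v j x \<noteq> 0})"
      from x(2) have "?v x = 0" by (intro sum.neutral) simp
      with x(1) show False by simp
    qed
  qed
  have Hv: "v j \<in> H1 ?E" if "j \<in> I" for j by (rule trace_onD(1)[OF ext(1)[OF that]])
  have "AE x in leb ?E. \<forall>j\<in>I. wgrad ?E (v j) x = G j x"
    using ext(3) I by (simp add: AE_finite_all)
  moreover have "AE x in leb ?E. wgrad ?E ?v x = (\<Sum>j\<in>I. c j *s wgrad ?E (v j) x)"
    by (rule wgrad_AE[OF E H1_sum(2)[OF E Hv]])
  ultimately have wG: "AE x in leb ?E. wgrad ?E ?v x = ?G x"
  proof eventually_elim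
    case (elim x)
    then have "wgrad ?E ?v x = (\<Sum>j\<in>I. c j *s wgrad ?E (v j) x)" by simp
    also have "\<dots> = ?G x" by (rule sum.cong[OF refl]) (use elim in simp)
    finally show ?case .
  qed
  have GM: "?G \<in> borel_measurable (leb ?E)"
  proof -
    have "(\<lambda>x. c j *s g x) \<in> borel_measurable M" if "g \<in> borel_measurable M" for j M and g :: "_ \<Rightarrow> complex ^ 'n"
      by (rule measurable_compose[OF that borel_measurable_continuous_onI]) (auto simp: vector_scalar_mult_def intro!: continuous_intros)
    then show ?thesis using Gm by (intro borel_measurable_sum) auto
  qed
  have "T \<phi> \<chi>' = - (\<integral>x. (cdot (cgrad u x) (cvec_cnj (wgrad ?E ?v x)) - (cpx k)\<^sup>2 * u x * cnj (?v x)) \<partial>leb ?E)"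
    by (rule Tu[unfolded DtN_represents_def, THEN bspec, THEN spec, THEN mp, OF H(3) conjI[OF bv tv]])
  also have "\<dots> = - (\<integral>x. (cdot (cgrad u x) (cvec_cnj (?G x)) - (cpx k)\<^sup>2 * u x * cnj (?v x)) \<partial>leb ?E)"
    using DtN_pairing[OF u tv wG GM] by simp
  also have "(\<integral>x. (cdot (cgrad u x) (cvec_cnj (?G x)) - (cpx k)\<^sup>2 * u x * cnj (?v x)) \<partial>leb ?E) =
      (\<integral>x. (\<Sum>j\<in>I. cnj (c j) * ?J j x) \<partial>leb ?E)"
  proof (rule Bochner_Integration.integral_cong[OF refl])
    fix x
    have "cdot (cgrad u x) (cvec_cnj (?G x)) = (\<Sum>j\<in>I. cnj (c j) * cdot (cgrad u x) (cvec_cnj (G j x)))"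
      by (simp only: cvec_cnj_sum cvec_cnj_smult cdot_sum_right cdot_smult_right)
    moreover have "(cpx k)\<^sup>2 * u x * cnj (?v x) = (\<Sum>j\<in>I. cnj (c j) * ((cpx k)\<^sup>2 * u x * cnj (v j x)))"
      by (simp add: sum_distrib_left mult_ac)
    ultimately show "cdot (cgrad u x) (cvec_cnj (?G x)) - (cpx k)\<^sup>2 * u x * cnj (?v x) = (\<Sum>j\<in>I. cnj (c j) * ?J j x)"
      by (simp only: right_diff_distrib sum_subtractf)
  qed
  also have "\<dots> = (\<Sum>j\<in>I. cnj (c j) * (\<integral>x. ?J j x \<partial>leb ?E))"
  proof (subst Bochner_Integration.integral_sum)
    show "integrable (leb ?E) (\<lambda>x. cnj (c j) * ?J j x)" if "j \<in> I" for j
      by (rule Bochner_Integration.integrable_mult_right[OF J[OF that]])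
    show "(\<Sum>j\<in>I. \<integral>x. cnj (c j) * ?J j x \<partial>leb ?E) = (\<Sum>j\<in>I. cnj (c j) * (\<integral>x. ?J j x \<partial>leb ?E))"
      by (simp only: integral_mult_right_zero)
  qed
  finally show ?thesis using TJ by (simp add: sum_negf)
qed

end

section \<open>The boundary operator on traces\<close>

definition boundary_condition :: "real \<Rightarrow> (real ^ 'n::finite) set \<Rightarrow> 'n boundary_op \<Rightarrow> bool" where
  "boundary_condition k Dt T \<longleftrightarrow> is_impedance k Dt T \<or> is_DtN k Dt T"

context
  fixes Dm Dt :: "(real ^ 'n::finite) set"
  assumes dim2: "2 \<le> CARD('n)" and geo: "geometry Dm Dt"
begin

lemma boundary_symmetric:
  assumes k: "0 < k" and T: "boundary_condition k Dt T"
    and H: "\<phi> \<in> H_half Dt" "\<psi> \<in> H_half Dt" "\<phi>' \<in> H_half Dt" "\<psi>' \<in> H_half Dt"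
    and cn: "AE x in surface (frontier Dt). \<phi>' x = cnj (\<phi> x)" "AE x in surface (frontier Dt). \<psi>' x = cnj (\<psi> x)"
  shows "T \<phi> \<psi>' = T \<psi> \<phi>'"
  using T unfolding boundary_condition_def
proof
  assume T: "is_impedance k Dt T"
  note l = H_half_L2[OF dim2 geo]
  have m: "(\<lambda>x. \<i> * cpx k * f x * cnj (g x)) \<in> borel_measurable (surface (frontier Dt))"
    if "f \<in> H_half Dt" "g \<in> H_half Dt" for f g
    by (intro borel_measurable_times borel_measurable_const L2_D(1)[OF L2_cnj[OF l]] L2_D(1)[OF l] that)
  have "T \<phi> \<psi>' = (\<integral>x. (\<i> * cpx k * \<phi> x) * cnj (\<psi>' x) \<partial>surface (frontier Dt))"
    using T H by (simp add: is_impedance_def)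
  also have "\<dots> = (\<integral>x. (\<i> * cpx k * \<psi> x) * cnj (\<phi>' x) \<partial>surface (frontier Dt))"
  proof (rule integral_cong_AE)
    show "AE x in surface (frontier Dt). \<i> * cpx k * \<phi> x * cnj (\<psi>' x) = \<i> * cpx k * \<psi> x * cnj (\<phi>' x)"
      using cn by eventually_elim simp
  qed (rule m[OF H(1,4)] m[OF H(2,3)])+
  also have "\<dots> = T \<psi> \<phi>'" using T H by (simp add: is_impedance_def)
  finally show ?thesis .
next
  assume "is_DtN k Dt T"
  from DtN_symmetric[OF dim2 geo k this H cn] show ?thesis .
qed

lemma boundary_antilinear:
  assumes T: "boundary_condition k Dt T" and H: "\<phi> \<in> H_half Dt" "\<And>j. j \<in> I \<Longrightarrow> \<psi> j \<in> H_half Dt" "\<chi>' \<in> H_half Dt" and I: "finite I"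
    and eq: "AE x in surface (frontier Dt). \<chi>' x = (\<Sum>j\<in>I. c j * \<psi> j x)"
  shows "T \<phi> \<chi>' = (\<Sum>j\<in>I. cnj (c j) * T \<phi> (\<psi> j))"
  using T unfolding boundary_condition_def
proof
  assume T: "is_impedance k Dt T"
  let ?M = "surface (frontier Dt)"
  note l = H_half_L2[OF dim2 geo]
  have int: "integrable ?M (\<lambda>x. \<i> * cpx k * \<phi> x * cnj (\<psi> j x))" if "j \<in> I" for j
    by (intro L2_integrable_mult(1) L2_cmult L2_cnj l H that)
  have "T \<phi> \<chi>' = (\<integral>x. (\<i> * cpx k * \<phi> x) * cnj (\<chi>' x) \<partial>?M)"
    using T H by (simp add: is_impedance_def)
  also have "\<dots> = (\<integral>x. (\<Sum>j\<in>I. cnj (c j) * (\<i> * cpx k * \<phi> x * cnj (\<psi> j x))) \<partial>?M)"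
  proof (rule integral_cong_AE)
    show "AE x in ?M. \<i> * cpx k * \<phi> x * cnj (\<chi>' x) = (\<Sum>j\<in>I. cnj (c j) * (\<i> * cpx k * \<phi> x * cnj (\<psi> j x)))"
      using eq by eventually_elim (simp add: sum_distrib_left mult_ac)
    show "(\<lambda>x. \<i> * cpx k * \<phi> x * cnj (\<chi>' x)) \<in> borel_measurable ?M"
      by (intro borel_measurable_times borel_measurable_const L2_D(1)[OF L2_cnj[OF l]] L2_D(1)[OF l] H)
    show "(\<lambda>x. \<Sum>j\<in>I. cnj (c j) * (\<i> * cpx k * \<phi> x * cnj (\<psi> j x))) \<in> borel_measurable ?M"
      by (rule borel_measurable_sum[OF borel_measurable_integrable[OF Bochner_Integration.integrable_mult_right[OF int]]])
  qed
  also have "\<dots> = (\<Sum>j\<in>I. cnj (c j) * (\<integral>x. \<i> * cpx k * \<phi> x * cnj (\<psi> j x) \<partial>?M))"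
  proof (subst Bochner_Integration.integral_sum)
    show "integrable ?M (\<lambda>x. cnj (c j) * (\<i> * cpx k * \<phi> x * cnj (\<psi> j x)))" if "j \<in> I" for j
      by (rule Bochner_Integration.integrable_mult_right[OF int[OF that]])
  qed (simp only: integral_mult_right_zero)
  also have "\<dots> = (\<Sum>j\<in>I. cnj (c j) * T \<phi> (\<psi> j))"
    using T H by (intro sum.cong refl) (simp add: is_impedance_def)
  finally show ?thesis .
next
  assume "is_DtN k Dt T"
  from DtN_antilinear[OF dim2 geo this H I eq] show ?thesis .
qed

lemma dtrace_H_half: "v \<in> H10D Dm Dt \<Longrightarrow> dtrace (dom_D Dm Dt) v \<in> H_half Dt"
  by (rule trace_H_half[OF dim2 geo H10D_D(2)[OF dim2 geo]])

lemma boundary_dtrace_symmetric: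
  assumes k: "0 < k" and T: "boundary_condition k Dt T" and w: "w \<in> H10D Dm Dt" and v: "v \<in> H10D Dm Dt"
  shows "T (dtrace (dom_D Dm Dt) w) (dtrace (dom_D Dm Dt) (\<lambda>x. cnj (v x))) =
    T (dtrace (dom_D Dm Dt) v) (dtrace (dom_D Dm Dt) (\<lambda>x. cnj (w x)))"
  by (rule boundary_symmetric[OF k T dtrace_H_half[OF w] dtrace_H_half[OF v]
    dtrace_H_half[OF H10D_cnj(1)[OF dim2 geo w]] dtrace_H_half[OF H10D_cnj(1)[OF dim2 geo v]]
    H10D_cnj(2)[OF dim2 geo w] H10D_cnj(2)[OF dim2 geo v]])

text \<open>Symmetry moves the sum into the second argument, antilinearity takes it apart there, and
  symmetry moves each term back. The two conjugations restore the coefficients.\<close>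

lemma boundary_dtrace_sum:
  assumes k: "0 < k" and T: "boundary_condition k Dt T" and I: "finite I"
    and w: "\<And>j. j \<in> I \<Longrightarrow> w j \<in> H10D Dm Dt" and v: "v \<in> H10D Dm Dt"
  shows "T (dtrace (dom_D Dm Dt) (\<lambda>x. \<Sum>j\<in>I. c j * w j x)) (dtrace (dom_D Dm Dt) v) =
    (\<Sum>j\<in>I. c j * T (dtrace (dom_D Dm Dt) (w j)) (dtrace (dom_D Dm Dt) v))"
proof -
  let ?t = "dtrace (dom_D Dm Dt)" and ?v = "\<lambda>x. cnj (v x)" and ?w = "\<lambda>j x. cnj (w j x)"
  note cn = H10D_cnj(1)[OF dim2 geo]
  have cc: "(\<lambda>x. cnj (?v x)) = v" by simp
  have "T (?t (\<lambda>x. \<Sum>j\<in>I. c j * w j x)) (?t v) = T (?t ?v) (?t (\<lambda>x. cnj (\<Sum>j\<in>I. c j * w j x)))"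
    using boundary_dtrace_symmetric[OF k T H10D_sum(1)[OF dim2 geo w I] cn[OF v]] unfolding cc .
  also have "(\<lambda>x. cnj (\<Sum>j\<in>I. c j * w j x)) = (\<lambda>x. \<Sum>j\<in>I. cnj (c j) * ?w j x)" by simp
  also have "T (?t ?v) (?t (\<lambda>x. \<Sum>j\<in>I. cnj (c j) * ?w j x)) = (\<Sum>j\<in>I. cnj (cnj (c j)) * T (?t ?v) (?t (?w j)))"
    by (rule boundary_antilinear[OF T dtrace_H_half[OF cn[OF v]] dtrace_H_half[OF cn[OF w]]
      dtrace_H_half[OF H10D_sum(1)[OF dim2 geo cn[OF w] I]] I H10D_sum(2)[OF dim2 geo cn[OF w] I]])
  also have "\<dots> = (\<Sum>j\<in>I. c j * T (?t (w j)) (?t v))"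
  proof (rule sum.cong[OF refl])
    fix j assume "j \<in> I"
    have "T (?t ?v) (?t (?w j)) = T (?t (w j)) (?t v)"
      using boundary_dtrace_symmetric[OF k T cn[OF v] w[OF \<open>j \<in> I\<close>]] unfolding cc .
    then show "cnj (cnj (c j)) * T (?t ?v) (?t (?w j)) = c j * T (?t (w j)) (?t v)" by simp
  qed
  finally show ?thesis .
qed

end

text \<open>Bounded entries without definiteness: differences of two coefficients have to be covered
  as well.\<close>

definition Linf_mat :: "(real ^ 'n::finite) set \<Rightarrow> (real ^ 'n \<Rightarrow> real ^ 'n ^ 'n) \<Rightarrow> bool" where
  "Linf_mat U A \<longleftrightarrow> (\<forall>i j. (\<lambda>x. A x $ i $ j) \<in> Linf U)"

lemma Linf_D:
  assumes "f \<in> Linf U"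
  shows "f \<in> borel_measurable (leb U)" "\<exists>B\<ge>0. AE x in leb U. \<bar>f x\<bar> \<le> B"
proof -
  show "f \<in> borel_measurable (leb U)" using assms by (simp add: Linf_def)
  obtain B where "AE x in leb U. \<bar>f x\<bar> \<le> B" using assms by (auto simp: Linf_def)
  then have "AE x in leb U. \<bar>f x\<bar> \<le> \<bar>B\<bar>" by eventually_elim simp
  then show "\<exists>B\<ge>0. AE x in leb U. \<bar>f x\<bar> \<le> B" by (intro exI[of _ "\<bar>B\<bar>"]) simp
qed

lemma Linf_diff:
  assumes "f \<in> Linf U" "g \<in> Linf U"
  shows "(\<lambda>x. f x - g x) \<in> Linf U"
proof -
  obtain B C where B: "AE x in leb U. \<bar>f x\<bar> \<le> B" and C: "AE x in leb U. \<bar>g x\<bar> \<le> C"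
    using assms by (auto simp: Linf_def)
  from B C have "AE x in leb U. \<bar>f x - g x\<bar> \<le> B + C" by eventually_elim linarith
  moreover have "(\<lambda>x. f x - g x) \<in> borel_measurable (leb U)"
    using Linf_D(1)[OF assms(1)] Linf_D(1)[OF assms(2)] by measurable
  ultimately show ?thesis by (auto simp: Linf_def)
qed

lemma Linf_mult_L2:
  fixes f :: "real ^ 'n::finite \<Rightarrow> complex"
  assumes n: "n \<in> Linf U" and f: "f \<in> L2 (leb U)"
  shows "(\<lambda>x. cpx (n x) * f x) \<in> L2 (leb U)"
proof -
  obtain B where "0 \<le> B" "AE x in leb U. \<bar>n x\<bar> \<le> B" using Linf_D(2)[OF n] by blast
  then have "(\<lambda>x. n x *\<^sub>R f x) \<in> L2 (leb U)" using L2_bounded_mult(1)[OF f Linf_D(1)[OF n]] by blast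
  then show ?thesis by (simp add: scaleR_conv_of_real)
qed

lemma cmat_nth: "(cmat A *v \<xi>) $ i = (\<Sum>j\<in>UNIV. cpx (A $ i $ j) * \<xi> $ j)"
  by (simp add: matrix_vector_mult_def cmat_def)

lemma Linf_mat_mult_L2:
  fixes g :: "real ^ 'n::finite \<Rightarrow> complex ^ 'n"
  assumes A: "Linf_mat U A" and g: "g \<in> L2 (leb U)"
  shows "(\<lambda>x. cmat (A x) *v g x) \<in> L2 (leb U)"
proof -
  have "(\<lambda>x. \<chi> i. \<Sum>j\<in>UNIV. cpx (A x $ i $ j) * g x $ j) \<in> L2 (leb U)"
    using A unfolding Linf_mat_def by (intro L2_vecI L2_sum Linf_mult_L2 L2_vec_nth[OF g]) simp
  then show ?thesis by (simp add: matrix_vector_mult_def cmat_def)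
qed

lemma cdot_L2:
  fixes f g :: "'a \<Rightarrow> complex ^ 'n::finite"
  assumes f: "f \<in> L2 M" and g: "g \<in> L2 M"
  shows "integrable M (\<lambda>x. cdot (f x) (g x))" "cmod (\<integral>x. cdot (f x) (g x) \<partial>M) \<le> L2_norm M f * L2_norm M g"
proof -
  have "AE x in M. cmod (cdot (f x) (g x)) \<le> 1 * (norm (f x) * norm (g x))"
    by (rule AE_I2) (simp add: norm_cdot_le)
  note p = L2_product[OF f g cdot_measurable[OF L2_D(1)[OF f] L2_D(1)[OF g]] this zero_le_one]
  show "integrable M (\<lambda>x. cdot (f x) (g x))" by (rule p(1))
  show "cmod (\<integral>x. cdot (f x) (g x) \<partial>M) \<le> L2_norm M f * L2_norm M g" using p(2) by simp
qed

lemma cmat_symmetric: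
  fixes A :: "real ^ 'n::finite ^ 'n"
  assumes "Finite_Cartesian_Product.transpose A = A"
  shows "cdot (cmat A *v \<xi>) \<zeta> = cdot (cmat A *v \<zeta>) \<xi>"
proof -
  have s: "A $ i $ j = A $ j $ i" for i j :: 'n
    using arg_cong[OF assms, of "\<lambda>C. C $ j $ i"] by (simp add: Finite_Cartesian_Product.transpose_def)
  have "cdot (cmat A *v \<xi>) \<zeta> = (\<Sum>i\<in>UNIV. \<Sum>j\<in>UNIV. cpx (A $ i $ j) * \<xi> $ j * \<zeta> $ i)"
    by (simp add: cdot_def cmat_nth sum_distrib_right)
  also have "\<dots> = (\<Sum>j\<in>UNIV. \<Sum>i\<in>UNIV. cpx (A $ j $ i) * \<zeta> $ i * \<xi> $ j)"
    by (subst sum.swap) (intro sum.cong refl, simp add: s mult_ac)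
  also have "\<dots> = cdot (cmat A *v \<zeta>) \<xi>"
    by (simp add: cdot_def cmat_nth sum_distrib_right)
  finally show ?thesis .
qed

lemma cmat_mult_sum: "cmat A *v (\<Sum>j\<in>I. c j *s \<xi> j) = (\<Sum>j\<in>I. c j *s (cmat A *v \<xi> j))"
  unfolding Finite_Cartesian_Product.vec_eq_iff
  by (simp add: cmat_nth sum_component sum_distrib_left mult_ac) (intro allI, rule sum.swap)

section \<open>The sesquilinear form\<close>

lemma wgrad_sum:
  fixes U :: "(real ^ 'n::finite) set"
  assumes "open U" "\<And>j. j \<in> I \<Longrightarrow> u j \<in> H1 U"
  shows "AE x in leb U. wgrad U (\<lambda>x. \<Sum>j\<in>I. c j * u j x) x = (\<Sum>j\<in>I. c j *s wgrad U (u j) x)"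
  by (rule wgrad_AE[OF assms(1) H1_sum(2)[OF assms]])

lemma wgrad_cnj:
  fixes U :: "(real ^ 'n::finite) set"
  assumes "open U" "u \<in> H1 U"
  shows "AE x in leb U. wgrad U (\<lambda>x. cnj (u x)) x = cvec_cnj (wgrad U u x)"
  by (rule wgrad_AE[OF assms(1) H1_cnj(2)[OF assms]])

lemma grad_functional_integrand:
  fixes U :: "(real ^ 'n::finite) set"
  assumes "Linf_mat U A" "w \<in> H1 U" "v \<in> H1 U"
  shows "integrable (leb U) (\<lambda>x. cdot (cmat (A x) *v wgrad U w x) (cvec_cnj (wgrad U v x)))"
    and "cmod (grad_functional U A w v) \<le> norm2 U (\<lambda>x. cmat (A x) *v wgrad U w x) * norm2 U (wgrad U v)"
  using cdot_L2[OF Linf_mat_mult_L2[OF assms(1) wgrad_L2[OF assms(2)]] L2_cvec_cnj[OF wgrad_L2[OF assms(3)]]]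
  by (simp_all add: grad_functional_def L2_norm_def)

lemma grad_functional_sum:
  fixes U :: "(real ^ 'n::finite) set"
  assumes U: "open U" and A: "Linf_mat U A" and w: "\<And>j. j \<in> I \<Longrightarrow> w j \<in> H1 U" and v: "v \<in> H1 U"
  shows "grad_functional U A (\<lambda>x. \<Sum>j\<in>I. c j * w j x) v = (\<Sum>j\<in>I. c j * grad_functional U A (w j) v)"
proof -
  note int = grad_functional_integrand(1)[OF A _ v]
  let ?g = "\<lambda>w x. cdot (cmat (A x) *v wgrad U w x) (cvec_cnj (wgrad U v x))"
  have "grad_functional U A (\<lambda>x. \<Sum>j\<in>I. c j * w j x) v = (\<integral>x. (\<Sum>j\<in>I. c j * ?g (w j) x) \<partial>leb U)"
    unfolding grad_functional_def
  proof (rule integral_cong_AE)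
    show "?g (\<lambda>x. \<Sum>j\<in>I. c j * w j x) \<in> borel_measurable (leb U)"
      by (rule borel_measurable_integrable[OF int[OF H1_sum(1)[OF U w]]])
    show "(\<lambda>x. \<Sum>j\<in>I. c j * ?g (w j) x) \<in> borel_measurable (leb U)"
      by (rule borel_measurable_sum[OF borel_measurable_integrable[OF Bochner_Integration.integrable_mult_right[OF int[OF w]]]])
    show "AE x in leb U. ?g (\<lambda>x. \<Sum>j\<in>I. c j * w j x) x = (\<Sum>j\<in>I. c j * ?g (w j) x)"
    proof -
      have "AE x in leb U. wgrad U (\<lambda>x. \<Sum>j\<in>I. c j * w j x) x = (\<Sum>j\<in>I. c j *s wgrad U (w j) x)"
        by (rule wgrad_sum[OF U w])
      then show ?thesis
      by eventually_elim (simp add: cmat_mult_sum cdot_commute[of _ "cvec_cnj _"] cdot_sum_right cdot_smult_right)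
    qed
  qed
  also have "\<dots> = (\<Sum>j\<in>I. c j * grad_functional U A (w j) v)"
  proof (subst Bochner_Integration.integral_sum)
    show "integrable (leb U) (\<lambda>x. c j * ?g (w j) x)" if "j \<in> I" for j
      by (rule Bochner_Integration.integrable_mult_right[OF int[OF w[OF that]]])
  qed (simp only: integral_mult_right_zero grad_functional_def)
  finally show ?thesis .
qed

lemma grad_functional_symmetric:
  fixes U :: "(real ^ 'n::finite) set"
  assumes U: "open U" and A: "Linf_mat U A" "AE x in leb U. Finite_Cartesian_Product.transpose (A x) = A x"
    and w: "w \<in> H1 U" and v: "v \<in> H1 U"
  shows "grad_functional U A w (\<lambda>x. cnj (v x)) = grad_functional U A v (\<lambda>x. cnj (w x))"
  unfolding grad_functional_def
proof (rule integral_cong_AE)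
  note int = borel_measurable_integrable[OF grad_functional_integrand(1)[OF A(1)]]
  show "(\<lambda>x. cdot (cmat (A x) *v wgrad U w x) (cvec_cnj (wgrad U (\<lambda>x. cnj (v x)) x))) \<in> borel_measurable (leb U)"
    by (rule int[OF w H1_cnj(1)[OF U v]])
  show "(\<lambda>x. cdot (cmat (A x) *v wgrad U v x) (cvec_cnj (wgrad U (\<lambda>x. cnj (w x)) x))) \<in> borel_measurable (leb U)"
    by (rule int[OF v H1_cnj(1)[OF U w]])
  show "AE x in leb U. cdot (cmat (A x) *v wgrad U w x) (cvec_cnj (wgrad U (\<lambda>x. cnj (v x)) x)) =
      cdot (cmat (A x) *v wgrad U v x) (cvec_cnj (wgrad U (\<lambda>x. cnj (w x)) x))"
    using A(2) wgrad_cnj[OF U w] wgrad_cnj[OF U v] by eventually_elim (simp add: cmat_symmetric)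
qed

lemma grad_functional_diff:
  fixes U :: "(real ^ 'n::finite) set"
  assumes A: "Linf_mat U A" and B: "Linf_mat U B" and w: "w \<in> H1 U" and v: "v \<in> H1 U"
  shows "grad_functional U (\<lambda>x. A x - B x) w v = grad_functional U A w v - grad_functional U B w v"
proof -
  have "cmat (A x - B x) *v \<xi> = cmat (A x) *v \<xi> - cmat (B x) *v \<xi>" for x \<xi>
    by (simp add: Finite_Cartesian_Product.vec_eq_iff cmat_nth sum_subtractf left_diff_distrib)
  moreover have "cdot (\<xi> - \<zeta>) \<omega> = cdot \<xi> \<omega> - cdot \<zeta> \<omega>" for \<xi> \<zeta> \<omega> :: "complex ^ 'n"
    by (simp add: cdot_def sum_subtractf left_diff_distrib)
  ultimately show ?thesis
    unfolding grad_functional_def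
    using Bochner_Integration.integral_diff[OF grad_functional_integrand(1)[OF A w v] grad_functional_integrand(1)[OF B w v]] by simp
qed

lemma L2_functional_sum:
  assumes "\<And>j. j \<in> I \<Longrightarrow> f j \<in> L2 (leb U)" "v \<in> L2 (leb U)"
  shows "L2_functional U (\<lambda>x. \<Sum>j\<in>I. c j * f j x) v = (\<Sum>j\<in>I. c j * L2_functional U (f j) v)"
proof -
  have int: "integrable (leb U) (\<lambda>x. c j * (f j x * cnj (v x)))" if "j \<in> I" for j
    by (intro Bochner_Integration.integrable_mult_right L2_integrable_mult(1) L2_cnj assms that)
  have "L2_functional U (\<lambda>x. \<Sum>j\<in>I. c j * f j x) v = (\<integral>x. (\<Sum>j\<in>I. c j * (f j x * cnj (v x))) \<partial>leb U)"
    by (simp add: L2_functional_def sum_distrib_right mult.assoc)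
  also have "\<dots> = (\<Sum>j\<in>I. c j * L2_functional U (f j) v)"
    by (subst Bochner_Integration.integral_sum[OF int]) (simp_all only: integral_mult_right_zero L2_functional_def)
  finally show ?thesis .
qed

text \<open>The problem at one wavenumber. Symmetry of \<open>A\<close> almost everywhere and of the
  boundary operator makes the form complex symmetric.\<close>

locale helmholtz_problem =
  fixes k :: real and Dm Dt :: "(real ^ 'n::finite) set" and T :: "'n boundary_op"
    and A :: "real ^ 'n \<Rightarrow> real ^ 'n ^ 'n" and n :: "real ^ 'n \<Rightarrow> real"
  assumes dim2: "2 \<le> CARD('n)" and geo: "geometry Dm Dt" and k: "0 < k"
    and T: "boundary_condition k Dt T"
    and A: "Linf_mat (dom_D Dm Dt) A" "AE x in leb (dom_D Dm Dt). Finite_Cartesian_Product.transpose (A x) = A x"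
    and n: "n \<in> Linf (dom_D Dm Dt)"
begin

abbreviation "D \<equiv> dom_D Dm Dt"
abbreviation "V \<equiv> H10D Dm Dt"
abbreviation "a \<equiv> helmholtz_form k Dm Dt T A n"

lemma D: "open D"
  by (rule open_dom[OF dim2 geo])

lemma V_H1: "v \<in> V \<Longrightarrow> v \<in> H1 D"
  by (rule H10D_D(1)[OF dim2 geo])

lemma V_L2: "v \<in> V \<Longrightarrow> v \<in> L2 (leb D)"
  by (rule H1_L2[OF V_H1])

lemma V_cnj: "v \<in> V \<Longrightarrow> (\<lambda>x. cnj (v x)) \<in> V"
  by (rule H10D_cnj(1)[OF dim2 geo])

lemma form_eq:
  assumes w: "w \<in> V" and v: "v \<in> V"
  shows "a w v = grad_functional D A w v - cpx (k\<^sup>2) * L2_functional D (\<lambda>x. cpx (n x) * w x) v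
    - T (dtrace D w) (dtrace D v)"
proof -
  have i: "integrable (leb D) (\<lambda>x. cpx (n x) * w x * cnj (v x))"
    by (intro L2_integrable_mult(1) Linf_mult_L2 n L2_cnj V_L2 w v)
  have "(\<integral>x. (cdot (cmat (A x) *v wgrad D w x) (cvec_cnj (wgrad D v x)) - cpx (k\<^sup>2 * n x) * w x * cnj (v x)) \<partial>leb D) =
    (\<integral>x. (cdot (cmat (A x) *v wgrad D w x) (cvec_cnj (wgrad D v x)) - cpx (k\<^sup>2) * (cpx (n x) * w x * cnj (v x))) \<partial>leb D)"
    by (simp add: mult.assoc)
  also have "\<dots> = grad_functional D A w v - cpx (k\<^sup>2) * L2_functional D (\<lambda>x. cpx (n x) * w x) v"
    by (subst Bochner_Integration.integral_diff[OF grad_functional_integrand(1)[OF A(1) V_H1[OF w] V_H1[OF v]]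
        Bochner_Integration.integrable_mult_right[OF i]])
      (simp only: integral_mult_right_zero grad_functional_def L2_functional_def)
  finally show ?thesis by (simp add: helmholtz_form_def Let_def)
qed

lemma form_sum:
  assumes I: "finite I" and w: "\<And>j. j \<in> I \<Longrightarrow> w j \<in> V" and v: "v \<in> V"
  shows "a (\<lambda>x. \<Sum>j\<in>I. c j * w j x) v = (\<Sum>j\<in>I. c j * a (w j) v)"
proof -
  have "L2_functional D (\<lambda>x. cpx (n x) * (\<Sum>j\<in>I. c j * w j x)) v =
      L2_functional D (\<lambda>x. \<Sum>j\<in>I. c j * (cpx (n x) * w j x)) v"
    by (simp add: sum_distrib_left mult_ac)
  also have "\<dots> = (\<Sum>j\<in>I. c j * L2_functional D (\<lambda>x. cpx (n x) * w j x) v)"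
    by (rule L2_functional_sum[OF Linf_mult_L2[OF n V_L2[OF w]] V_L2[OF v]])
  finally have m: "L2_functional D (\<lambda>x. cpx (n x) * (\<Sum>j\<in>I. c j * w j x)) v =
      (\<Sum>j\<in>I. c j * L2_functional D (\<lambda>x. cpx (n x) * w j x) v)" .
  have W: "(\<lambda>x. \<Sum>j\<in>I. c j * w j x) \<in> V" by (rule H10D_sum(1)[OF dim2 geo w I])
  have t: "T (dtrace D (\<lambda>x. \<Sum>j\<in>I. c j * w j x)) (dtrace D v) = (\<Sum>j\<in>I. c j * T (dtrace D (w j)) (dtrace D v))"
    by (rule boundary_dtrace_sum[OF dim2 geo k T I w v])
  have g: "grad_functional D A (\<lambda>x. \<Sum>j\<in>I. c j * w j x) v = (\<Sum>j\<in>I. c j * grad_functional D A (w j) v)"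
    by (rule grad_functional_sum[OF D A(1) V_H1[OF w] V_H1[OF v]])
  have "(\<Sum>j\<in>I. c j * a (w j) v) = (\<Sum>j\<in>I. c j * (grad_functional D A (w j) v
      - cpx (k\<^sup>2) * L2_functional D (\<lambda>x. cpx (n x) * w j x) v - T (dtrace D (w j)) (dtrace D v)))"
    by (intro sum.cong refl arg_cong2[where f = times] form_eq w v)
  also have "\<dots> = a (\<lambda>x. \<Sum>j\<in>I. c j * w j x) v"
    unfolding form_eq[OF W v] m t g
    by (simp add: right_diff_distrib sum_subtractf sum_distrib_left mult_ac)
  finally show ?thesis ..
qed

lemma form_symmetric:
  assumes w: "w \<in> V" and v: "v \<in> V"
  shows "a w (\<lambda>x. cnj (v x)) = a v (\<lambda>x. cnj (w x))"
  unfolding form_eq[OF w V_cnj[OF v]] form_eq[OF v V_cnj[OF w]]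
    grad_functional_symmetric[OF D A V_H1[OF w] V_H1[OF v]] boundary_dtrace_symmetric[OF dim2 geo k T w v]
  by (simp add: L2_functional_def mult_ac)

text \<open>Duality: the form is complex symmetric, so the solution for the data \<open>cnj u\<close> also solves
  the adjoint problem, up to conjugation.\<close>

lemma solution_L2_bound:
  assumes N: "\<And>f. f \<in> L2 (leb D) \<Longrightarrow> \<exists>z. solves V a (L2_functional D f) z \<and> H1k_norm k D z \<le> C * norm2 D f"
    and u: "solves V a F u" and F: "\<And>v. v \<in> V \<Longrightarrow> cmod (F v) \<le> B * H1k_norm k D v" and B: "0 \<le> B" "0 \<le> C"
  shows "norm2 D u \<le> C * B"
proof -
  have uV: "u \<in> V" and ua: "\<And>v. v \<in> V \<Longrightarrow> a u v = F v" using u by (auto simp: solves_def)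
  obtain z where z: "solves V a (L2_functional D (\<lambda>x. cnj (u x))) z" "H1k_norm k D z \<le> C * norm2 D (\<lambda>x. cnj (u x))"
    using N[OF L2_cnj[OF V_L2[OF uV]]] by blast
  have zV: "z \<in> V" and za: "\<And>v. v \<in> V \<Longrightarrow> a z v = L2_functional D (\<lambda>x. cnj (u x)) v" using z by (auto simp: solves_def)
  have "cpx ((norm2 D u)\<^sup>2) = (\<integral>x. cpx ((cmod (u x))\<^sup>2) \<partial>leb D)"
    unfolding L2_norm_sq by (rule integral_complex_of_real[symmetric])
  also have "\<dots> = L2_functional D (\<lambda>x. cnj (u x)) (\<lambda>x. cnj (u x))"
    unfolding L2_functional_def by (rule Bochner_Integration.integral_cong[OF refl]) (simp add: complex_norm_square mult.commute del: of_real_power)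
  also have "\<dots> = a z (\<lambda>x. cnj (u x))" by (rule za[OF V_cnj[OF uV], symmetric])
  also have "\<dots> = a u (\<lambda>x. cnj (z x))" by (rule form_symmetric[OF zV uV])
  also have "\<dots> = F (\<lambda>x. cnj (z x))" by (rule ua[OF V_cnj[OF zV]])
  finally have eq: "cpx ((norm2 D u)\<^sup>2) = F (\<lambda>x. cnj (z x))" .
  have "(norm2 D u)\<^sup>2 = cmod (cpx ((norm2 D u)\<^sup>2))"
    by (simp only: norm_of_real abs_of_nonneg[OF zero_le_power2])
  also have "\<dots> = cmod (F (\<lambda>x. cnj (z x)))" by (simp only: eq)
  also have "\<dots> \<le> B * H1k_norm k D z" using F[OF V_cnj[OF zV]] H1_cnj(3)[OF D V_H1[OF zV]] by simp
  also have "\<dots> \<le> B * (C * norm2 D u)"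
    using z(2) B by (intro mult_left_mono) (simp_all add: L2_norm_def)
  finally have "norm2 D u * norm2 D u \<le> C * B * norm2 D u"
    by (simp add: power2_eq_square mult_ac)
  moreover have "0 \<le> C * B" using B by simp
  ultimately show ?thesis
    using L2_norm_nonneg[of "leb D" u] by (cases "norm2 D u = 0") auto
qed

end

text \<open>A supremum of reals is meaningful only for a nonempty set bounded above, which the
  hypotheses on F and w supply. Elements of norm zero contribute the default quotient 0, and F
  vanishes on them by its bound.\<close>

lemma dual_norm:
  assumes F: "\<And>v. v \<in> H10D Dm Dt \<Longrightarrow> cmod (F v) \<le> B * H1k_norm k (dom_D Dm Dt) v" and B: "0 \<le> B"
    and ne: "w \<in> H10D Dm Dt"
  shows "dual_norm k Dm Dt F \<le> B" "0 \<le> dual_norm k Dm Dt F"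
    and "v \<in> H10D Dm Dt \<Longrightarrow> cmod (F v) \<le> dual_norm k Dm Dt F * H1k_norm k (dom_D Dm Dt) v"
proof -
  let ?q = "\<lambda>v. cmod (F v) / H1k_norm k (dom_D Dm Dt) v"
  have q: "?q v \<le> B" if "v \<in> H10D Dm Dt" for v
    using F[OF that] B H1k_norm_nonneg[of k "dom_D Dm Dt" v]
    by (cases "H1k_norm k (dom_D Dm Dt) v = 0") (simp_all add: pos_divide_le_eq order.strict_iff_order)
  then have bdd: "bdd_above (?q ` H10D Dm Dt)" by (intro bdd_aboveI[of _ B]) auto
  show "dual_norm k Dm Dt F \<le> B" unfolding dual_norm_def by (rule cSUP_least) (use ne q in auto)
  have up: "?q v \<le> dual_norm k Dm Dt F" if "v \<in> H10D Dm Dt" for v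
    unfolding dual_norm_def by (rule cSUP_upper[OF that bdd])
  show "0 \<le> dual_norm k Dm Dt F" by (rule order_trans[OF _ up[OF ne]]) simp
  assume v: "v \<in> H10D Dm Dt"
  show "cmod (F v) \<le> dual_norm k Dm Dt F * H1k_norm k (dom_D Dm Dt) v"
  proof (cases "H1k_norm k (dom_D Dm Dt) v = 0")
    case True
    then show ?thesis using F[OF v] by simp
  next
    case False
    then have "0 < H1k_norm k (dom_D Dm Dt) v" using H1k_norm_nonneg[of k "dom_D Dm Dt" v] by linarith
    then show ?thesis using up[OF v] by (simp add: pos_divide_le_eq)
  qed
qed

lemma dtrace_cong: "(\<And>x. x \<in> U \<Longrightarrow> v x = v' x) \<Longrightarrow> dtrace U v = dtrace U v'"
  using trace_on_cong[of U v v' "frontier U"] by (simp add: dtrace_def)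

locale galerkin = helmholtz_problem k Dm Dt T A n
  for k and Dm Dt :: "(real ^ 'n::finite) set" and T A n +
  fixes N :: nat and \<phi> :: "nat \<Rightarrow> real ^ 'n \<Rightarrow> real"
  assumes basis: "\<And>i. i < N \<Longrightarrow> cbasis \<phi> i \<in> V"
begin

abbreviation "fe \<equiv> fe_fun N \<phi>"
abbreviation "M \<equiv> galerkin_mat k D T A n N \<phi>"

lemma fe_eq: "fe c = (\<lambda>x. \<Sum>j<N. c j * cbasis \<phi> j x)"
  by (simp add: fe_fun_def fun_eq_iff)

lemma fe_V: "fe c \<in> V"
  unfolding fe_eq by (rule H10D_sum(1)[OF dim2 geo]) (use basis in auto)

lemma M_dim [simp]: "dim_row M = N" "dim_col M = N" "M \<in> carrier_mat N N"
  by (auto simp: galerkin_mat_def stiffness_mat_def mass_mat_def boundary_mat_def)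

lemma wgrad_basis_real:
  assumes "i < N"
  shows "AE x in leb D. cvec_cnj (wgrad D (cbasis \<phi> i) x) = wgrad D (cbasis \<phi> i) x"
proof -
  have "AE x in leb D. wgrad D (cbasis \<phi> i) x = cvec_cnj (wgrad D (cbasis \<phi> i) x)"
    using wgrad_cnj[OF D V_H1[OF basis[OF assms]]] by simp
  then show ?thesis by eventually_elim (rule sym)
qed

text \<open>The matrix has no conjugate whereas the form has one. For a real basis function the
  chosen weak gradient equals its conjugate almost everywhere, which reconciles the two.\<close>

lemma stiffness_entry:
  assumes B: "Linf_mat D B" and i: "i < N" and j: "j < N"
  shows "stiffness_mat D B N \<phi> $$ (i, j) = grad_functional D B (cbasis \<phi> j) (cbasis \<phi> i)"
proof -
  note b = V_H1[OF basis[OF i]] V_H1[OF basis[OF j]]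
  have "(\<integral>x. cdot (cmat (B x) *v wgrad D (cbasis \<phi> j) x) (wgrad D (cbasis \<phi> i) x) \<partial>leb D) = grad_functional D B (cbasis \<phi> j) (cbasis \<phi> i)"
    unfolding grad_functional_def
  proof (rule integral_cong_AE)
    show "AE x in leb D. cdot (cmat (B x) *v wgrad D (cbasis \<phi> j) x) (wgrad D (cbasis \<phi> i) x) =
      cdot (cmat (B x) *v wgrad D (cbasis \<phi> j) x) (cvec_cnj (wgrad D (cbasis \<phi> i) x))"
      using wgrad_basis_real[OF i] by eventually_elim simp
  qed (intro cdot_measurable L2_D(1)[OF Linf_mat_mult_L2[OF B wgrad_L2]] cvec_cnj_measurable L2_D(1)[OF wgrad_L2] b)+
  then show ?thesis using i j by (simp add: stiffness_mat_def)
qed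

lemma mass_entry:
  assumes "i < N" "j < N"
  shows "mass_mat D m N \<phi> $$ (i, j) = L2_functional D (\<lambda>x. cpx (m x) * cbasis \<phi> j x) (cbasis \<phi> i)"
  using assms by (simp add: mass_mat_def L2_functional_def mult_ac)

lemma M_entry:
  assumes i: "i < N" and j: "j < N"
  shows "M $$ (i, j) = a (cbasis \<phi> j) (cbasis \<phi> i)"
  using stiffness_entry[OF A(1) i j] mass_entry[OF i j, of n] form_eq[OF basis[OF j] basis[OF i]] i j
  by (simp add: galerkin_mat_def stiffness_mat_def mass_mat_def boundary_mat_def)

lemma M_symmetric: "M\<^sup>T = M"
proof (rule eq_matI)
  fix i j assume "i < dim_row M" "j < dim_col M"
  then have i: "i < N" and j: "j < N" by simp_all
  have "a (cbasis \<phi> i) (cbasis \<phi> j) = a (cbasis \<phi> j) (cbasis \<phi> i)"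
    using form_symmetric[OF basis[OF i] basis[OF j]] by simp
  then show "M\<^sup>T $$ (i, j) = M $$ (i, j)" using i j by (simp add: M_entry)
qed simp_all

lemma M_mult:
  assumes i: "i < N"
  shows "vec_index (M *\<^sub>v Matrix.vec N c) i = a (fe c) (cbasis \<phi> i)"
proof -
  have "vec_index (M *\<^sub>v Matrix.vec N c) i = (\<Sum>j<N. M $$ (i, j) * c j)"
    using i by (simp add: scalar_prod_def atLeast0LessThan)
  also have "\<dots> = (\<Sum>j<N. c j * a (cbasis \<phi> j) (cbasis \<phi> i))"
    using i by (intro sum.cong refl) (simp add: M_entry)
  also have "\<dots> = a (fe c) (cbasis \<phi> i)"
    unfolding fe_eq by (rule form_sum[symmetric]) (use basis i in auto)
  finally show ?thesis .
qed

lemma form_cong: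
  assumes "\<And>x. x \<in> D \<Longrightarrow> u x = u' x"
  shows "a u v = a u' v"
proof -
  have g: "wgrad D u = wgrad D u'" by (rule wgrad_cong[OF assms])
  have "(\<integral>x. (cdot (cmat (A x) *v wgrad D u x) (cvec_cnj (wgrad D v x)) - cpx (k\<^sup>2 * n x) * u x * cnj (v x)) \<partial>leb D) =
    (\<integral>x. (cdot (cmat (A x) *v wgrad D u' x) (cvec_cnj (wgrad D v x)) - cpx (k\<^sup>2 * n x) * u' x * cnj (v x)) \<partial>leb D)"
    unfolding g by (rule Bochner_Integration.integral_cong) (use assms in auto)
  then show ?thesis using dtrace_cong[of D u u', OF assms] by (simp add: helmholtz_form_def Let_def)
qed

text \<open>A finite-element solution agrees with a combination of basis functions on the closure of
  the domain only; congruence carries the form over, and testing with the basis gives the linear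
  system.\<close>

lemma solves_coefficients:
  assumes nb: "nodal_basis D W N \<phi>" and u: "solves W a F u"
  obtains c where "\<And>x. x \<in> D \<Longrightarrow> u x = fe c x" "M *\<^sub>v Matrix.vec N c = load_vec N \<phi> F"
proof -
  obtain c where c: "\<And>x. x \<in> closure D \<Longrightarrow> u x = fe c x"
    using nb u unfolding nodal_basis_def solves_def by meson
  have cD: "u x = fe c x" if "x \<in> D" for x using c that closure_subset[of D] by auto
  have "M *\<^sub>v Matrix.vec N c = load_vec N \<phi> F"
  proof (rule eq_vecI)
    fix i assume "i < dim_vec (load_vec N \<phi> F)"
    then have i: "i < N" by (simp add: load_vec_def)
    have "vec_index (M *\<^sub>v Matrix.vec N c) i = a u (cbasis \<phi> i)"
      unfolding M_mult[OF i] by (rule form_cong[OF cD[symmetric]])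
    also have "\<dots> = F (cbasis \<phi> i)"
      using u nodal_basis_def[THEN iffD1, OF nb, THEN conjunct1] i by (simp add: solves_def)
    finally show "vec_index (M *\<^sub>v Matrix.vec N c) i = vec_index (load_vec N \<phi> F) i" using i by (simp add: load_vec_def)
  qed (simp add: load_vec_def)
  with cD show thesis by (rule that)
qed

end

section \<open>GMRES\<close>

lemma euclid_norm_L2_set: "euclid_norm v = L2_set (\<lambda>i. cmod (vec_index v i)) {..<dim_vec v}"
  by (simp add: euclid_norm_def L2_set_def)

lemma euclid_norm_nonneg [simp]: "0 \<le> euclid_norm v"
  by (simp add: euclid_norm_L2_set L2_set_nonneg)

lemma euclid_norm_zero [simp]: "euclid_norm (0\<^sub>v m) = 0"
  by (simp add: euclid_norm_def)

lemma euclid_norm_eq_0: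
  assumes "x \<in> carrier_vec m" "euclid_norm x = 0"
  shows "x = 0\<^sub>v m"
  using assms by (intro eq_vecI) (auto simp: euclid_norm_L2_set L2_set_eq_0_iff)

lemma euclid_norm_uminus:
  assumes "x \<in> carrier_vec m"
  shows "euclid_norm (- x) = euclid_norm x"
  using assms by (simp add: euclid_norm_def)

lemma euclid_norm_triangle:
  assumes "x \<in> carrier_vec m" "y \<in> carrier_vec m"
  shows "euclid_norm (x + y) \<le> euclid_norm x + euclid_norm y"
proof -
  have "euclid_norm (x + y) \<le> L2_set (\<lambda>i. cmod (vec_index x i) + cmod (vec_index y i)) {..<m}"
    using assms by (auto simp: euclid_norm_L2_set intro!: L2_set_mono norm_triangle_ineq)
  also have "\<dots> \<le> euclid_norm x + euclid_norm y"
    using assms L2_set_triangle_ineq[of "\<lambda>i. cmod (vec_index x i)" "\<lambda>i. cmod (vec_index y i)" "{..<m}"]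
    by (simp add: euclid_norm_L2_set)
  finally show ?thesis .
qed

lemma euclid_norm_triangle_diff:
  assumes "x \<in> carrier_vec m" "y \<in> carrier_vec m"
  shows "euclid_norm x \<le> euclid_norm (x - y) + euclid_norm y"
proof -
  have "x = (x - y) + y" using assms by auto
  then show ?thesis using euclid_norm_triangle[of "x - y" m y] assms by auto
qed

text \<open>One step of Gram-Schmidt: the induction hypothesis is used for the new vector and for
  the datum. The part z of the new vector that is orthogonal to the old ones then corrects the
  residual.\<close>

lemma least_squares_orthogonal:
  fixes y :: "nat \<Rightarrow> nat \<Rightarrow> complex" and d :: "nat \<Rightarrow> complex"
  shows "\<exists>c. \<forall>i<m. (\<Sum>l<N. ((\<Sum>j<m. c j * y j l) - d l) * cnj (y i l)) = 0"
proof (induction m arbitrary: d)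
  case (Suc m)
  obtain p where p: "\<And>i. i < m \<Longrightarrow> (\<Sum>l<N. ((\<Sum>j<m. p j * y j l) - y m l) * cnj (y i l)) = 0" using Suc.IH[of "y m"] by blast
  obtain c where c: "\<And>i. i < m \<Longrightarrow> (\<Sum>l<N. ((\<Sum>j<m. c j * y j l) - d l) * cnj (y i l)) = 0" using Suc.IH[of d] by blast
  define z where "z l = y m l - (\<Sum>j<m. p j * y j l)" for l
  define r where "r l = (\<Sum>j<m. c j * y j l) - d l" for l
  define S where "S = (\<Sum>l<N. z l * cnj (z l))"
  \<comment> \<open>If the new vector depends on the old ones, then z vanishes and there is nothing
    to correct.\<close>
  define t where "t = (if S = 0 then 0 else - (\<Sum>l<N. r l * cnj (z l)) / S)"
  have zy: "(\<Sum>l<N. z l * cnj (y i l)) = 0" if "i < m" for i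
    using p[OF that] by (simp add: z_def left_diff_distrib sum_subtractf)
  have ry: "(\<Sum>l<N. r l * cnj (y i l)) = 0" if "i < m" for i
    using c[OF that] by (simp add: r_def)
  have z0: "z l = 0" if "S = 0" "l < N" for l
  proof -
    have "cpx (\<Sum>l<N. (cmod (z l))\<^sup>2) = S" by (simp add: S_def complex_norm_square del: of_real_power)
    with that(1) have "(\<Sum>l<N. (cmod (z l))\<^sup>2) = 0" by (simp del: of_real_sum)
    then show ?thesis using that(2) by (simp add: sum_nonneg_eq_0_iff)
  qed
  have "(\<Sum>l<N. (r l + t * z l) * cnj (z l)) = (\<Sum>l<N. r l * cnj (z l)) + t * S"
    by (simp only: S_def distrib_right sum.distrib sum_distrib_left mult.assoc)
  also have "\<dots> = 0"
  proof (cases "S = 0")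
    case True
    have "(\<Sum>l<N. r l * cnj (z l)) = 0" by (rule sum.neutral) (use z0[OF True] in simp)
    then show ?thesis using True by simp
  qed (simp add: t_def)
  finally have rz: "(\<Sum>l<N. (r l + t * z l) * cnj (z l)) = 0" .
  have rty: "(\<Sum>l<N. (r l + t * z l) * cnj (y i l)) = 0" if "i < m" for i
  proof -
    have "(\<Sum>l<N. (r l + t * z l) * cnj (y i l)) = (\<Sum>l<N. r l * cnj (y i l)) + t * (\<Sum>l<N. z l * cnj (y i l))"
      by (simp only: distrib_right sum.distrib sum_distrib_left mult.assoc)
    then show ?thesis using zy[OF that] ry[OF that] by simp
  qed
  have rtm: "(\<Sum>l<N. (r l + t * z l) * cnj (y m l)) = 0"
  proof -
    have "(\<Sum>l<N. (r l + t * z l) * cnj (\<Sum>j<m. p j * y j l)) = (\<Sum>l<N. \<Sum>j<m. cnj (p j) * ((r l + t * z l) * cnj (y j l)))"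
      by (simp add: sum_distrib_left mult_ac)
    also have "\<dots> = (\<Sum>j<m. cnj (p j) * (\<Sum>l<N. (r l + t * z l) * cnj (y j l)))"
      by (subst sum.swap) (simp add: sum_distrib_left)
    also have "\<dots> = 0" using rty by simp
    finally have "(\<Sum>l<N. (r l + t * z l) * cnj (\<Sum>j<m. p j * y j l)) = 0" .
    moreover have "cnj (y m l) = cnj (z l) + cnj (\<Sum>j<m. p j * y j l)" for l by (simp add: z_def)
    ultimately show ?thesis using rz by (simp add: distrib_left sum.distrib)
  qed
  let ?c = "\<lambda>j. if j < m then c j - t * p j else t"
  have "(\<Sum>j<Suc m. ?c j * y j l) - d l = r l + t * z l" for l
    by (simp add: r_def z_def algebra_simps sum_subtractf sum_distrib_left)
  then show ?case using rty rtm by (intro exI[of _ ?c]) (auto simp: less_Suc_eq simp del: sum.lessThan_Suc)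
qed simp

text \<open>By Pythagoras an orthogonal residual is minimal: any other combination changes it by a
  vector perpendicular to it. \<open>arg_min_on\<close> picks a minimiser only because the minimum
  is attained.\<close>

lemma least_squares_exists:
  fixes y :: "nat \<Rightarrow> nat \<Rightarrow> complex" and d :: "nat \<Rightarrow> complex"
  shows "\<exists>c. \<forall>c'. L2_set (\<lambda>l. cmod ((\<Sum>j<m. c j * y j l) - d l)) {..<N} \<le> L2_set (\<lambda>l. cmod ((\<Sum>j<m. c' j * y j l) - d l)) {..<N}"
proof -
  obtain c where c: "\<And>i. i < m \<Longrightarrow> (\<Sum>l<N. ((\<Sum>j<m. c j * y j l) - d l) * cnj (y i l)) = 0"
    using least_squares_orthogonal[where N = N and y = y and d = d and m = m] by blast
  define r where "r l = (\<Sum>j<m. c j * y j l) - d l" for l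
  have "(\<Sum>l<N. (cmod (r l))\<^sup>2) \<le> (\<Sum>l<N. (cmod ((\<Sum>j<m. c' j * y j l) - d l))\<^sup>2)" for c'
  proof -
    define s where "s l = (\<Sum>j<m. (c' j - c j) * y j l)" for l
    have eq: "(\<Sum>j<m. c' j * y j l) - d l = r l + s l" for l
      by (simp add: r_def s_def left_diff_distrib sum_subtractf)
    have "(\<Sum>l<N. r l * cnj (s l)) = (\<Sum>l<N. \<Sum>j<m. cnj (c' j - c j) * (r l * cnj (y j l)))"
      by (simp add: s_def sum_distrib_left mult_ac)
    also have "\<dots> = (\<Sum>j<m. cnj (c' j - c j) * (\<Sum>l<N. r l * cnj (y j l)))"
      by (subst sum.swap) (simp add: sum_distrib_left)
    also have "\<dots> = 0" using c by (simp add: r_def)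
    finally have 0: "(\<Sum>l<N. Re (r l * cnj (s l))) = 0" by (simp only: Re_sum[symmetric] zero_complex.simps)
    have "(cmod (r l + s l))\<^sup>2 = (cmod (r l))\<^sup>2 + 2 * Re (r l * cnj (s l)) + (cmod (s l))\<^sup>2" for l
      unfolding cmod_power2 by (simp add: power2_eq_square algebra_simps)
    then have "(\<Sum>l<N. (cmod (r l + s l))\<^sup>2) = (\<Sum>l<N. (cmod (r l))\<^sup>2) + 2 * (\<Sum>l<N. Re (r l * cnj (s l))) + (\<Sum>l<N. (cmod (s l))\<^sup>2)"
      by (simp only: sum.distrib sum_distrib_left)
    then have "(\<Sum>l<N. (cmod (r l + s l))\<^sup>2) = (\<Sum>l<N. (cmod (r l))\<^sup>2) + (\<Sum>l<N. (cmod (s l))\<^sup>2)"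
      unfolding 0 by simp
    moreover have "0 \<le> (\<Sum>l<N. (cmod (s l))\<^sup>2)" by (rule sum_nonneg) simp
    ultimately have "(\<Sum>l<N. (cmod (r l))\<^sup>2) \<le> (\<Sum>l<N. (cmod (r l + s l))\<^sup>2)" by linarith
    then show ?thesis unfolding eq .
  qed
  then show ?thesis unfolding L2_set_def r_def by (intro exI[of _ c] allI) (simp add: real_sqrt_le_mono)
qed

section \<open>Invertible and transposed matrices\<close>

lemma det_nonzero_inverse:
  fixes A :: "'a::field mat"
  assumes A: "A \<in> carrier_mat m m" and d: "Determinant.det A \<noteq> 0"
  obtains B where "mat_inverse A = Some B" "B \<in> carrier_mat m m" "A * B = 1\<^sub>m m" "B * A = 1\<^sub>m m"
proof (cases "mat_inverse A")
  case None
  from mat_inverse(1)[OF A this, of "()"] det_non_zero_imp_unit[OF A d, of "()"] show ?thesis by blast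
next
  case (Some B)
  from mat_inverse(2)[OF A Some] that[OF Some] show ?thesis by blast
qed

lemma injective_det_nonzero:
  fixes A :: "'a::field mat"
  assumes A: "A \<in> carrier_mat m m" and inj: "\<And>x. x \<in> carrier_vec m \<Longrightarrow> A *\<^sub>v x = 0\<^sub>v m \<Longrightarrow> x = 0\<^sub>v m"
  shows "Determinant.det A \<noteq> 0"
  using det_0_iff_vec_prod_zero[OF A] inj by blast

lemma det_nonzero_invertible:
  fixes A :: "'a::field mat"
  assumes A: "A \<in> carrier_mat m m" and d: "Determinant.det A \<noteq> 0"
  shows "invertible_mat A"
proof -
  obtain B where "B \<in> carrier_mat m m" "A * B = 1\<^sub>m m" "B * A = 1\<^sub>m m" by (rule det_nonzero_inverse[OF A d])
  then show ?thesis using A by (auto simp: invertible_mat_def inverts_mat_def)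
qed

text \<open>For y the conjugate of \<open>Q\<^sup>T *\<^sub>v x\<close>, the squared norm of y is
  the bilinear product of x with \<open>Q *\<^sub>v y\<close>, and Cauchy-Schwarz applies. The
  bilinear product fits the transpose without conjugating Q.\<close>

lemma transpose_contraction:
  fixes Q :: "complex mat"
  assumes Q: "Q \<in> carrier_mat m m" and q: "\<And>x. x \<in> carrier_vec m \<Longrightarrow> euclid_norm (Q *\<^sub>v x) \<le> q * euclid_norm x"
    and x: "x \<in> carrier_vec m"
  shows "euclid_norm (Q\<^sup>T *\<^sub>v x) \<le> q * euclid_norm x"
proof -
  define y where "y = Matrix.vec m (\<lambda>i. cnj (vec_index (Q\<^sup>T *\<^sub>v x) i))"
  have y: "y \<in> carrier_vec m" by (simp add: y_def)
  have ny: "euclid_norm y = euclid_norm (Q\<^sup>T *\<^sub>v x)" using Q by (simp add: euclid_norm_def y_def)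
  have "cpx ((euclid_norm y)\<^sup>2) = (\<Sum>i<m. vec_index (Q\<^sup>T *\<^sub>v x) i * vec_index y i)"
    unfolding ny using Q by (simp add: euclid_norm_def sum_nonneg y_def complex_norm_square del: of_real_power)
  also have "\<dots> = (\<Sum>i<m. \<Sum>j<m. Q $$ (j, i) * vec_index x j * vec_index y i)"
    using Q x by (intro sum.cong refl) (simp add: scalar_prod_def atLeast0LessThan sum_distrib_right)
  also have "\<dots> = (\<Sum>j<m. vec_index x j * vec_index (Q *\<^sub>v y) j)"
    using Q y by (subst sum.swap, intro sum.cong refl) (simp add: scalar_prod_def atLeast0LessThan sum_distrib_left mult_ac)
  finally have eq: "cpx ((euclid_norm y)\<^sup>2) = (\<Sum>j<m. vec_index x j * vec_index (Q *\<^sub>v y) j)" .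
  have "(euclid_norm y)\<^sup>2 = cmod (cpx ((euclid_norm y)\<^sup>2))"
    by (simp only: norm_of_real abs_of_nonneg[OF zero_le_power2])
  also have "\<dots> = cmod (\<Sum>j<m. vec_index x j * vec_index (Q *\<^sub>v y) j)" by (simp only: eq)
  also have "\<dots> \<le> (\<Sum>j<m. \<bar>cmod (vec_index x j)\<bar> * \<bar>cmod (vec_index (Q *\<^sub>v y) j)\<bar>)"
    by (rule order_trans[OF norm_sum]) (simp add: norm_mult)
  also have "\<dots> \<le> euclid_norm x * euclid_norm (Q *\<^sub>v y)"
    using L2_set_mult_ineq[of "\<lambda>j. cmod (vec_index x j)" "\<lambda>j. cmod (vec_index (Q *\<^sub>v y) j)" "{..<m}"] x Q
    by (simp add: euclid_norm_L2_set)
  also have "\<dots> \<le> euclid_norm x * (q * euclid_norm y)" by (rule mult_left_mono[OF q[OF y]]) simp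
  finally have *: "euclid_norm y * euclid_norm y \<le> q * euclid_norm x * euclid_norm y" by (simp add: power2_eq_square mult_ac)
  have "0 \<le> q * euclid_norm x" using q[OF x] euclid_norm_nonneg order_trans by blast
  with * show ?thesis unfolding ny[symmetric]
    using euclid_norm_nonneg[of y] by (cases "euclid_norm y = 0") auto
qed

section \<open>Krylov spaces and the Richardson iteration\<close>

definition krylov_vec :: "complex mat \<Rightarrow> complex Matrix.vec \<Rightarrow> nat \<Rightarrow> (nat \<Rightarrow> complex) \<Rightarrow> complex Matrix.vec" where
  "krylov_vec C r m c = Matrix.vec (dim_vec r) (\<lambda>l. \<Sum>i<m. c i * vec_index ((C ^\<^sub>m i) *\<^sub>v r) l)"

lemma krylov_eq: "krylov C r m = range (krylov_vec C r m)"
  by (auto simp: krylov_def krylov_vec_def)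

lemma pow_mat_Suc_left:
  fixes C :: "'a::semiring_1 mat"
  assumes C: "C \<in> carrier_mat N N"
  shows "C ^\<^sub>m Suc i = C * C ^\<^sub>m i"
proof (induction i)
  case 0
  then show ?case using C by simp
next
  case (Suc i)
  have "C ^\<^sub>m Suc (Suc i) = (C * C ^\<^sub>m i) * C" using Suc by simp
  also have "\<dots> = C * (C ^\<^sub>m i * C)" using C by (intro assoc_mult_mat) auto
  finally show ?case by simp
qed

lemma krylov_vec_mult:
  fixes C :: "complex mat"
  assumes C: "C \<in> carrier_mat N N" and r: "r \<in> carrier_vec N" and l: "l < N"
  shows "vec_index (C *\<^sub>v krylov_vec C r m c) l = (\<Sum>i<m. c i * vec_index ((C ^\<^sub>m Suc i) *\<^sub>v r) l)"
proof -
  have p: "C ^\<^sub>m i \<in> carrier_mat N N" for i using C by simp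
  have s: "vec_index ((C ^\<^sub>m Suc i) *\<^sub>v r) l = (\<Sum>j<N. C $$ (l, j) * vec_index ((C ^\<^sub>m i) *\<^sub>v r) j)" for i
  proof -
    have "(C ^\<^sub>m Suc i) *\<^sub>v r = C *\<^sub>v ((C ^\<^sub>m i) *\<^sub>v r)"
      unfolding pow_mat_Suc_left[OF C] by (rule assoc_mult_mat_vec[OF C p r])
    then show ?thesis using C p[of i] l by (simp add: scalar_prod_def atLeast0LessThan)
  qed
  have "vec_index (C *\<^sub>v krylov_vec C r m c) l = (\<Sum>j<N. C $$ (l, j) * (\<Sum>i<m. c i * vec_index ((C ^\<^sub>m i) *\<^sub>v r) j))"
    using C r l by (simp add: krylov_vec_def scalar_prod_def atLeast0LessThan)
  also have "\<dots> = (\<Sum>j<N. \<Sum>i<m. c i * (C $$ (l, j) * vec_index ((C ^\<^sub>m i) *\<^sub>v r) j))"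
    by (simp only: sum_distrib_left mult.left_commute)
  also have "\<dots> = (\<Sum>i<m. c i * (\<Sum>j<N. C $$ (l, j) * vec_index ((C ^\<^sub>m i) *\<^sub>v r) j))"
    by (subst sum.swap) (simp only: sum_distrib_left)
  finally show ?thesis unfolding s .
qed

text \<open>As a function of the Krylov coefficients the residual is a least-squares problem for the
  vectors \<open>(C ^\<^sub>m Suc i) *\<^sub>v r\<close>, so a minimiser exists.\<close>

lemma gmres_minimal:
  fixes C :: "complex mat"
  assumes C: "C \<in> carrier_mat N N" and d: "d \<in> carrier_vec N"
  defines "r \<equiv> C *\<^sub>v 0\<^sub>v (dim_col C) - d"
  shows "gmres_iterate C d m \<in> krylov C r m"
    and "x \<in> krylov C r m \<Longrightarrow> euclid_norm (C *\<^sub>v gmres_iterate C d m - d) \<le> euclid_norm (C *\<^sub>v x - d)"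
proof -
  let ?f = "\<lambda>x. euclid_norm (C *\<^sub>v x - d)"
  have r: "r \<in> carrier_vec N" using d C by (simp add: r_def)
  have f: "?f (krylov_vec C r m c) = L2_set (\<lambda>l. cmod ((\<Sum>i<m. c i * vec_index ((C ^\<^sub>m Suc i) *\<^sub>v r) l) - vec_index d l)) {..<N}" for c
    unfolding euclid_norm_L2_set
  proof (rule L2_set_cong)
    show "{..<dim_vec (C *\<^sub>v krylov_vec C r m c - d)} = {..<N}" using d by simp
    fix l assume "l \<in> {..<N}"
    then have l: "l < N" by simp
    then show "cmod (vec_index (C *\<^sub>v krylov_vec C r m c - d) l) = cmod ((\<Sum>i<m. c i * vec_index ((C ^\<^sub>m Suc i) *\<^sub>v r) l) - vec_index d l)"
      unfolding krylov_vec_mult[OF C r l, symmetric] using d by simp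
  qed
  have "\<exists>c. \<forall>c'. ?f (krylov_vec C r m c) \<le> ?f (krylov_vec C r m c')"
    unfolding f by (rule least_squares_exists)
  then obtain c where "\<And>c'. ?f (krylov_vec C r m c) \<le> ?f (krylov_vec C r m c')" by blast
  then have "is_arg_min ?f (\<lambda>x. x \<in> krylov C r m) (krylov_vec C r m c)"
    by (auto simp: is_arg_min_def krylov_eq not_less)
  then have m: "is_arg_min ?f (\<lambda>x. x \<in> krylov C r m) (gmres_iterate C d m)"
    unfolding gmres_iterate_def arg_min_on_def arg_min_def r_def by (rule someI)
  then show "gmres_iterate C d m \<in> krylov C r m" by (simp add: is_arg_min_def)
  assume "x \<in> krylov C r m"
  with m show "?f (gmres_iterate C d m) \<le> ?f x" by (auto simp: is_arg_min_def not_less)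
qed

text \<open>Each step subtracts the residual, so residuals are multiplied by 1 - C and contract when
  C is close to the identity. The iterates are competitors of the GMRES iterates in the same Krylov
  spaces.\<close>

primrec richardson :: "complex mat \<Rightarrow> complex Matrix.vec \<Rightarrow> nat \<Rightarrow> complex Matrix.vec" where
  "richardson C d 0 = 0\<^sub>v (dim_vec d)"
| "richardson C d (Suc m) = richardson C d m - (C *\<^sub>v richardson C d m - d)"

lemma richardson_krylov:
  fixes C :: "complex mat"
  assumes C: "C \<in> carrier_mat N N" and d: "d \<in> carrier_vec N"
  shows "richardson C d m \<in> krylov C (C *\<^sub>v 0\<^sub>v (dim_col C) - d) m"
proof (induction m)
  case 0
  have "richardson C d 0 = krylov_vec C (C *\<^sub>v 0\<^sub>v (dim_col C) - d) 0 (\<lambda>i. 0)"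
    using d by (intro eq_vecI) (simp_all add: krylov_vec_def)
  then show ?case by (simp add: krylov_eq)
next
  case (Suc m)
  let ?r = "C *\<^sub>v 0\<^sub>v (dim_col C) - d"
  have r: "?r \<in> carrier_vec N" using C d by simp
  obtain c where c: "richardson C d m = krylov_vec C ?r m c" using Suc by (auto simp: krylov_eq)
  \<comment> \<open>Multiplication by C shifts the coefficients by one. The entry 1 at index 0 comes
    from d, which is minus the initial residual for the zero guess.\<close>
  let ?c = "\<lambda>i. (if i < m then c i else 0) - (if i = 0 then 1 else c (i - 1))"
  have "richardson C d (Suc m) = krylov_vec C ?r (Suc m) ?c"
  proof (rule eq_vecI)
    fix l assume "l < dim_vec (krylov_vec C ?r (Suc m) ?c)"
    then have l: "l < N" using d by (simp add: krylov_vec_def)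
    let ?y = "\<lambda>i. vec_index ((C ^\<^sub>m i) *\<^sub>v ?r) l"
    have y0: "?y 0 = - vec_index d l" using C d l by simp
    have "vec_index (krylov_vec C ?r (Suc m) ?c) l = (\<Sum>i<Suc m. (if i < m then c i else 0) * ?y i) - (\<Sum>i<Suc m. (if i = 0 then 1 else c (i - 1)) * ?y i)"
      using d l by (simp add: krylov_vec_def left_diff_distrib sum_subtractf del: sum.lessThan_Suc pow_mat.simps)
    also have "(\<Sum>i<Suc m. (if i < m then c i else 0) * ?y i) = (\<Sum>i<m. c i * ?y i)" by simp
    also have "(\<Sum>i<Suc m. (if i = 0 then 1 else c (i - 1)) * ?y i) = ?y 0 + (\<Sum>i<m. c i * ?y (Suc i))"
      unfolding sum.lessThan_Suc_shift by simp
    finally have "vec_index (krylov_vec C ?r (Suc m) ?c) l = vec_index (richardson C d m) l - (vec_index (C *\<^sub>v richardson C d m) l - vec_index d l)"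
      unfolding y0 c krylov_vec_mult[OF C r l] using d l by (simp add: krylov_vec_def)
    then show "vec_index (richardson C d (Suc m)) l = vec_index (krylov_vec C ?r (Suc m) ?c) l"
      using C d l by simp
  qed (use C d in \<open>simp_all add: krylov_vec_def\<close>)
  then show ?case by (simp only: krylov_eq rangeI)
qed

lemma richardson_residual:
  fixes C :: "complex mat"
  assumes C: "C \<in> carrier_mat N N" and d: "d \<in> carrier_vec N" and q: "0 \<le> q"
    and le: "\<And>x. x \<in> carrier_vec N \<Longrightarrow> euclid_norm (x - C *\<^sub>v x) \<le> q * euclid_norm x"
  shows "richardson C d m \<in> carrier_vec N" "euclid_norm (C *\<^sub>v richardson C d m - d) \<le> q ^ m * euclid_norm d"
proof (induction m)
  case 0
  { case 1 show ?case using d by simp }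
  { case 2
    have "C *\<^sub>v richardson C d 0 - d = - d" using C d by (intro eq_vecI) simp_all
    then show ?case using euclid_norm_uminus[OF d] by simp }
next
  case (Suc m)
  let ?e = "C *\<^sub>v richardson C d m - d"
  have e: "?e \<in> carrier_vec N" by (rule carrier_vecI) (use d in simp)
  { case 1 show ?case using Suc e by simp }
  { case 2
    have "C *\<^sub>v richardson C d (Suc m) = C *\<^sub>v richardson C d m - C *\<^sub>v ?e"
      using mult_minus_distrib_mat_vec[OF C Suc.IH(1) e] by simp
    then have "C *\<^sub>v richardson C d (Suc m) - d = ?e - C *\<^sub>v ?e"
      using C d by (intro eq_vecI) simp_all
    then have "euclid_norm (C *\<^sub>v richardson C d (Suc m) - d) \<le> q * euclid_norm ?e" using le[OF e] by simp
    also have "\<dots> \<le> q * (q ^ m * euclid_norm d)" by (rule mult_left_mono[OF Suc.IH(2) q])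
    finally show ?case by (simp add: mult_ac) }
qed

lemma contraction_invertible:
  fixes C :: "complex mat"
  assumes C: "C \<in> carrier_mat N N" and q: "q < 1"
    and le: "\<And>x. x \<in> carrier_vec N \<Longrightarrow> euclid_norm (x - C *\<^sub>v x) \<le> q * euclid_norm x"
  shows "Determinant.det C \<noteq> 0"
proof (rule injective_det_nonzero[OF C])
  fix x assume x: "x \<in> carrier_vec N" "C *\<^sub>v x = 0\<^sub>v N"
  then have "euclid_norm x \<le> q * euclid_norm x" using le[OF x(1)] by simp
  then have "(1 - q) * euclid_norm x \<le> 0" by (simp add: algebra_simps)
  then have "euclid_norm x = 0" using q euclid_norm_nonneg[of x] by (simp add: mult_le_0_iff)
  then show "x = 0\<^sub>v N" by (rule euclid_norm_eq_0[OF x(1)])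
qed

text \<open>The GMRES residual is at most that of Richardson, \<open>q ^ m\<close> times the norm of
  d. Closeness of C to the identity gives the factor 1 + q from d to u, and the factor 1 / (1 - q)
  from the residual to the error.\<close>

lemma gmres_convergence:
  fixes C :: "complex mat"
  assumes C: "C \<in> carrier_mat N N" and d: "d \<in> carrier_vec N" and q: "0 \<le> q" "q < 1"
    and le: "\<And>x. x \<in> carrier_vec N \<Longrightarrow> euclid_norm (x - C *\<^sub>v x) \<le> q * euclid_norm x"
  shows "gmres_error_le C d m (q ^ m * (1 + q) / (1 - q))"
  unfolding gmres_error_le_def
proof (intro conjI ballI impI)
  show "invertible_mat C" by (rule det_nonzero_invertible[OF C contraction_invertible[OF C q(2) le]])
  fix u assume "u \<in> carrier_vec (dim_col C)" and Cu: "C *\<^sub>v u = d"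
  then have u: "u \<in> carrier_vec N" using C by simp
  let ?x = "gmres_iterate C d m"
  have "?x \<in> carrier_vec N" using gmres_minimal(1)[OF C d, of m] C d by (auto simp: krylov_eq krylov_vec_def)
  then have xu: "?x - u \<in> carrier_vec N" using u by simp
  have "C *\<^sub>v (?x - u) = C *\<^sub>v ?x - d"
    using mult_minus_distrib_mat_vec[OF C \<open>?x \<in> carrier_vec N\<close> u] Cu by simp
  then have "euclid_norm (C *\<^sub>v (?x - u)) \<le> euclid_norm (C *\<^sub>v richardson C d m - d)"
    using gmres_minimal(2)[OF C d richardson_krylov[OF C d]] by simp
  also have "\<dots> \<le> q ^ m * euclid_norm d" by (rule richardson_residual(2)[OF C d q(1) le])
  also have "euclid_norm d \<le> (1 + q) * euclid_norm u"
  proof -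
    have "d = u - (u - C *\<^sub>v u)" using Cu u d C by (intro eq_vecI) auto
    moreover have "u - C *\<^sub>v u \<in> carrier_vec N" using u C by simp
    ultimately have "euclid_norm d \<le> euclid_norm u + euclid_norm (u - C *\<^sub>v u)"
      using euclid_norm_triangle[of u N "- (u - C *\<^sub>v u)"] u euclid_norm_uminus[of "u - C *\<^sub>v u" N]
      by (metis minus_add_uminus_vec uminus_carrier_vec)
    then show ?thesis using le[OF u] by (simp add: algebra_simps)
  qed
  finally have 1: "euclid_norm (C *\<^sub>v (?x - u)) \<le> q ^ m * ((1 + q) * euclid_norm u)" using q by (simp add: mult_left_mono)
  have "euclid_norm (?x - u) \<le> euclid_norm (?x - u - C *\<^sub>v (?x - u)) + euclid_norm (C *\<^sub>v (?x - u))"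
    by (rule euclid_norm_triangle_diff[OF xu]) (use C xu in simp)
  then have "(1 - q) * euclid_norm (?x - u) \<le> q ^ m * ((1 + q) * euclid_norm u)"
    using le[OF xu] 1 by (simp add: algebra_simps)
  then have "euclid_norm (?x - u) \<le> q ^ m * (1 + q) / (1 - q) * euclid_norm u"
    using q by (simp add: field_simps)
  \<comment> \<open>For u = 0 the quotient has the default value 0, which the bound also
    covers.\<close>
  then show "euclid_norm (?x - u) / euclid_norm u \<le> q ^ m * (1 + q) / (1 - q)"
    using q by (cases "euclid_norm u = 0") (simp_all add: pos_divide_le_eq order.strict_iff_order)
qed

lemma gmres_error_le_mono: "gmres_error_le C d m \<tau> \<Longrightarrow> \<tau> \<le> \<tau>' \<Longrightarrow> gmres_error_le C d m \<tau>'"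
  by (auto simp: gmres_error_le_def intro: order_trans)

section \<open>Finite-element solutions\<close>

text \<open>\<open>real_of_ereal\<close> would send an infinite essential supremum to 0; membership
  in \<open>Linf\<close> excludes the value \<infinity>.\<close>

lemma Linf_norm_AE:
  fixes f :: "real ^ 'n::finite \<Rightarrow> real"
  assumes f: "f \<in> Linf U"
  shows "AE x in leb U. \<bar>f x\<bar> \<le> Linf_norm U f"
proof -
  let ?M = "leb U" and ?g = "\<lambda>x. ereal \<bar>f x\<bar>"
  obtain B where B: "AE x in ?M. \<bar>f x\<bar> \<le> B" using f by (auto simp: Linf_def)
  have "(\<lambda>x. \<bar>f x\<bar>) \<in> borel_measurable ?M" using Linf_D(1)[OF f] by measurable
  then have m: "?g \<in> borel_measurable ?M" by measurable
  have "esssup ?M ?g \<le> ereal B" by (rule esssup_I[OF m]) (use B in simp)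
  moreover have "AE x in ?M. ?g x \<le> esssup ?M ?g" by (rule esssup_AE)
  ultimately show ?thesis unfolding Linf_norm_def by (cases "esssup ?M ?g") auto
qed

lemma onorm_matrix_bound:
  fixes A :: "real ^ 'n::finite ^ 'n"
  shows "onorm (\<lambda>\<xi>. A *v \<xi>) \<le> real CARD('n) * real CARD('n) * norm A"
proof (rule onorm_le_matrix_component)
  fix i j :: 'n
  show "\<bar>A $ i $ j\<bar> \<le> norm A"
    using Finite_Cartesian_Product.norm_nth_le[of "A $ i" j] Finite_Cartesian_Product.norm_nth_le[of A i] by simp
qed

lemma onorm_matrix_lipschitz:
  fixes A B :: "real ^ 'n::finite ^ 'n"
  shows "onorm (\<lambda>\<xi>. A *v \<xi>) \<le> onorm (\<lambda>\<xi>. B *v \<xi>) + real CARD('n) * real CARD('n) * norm (A - B)"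
proof -
  have l: "bounded_linear (\<lambda>\<xi>. C *v \<xi>)" for C :: "real ^ 'n ^ 'n" by (rule matrix_vector_mul_bounded_linear)
  have "onorm (\<lambda>\<xi>. B *v \<xi> + (A - B) *v \<xi>) \<le> onorm (\<lambda>\<xi>. B *v \<xi>) + onorm (\<lambda>\<xi>. (A - B) *v \<xi>)"
    by (rule onorm_triangle[OF l l])
  then show ?thesis using onorm_matrix_bound[of "A - B"] by (simp flip: matrix_vector_mult_add_rdistrib)
qed

text \<open>Continuity makes the pointwise operator norm of a measurable coefficient measurable, so
  that its essential supremum is a bound almost everywhere.\<close>

lemma continuous_on_onorm: "continuous_on UNIV (\<lambda>A :: real ^ 'n::finite ^ 'n. onorm (\<lambda>\<xi>. A *v \<xi>))"
proof (rule lipschitz_on_continuous_on)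
  show "(real CARD('n) * real CARD('n))-lipschitz_on UNIV (\<lambda>A :: real ^ 'n ^ 'n. onorm (\<lambda>\<xi>. A *v \<xi>))"
  proof (rule lipschitz_onI)
    fix A B :: "real ^ 'n ^ 'n"
    show "dist (onorm (\<lambda>\<xi>. A *v \<xi>)) (onorm (\<lambda>\<xi>. B *v \<xi>)) \<le> real CARD('n) * real CARD('n) * dist A B"
      using onorm_matrix_lipschitz[of A B] onorm_matrix_lipschitz[of B A] by (simp add: dist_norm norm_minus_commute abs_le_iff)
  qed simp
qed

lemma Linf_mat_measurable:
  fixes A :: "real ^ 'n::finite \<Rightarrow> real ^ 'n ^ 'n"
  assumes "Linf_mat U A"
  shows "A \<in> borel_measurable (leb U)"
proof (subst borel_measurable_euclidean_space, rule ballI)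
  fix b :: "real ^ 'n ^ 'n" assume "b \<in> Basis"
  then obtain i j where b: "b = axis i (axis j 1)" by (auto simp: Basis_vec_def)
  have "(\<lambda>x. A x $ i $ j) \<in> borel_measurable (leb U)" using assms Linf_D(1) by (auto simp: Linf_mat_def)
  then show "(\<lambda>x. A x \<bullet> b) \<in> borel_measurable (leb U)" by (simp add: b inner_axis)
qed

lemma Linf_op_norm_AE:
  fixes A :: "real ^ 'n::finite \<Rightarrow> real ^ 'n ^ 'n"
  assumes A: "Linf_mat U A"
  shows "AE x in leb U. onorm (\<lambda>\<xi>. A x *v \<xi>) \<le> Linf_op_norm U A"
proof -
  have m: "(\<lambda>x. onorm (\<lambda>\<xi>. A x *v \<xi>)) \<in> borel_measurable (leb U)"
    by (rule measurable_compose[OF Linf_mat_measurable[OF A] borel_measurable_continuous_onI[OF continuous_on_onorm]])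
  have "\<exists>B. AE x in leb U. \<bar>A x $ i $ j\<bar> \<le> B" for i j :: 'n
    using A by (auto simp: Linf_mat_def Linf_def)
  then obtain B where B: "\<And>i j :: 'n. AE x in leb U. \<bar>A x $ i $ j\<bar> \<le> B i j" by metis
  let ?B = "\<Sum>i\<in>UNIV. \<Sum>j\<in>UNIV. \<bar>B i j\<bar>"
  have le: "B i j \<le> ?B" for i j
  proof -
    have "\<bar>B i j\<bar> \<le> (\<Sum>j\<in>UNIV. \<bar>B i j\<bar>)" by (rule member_le_sum) auto
    also have "\<dots> \<le> ?B" by (rule member_le_sum[of i UNIV "\<lambda>i. \<Sum>j\<in>UNIV. \<bar>B i j\<bar>"]) (auto intro: sum_nonneg)
    finally show ?thesis by linarith
  qed
  have "AE x in leb U. \<forall>i j :: 'n. \<bar>A x $ i $ j\<bar> \<le> B i j" using B by (simp add: AE_all_countable)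
  then have "AE x in leb U. \<bar>onorm (\<lambda>\<xi>. A x *v \<xi>)\<bar> \<le> real CARD('n) * real CARD('n) * ?B"
  proof eventually_elim
    case (elim x)
    have "onorm (\<lambda>\<xi>. A x *v \<xi>) \<le> real CARD('n) * real CARD('n) * ?B"
      by (rule onorm_le_matrix_component) (use elim le order_trans in blast)
    then show ?case using onorm_pos_le[OF matrix_vector_mul_bounded_linear[of "A x"]] by simp
  qed
  with m have "(\<lambda>x. onorm (\<lambda>\<xi>. A x *v \<xi>)) \<in> Linf U" by (auto simp: Linf_def)
  from Linf_norm_AE[OF this] show ?thesis unfolding Linf_op_norm_def by eventually_elim simp
qed

text \<open>A real matrix acts separately on real and imaginary parts, so its real operator norm
  also bounds its action on complex vectors.\<close>

lemma norm_cmat_le: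
  fixes B :: "real ^ 'n::finite ^ 'n" and \<xi> :: "complex ^ 'n"
  assumes "onorm (\<lambda>\<zeta>. B *v \<zeta>) \<le> \<beta>"
  shows "norm (cmat B *v \<xi>) \<le> \<beta> * norm \<xi>"
proof -
  let ?a = "\<chi> i. Re (\<xi> $ i)" and ?b = "\<chi> i. Im (\<xi> $ i)"
  have split: "(norm \<zeta>)\<^sup>2 = (norm (\<chi> i. Re (\<zeta> $ i)))\<^sup>2 + (norm (\<chi> i. Im (\<zeta> $ i)))\<^sup>2" for \<zeta> :: "complex ^ 'n"
    by (simp add: norm_vec_def L2_set_def sum_nonneg cmod_power2 sum.distrib)
  have r: "(\<chi> i. Re ((cmat B *v \<xi>) $ i)) = B *v ?a" "(\<chi> i. Im ((cmat B *v \<xi>) $ i)) = B *v ?b"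
    by (simp_all add: Finite_Cartesian_Product.vec_eq_iff matrix_vector_mult_def cmat_def)
  have le: "norm (B *v \<zeta>) \<le> \<beta> * norm \<zeta>" for \<zeta>
    using onorm[OF matrix_vector_mul_bounded_linear[of B], of \<zeta>] assms mult_right_mono[OF assms norm_ge_zero[of \<zeta>]] by linarith
  have sq: "(norm (B *v \<zeta>))\<^sup>2 \<le> \<beta>\<^sup>2 * (norm \<zeta>)\<^sup>2" for \<zeta>
    using power_mono[OF le[of \<zeta>] norm_ge_zero, of 2] by (simp add: power_mult_distrib)
  have "(norm (cmat B *v \<xi>))\<^sup>2 \<le> \<beta>\<^sup>2 * (norm ?a)\<^sup>2 + \<beta>\<^sup>2 * (norm ?b)\<^sup>2"
    unfolding split[of "cmat B *v \<xi>"] r by (intro add_mono sq)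
  also have "\<dots> = (\<beta> * norm \<xi>)\<^sup>2" unfolding split[of \<xi>] power_mult_distrib by (simp add: distrib_left)
  finally have sq: "(norm (cmat B *v \<xi>))\<^sup>2 \<le> (\<beta> * norm \<xi>)\<^sup>2" .
  have "0 \<le> onorm (\<lambda>\<zeta>. B *v \<zeta>)" by (rule onorm_pos_le[OF matrix_vector_mul_bounded_linear])
  then have "0 \<le> \<beta> * norm \<xi>" using assms by simp
  from power2_le_imp_le[OF sq this] show ?thesis .
qed

text \<open>A symmetric matrix of norm below \<open>\<beta>\<close> is the difference of the positive definite matrices
  \<open>spd_part \<beta> B\<close> and \<open>spd_part \<beta> (- B)\<close>, so that Condition F applies to each of them.\<close>

definition spd_part :: "real \<Rightarrow> real ^ 'n::finite ^ 'n \<Rightarrow> real ^ 'n ^ 'n" where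
  "spd_part \<beta> B = (1 / 2) *\<^sub>R (\<beta> *\<^sub>R Finite_Cartesian_Product.mat 1 + B)"

lemma spd_part_nth: "spd_part \<beta> B $ i $ j = ((if i = j then \<beta> else 0) + B $ i $ j) / 2"
  for i j :: "'n::finite"
  by (simp add: spd_part_def Finite_Cartesian_Product.mat_def)

lemma spd_part_diff: "spd_part \<beta> B - spd_part \<beta> (- B) = B"
  by (simp add: Finite_Cartesian_Product.vec_eq_iff spd_part_nth field_simps)

lemma spd_part_SPD:
  fixes B :: "real ^ 'n::finite ^ 'n"
  assumes sym: "Finite_Cartesian_Product.transpose B = B" and le: "onorm (\<lambda>\<zeta>. B *v \<zeta>) \<le> \<beta>" and "\<beta> < \<beta>'"
  shows "spd_part \<beta>' B \<in> SPD"
  unfolding SPD_def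
proof (intro CollectI conjI allI impI)
  have "B $ i $ j = B $ j $ i" for i j :: 'n
    using arg_cong[OF sym, of "\<lambda>C. C $ j $ i"] by (simp add: Finite_Cartesian_Product.transpose_def)
  then show "Finite_Cartesian_Product.transpose (spd_part \<beta>' B) = spd_part \<beta>' B"
    by (simp add: Finite_Cartesian_Product.vec_eq_iff Finite_Cartesian_Product.transpose_def spd_part_def Finite_Cartesian_Product.mat_def)
  fix \<xi> :: "real ^ 'n" assume \<xi>: "\<xi> \<noteq> 0"
  have "spd_part \<beta>' B *v \<xi> = (1 / 2) *\<^sub>R (\<beta>' *\<^sub>R \<xi> + B *v \<xi>)"
    by (simp add: spd_part_def matrix_vector_mult_add_rdistrib scaleR_matrix_vector_assoc[symmetric])
  then have eq: "(spd_part \<beta>' B *v \<xi>) \<bullet> \<xi> = (\<beta>' * (\<xi> \<bullet> \<xi>) + (B *v \<xi>) \<bullet> \<xi>) / 2" by (simp add: inner_add_left)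
  have "\<bar>(B *v \<xi>) \<bullet> \<xi>\<bar> \<le> norm (B *v \<xi>) * norm \<xi>" by (rule Cauchy_Schwarz_ineq2)
  also have "\<dots> \<le> (onorm (\<lambda>\<zeta>. B *v \<zeta>) * norm \<xi>) * norm \<xi>"
    by (intro mult_right_mono onorm[OF matrix_vector_mul_bounded_linear] norm_ge_zero)
  also have "\<dots> \<le> (\<beta> * norm \<xi>) * norm \<xi>" by (intro mult_right_mono le norm_ge_zero)
  also have "\<dots> = \<beta> * (\<xi> \<bullet> \<xi>)" by (simp add: power2_norm_eq_inner[symmetric] power2_eq_square)
  finally have "- (\<beta> * (\<xi> \<bullet> \<xi>)) \<le> (B *v \<xi>) \<bullet> \<xi>" by linarith
  moreover have "\<beta> * (\<xi> \<bullet> \<xi>) < \<beta>' * (\<xi> \<bullet> \<xi>)" using \<xi> assms(3) by simp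
  ultimately show "0 < (spd_part \<beta>' B *v \<xi>) \<bullet> \<xi>" unfolding eq by simp
qed

text \<open>By the parallelogram law the squares add up to half of |\<beta> \<xi>|^2 + |B \<xi>|^2.
  Bounding the squares jointly is what gives the factor sqrt 2 for the sum of the norms, where
  separate bounds would give 2.\<close>

lemma spd_part_norm:
  fixes B :: "real ^ 'n::finite ^ 'n" and \<xi> :: "complex ^ 'n"
  assumes le: "onorm (\<lambda>\<zeta>. B *v \<zeta>) \<le> \<beta>"
  shows "(norm (cmat (spd_part \<beta> B) *v \<xi>))\<^sup>2 + (norm (cmat (spd_part \<beta> (- B)) *v \<xi>))\<^sup>2 \<le> \<beta>\<^sup>2 * (norm \<xi>)\<^sup>2"
proof -
  let ?x = "\<beta> *\<^sub>R \<xi>" and ?y = "cmat B *v \<xi>"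
  have p: "cmat (spd_part \<beta> C) *v \<xi> = (1 / 2) *\<^sub>R (?x + cmat C *v \<xi>)" for C
    unfolding Finite_Cartesian_Product.vec_eq_iff
  proof
    fix i :: 'n
    have "(cmat (spd_part \<beta> C) *v \<xi>) $ i = (\<Sum>j\<in>UNIV. (if i = j then cpx (\<beta> / 2) * \<xi> $ j else 0) + cpx (C $ i $ j / 2) * \<xi> $ j)"
      unfolding cmat_nth spd_part_nth by (intro sum.cong refl) (simp add: add_divide_distrib distrib_right)
    also have "\<dots> = cpx (\<beta> / 2) * \<xi> $ i + (\<Sum>j\<in>UNIV. cpx (C $ i $ j / 2) * \<xi> $ j)"
      by (simp add: sum.distrib)
    also have "\<dots> = ((1 / 2) *\<^sub>R (?x + cmat C *v \<xi>)) $ i"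
      by (simp only: vector_scaleR_component vector_add_component cmat_nth)
        (simp add: scaleR_conv_of_real add_divide_distrib sum_divide_distrib)
    finally show "(cmat (spd_part \<beta> C) *v \<xi>) $ i = ((1 / 2) *\<^sub>R (?x + cmat C *v \<xi>)) $ i" .
  qed
  have m: "cmat (- B) *v \<xi> = - ?y"
    unfolding Finite_Cartesian_Product.vec_eq_iff by (simp add: cmat_nth sum_negf)
  have "(norm (cmat (spd_part \<beta> B) *v \<xi>))\<^sup>2 + (norm (cmat (spd_part \<beta> (- B)) *v \<xi>))\<^sup>2 = ((norm (?x + ?y))\<^sup>2 + (norm (?x - ?y))\<^sup>2) / 4"
    unfolding p m by (simp add: power_divide power_mult_distrib)
  also have "\<dots> = ((norm ?x)\<^sup>2 + (norm ?y)\<^sup>2) / 2"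
    by (simp only: power2_norm_eq_inner) (simp add: inner_add_left inner_add_right inner_diff_left inner_diff_right inner_commute)
  also have "\<dots> \<le> \<beta>\<^sup>2 * (norm \<xi>)\<^sup>2"
    using power_mono[OF norm_cmat_le[OF le, of \<xi>] norm_ge_zero, of 2] by (simp add: power_mult_distrib)
  finally show ?thesis .
qed

lemma Linf_SPD_mat:
  assumes "A \<in> Linf_SPD U"
  shows "Linf_mat U A" "AE x in leb U. Finite_Cartesian_Product.transpose (A x) = A x"
proof -
  show "Linf_mat U A" using assms by (simp add: Linf_SPD_def Linf_mat_def)
  have "AE x in leb U. A x \<in> SPD" using assms by (simp add: Linf_SPD_def)
  then show "AE x in leb U. Finite_Cartesian_Product.transpose (A x) = A x" by eventually_elim (simp add: SPD_def)
qed

lemma Linf_const: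
  "(\<lambda>x. c) \<in> Linf U"
  unfolding Linf_def by (auto intro!: exI[of _ "\<bar>c\<bar>"])

lemma Linf_mat_diff:
  assumes "Linf_mat U A" "Linf_mat U B"
  shows "Linf_mat U (\<lambda>x. A x - B x)"
  using assms by (simp add: Linf_mat_def Linf_diff)

lemma Linf_spd_part:
  fixes B :: "real ^ 'n::finite \<Rightarrow> real ^ 'n ^ 'n"
  assumes B: "Linf_mat U B" "AE x in leb U. Finite_Cartesian_Product.transpose (B x) = B x"
    and le: "AE x in leb U. onorm (\<lambda>\<zeta>. B x *v \<zeta>) \<le> \<beta>" "\<beta> < \<beta>'"
  shows "(\<lambda>x. spd_part \<beta>' (B x)) \<in> Linf_SPD U"
  unfolding Linf_SPD_def
proof (intro CollectI conjI allI)
  fix i j :: 'n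
  let ?c = "if i = j then \<beta>' else 0"
  obtain C where C: "AE x in leb U. \<bar>B x $ i $ j\<bar> \<le> C" and m: "(\<lambda>x. B x $ i $ j) \<in> borel_measurable (leb U)"
    using B(1) by (auto simp: Linf_mat_def Linf_def)
  from C have "AE x in leb U. \<bar>(?c + B x $ i $ j) / 2\<bar> \<le> \<bar>?c\<bar> + C"
  proof eventually_elim
    case (elim x)
    have "\<bar>(c + b) / 2\<bar> \<le> \<bar>c\<bar> + C" if "\<bar>b\<bar> \<le> C" for b c :: real
    proof -
      have "\<bar>(c + b) / 2\<bar> = \<bar>c + b\<bar> / 2" by simp
      then show ?thesis using abs_triangle_ineq[of c b] abs_ge_zero[of c] abs_ge_zero[of b] that by linarith
    qed
    from this[OF elim] show ?case .
  qed
  moreover have "(\<lambda>x. (?c + B x $ i $ j) / 2) \<in> borel_measurable (leb U)" using m by measurable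
  ultimately show "(\<lambda>x. spd_part \<beta>' (B x) $ i $ j) \<in> Linf U" unfolding spd_part_nth Linf_def by blast
  show "AE x in leb U. spd_part \<beta>' (B x) \<in> SPD"
    using B(2) le(1) by eventually_elim (rule spd_part_SPD[OF _ _ le(2)])
qed

text \<open>The pointwise bound is integrated first, and the sum of the two norms is then estimated
  by sqrt 2 times the root of the sum of squares.\<close>

lemma L2_norm_parts:
  fixes B :: "real ^ 'n::finite \<Rightarrow> real ^ 'n ^ 'n"
  assumes B: "Linf_mat U B" "AE x in leb U. Finite_Cartesian_Product.transpose (B x) = B x"
    and le: "AE x in leb U. onorm (\<lambda>\<zeta>. B x *v \<zeta>) \<le> \<beta>" and g: "g \<in> L2 (leb U)"
    and P: "Linf_mat U (\<lambda>x. spd_part \<beta> (B x))" "Linf_mat U (\<lambda>x. spd_part \<beta> (- B x))" and \<beta>: "0 \<le> \<beta>"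
  shows "norm2 U (\<lambda>x. cmat (spd_part \<beta> (B x)) *v g x) + norm2 U (\<lambda>x. cmat (spd_part \<beta> (- B x)) *v g x)
    \<le> sqrt 2 * \<beta> * norm2 U g"
proof -
  let ?M = "leb U"
  let ?p = "\<lambda>x. cmat (spd_part \<beta> (B x)) *v g x" and ?q = "\<lambda>x. cmat (spd_part \<beta> (- B x)) *v g x"
  let ?a = "L2_norm ?M ?p" and ?b = "L2_norm ?M ?q"
  note i = L2_D(2)[OF Linf_mat_mult_L2[OF P(1) g]] L2_D(2)[OF Linf_mat_mult_L2[OF P(2) g]]
  have "?a\<^sup>2 + ?b\<^sup>2 = (\<integral>x. (norm (?p x))\<^sup>2 + (norm (?q x))\<^sup>2 \<partial>?M)"
    unfolding L2_norm_sq by (rule Bochner_Integration.integral_add[OF i, symmetric])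
  also have "\<dots> \<le> (\<integral>x. \<beta>\<^sup>2 * (norm (g x))\<^sup>2 \<partial>?M)"
  proof (rule integral_mono_AE)
    show "AE x in ?M. (norm (?p x))\<^sup>2 + (norm (?q x))\<^sup>2 \<le> \<beta>\<^sup>2 * (norm (g x))\<^sup>2"
      using le by eventually_elim (rule spd_part_norm)
  qed (use i L2_D(2)[OF g] in auto)
  also have "\<dots> = (\<beta> * L2_norm ?M g)\<^sup>2" by (simp add: power_mult_distrib L2_norm_sq)
  finally have "?a\<^sup>2 + ?b\<^sup>2 \<le> (\<beta> * L2_norm ?M g)\<^sup>2" .
  moreover have "(?a + ?b)\<^sup>2 \<le> 2 * (?a\<^sup>2 + ?b\<^sup>2)" using zero_le_power2[of "?a - ?b"] by (simp add: power2_eq_square algebra_simps)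
  ultimately have "(?a + ?b)\<^sup>2 \<le> (sqrt 2 * \<beta> * L2_norm ?M g)\<^sup>2" by (simp add: power_mult_distrib)
  then show ?thesis by (rule power2_le_imp_le) (simp add: \<beta>)
qed

text \<open>Conditions N and F at one wavenumber and one mesh: \<open>Cb\<close> is the constant of
  Condition N, \<open>C1\<close> and \<open>C2\<close> are those of the two parts of Condition F,
  and \<mu> stands for \<open>m_minus\<close> times h^(d/2).\<close>

locale fem = galerkin k Dm Dt T A n N \<phi>
  for k and Dm Dt :: "(real ^ 'n::finite) set" and T A n N \<phi> +
  fixes W :: "(real ^ 'n \<Rightarrow> complex) set" and Cb C1 C2 \<mu> :: real
  assumes nb: "nodal_basis D W N \<phi>"
    and cond_N: "\<And>f. f \<in> L2 (leb D) \<Longrightarrow> \<exists>z. solves_uniquely D V a (L2_functional D f) z \<and> H1k_norm k D z \<le> Cb * norm2 D f"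
    and cond_F1: "\<And>m \<alpha>. m \<in> Linf D \<Longrightarrow>
      \<exists>u uh. solves V a (L2_functional D (\<lambda>x. cpx (m x) * fe \<alpha> x)) u \<and>
        solves_uniquely D W a (L2_functional D (\<lambda>x. cpx (m x) * fe \<alpha> x)) uh \<and>
        H1k_norm k D (\<lambda>x. u x - uh x) \<le> C1 * norm2 D (\<lambda>x. cpx (m x) * fe \<alpha> x)"
    and cond_F2: "\<And>A' \<alpha>. A' \<in> Linf_SPD D \<Longrightarrow>
      \<exists>u uh. solves V a (grad_functional D A' (fe \<alpha>)) u \<and> solves_uniquely D W a (grad_functional D A' (fe \<alpha>)) uh \<and>
        H1k_norm k D (\<lambda>x. u x - uh x) \<le> C2 * k * dual_norm k Dm Dt (grad_functional D A' (fe \<alpha>))"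
    and \<mu>: "0 < \<mu>" "\<And>c. \<mu> * euclid_norm (Matrix.vec N c) \<le> norm2 D (fe c)"
    and N: "0 < N"
begin

lemma fe_pos: "\<exists>\<alpha>. 0 < norm2 D (fe \<alpha>)"
proof -
  have "0 < euclid_norm (Matrix.vec N (\<lambda>i. 1))" using N by (simp add: euclid_norm_def)
  then have "0 < \<mu> * euclid_norm (Matrix.vec N (\<lambda>i. 1))" using \<mu>(1) by simp
  also note \<mu>(2)
  finally show ?thesis by blast
qed

text \<open>The conditions bound norms by these constants times the norm of the datum, so one
  finite-element datum of positive norm settles both signs.\<close>

lemma Cb_nonneg: "0 \<le> Cb" and C1_nonneg: "0 \<le> C1"
proof -
  obtain \<alpha> where \<alpha>: "0 < norm2 D (fe \<alpha>)" using fe_pos by blast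
  obtain z where "H1k_norm k D z \<le> Cb * norm2 D (fe \<alpha>)" using cond_N[OF V_L2[OF fe_V]] by blast
  then have "0 \<le> Cb * norm2 D (fe \<alpha>)" using H1k_norm_nonneg order_trans by blast
  then show "0 \<le> Cb" using \<alpha> by (simp add: zero_le_mult_iff)
  obtain w where "H1k_norm k D w \<le> C1 * norm2 D (fe \<alpha>)" using cond_F1[OF Linf_const[of 1], of \<alpha>] by auto
  then have "0 \<le> C1 * norm2 D (fe \<alpha>)" using H1k_norm_nonneg order_trans by blast
  then show "0 \<le> C1" using \<alpha> by (simp add: zero_le_mult_iff)
qed

lemma fe_solution_L2:
  assumes "solves V a F u" "solves W a F uh"
  obtains c where "M *\<^sub>v Matrix.vec N c = load_vec N \<phi> F"
    "k * norm2 D (fe c) \<le> k * norm2 D u + H1k_norm k D (\<lambda>x. u x - uh x)"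
proof -
  obtain c where c: "\<And>x. x \<in> D \<Longrightarrow> uh x = fe c x" "M *\<^sub>v Matrix.vec N c = load_vec N \<phi> F"
    by (rule solves_coefficients[OF nb assms(2)]) blast
  have u: "u \<in> L2 (leb D)" using V_L2 assms(1) by (simp add: solves_def)
  have "uh \<in> L2 (leb D)" "norm2 D uh = norm2 D (fe c)"
    using L2_cong_on[of D uh "fe c", OF c(1)] V_L2[OF fe_V] by auto
  moreover have "norm2 D (\<lambda>x. u x - (u x - uh x)) \<le> norm2 D u + norm2 D (\<lambda>x. u x - uh x)"
    by (rule L2_norm_triangle_diff[OF u L2_diff[OF u calculation(1)]])
  ultimately have "norm2 D (fe c) \<le> norm2 D u + norm2 D (\<lambda>x. u x - uh x)" by simp
  then have "k * norm2 D (fe c) \<le> k * norm2 D u + k * norm2 D (\<lambda>x. u x - uh x)"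
    using k by (simp flip: distrib_left)
  moreover have "k * norm2 D (\<lambda>x. u x - uh x) \<le> H1k_norm k D (\<lambda>x. u x - uh x)"
    using H1k_norm_bounds(2)[of k D "\<lambda>x. u x - uh x"] k by simp
  ultimately have "k * norm2 D (fe c) \<le> k * norm2 D u + H1k_norm k D (\<lambda>x. u x - uh x)" by linarith
  with c(2) show thesis by (rule that)
qed

text \<open>Condition F yields some exact solution and Condition N the bounded one; they coincide
  almost everywhere by uniqueness. The bound keeps one factor k on the left, so that the datum with
  k^2 costs a single factor k.\<close>

lemma mass_solution:
  assumes m: "m \<in> Linf D"
  obtains c where "M *\<^sub>v Matrix.vec N c = load_vec N \<phi> (L2_functional D (\<lambda>x. cpx (m x) * fe \<alpha> x))"
    "k * norm2 D (fe c) \<le> (C1 + Cb) * norm2 D (\<lambda>x. cpx (m x) * fe \<alpha> x)"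
proof -
  let ?f = "\<lambda>x. cpx (m x) * fe \<alpha> x"
  obtain u uh where u: "solves V a (L2_functional D ?f) u" and uh: "solves_uniquely D W a (L2_functional D ?f) uh"
    and e: "H1k_norm k D (\<lambda>x. u x - uh x) \<le> C1 * norm2 D ?f" using cond_F1[OF m] by blast
  obtain z where z: "solves_uniquely D V a (L2_functional D ?f) z" "H1k_norm k D z \<le> Cb * norm2 D ?f"
    using cond_N[OF Linf_mult_L2[OF m V_L2[OF fe_V]]] by blast
  have "z \<in> V" "u \<in> V" "AE x in leb D. u x = z x" using z(1) u by (auto simp: solves_uniquely_def solves_def)
  then have "norm2 D u = norm2 D z" by (intro L2_norm_cong_AE L2_D(1) V_L2)
  then have "k * norm2 D u \<le> Cb * norm2 D ?f"
    using H1k_norm_bounds(2)[of k D z] z(2) k by simp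
  moreover obtain c where "M *\<^sub>v Matrix.vec N c = load_vec N \<phi> (L2_functional D ?f)"
    "k * norm2 D (fe c) \<le> k * norm2 D u + H1k_norm k D (\<lambda>x. u x - uh x)"
    by (rule fe_solution_L2[OF u]) (use uh in \<open>auto simp: solves_uniquely_def\<close>)
  ultimately show thesis using e by (intro that[of c]) (simp_all add: distrib_right)
qed

lemma grad_functional_dual:
  fixes \<alpha> :: "nat \<Rightarrow> complex"
  assumes A': "Linf_mat D A'"
  defines "F \<equiv> grad_functional D A' (fe \<alpha>)"
  shows "dual_norm k Dm Dt F \<le> norm2 D (\<lambda>x. cmat (A' x) *v wgrad D (fe \<alpha>) x)" "0 \<le> dual_norm k Dm Dt F"
    and "v \<in> V \<Longrightarrow> cmod (F v) \<le> dual_norm k Dm Dt F * H1k_norm k D v"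
proof -
  let ?B = "norm2 D (\<lambda>x. cmat (A' x) *v wgrad D (fe \<alpha>) x)"
  have F: "cmod (F v) \<le> ?B * H1k_norm k D v" if "v \<in> V" for v
  proof -
    have "cmod (F v) \<le> ?B * norm2 D (wgrad D v)"
      unfolding F_def by (rule grad_functional_integrand(2)[OF A' V_H1[OF fe_V] V_H1[OF that]])
    also have "\<dots> \<le> ?B * H1k_norm k D v" by (intro mult_left_mono H1k_norm_bounds(1)) simp
    finally show ?thesis .
  qed
  note d = dual_norm[OF F L2_norm_nonneg fe_V[of "\<lambda>i. 0"]]
  show "dual_norm k Dm Dt F \<le> ?B" "0 \<le> dual_norm k Dm Dt F" by (rule d(1), assumption) (rule d(2), assumption)
  show "v \<in> V \<Longrightarrow> cmod (F v) \<le> dual_norm k Dm Dt F * H1k_norm k D v" by (rule d(3))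
qed

text \<open>The factor k in the second part of Condition F is cancelled by the k in front of the L2
  part of the weighted norm. The exact solution contributes \<open>Cb\<close> by duality, so the sum
  is free of k.\<close>

lemma grad_solution:
  assumes A': "A' \<in> Linf_SPD D"
  obtains c where "M *\<^sub>v Matrix.vec N c = load_vec N \<phi> (grad_functional D A' (fe \<alpha>))"
    "norm2 D (fe c) \<le> (C2 + Cb) * dual_norm k Dm Dt (grad_functional D A' (fe \<alpha>))"
proof -
  let ?F = "grad_functional D A' (fe \<alpha>)"
  note d = grad_functional_dual[OF Linf_SPD_mat(1)[OF A'], where \<alpha> = \<alpha>]
  obtain u uh where u: "solves V a ?F u" and uh: "solves_uniquely D W a ?F uh"
    and e: "H1k_norm k D (\<lambda>x. u x - uh x) \<le> C2 * k * dual_norm k Dm Dt ?F" using cond_F2[OF A'] by blast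
  have "norm2 D u \<le> Cb * dual_norm k Dm Dt ?F"
    by (rule solution_L2_bound[OF _ u d(3) d(2) Cb_nonneg]) (use cond_N in \<open>auto simp: solves_uniquely_def\<close>)
  then have "k * norm2 D u \<le> k * (Cb * dual_norm k Dm Dt ?F)" using k by simp
  moreover obtain c where c: "M *\<^sub>v Matrix.vec N c = load_vec N \<phi> ?F"
    "k * norm2 D (fe c) \<le> k * norm2 D u + H1k_norm k D (\<lambda>x. u x - uh x)"
    by (rule fe_solution_L2[OF u]) (use uh in \<open>auto simp: solves_uniquely_def\<close>)
  ultimately have "k * norm2 D (fe c) \<le> k * ((C2 + Cb) * dual_norm k Dm Dt ?F)" using e by (simp add: algebra_simps)
  then have "norm2 D (fe c) \<le> (C2 + Cb) * dual_norm k Dm Dt ?F" using k by simp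
  with c(1) show thesis by (rule that)
qed

text \<open>Let x be in the kernel and f the finite-element function with conjugate coefficients.
  The Galerkin system is solvable for the datum f, by c say, and by symmetry the product of x with
  its load vector equals that of c with M x, which is zero. But that product is the squared norm of
  f.\<close>

lemma M_det: "Determinant.det M \<noteq> 0"
proof (rule injective_det_nonzero[OF M_dim(3)])
  fix x assume x: "x \<in> carrier_vec N" "M *\<^sub>v x = 0\<^sub>v N"
  define \<alpha> where "\<alpha> i = cnj (vec_index x i)" for i
  let ?f = "fe \<alpha>"
  obtain c where c: "M *\<^sub>v Matrix.vec N c = load_vec N \<phi> (L2_functional D (\<lambda>x. cpx 1 * fe \<alpha> x))"
    by (rule mass_solution[OF Linf_const])
  have "(\<Sum>i<N. vec_index x i * L2_functional D ?f (cbasis \<phi> i)) = (\<Sum>i<N. vec_index x i * vec_index (M *\<^sub>v Matrix.vec N c) i)"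
    unfolding c by (simp add: load_vec_def)
  also have "\<dots> = (\<Sum>i<N. \<Sum>j<N. vec_index x i * (M $$ (i, j) * c j))"
    by (simp add: scalar_prod_def atLeast0LessThan sum_distrib_left)
  also have "\<dots> = (\<Sum>j<N. c j * (\<Sum>i<N. M $$ (j, i) * vec_index x i))"
  proof (subst sum.swap, rule sum.cong[OF refl])
    fix j assume j: "j \<in> {..<N}"
    have "M $$ (i, j) = M $$ (j, i)" if "i < N" for i
      using arg_cong[OF M_symmetric, of "\<lambda>B. B $$ (j, i)"] j that by simp
    then show "(\<Sum>i<N. vec_index x i * (M $$ (i, j) * c j)) = c j * (\<Sum>i<N. M $$ (j, i) * vec_index x i)"
      unfolding sum_distrib_left by (intro sum.cong refl) (simp add: mult_ac)
  qed
  also have "\<dots> = (\<Sum>j<N. c j * vec_index (M *\<^sub>v x) j)"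
    using x(1) by (intro sum.cong refl) (simp add: scalar_prod_def atLeast0LessThan)
  also have "\<dots> = 0" using x(2) by simp
  finally have z: "(\<Sum>i<N. vec_index x i * L2_functional D ?f (cbasis \<phi> i)) = 0" .
  have i: "integrable (leb D) (\<lambda>y. ?f y * cnj (cbasis \<phi> i y))" if "i < N" for i
    by (intro L2_integrable_mult(1) L2_cnj V_L2 fe_V basis that)
  have "cpx ((norm2 D ?f)\<^sup>2) = (\<integral>y. cpx ((cmod (?f y))\<^sup>2) \<partial>leb D)"
    unfolding L2_norm_sq by (rule integral_complex_of_real[symmetric])
  also have "\<dots> = (\<integral>y. (\<Sum>i<N. vec_index x i * (?f y * cnj (cbasis \<phi> i y))) \<partial>leb D)"
  proof (rule Bochner_Integration.integral_cong[OF refl])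
    fix y
    have "cpx ((cmod (?f y))\<^sup>2) = ?f y * cnj (?f y)" by (simp only: complex_norm_square)
    also have "cnj (?f y) = (\<Sum>i<N. vec_index x i * cpx (\<phi> i y))" by (simp add: fe_fun_def \<alpha>_def)
    finally show "cpx ((cmod (?f y))\<^sup>2) = (\<Sum>i<N. vec_index x i * (?f y * cnj (cbasis \<phi> i y)))"
      by (simp add: sum_distrib_left mult_ac)
  qed
  also have "\<dots> = (\<Sum>i<N. vec_index x i * L2_functional D ?f (cbasis \<phi> i))"
  proof (subst Bochner_Integration.integral_sum)
    show "integrable (leb D) (\<lambda>y. vec_index x i * (?f y * cnj (cbasis \<phi> i y)))" if "i \<in> {..<N}" for i
      by (rule Bochner_Integration.integrable_mult_right[OF i]) (use that in simp)
  qed (simp only: integral_mult_right_zero L2_functional_def)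
  finally have "cpx ((norm2 D ?f)\<^sup>2) = 0" unfolding z .
  then have "norm2 D ?f = 0" by simp
  then have "\<mu> * euclid_norm (Matrix.vec N \<alpha>) \<le> 0" using \<mu>(2)[of \<alpha>] by simp
  then have "euclid_norm (Matrix.vec N \<alpha>) = 0" using \<mu>(1) euclid_norm_nonneg[of "Matrix.vec N \<alpha>"] by (simp add: mult_le_0_iff)
  moreover have "euclid_norm (Matrix.vec N \<alpha>) = euclid_norm x" using x(1) by (simp add: euclid_norm_def \<alpha>_def)
  ultimately show "x = 0\<^sub>v N" using euclid_norm_eq_0[OF x(1)] by simp
qed

end

lemma cdot_cvec_cnj: "cdot \<xi> (cvec_cnj \<xi>) = cpx ((norm \<xi>)\<^sup>2)"
  by (simp add: cdot_def norm_vec_def L2_set_def sum_nonneg complex_norm_square del: of_real_power)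

lemma cmat_mat_1 [simp]: "cmat (Finite_Cartesian_Product.mat 1) *v \<xi> = \<xi>"
  unfolding Finite_Cartesian_Product.vec_eq_iff
proof
  fix i
  have "(cmat (Finite_Cartesian_Product.mat 1) *v \<xi>) $ i = (\<Sum>j\<in>UNIV. if i = j then \<xi> $ j else 0)"
    unfolding cmat_nth by (intro sum.cong refl) (simp add: Finite_Cartesian_Product.mat_def)
  then show "(cmat (Finite_Cartesian_Product.mat 1) *v \<xi>) $ i = \<xi> $ i" by simp
qed

lemma Linf_SPD_mat_1: "(\<lambda>x. Finite_Cartesian_Product.mat 1) \<in> Linf_SPD U"
  by (auto simp: Linf_SPD_def Linf_const SPD_def)

context fem
begin

text \<open>With the identity as coefficient, the functional takes at its own finite-element
  function the squared norm of the gradient as value. Its dual norm is then positive, and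
  \<open>grad_solution\<close> forces the sign of the constant.\<close>

lemma C2_Cb_nonneg:
  assumes "0 < norm2 D (wgrad D (fe \<alpha>))"
  shows "0 \<le> C2 + Cb"
proof -
  let ?F = "grad_functional D (\<lambda>x. Finite_Cartesian_Product.mat 1) (fe \<alpha>)"
  note d = grad_functional_dual[OF Linf_SPD_mat(1)[OF Linf_SPD_mat_1], where \<alpha> = \<alpha>]
  have "?F (fe \<alpha>) = cpx ((norm2 D (wgrad D (fe \<alpha>)))\<^sup>2)"
    unfolding grad_functional_def cmat_mat_1 cdot_cvec_cnj L2_norm_sq by (rule integral_complex_of_real)
  then have "cmod (?F (fe \<alpha>)) = (norm2 D (wgrad D (fe \<alpha>)))\<^sup>2" by (simp only: norm_of_real abs_of_nonneg[OF zero_le_power2])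
  moreover have "0 < (norm2 D (wgrad D (fe \<alpha>)))\<^sup>2" using assms by (rule zero_less_power)
  ultimately have "0 < cmod (?F (fe \<alpha>))" by linarith
  also note d(3)[OF fe_V[of \<alpha>]]
  finally have pos: "0 < dual_norm k Dm Dt ?F" using d(2) by (auto simp only: zero_less_mult_iff)
  obtain c where "norm2 D (fe c) \<le> (C2 + Cb) * dual_norm k Dm Dt ?F" by (rule grad_solution[OF Linf_SPD_mat_1])
  from order_trans[OF L2_norm_nonneg this] have "0 \<le> (C2 + Cb) * dual_norm k Dm Dt ?F" .
  then show ?thesis using pos by (simp add: zero_le_mult_iff)
qed

text \<open>A negative b would make the hypothesis contradictory almost everywhere, that is, the
  domain null, against the existence of a function of positive norm.\<close>

lemma bound_nonneg:
  fixes f :: "real ^ 'n \<Rightarrow> real"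
  assumes "AE x in leb D. 0 \<le> f x \<and> f x \<le> b"
  shows "0 \<le> b"
proof (rule ccontr)
  assume b: "\<not> 0 \<le> b"
  obtain \<alpha> where \<alpha>: "0 < norm2 D (fe \<alpha>)" using fe_pos by blast
  from assms have "AE x in leb D. fe \<alpha> x = 0" by eventually_elim (use b in linarith)
  then have "norm2 D (fe \<alpha>) = norm2 D (\<lambda>x. 0 :: complex)"
    by (intro L2_norm_cong_AE L2_D(1)[OF V_L2[OF fe_V]] borel_measurable_const)
  then show False using \<alpha> by (simp add: L2_norm_def)
qed

lemma M_mult_sum: "i < N \<Longrightarrow> vec_index (M *\<^sub>v Matrix.vec N c) i = (\<Sum>j<N. M $$ (i, j) * c j)"
  by (simp add: scalar_prod_def atLeast0LessThan)

lemma M_inj: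
  assumes "y \<in> carrier_vec N" "z \<in> carrier_vec N" "M *\<^sub>v y = M *\<^sub>v z"
  shows "y = z"
proof -
  have "M *\<^sub>v (y - z) = 0\<^sub>v N"
    unfolding mult_minus_distrib_mat_vec[OF M_dim(3) assms(1,2)] assms(3) by (intro minus_cancel_vec mult_mat_vec_carrier[OF M_dim(3) assms(2)])
  moreover have "y - z \<in> carrier_vec N" using assms(1,2) by simp
  ultimately have "y - z = 0\<^sub>v N" using M_det det_0_iff_vec_prod_zero[OF M_dim(3)] by blast
  then have "vec_index (y - z) i = 0" if "i < N" for i
    using that by simp
  then have "vec_index y i - vec_index z i = 0" if "i < N" for i
    using assms(1,2) that by simp
  then show ?thesis using assms(1,2) by (intro eq_vecI) simp_all
qed

text \<open>The vector y is written as a difference of the Galerkin solutions for the two positive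
  definite parts, minus k^2 times the one for the mass datum. The norm equivalence turns the bounds
  on these solutions into one on the coefficients.\<close>

lemma contraction:
  assumes G2: "galerkin k Dm Dt T A2 n2 N \<phi>"
    and \<mu>': "0 \<le> \<mu>'" "\<And>c. norm2 D (fe c) \<le> \<mu>' * euclid_norm (Matrix.vec N c)"
    and \<sigma>: "0 \<le> \<sigma>" "\<And>c. norm2 D (wgrad D (fe c)) \<le> \<sigma> * euclid_norm (Matrix.vec N c)"
    and K: "0 \<le> C2 + Cb"
    and le: "(C2 + Cb) * \<sigma> * Linf_op_norm D (\<lambda>x. A x - A2 x) + k * (C1 + Cb) * \<mu>' * Linf_norm D (\<lambda>x. n x - n2 x) \<le> \<mu> / 2"
    and x: "x \<in> carrier_vec N" and y: "y \<in> carrier_vec N"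
    and eq: "M *\<^sub>v y = (M - galerkin_mat k D T A2 n2 N \<phi>) *\<^sub>v x"
  shows "euclid_norm y \<le> sqrt 2 / 2 * euclid_norm x"
proof -
  interpret G2: galerkin k Dm Dt T A2 n2 N \<phi> by (rule G2)
  let ?M = "leb D" and ?B = "\<lambda>x. A x - A2 x" and ?m = "\<lambda>x. n x - n2 x"
  let ?\<beta> = "Linf_op_norm D ?B" and ?\<nu> = "Linf_norm D ?m" and ?X = "euclid_norm x"
  define \<alpha> where "\<alpha> = vec_index x"
  have x\<alpha>: "x = Matrix.vec N \<alpha>" using x by (intro eq_vecI) (simp_all add: \<alpha>_def)
  have B: "Linf_mat D ?B" by (rule Linf_mat_diff[OF A(1) G2.A(1)])
  have Bs: "AE x in ?M. Finite_Cartesian_Product.transpose (?B x) = ?B x"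
    using A(2) G2.A(2)
  proof eventually_elim
    case (elim x)
    then show ?case
      unfolding Finite_Cartesian_Product.vec_eq_iff Finite_Cartesian_Product.transpose_def by simp
  qed
  have B\<beta>: "AE x in ?M. onorm (\<lambda>\<zeta>. ?B x *v \<zeta>) \<le> ?\<beta>" by (rule Linf_op_norm_AE[OF B])
  have m: "?m \<in> Linf D" by (rule Linf_diff[OF n G2.n])
  have m\<nu>: "AE x in ?M. \<bar>?m x\<bar> \<le> ?\<nu>" by (rule Linf_norm_AE[OF m])
  have \<beta>0: "0 \<le> ?\<beta>"
  proof (rule bound_nonneg)
    show "AE x in ?M. 0 \<le> onorm (\<lambda>\<zeta>. ?B x *v \<zeta>) \<and> onorm (\<lambda>\<zeta>. ?B x *v \<zeta>) \<le> ?\<beta>"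
      using B\<beta> by eventually_elim (simp add: onorm_pos_le[OF matrix_vector_mul_bounded_linear])
  qed
  have \<nu>0: "0 \<le> ?\<nu>" by (rule bound_nonneg[of "\<lambda>x. \<bar>?m x\<bar>"]) (use m\<nu> in simp)
  have fb: "fe \<alpha> \<in> V" "\<And>i. i < N \<Longrightarrow> cbasis \<phi> i \<in> V" using fe_V basis by auto
  have rhs: "vec_index ((M - G2.M) *\<^sub>v x) i = grad_functional D ?B (fe \<alpha>) (cbasis \<phi> i)
      - cpx (k\<^sup>2) * L2_functional D (\<lambda>x. cpx (?m x) * fe \<alpha> x) (cbasis \<phi> i)" if i: "i < N" for i
  proof -
    have "vec_index ((M - G2.M) *\<^sub>v x) i = vec_index (M *\<^sub>v x) i - vec_index (G2.M *\<^sub>v x) i"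
      using minus_mult_distrib_mat_vec[OF M_dim(3) G2.M_dim(3) x] i by simp
    also have "\<dots> = a (fe \<alpha>) (cbasis \<phi> i) - G2.a (fe \<alpha>) (cbasis \<phi> i)" unfolding x\<alpha> M_mult[OF i] G2.M_mult[OF i] ..
    also have "\<dots> = grad_functional D A (fe \<alpha>) (cbasis \<phi> i) - grad_functional D A2 (fe \<alpha>) (cbasis \<phi> i)
      - cpx (k\<^sup>2) * (L2_functional D (\<lambda>x. cpx (n x) * fe \<alpha> x) (cbasis \<phi> i) - L2_functional D (\<lambda>x. cpx (n2 x) * fe \<alpha> x) (cbasis \<phi> i))"
      unfolding form_eq[OF fb(1) fb(2)[OF i]] G2.form_eq[OF fb(1) fb(2)[OF i]] by (simp add: algebra_simps)
    also have "L2_functional D (\<lambda>x. cpx (n x) * fe \<alpha> x) (cbasis \<phi> i) - L2_functional D (\<lambda>x. cpx (n2 x) * fe \<alpha> x) (cbasis \<phi> i)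
      = L2_functional D (\<lambda>x. cpx (?m x) * fe \<alpha> x) (cbasis \<phi> i)"
    proof -
      have int: "integrable ?M (\<lambda>x. cpx (l x) * fe \<alpha> x * cnj (cbasis \<phi> i x))" if "l \<in> Linf D" for l
        by (intro L2_integrable_mult(1) Linf_mult_L2 L2_cnj V_L2 fb i that)
      show ?thesis unfolding L2_functional_def
        by (subst Bochner_Integration.integral_diff[OF int[OF n] int[OF G2.n], symmetric]) (simp add: algebra_simps)
    qed
    also have "grad_functional D A (fe \<alpha>) (cbasis \<phi> i) - grad_functional D A2 (fe \<alpha>) (cbasis \<phi> i) = grad_functional D ?B (fe \<alpha>) (cbasis \<phi> i)"
      by (rule grad_functional_diff[OF A(1) G2.A(1) V_H1[OF fb(1)] V_H1[OF fb(2)[OF i]], symmetric])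
    finally show ?thesis .
  qed
  obtain c3 where c3: "M *\<^sub>v Matrix.vec N c3 = load_vec N \<phi> (L2_functional D (\<lambda>x. cpx (?m x) * fe \<alpha> x))"
    "k * L2_norm ?M (fe c3) \<le> (C1 + Cb) * L2_norm ?M (\<lambda>x. cpx (?m x) * fe \<alpha> x)" by (rule mass_solution[OF m])
  have "L2_norm ?M (\<lambda>x. cpx (?m x) * fe \<alpha> x) \<le> ?\<nu> * L2_norm ?M (fe \<alpha>)"
    using L2_bounded_mult(2)[OF V_L2[OF fb(1)] Linf_D(1)[OF m] m\<nu> \<nu>0] by (simp add: scaleR_conv_of_real)
  also have "\<dots> \<le> ?\<nu> * (\<mu>' * ?X)" unfolding x\<alpha> by (rule mult_left_mono[OF \<mu>'(2) \<nu>0])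
  finally have c3': "k * L2_norm ?M (fe c3) \<le> (C1 + Cb) * (?\<nu> * (\<mu>' * ?X))"
    using c3(2) mult_left_mono[of _ "?\<nu> * (\<mu>' * ?X)" "C1 + Cb"] Cb_nonneg C1_nonneg by fastforce
  \<comment> \<open>The parts are positive definite only for \<beta>' strictly above the norm of the
    difference; the equality case is reached afterwards by letting \<beta>' decrease.\<close>
  have main: "\<mu> * euclid_norm y \<le> (C2 + Cb) * (sqrt 2 * \<beta>' * (\<sigma> * ?X)) + k * ((C1 + Cb) * (?\<nu> * (\<mu>' * ?X)))" if \<beta>': "?\<beta> < \<beta>'" for \<beta>'
  proof -
    let ?P = "\<lambda>x. spd_part \<beta>' (?B x)" and ?Q = "\<lambda>x. spd_part \<beta>' (- ?B x)"
    have P: "?P \<in> Linf_SPD D" by (rule Linf_spd_part[OF B Bs B\<beta> \<beta>'])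
    have Q: "?Q \<in> Linf_SPD D"
    proof (rule Linf_spd_part[OF _ _ _ \<beta>'])
      show "Linf_mat D (\<lambda>x. - ?B x)" using Linf_mat_diff[OF G2.A(1) A(1)] by simp
      show "AE x in ?M. Finite_Cartesian_Product.transpose (- ?B x) = - ?B x"
      proof -
        have "Finite_Cartesian_Product.transpose (- C) = - Finite_Cartesian_Product.transpose C" for C :: "real ^ 'n ^ 'n"
          by (simp add: Finite_Cartesian_Product.vec_eq_iff Finite_Cartesian_Product.transpose_def)
        then show ?thesis using Bs by (auto elim!: eventually_mono simp del: minus_diff_eq)
      qed
      have "onorm (\<lambda>\<zeta>. - C *v \<zeta>) = onorm (\<lambda>\<zeta>. C *v \<zeta>)" for C :: "real ^ 'n ^ 'n"
      proof -
        have "- C *v \<zeta> = - (C *v \<zeta>)" for \<zeta>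
          by (simp add: matrix_vector_mult_def Finite_Cartesian_Product.vec_eq_iff sum_negf)
        then show ?thesis using onorm_neg[of "\<lambda>\<zeta>. C *v \<zeta>"] by simp
      qed
      then show "AE x in ?M. onorm (\<lambda>\<zeta>. - ?B x *v \<zeta>) \<le> ?\<beta>" using B\<beta> by (simp del: minus_diff_eq)
    qed
    note PQ = Linf_SPD_mat(1)[OF P] Linf_SPD_mat(1)[OF Q]
    let ?FP = "grad_functional D ?P (fe \<alpha>)" and ?FQ = "grad_functional D ?Q (fe \<alpha>)"
    obtain c1 where c1: "M *\<^sub>v Matrix.vec N c1 = load_vec N \<phi> ?FP" "L2_norm ?M (fe c1) \<le> (C2 + Cb) * dual_norm k Dm Dt ?FP"
      by (rule grad_solution[OF P])
    obtain c2 where c2: "M *\<^sub>v Matrix.vec N c2 = load_vec N \<phi> ?FQ" "L2_norm ?M (fe c2) \<le> (C2 + Cb) * dual_norm k Dm Dt ?FQ"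
      by (rule grad_solution[OF Q])
    \<comment> \<open>The three right-hand sides combine to (M - M2) x, because the two definite
      parts differ by \<open>A - A2\<close>; injectivity of M identifies these coefficients with
      y.\<close>
    define c where "c j = c1 j - c2 j - cpx (k\<^sup>2) * c3 j" for j
    have "M *\<^sub>v Matrix.vec N c = M *\<^sub>v y"
    proof (rule eq_vecI)
      fix i assume "i < dim_vec (M *\<^sub>v y)"
      then have i: "i < N" by simp
      have "vec_index (M *\<^sub>v Matrix.vec N c) i = vec_index (M *\<^sub>v Matrix.vec N c1) i - vec_index (M *\<^sub>v Matrix.vec N c2) i
          - cpx (k\<^sup>2) * vec_index (M *\<^sub>v Matrix.vec N c3) i"
        unfolding M_mult_sum[OF i] c_def by (simp only: right_diff_distrib sum_subtractf sum_distrib_left mult.left_commute)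
      also have "\<dots> = (?FP (cbasis \<phi> i) - ?FQ (cbasis \<phi> i)) - cpx (k\<^sup>2) * L2_functional D (\<lambda>x. cpx (?m x) * fe \<alpha> x) (cbasis \<phi> i)"
        unfolding c1(1) c2(1) c3(1) using i by (simp add: load_vec_def)
      also have "?FP (cbasis \<phi> i) - ?FQ (cbasis \<phi> i) = grad_functional D ?B (fe \<alpha>) (cbasis \<phi> i)"
        using grad_functional_diff[OF PQ V_H1[OF fb(1)] V_H1[OF fb(2)[OF i]]] unfolding spd_part_diff by simp
      also have "\<dots> - cpx (k\<^sup>2) * L2_functional D (\<lambda>x. cpx (?m x) * fe \<alpha> x) (cbasis \<phi> i) = vec_index (M *\<^sub>v y) i"
        unfolding eq rhs[OF i] ..
      finally show "vec_index (M *\<^sub>v Matrix.vec N c) i = vec_index (M *\<^sub>v y) i" .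
    qed simp
    then have yc: "y = Matrix.vec N c" by (intro M_inj[OF y, symmetric, THEN sym]) simp_all
    note f2 = V_L2[OF fe_V]
    have "fe c = (\<lambda>x. (fe c1 x - fe c2 x) - cpx (k\<^sup>2) * fe c3 x)"
      by (rule ext) (simp only: fe_fun_def c_def left_diff_distrib sum_subtractf sum_distrib_left mult.assoc)
    then have "L2_norm ?M (fe c) \<le> L2_norm ?M (\<lambda>x. fe c1 x - fe c2 x) + L2_norm ?M (\<lambda>x. cpx (k\<^sup>2) * fe c3 x)"
      by (simp only: L2_norm_triangle_diff[OF L2_diff[OF f2 f2] L2_cmult[OF f2]])
    also have "L2_norm ?M (\<lambda>x. fe c1 x - fe c2 x) \<le> L2_norm ?M (fe c1) + L2_norm ?M (fe c2)"
      by (rule L2_norm_triangle_diff[OF f2 f2])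
    also have "L2_norm ?M (\<lambda>x. cpx (k\<^sup>2) * fe c3 x) = k * (k * L2_norm ?M (fe c3))"
      unfolding L2_norm_cmult by (simp add: power2_eq_square norm_mult k)
    finally have "L2_norm ?M (fe c) \<le> (C2 + Cb) * (dual_norm k Dm Dt ?FP + dual_norm k Dm Dt ?FQ) + k * (k * L2_norm ?M (fe c3))"
      using c1(2) c2(2) by (simp add: distrib_left)
    also have "\<dots> \<le> (C2 + Cb) * (sqrt 2 * \<beta>' * (\<sigma> * ?X)) + k * ((C1 + Cb) * (?\<nu> * (\<mu>' * ?X)))"
    proof (intro add_mono mult_left_mono K c3')
      have "dual_norm k Dm Dt ?FP + dual_norm k Dm Dt ?FQ \<le> L2_norm ?M (\<lambda>x. cmat (?P x) *v wgrad D (fe \<alpha>) x) + L2_norm ?M (\<lambda>x. cmat (?Q x) *v wgrad D (fe \<alpha>) x)"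
        by (intro add_mono grad_functional_dual(1) PQ)
      also have "\<dots> \<le> sqrt 2 * \<beta>' * L2_norm ?M (wgrad D (fe \<alpha>))"
        by (rule L2_norm_parts[OF B Bs _ wgrad_L2[OF V_H1[OF fb(1)]] PQ]) (use B\<beta> \<beta>' \<beta>0 in \<open>auto elim!: eventually_mono\<close>)
      also have "\<dots> \<le> sqrt 2 * \<beta>' * (\<sigma> * ?X)" unfolding x\<alpha> using \<beta>' \<beta>0 by (intro mult_left_mono \<sigma>) simp
      finally show "dual_norm k Dm Dt ?FP + dual_norm k Dm Dt ?FQ \<le> sqrt 2 * \<beta>' * (\<sigma> * ?X)" .
    qed (use k in simp)
    finally show ?thesis using \<mu>(2)[of c] unfolding yc by linarith
  qed
  have "\<mu> * euclid_norm y \<le> (C2 + Cb) * (sqrt 2 * ?\<beta> * (\<sigma> * ?X)) + k * ((C1 + Cb) * (?\<nu> * (\<mu>' * ?X)))"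
  proof (rule field_le_epsilon)
    fix e :: real assume e: "0 < e"
    let ?L = "(C2 + Cb) * (sqrt 2 * (\<sigma> * ?X))"
    \<comment> \<open>The increment e / (L + 1) of \<beta> changes the bound by L e / (L + 1), hence
      by at most e, also when L is 0.\<close>
    have L: "0 \<le> ?L" using K \<sigma>(1) by simp
    have "\<mu> * euclid_norm y \<le> (C2 + Cb) * (sqrt 2 * (?\<beta> + e / (?L + 1)) * (\<sigma> * ?X)) + k * ((C1 + Cb) * (?\<nu> * (\<mu>' * ?X)))"
      by (rule main) (use e L in simp)
    moreover have "(C2 + Cb) * (sqrt 2 * (?\<beta> + e / (?L + 1)) * (\<sigma> * ?X)) = (C2 + Cb) * (sqrt 2 * ?\<beta> * (\<sigma> * ?X)) + ?L * (e / (?L + 1))"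
      by (simp only: distrib_left distrib_right mult_ac)
    moreover have "?L * (e / (?L + 1)) \<le> e" using L e by (simp add: field_simps)
    ultimately show "\<mu> * euclid_norm y \<le> (C2 + Cb) * (sqrt 2 * ?\<beta> * (\<sigma> * ?X)) + k * ((C1 + Cb) * (?\<nu> * (\<mu>' * ?X))) + e"
      by linarith
  qed
  also have "\<dots> \<le> sqrt 2 * (((C2 + Cb) * \<sigma> * ?\<beta> + k * (C1 + Cb) * \<mu>' * ?\<nu>) * ?X)"
  proof -
    \<comment> \<open>The mass term carries no sqrt 2 of its own; it is enlarged by that factor so
      that the hypothesis applies to the whole sum.\<close>
    have "0 \<le> k * (C1 + Cb) * \<mu>' * ?\<nu> * ?X" using k C1_nonneg Cb_nonneg \<mu>'(1) \<nu>0 by simp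
    then have "k * (C1 + Cb) * \<mu>' * ?\<nu> * ?X \<le> sqrt 2 * (k * (C1 + Cb) * \<mu>' * ?\<nu> * ?X)" by (simp add: mult_le_cancel_right1)
    then show ?thesis by (simp add: algebra_simps)
  qed
  also have "\<dots> \<le> sqrt 2 * (\<mu> / 2 * ?X)" by (intro mult_left_mono mult_right_mono le) simp_all
  finally have "\<mu> * euclid_norm y \<le> \<mu> * (sqrt 2 / 2 * ?X)" by (simp add: mult_ac)
  then show ?thesis using \<mu>(1) by simp
qed

end

section \<open>Finite-element functions with nonzero gradient\<close>

context
  fixes Dm Dt :: "(real ^ 'n::finite) set"
  assumes dim2: "2 \<le> CARD('n)" and geo: "geometry Dm Dt"
begin

text \<open>The mesh covers the closure of the domain, and the interiors of its simplices should lie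
  in the domain itself. The obstacle is open and disjoint from the domain, so an interior point of
  the closure avoids its closure; a point of the outer boundary is excluded because just beyond the
  graph there are no points of \<open>closure Dt\<close>.\<close>

lemma interior_closure_dom: "interior (closure (dom_D Dm Dt)) \<subseteq> dom_D Dm Dt"
proof
  let ?D = "dom_D Dm Dt"
  let ?I = "interior (closure ?D)"
  fix x assume x: "x \<in> ?I"
  have DDt: "closure ?D \<subseteq> closure Dt" by (intro closure_mono) (auto simp: dom_D_def)
  have "open Dm" using geo by (simp add: geometry_def lipschitz_open_def)
  moreover have "Dm \<inter> ?D = {}" using closure_subset[of Dm] by (auto simp: dom_D_def)
  ultimately have "Dm \<inter> closure ?D = {}" by (simp add: open_Int_closure_eq_empty)
  then have "Dm \<inter> ?I = {}" using interior_subset by blast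
  then have "closure Dm \<inter> ?I = {}" using open_Int_closure_eq_empty[OF open_interior, of "closure ?D" Dm] by (simp add: Int_commute)
  then have xm: "x \<notin> closure Dm" using x by blast
  have "x \<in> Dt"
  proof (rule ccontr)
    assume "x \<notin> Dt"
    moreover have "x \<in> closure Dt" using x DDt interior_subset by blast
    ultimately have fr: "x \<in> frontier Dt" using open_Dt[OF dim2 geo] by (simp add: frontier_def interior_open)
    obtain e r L and g :: "real ^ 'n \<Rightarrow> real" where e: "norm e = 1" "0 < r"
      and ch: "\<And>y. y \<in> ball x r \<Longrightarrow> y \<in> Dt \<longleftrightarrow> y \<bullet> e < g (orth_part e y)"
        "\<And>y. y \<in> frontier Dt \<Longrightarrow> y \<in> ball x r \<Longrightarrow> y \<bullet> e = g (orth_part e y)"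
      by (rule lipschitz_chart[OF lipschitz_Dt[OF dim2 geo] fr]) blast
    obtain s where s: "0 < s" "ball x s \<subseteq> ?I" using x open_contains_ball_eq[OF open_interior] by blast
    define t where "t = min r s / 2"
    have t: "0 < t" "t < r" "t < s" using e(2) s(1) by (auto simp: t_def)
    let ?y = "x + t *\<^sub>R e"
    have ee: "e \<bullet> e = 1" using e(1) by (simp add: norm_eq_1)
    have "dist x ?y = t" using e(1) t(1) by (simp add: dist_norm)
    then have yr: "?y \<in> ball x r" and "?y \<in> ball x s" using t by simp_all
    then have "?y \<in> closure Dt" using s(2) DDt interior_subset by blast
    then have "?y \<in> Dt \<or> ?y \<in> frontier Dt" using open_Dt[OF dim2 geo] by (auto simp: frontier_def interior_open)
    then have "?y \<bullet> e \<le> g (orth_part e ?y)" using ch(1)[OF yr] ch(2)[OF _ yr] by auto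
    moreover have "orth_part e ?y = orth_part e x" by (simp add: orth_part_def inner_add_left ee algebra_simps)
    moreover have "x \<bullet> e = g (orth_part e x)" by (rule ch(2)[OF fr]) (use e(2) in simp)
    ultimately show False using t(1) by (simp add: inner_add_left ee)
  qed
  with xm show "x \<in> ?D" by (simp add: dom_D_def)
qed

end

lemma poly_fun_smooth:
  fixes q :: "real ^ 'n::finite \<Rightarrow> complex"
  assumes "q \<in> poly_fun p"
  shows "Ck_on m UNIV q"
proof -
  obtain c :: "('n \<Rightarrow> nat) \<Rightarrow> complex" where c: "\<And>x. q x = (\<Sum>\<alpha> | sum \<alpha> UNIV \<le> p. c \<alpha> * cpx (\<Prod>i\<in>UNIV. (x $ i) ^ \<alpha> i))"
    using assms by (auto simp: poly_fun_def)
  have "Ck_on m UNIV (\<lambda>x :: real ^ 'n. c \<alpha> * cpx (\<Prod>i\<in>UNIV. \<Prod>j<\<alpha> i. x $ i))" for \<alpha>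
  proof (rule Ck_on_bounded_linear[where L = "\<lambda>r. c \<alpha> * cpx r"])
    show "bounded_linear (\<lambda>r. c \<alpha> * cpx r)"
      by (rule bounded_linear_const_mult[OF bounded_linear_of_real])
    show "Ck_on m UNIV (\<lambda>x :: real ^ 'n. \<Prod>i\<in>UNIV. \<Prod>j<\<alpha> i. x $ i)"
      by (rule Ck_on_prod[OF open_UNIV Ck_on_prod[OF open_UNIV Ck_on_linear[OF bounded_linear_vec_nth open_UNIV]]])
  qed simp
  then have "Ck_on m UNIV (\<lambda>x. \<Sum>\<alpha> | sum \<alpha> UNIV \<le> p. c \<alpha> * cpx (\<Prod>i\<in>UNIV. \<Prod>j<\<alpha> i. x $ i))"
    by (intro Ck_on_sum open_UNIV)
  then show ?thesis by (simp add: c[abs_def])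
qed

lemma poly_fun_coordinate:
  assumes "1 \<le> p"
  shows "(\<lambda>x :: real ^ 'n::finite. c * cpx (x $ i)) \<in> poly_fun p"
proof -
  let ?\<delta> = "\<lambda>j :: 'n. if j = i then 1 else (0 :: nat)"
  have fin: "finite {\<alpha> :: 'n \<Rightarrow> nat. sum \<alpha> UNIV \<le> p}"
  proof (rule finite_subset)
    show "{\<alpha> :: 'n \<Rightarrow> nat. sum \<alpha> UNIV \<le> p} \<subseteq> PiE UNIV (\<lambda>_. {..p})"
    proof
      fix \<alpha> :: "'n \<Rightarrow> nat" assume \<alpha>: "\<alpha> \<in> {\<alpha>. sum \<alpha> UNIV \<le> p}"
      have "\<alpha> j \<le> sum \<alpha> UNIV" for j by (rule member_le_sum) simp_all
      then show "\<alpha> \<in> PiE UNIV (\<lambda>_. {..p})" using \<alpha> by (auto simp: PiE_def Pi_def intro: order_trans)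
    qed
  qed (intro finite_PiE; simp)
  have "(\<Sum>\<alpha> | sum \<alpha> UNIV \<le> p. (if \<alpha> = ?\<delta> then c else 0) * cpx (\<Prod>j\<in>UNIV. (x $ j) ^ \<alpha> j)) = c * cpx (x $ i)" for x :: "real ^ 'n"
  proof -
    have "(\<Sum>\<alpha> | sum \<alpha> UNIV \<le> p. (if \<alpha> = ?\<delta> then c else 0) * cpx (\<Prod>j\<in>UNIV. (x $ j) ^ \<alpha> j)) =
      (\<Sum>\<alpha> | sum \<alpha> UNIV \<le> p. if \<alpha> = ?\<delta> then c * cpx (\<Prod>j\<in>UNIV. (x $ j) ^ ?\<delta> j) else 0)"
      by (intro sum.cong refl) auto
    also have "\<dots> = c * cpx (\<Prod>j\<in>UNIV. (x $ j) ^ ?\<delta> j)" using fin assms by simp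
    also have "(\<Prod>j\<in>UNIV. (x $ j) ^ ?\<delta> j) = (\<Prod>j\<in>UNIV. if j = i then x $ j else 1)" by (intro prod.cong refl) auto
    also have "\<dots> = x $ i" by simp
    finally show ?thesis .
  qed
  then show ?thesis unfolding poly_fun_def by (intro CollectI exI[of _ "\<lambda>\<alpha>. if \<alpha> = ?\<delta> then c else 0"] allI) simp
qed

text \<open>In the interior of the simplex the classical gradient of q vanishes almost everywhere.
  It is continuous, so the set where it does not vanish is open and null, hence empty. Convexity
  makes q constant there, and the interior is dense in the simplex.\<close>

lemma zero_weak_gradient_constant:
  fixes K :: "(real ^ 'n::finite) set"
  assumes K: "int CARD('n) simplex K" and q: "Ck_on 1 UNIV q" and f: "\<And>x. x \<in> K \<Longrightarrow> f x = q x"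
    and D: "interior K \<subseteq> D" "open D" and g: "is_weak_grad D f g" "AE x in leb D. g x = 0"
  shows "\<exists>c. \<forall>x\<in>K. f x = c"
proof -
  let ?U = "interior K"
  have U: "open ?U" "?U \<subseteq> K" by (simp_all add: interior_subset)
  have conv: "convex K" "closed K" using K convex_simplex closed_simplex by auto
  have ad: "aff_dim K = int DIM(real ^ 'n)" using aff_dim_simplex[OF K] by simp
  then have "K \<noteq> {}" by auto
  then have "?U \<noteq> {}" using ad conv(1) by (simp add: interior_rel_interior_gen rel_interior_eq_empty)
  then have cl: "closure ?U = K" using convex_closure_interior[OF conv(1)] conv(2) by (simp add: closure_closed)
  have qd: "q differentiable (at x)" for x using q by simp
  have "is_weak_grad ?U f g" by (rule weak_grad_subset[OF g(1) D(1)]) (use U(1) D(2) in auto)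
  moreover have "is_weak_grad ?U f = is_weak_grad ?U q" by (rule weak_grad_cong[OF f[OF subsetD[OF U(2)]]])
  ultimately have "is_weak_grad ?U q g" by simp
  from weak_grad_classical_AE[OF U(1) Ck_on_subset[OF q subset_UNIV] this]
  have "AE x in leb ?U. g x = cgrad q x" .
  then have n1: "negligible {x \<in> ?U. \<not> g x = cgrad q x}" by (simp add: AE_lebesgue_on_iff_negligible)
  have n2: "negligible {x \<in> D. \<not> g x = 0}" using g(2) D(2) by (simp add: AE_lebesgue_on_iff_negligible)
  have "{x \<in> ?U. cgrad q x \<noteq> 0} \<subseteq> {x \<in> ?U. \<not> g x = cgrad q x} \<union> {x \<in> D. \<not> g x = 0}" using D(1) by auto
  then have "negligible {x \<in> ?U. cgrad q x \<noteq> 0}" using negligible_subset[OF negligible_Un[OF n1 n2]] by blast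
  moreover have "open {x \<in> ?U. cgrad q x \<noteq> 0}"
  proof -
    have "continuous_on ?U (cgrad q)" by (rule continuous_on_subset[OF continuous_on_cgrad[OF q]]) simp
    from continuous_open_preimage[OF this U(1), of "- {0}"] have "open (?U \<inter> cgrad q -` (- {0}))" by (simp add: open_Compl)
    moreover have "?U \<inter> cgrad q -` (- {0}) = {x \<in> ?U. cgrad q x \<noteq> 0}" by blast
    ultimately show ?thesis by simp
  qed
  ultimately have e: "{x \<in> ?U. cgrad q x \<noteq> 0} = {}" using open_not_negligible[of "{x \<in> ?U. cgrad q x \<noteq> 0}"] by metis
  have z: "cgrad q x = 0" if "x \<in> ?U" for x using e that by simp
  have "(q has_derivative (\<lambda>v. 0)) (at x within ?U)" if "x \<in> ?U" for x
  proof -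
    have "partial i q x = 0" for i using arg_cong[OF z[OF that], of "\<lambda>y. y $ i"] by (simp add: cgrad_def)
    then have "fderiv q x = (\<lambda>v. 0)"
      by (intro ext) (subst frechet_derivative_components[OF qd[of x]], simp)
    moreover have "(q has_derivative fderiv q x) (at x)" by (rule frechet_derivative_works[THEN iffD1, OF qd])
    ultimately show ?thesis by (simp only: has_derivative_at_withinI)
  qed
  then obtain c where c: "\<forall>x\<in>?U. q x = c" using has_derivative_zero_constant[OF convex_interior[OF conv(1)], of q] by blast
  have "continuous_on (closure ?U) q" by (rule continuous_on_subset[OF Ck_on_imp_continuous_on[OF open_UNIV q]]) simp
  from continuous_constant_on_closure[OF this, of c] have "q x = c" if "x \<in> K" for x using c that cl by blast
  then show ?thesis using f by (intro exI[of _ c]) simp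
qed

context
  fixes Dm Dt :: "(real ^ 'n::finite) set"
  assumes dim2: "2 \<le> CARD('n)" and geo: "geometry Dm Dt"
begin

text \<open>If every element of the space had zero gradient, each would be constant on every simplex and
  could be multiplied by a coordinate without leaving the space.\<close>

lemma fe_gradient_nonzero:
  assumes p: "1 \<le> p" and mesh: "simplicial_mesh (dom_D Dm Dt) \<K>" and f: "f \<in> fe_space p Dm Dt \<K>"
    and f0: "0 < norm2 (dom_D Dm Dt) f"
  shows "\<exists>g \<in> fe_space p Dm Dt \<K>. 0 < norm2 (dom_D Dm Dt) (wgrad (dom_D Dm Dt) g)"
proof (cases "norm2 (dom_D Dm Dt) (wgrad (dom_D Dm Dt) f) = 0")
  case False
  then show ?thesis using f by (intro bexI[of _ f]) (simp_all add: order.strict_iff_order)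
next
  case True
  let ?D = "dom_D Dm Dt" and ?\<Gamma> = "frontier (dom_D Dm Dt)"
  obtain i :: 'n where True by simp
  have D: "open ?D" by (rule open_dom[OF dim2 geo])
  note fin = finite_surface_dom[OF dim2 geo]
  have fV: "f \<in> H10D Dm Dt" and fc: "continuous_on (closure ?D) f" and fp: "\<And>K. K \<in> \<K> \<Longrightarrow> \<exists>q \<in> poly_fun p. \<forall>x \<in> K. f x = q x"
    using f by (auto simp: fe_space_def)
  have f1: "f \<in> H1 ?D" by (rule H10D_D(1)[OF dim2 geo fV])
  have w0: "AE x in leb ?D. wgrad ?D f x = 0" by (rule L2_norm_eq_0_AE[OF wgrad_L2[OF f1] True])
  have "bounded (closure ?D)" by (rule bounded_closure[OF bounded_dom[OF dim2 geo]])
  then obtain b where b: "0 < b" "\<And>x. x \<in> closure ?D \<Longrightarrow> norm x \<le> b" by (meson bounded_pos)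
  \<comment> \<open>The coordinate is cut off outside the domain so that it becomes a test function;
    on the closure of the domain it is unchanged.\<close>
  define \<eta> where "\<eta> x = x $ i * ball_step 0 b x" for x :: "real ^ 'n"
  have \<eta>: "\<eta> \<in> test_functions UNIV" unfolding \<eta>_def
    by (rule test_functions_mult[OF ball_step_test[OF b(1)]]) (rule Ck_on_linear[OF bounded_linear_vec_nth open_UNIV])
  have \<eta>1: "\<eta> x = x $ i" if "x \<in> closure ?D" for x
    using ball_step_eq_1[OF b(1), of x 0] b(2)[OF that] by (simp add: \<eta>_def)
  have DD: "?D \<subseteq> closure ?D" by (rule closure_subset)
  let ?g = "\<lambda>x. cpx (\<eta> x) * f x"
  obtain \<phi> where \<phi>: "trace_on ?D ?\<Gamma> f \<phi>" "AE x in surface (frontier Dm). \<phi> x = 0" using fV by (auto simp: H10D_def)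
  have tg: "trace_on ?D ?\<Gamma> ?g (\<lambda>x. cpx (\<eta> x) * \<phi> x)"
    by (rule trace_on_cutoff[OF \<eta> D D order_refl _ fin _ order_refl \<phi>(1)]) auto
  have gV: "?g \<in> H10D Dm Dt"
    unfolding H10D_def
  proof (intro CollectI conjI exI)
    show "?g \<in> H1 ?D" by (rule trace_onD(1)[OF tg])
    show "trace_on ?D ?\<Gamma> ?g (\<lambda>x. cpx (\<eta> x) * \<phi> x)" by (rule tg)
    show "AE x in surface (frontier Dm). cpx (\<eta> x) * \<phi> x = 0" using \<phi>(2) by eventually_elim simp
  qed
  have KD: "K \<subseteq> closure ?D" and Ks: "int CARD('n) simplex K" if "K \<in> \<K>" for K
    using mesh that by (auto simp: simplicial_mesh_def)
  have "?g \<in> fe_space p Dm Dt \<K>"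
    unfolding fe_space_def
  proof (intro CollectI conjI ballI)
    show "?g \<in> H10D Dm Dt" by (rule gV)
    show "continuous_on (closure ?D) ?g"
      by (intro continuous_intros fc continuous_on_subset[OF test_functions_continuous[OF \<eta>]]) simp
    fix K assume K: "K \<in> \<K>"
    obtain q where q: "q \<in> poly_fun p" "\<forall>x \<in> K. f x = q x" by (rule bexE[OF fp[OF K]])
    have KI: "interior K \<subseteq> ?D" by (rule order_trans[OF interior_mono[OF KD[OF K]] interior_closure_dom[OF dim2 geo]])
    \<comment> \<open>Constancy on the simplex makes the product with a coordinate a polynomial of
      degree one, so it stays in the space for every degree p \<ge> 1.\<close>
    have "\<exists>c. \<forall>x\<in>K. f x = c"
      by (rule zero_weak_gradient_constant[OF Ks[OF K] poly_fun_smooth[OF q(1)] q(2)[rule_format] KI D is_weak_grad_wgrad[OF f1] w0])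
    then obtain c where c: "\<forall>x\<in>K. f x = c" ..
    show "\<exists>q \<in> poly_fun p. \<forall>x \<in> K. ?g x = q x"
    proof (rule bexI[OF _ poly_fun_coordinate[OF p]], rule ballI)
      fix x assume x: "x \<in> K"
      show "?g x = c * cpx (x $ i)" using \<eta>1[OF subsetD[OF KD[OF K] x]] bspec[OF c x] by (simp add: mult.commute)
    qed
  qed
  \<comment> \<open>By the product rule the i-th component of the gradient is f itself, since the
    gradient of f vanishes; its norm is positive by assumption.\<close>
  moreover have "0 < norm2 ?D (wgrad ?D ?g)"
  proof -
    have pd: "partial i \<eta> x = 1" if "x \<in> ?D" for x
    proof -
      have "((\<lambda>x :: real ^ 'n. x $ i) has_derivative (\<lambda>v. v $ i)) (at x)"
        by (rule bounded_linear_imp_has_derivative[OF bounded_linear_vec_nth])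
      then have "(\<eta> has_derivative (\<lambda>v. v $ i)) (at x)"
        by (rule has_derivative_transform_within_open[OF _ D that]) (simp add: \<eta>1[OF subsetD[OF DD]])
      then show ?thesis by (simp add: frechet_derivative_eq axis_def)
    qed
    obtain C where "\<And>v g. v \<in> L2 (leb ?D) \<Longrightarrow> is_weak_grad ?D v g \<Longrightarrow> is_weak_grad ?D (\<lambda>x. cpx (\<eta> x) * v x) (cutoff_grad \<eta> v g)"
      by (rule cutoff_mult[OF \<eta> D D order_refl]) auto
    from this[OF H1_L2[OF f1] is_weak_grad_wgrad[OF f1]]
    have "AE x in leb ?D. wgrad ?D ?g x = cutoff_grad \<eta> f (wgrad ?D f) x" by (rule wgrad_AE[OF D])
    moreover have "AE x in leb ?D. x \<in> ?D" by (rule AE_I2) simp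
    ultimately have "AE x in leb ?D. wgrad ?D ?g x $ i = f x"
      using w0 by eventually_elim (simp add: cutoff_grad_def pd)
    moreover have "(\<lambda>x. wgrad ?D ?g x $ i) \<in> L2 (leb ?D)" by (rule L2_vec_nth[OF wgrad_L2[OF trace_onD(1)[OF tg]]])
    ultimately have "norm2 ?D (\<lambda>x. wgrad ?D ?g x $ i) = norm2 ?D f"
      using H1_L2[OF f1] by (intro L2_norm_cong_AE L2_D(1))
    then show ?thesis using f0 L2_norm_vec_nth[OF wgrad_L2[OF trace_onD(1)[OF tg]], of i] by simp
  qed
  ultimately show ?thesis by blast
qed

end

section \<open>The preconditioned matrices\<close>

lemma inverse_symmetric:
  fixes M B :: "complex mat"
  assumes M: "M \<in> carrier_mat N N" "M\<^sup>T = M" and B: "B \<in> carrier_mat N N" "M * B = 1\<^sub>m N" "B * M = 1\<^sub>m N"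
  shows "B\<^sup>T = B"
proof -
  have Bt: "B\<^sup>T \<in> carrier_mat N N" using B(1) by simp
  have "B\<^sup>T * M = 1\<^sub>m N"
    using transpose_mult[OF M(1) B(1)] by (simp add: M(2) B(2))
  have "B\<^sup>T = B\<^sup>T * (M * B)" using B(2) Bt by simp
  also have "\<dots> = (B\<^sup>T * M) * B" by (rule assoc_mult_mat[OF Bt M(1) B(1), symmetric])
  also have "\<dots> = B" using \<open>B\<^sup>T * M = 1\<^sub>m N\<close> B(1) by simp
  finally show ?thesis .
qed

text \<open>The hypothesis says that Q, the inverse of M times M - M2, contracts, and Q is the
  identity minus the left-preconditioned matrix. As M, its inverse and M2 are symmetric, the
  transpose of Q is the identity minus the right-preconditioned matrix, with the same rate.\<close>

lemma preconditioned_contraction: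
  fixes M M2 :: "complex mat"
  assumes M: "M \<in> carrier_mat N N" "M\<^sup>T = M" "Determinant.det M \<noteq> 0" and M2: "M2 \<in> carrier_mat N N" "M2\<^sup>T = M2"
    and le: "\<And>x y. x \<in> carrier_vec N \<Longrightarrow> y \<in> carrier_vec N \<Longrightarrow> M *\<^sub>v y = (M - M2) *\<^sub>v x \<Longrightarrow> euclid_norm y \<le> q * euclid_norm x"
    and x: "x \<in> carrier_vec N"
  shows "inv_mat M \<in> carrier_mat N N"
    and "euclid_norm (x - (inv_mat M * M2) *\<^sub>v x) \<le> q * euclid_norm x"
    and "euclid_norm (x - (M2 * inv_mat M) *\<^sub>v x) \<le> q * euclid_norm x"
proof -
  obtain B where B: "mat_inverse M = Some B" "B \<in> carrier_mat N N" "M * B = 1\<^sub>m N" "B * M = 1\<^sub>m N"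
    by (rule det_nonzero_inverse[OF M(1,3)])
  have inv: "inv_mat M = B" by (simp add: B(1))
  then show "inv_mat M \<in> carrier_mat N N" using B(2) by simp
  have E: "M - M2 \<in> carrier_mat N N" using M2(1) by (rule minus_carrier_mat)
  define Q where "Q = B * (M - M2)"
  have Q: "Q \<in> carrier_mat N N" unfolding Q_def by (rule mult_carrier_mat[OF B(2) E])
  have Qle: "euclid_norm (Q *\<^sub>v x) \<le> q * euclid_norm x" if "x \<in> carrier_vec N" for x
  proof (rule le[OF that])
    show "Q *\<^sub>v x \<in> carrier_vec N" by (rule mult_mat_vec_carrier[OF Q that])
    have "M *\<^sub>v (Q *\<^sub>v x) = (M * Q) *\<^sub>v x" by (rule assoc_mult_mat_vec[OF M(1) Q that, symmetric])
    also have "M * Q = (M * B) * (M - M2)" unfolding Q_def by (rule assoc_mult_mat[OF M(1) B(2) E, symmetric])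
    also have "\<dots> = M - M2" unfolding B(3) by (rule left_mult_one_mat[OF E])
    finally show "M *\<^sub>v (Q *\<^sub>v x) = (M - M2) *\<^sub>v x" .
  qed
  have "Q = 1\<^sub>m N - B * M2"
    unfolding Q_def mult_minus_distrib_mat[OF B(2) M(1) M2(1)] B(4) ..
  then have "Q *\<^sub>v x = x - (B * M2) *\<^sub>v x"
    using minus_mult_distrib_mat_vec[OF one_carrier_mat mult_carrier_mat[OF B(2) M2(1)] x] x by simp
  then show "euclid_norm (x - (inv_mat M * M2) *\<^sub>v x) \<le> q * euclid_norm x" using Qle[OF x] unfolding inv by simp
  have "Q\<^sup>T = (M - M2)\<^sup>T * B\<^sup>T" unfolding Q_def by (rule transpose_mult[OF B(2) E])
  also have "\<dots> = (M - M2) * B"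
    unfolding transpose_minus[OF M(1) M2(1)] M(2) M2(2) inverse_symmetric[OF M(1,2) B(2,3,4)] ..
  also have "\<dots> = 1\<^sub>m N - M2 * B" unfolding minus_mult_distrib_mat[OF M(1) M2(1) B(2)] B(3) ..
  finally have "Q\<^sup>T *\<^sub>v x = x - (M2 * B) *\<^sub>v x"
    using minus_mult_distrib_mat_vec[OF one_carrier_mat mult_carrier_mat[OF M2(1) B(2)] x] x by simp
  then show "euclid_norm (x - (M2 * inv_mat M) *\<^sub>v x) \<le> q * euclid_norm x"
    using transpose_contraction[OF Q Qle x] unfolding inv by simp
qed

lemma (in fem) Linf_op_norm_nonneg:
  assumes "Linf_mat D B"
  shows "0 \<le> Linf_op_norm D B"
proof (rule bound_nonneg)
  show "AE x in leb D. 0 \<le> onorm (\<lambda>\<zeta>. B x *v \<zeta>) \<and> onorm (\<lambda>\<zeta>. B x *v \<zeta>) \<le> Linf_op_norm D B"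
    using Linf_op_norm_AE[OF assms] by eventually_elim (simp add: onorm_pos_le[OF matrix_vector_mul_bounded_linear])
qed

text \<open>From sqrt 2 \<le> 10/7 the rate is at most 5/7, and (1 + 5/7) / (1 - 5/7) = 6.\<close>

lemma contraction_rate: "0 \<le> sqrt 2 / 2" "sqrt 2 / 2 < 1" "(1 + sqrt 2 / 2) / (1 - sqrt 2 / 2) \<le> 6"
proof -
  have s: "0 \<le> sqrt 2" "sqrt 2 \<le> 10 / 7"
    by simp (rule real_le_lsqrt, simp_all add: power2_eq_square)
  show "0 \<le> sqrt 2 / 2" "sqrt 2 / 2 < 1" using s by linarith+
  then show "(1 + sqrt 2 / 2) / (1 - sqrt 2 / 2) \<le> 6" using s(2) by (simp add: pos_divide_le_eq)
qed

theorem theorem2p3: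
  fixes Dm Dt :: "(real ^ 'n::finite) set"
    and T :: "real \<Rightarrow> 'n boundary_op"
    and A1 A2 :: "real \<Rightarrow> real ^ 'n \<Rightarrow> real ^ 'n ^ 'n"
    and n1 n2 :: "real \<Rightarrow> real ^ 'n \<Rightarrow> real"
    and A1min A1max A2min A2max n1min n1max n2min n2max :: real
    and k0 Cbound1 Cbound2 :: real
  assumes dim: "CARD('n) \<in> {2, 3}"
    and geometry: "geometry Dm Dt"
    and k0: "0 < k0"
    and T: "(\<forall>k\<ge>k0. is_impedance k Dt (T k)) \<or> (\<forall>k\<ge>k0. is_DtN k Dt (T k))"
    and A1: "\<And>k. k0 \<le> k \<Longrightarrow> admissible_A Dm Dt (A1 k) A1min A1max"
    and A2: "\<And>k. k0 \<le> k \<Longrightarrow> admissible_A Dm Dt (A2 k) A2min A2max"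
    and n1: "\<And>k. k0 \<le> k \<Longrightarrow> admissible_n Dm Dt (n1 k) n1min n1max"
    and n2: "\<And>k. k0 \<le> k \<Longrightarrow> admissible_n Dm Dt (n2 k) n2min n2max"
    and N1: "condition_N Dm Dt T A1 n1 k0 Cbound1"
    and N2: "condition_N Dm Dt T A2 n2 k0 Cbound2"
  shows "\<exists>c2>0. \<forall>\<epsilon>>0. \<exists>c1>0.
    \<forall>(p::nat) (H::real set) (\<K>::real \<Rightarrow> (real ^ 'n) set set) (N::real \<Rightarrow> nat)
      (\<phi>::real \<Rightarrow> nat \<Rightarrow> real ^ 'n \<Rightarrow> real) (h::real \<Rightarrow> real)
      m_minus m_plus s_plus CFEM1_1 CFEM2_1 CFEM1_2 CFEM2_2.
      let D = dom_D Dm Dt;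
          V = (\<lambda>h. fe_space p Dm Dt (\<K> h));
          C1 = CFEM2_1 + 1 / min A1min n1min * (1 / k0 + 2 * Cbound1 * n1max);
          C2 = CFEM1_1 + Cbound1
      in
        1 \<le> p \<and> quasi_uniform_family D H \<K> \<and>
        (\<forall>h\<in>H. nodal_basis D (V h) (N h) (\<phi> h)) \<and>
        norm_equivalence D H N \<phi> m_minus m_plus s_plus \<and>
        (\<forall>k\<ge>k0. h k \<in> H) \<and>
        condition_F Dm Dt T A1 n1 V N \<phi> h k0 CFEM1_1 CFEM2_1 \<and>
        condition_F Dm Dt T A2 n2 V N \<phi> h k0 CFEM1_2 CFEM2_2 \<and>
        (\<forall>k\<ge>k0.
           C1 * (s_plus / m_minus) * (1 / h k) * Linf_op_norm D (\<lambda>x. A1 k x - A2 k x)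
           + C2 * (m_plus / m_minus) * k * Linf_norm D (\<lambda>x. n1 k x - n2 k x) \<le> 1 / 2)
        \<longrightarrow>
        (\<forall>k\<ge>k0. \<forall>F \<in> H10D_dual Dm Dt.
           let \<A>1 = galerkin_mat k D (T k) (A1 k) (n1 k) (N (h k)) (\<phi> (h k));
               \<A>2 = galerkin_mat k D (T k) (A2 k) (n2 k) (N (h k)) (\<phi> (h k));
               f = load_vec (N (h k)) (\<phi> (h k)) F
           in f \<noteq> 0\<^sub>v (N (h k)) \<longrightarrow>
              invertible_mat \<A>1 \<and>
              (\<forall>m::nat. c1 \<le> real m \<longrightarrow>
                 gmres_error_le (inv_mat \<A>1 * \<A>2) (inv_mat \<A>1 *\<^sub>v f) m (c2 * \<epsilon>) \<and>
                 gmres_error_le (\<A>2 * inv_mat \<A>1) f m (c2 * \<epsilon>)))"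
proof (rule exI[of _ 6], rule conjI, simp, rule allI, rule impI, goal_cases)
  case (1 \<epsilon>)
  then have \<epsilon>: "0 < \<epsilon>" .
  let ?q = "sqrt 2 / 2 :: real"
  \<comment> \<open>The number of iterations depends on \<epsilon> alone; the remaining factor (1 +
    q) / (1 - q) is absorbed into the 6 chosen for c2.\<close>
  obtain m0 where m0: "?q ^ m0 < \<epsilon>" using real_arch_pow_inv[OF \<epsilon> contraction_rate(2)] by blast
  have rate: "?q ^ m * (1 + ?q) / (1 - ?q) \<le> 6 * \<epsilon>" if "real m0 + 1 \<le> real m" for m
  proof -
    have "m0 \<le> m" using that by simp
    then have "?q ^ m \<le> ?q ^ m0" by (rule power_decreasing) (use contraction_rate in \<open>simp_all only: less_imp_le\<close>)
    then have "?q ^ m \<le> \<epsilon>" using m0 by linarith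
    moreover have "0 \<le> (1 + ?q) / (1 - ?q)"
      by (rule divide_nonneg_nonneg) (use contraction_rate(1,2) in linarith)+
    ultimately have "?q ^ m * ((1 + ?q) / (1 - ?q)) \<le> \<epsilon> * 6"
      by (rule mult_mono[OF _ contraction_rate(3) less_imp_le[OF \<epsilon>]])
    then show ?thesis by (simp only: times_divide_eq_right mult.commute[of \<epsilon>])
  qed
  let ?D = "dom_D Dm Dt"
  have dim2: "2 \<le> CARD('n)" using dim by auto
  show ?case
    unfolding Let_def
  \<comment> \<open>The summand 1 makes the threshold positive even when m0 is 0.\<close>
  proof (rule exI[of _ "real m0 + 1"], rule conjI, simp, intro allI impI ballI, (elim conjE)?)
    fix p H \<K> N \<phi> h m_minus m_plus s_plus CFEM1_1 CFEM2_1 CFEM1_2 CFEM2_2 k F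
    assume p: "(1::nat) \<le> p" and qu: "quasi_uniform_family ?D H \<K>"
      and nb: "\<forall>h\<in>H. nodal_basis ?D (fe_space p Dm Dt (\<K> h)) (N h) (\<phi> h)"
      and ne: "norm_equivalence ?D H N \<phi> m_minus m_plus s_plus" and hH: "\<forall>k\<ge>k0. h k \<in> H"
      and F1: "condition_F Dm Dt T A1 n1 (\<lambda>h. fe_space p Dm Dt (\<K> h)) N \<phi> h k0 CFEM1_1 CFEM2_1"
      and small: "\<forall>k\<ge>k0.
           (CFEM2_1 + 1 / min A1min n1min * (1 / k0 + 2 * Cbound1 * n1max)) * (s_plus / m_minus) * (1 / h k) * Linf_op_norm ?D (\<lambda>x. A1 k x - A2 k x)
           + (CFEM1_1 + Cbound1) * (m_plus / m_minus) * k * Linf_norm ?D (\<lambda>x. n1 k x - n2 k x) \<le> 1 / 2"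
      and kk: "k0 \<le> k" and F: "F \<in> H10D_dual Dm Dt" and f0: "load_vec (N (h k)) (\<phi> (h k)) F \<noteq> 0\<^sub>v (N (h k))"
    let ?h = "h k" and ?N = "N (h k)" and ?\<phi> = "\<phi> (h k)" and ?W = "fe_space p Dm Dt (\<K> (h k))"
    let ?M1 = "galerkin_mat k ?D (T k) (A1 k) (n1 k) ?N ?\<phi>" and ?M2 = "galerkin_mat k ?D (T k) (A2 k) (n2 k) ?N ?\<phi>"
    have k: "0 < k" using k0 kk by linarith
    have hk: "?h \<in> H" and hpos: "0 < ?h" and mesh: "simplicial_mesh ?D (\<K> ?h)"
      using hH kk qu by (auto simp: quasi_uniform_family_def)
    note nbk = nb[rule_format, OF hk]
    \<comment> \<open>A nonzero load vector has at least one entry, so the finite-element space is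
      not trivial.\<close>
    have N0: "0 < ?N"
    proof (rule ccontr)
      assume "\<not> 0 < ?N"
      then have "load_vec ?N ?\<phi> F = 0\<^sub>v ?N" by (intro eq_vecI) (simp_all add: load_vec_def)
      with f0 show False by simp
    qed
    have Tk: "boundary_condition k Dt (T k)" using T kk by (auto simp: boundary_condition_def)
    have basis: "cbasis ?\<phi> i \<in> ?W" if "i < ?N" for i using nbk that by (simp add: nodal_basis_def)
    have A1k: "A1 k \<in> Linf_SPD ?D" and A2k: "A2 k \<in> Linf_SPD ?D" and n1k: "n1 k \<in> Linf ?D" and n2k: "n2 k \<in> Linf ?D"
      using A1[OF kk] A2[OF kk] n1[OF kk] n2[OF kk] by (auto simp: admissible_A_def admissible_n_def)
    have G: "galerkin k Dm Dt (T k) A n ?N ?\<phi>" if "A \<in> Linf_SPD ?D" "n \<in> Linf ?D" for A n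
      using dim2 geometry k Tk Linf_SPD_mat[OF that(1)] that(2) basis by unfold_locales (auto simp: fe_space_def)
    interpret G1: galerkin k Dm Dt "T k" "A1 k" "n1 k" ?N ?\<phi> by (rule G[OF A1k n1k])
    interpret G2: galerkin k Dm Dt "T k" "A2 k" "n2 k" ?N ?\<phi> by (rule G[OF A2k n2k])
    define \<mu> where "\<mu> = m_minus * ?h powr (real CARD('n) / 2)"
    define \<mu>' where "\<mu>' = m_plus * ?h powr (real CARD('n) / 2)"
    define \<sigma> where "\<sigma> = s_plus * ?h powr (real CARD('n) / 2 - 1)"
    have pos: "0 < m_minus" "0 < m_plus" "0 < s_plus" and nes: "\<mu> * euclid_norm (Matrix.vec ?N c) \<le> norm2 ?D (fe_fun ?N ?\<phi> c)"
      "norm2 ?D (fe_fun ?N ?\<phi> c) \<le> \<mu>' * euclid_norm (Matrix.vec ?N c)"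
      "norm2 ?D (wgrad ?D (fe_fun ?N ?\<phi> c)) \<le> \<sigma> * euclid_norm (Matrix.vec ?N c)" for c
      using ne hk unfolding norm_equivalence_def Let_def \<mu>_def \<mu>'_def \<sigma>_def by blast+
    have \<mu>: "0 < \<mu>" and \<mu>': "0 \<le> \<mu>'" and \<sigma>: "0 \<le> \<sigma>" using pos hpos by (simp_all add: \<mu>_def \<mu>'_def \<sigma>_def)
    interpret fem k Dm Dt "T k" "A1 k" "n1 k" ?N ?\<phi> ?W Cbound1 CFEM1_1 CFEM2_1 \<mu>
    proof (unfold_locales, goal_cases)
      case 1
      show ?case by (rule nbk)
    next
      case (2 f)
      then show ?case using N1 kk unfolding condition_N_def Let_def by blast
    next
      case (3 m \<alpha>)
      then show ?case using F1 kk unfolding condition_F_def Let_def by blast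
    next
      case (4 A' \<alpha>)
      then show ?case using F1 kk unfolding condition_F_def Let_def by blast
    qed (fact \<mu> nes(1) N0)+
    \<comment> \<open>A basis function has positive norm by the norm equivalence. It yields a
      function with nonzero gradient in the space, and this fixes the sign of the constant.\<close>
    have K: "0 \<le> CFEM2_1 + Cbound1"
    proof -
      have b0: "cbasis ?\<phi> 0 = fe_fun ?N ?\<phi> (\<lambda>i. if i = 0 then 1 else 0)"
        using N0 by (simp add: fe_fun_def fun_eq_iff if_distrib[of "\<lambda>c. c * _"] cong: if_cong)
      have "0 < euclid_norm (Matrix.vec ?N (\<lambda>i. if i = 0 then 1 else 0))"
        using N0 by (simp add: euclid_norm_def if_distrib[of cmod] if_distrib[of "\<lambda>c. c\<^sup>2"] cong: if_cong)
      then have "0 < \<mu> * euclid_norm (Matrix.vec ?N (\<lambda>i. if i = 0 then 1 else 0))" using \<mu> by simp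
      also note nes(1)
      finally have "0 < norm2 ?D (cbasis ?\<phi> 0)" unfolding b0 .
      then obtain g where g: "g \<in> ?W" "0 < norm2 ?D (wgrad ?D g)"
        using fe_gradient_nonzero[OF dim2 geometry p mesh basis[OF N0]] by blast
      obtain c where c: "\<forall>x\<in>closure ?D. g x = fe_fun ?N ?\<phi> c x" using nbk g(1) unfolding nodal_basis_def by blast
      have "wgrad ?D g = wgrad ?D (fe_fun ?N ?\<phi> c)" by (rule wgrad_cong) (use c closure_subset[of ?D] in auto)
      with g(2) show ?thesis by (intro C2_Cb_nonneg[of c]) simp
    qed
    have n1m: "0 < n1min" "0 < A1min" and n1b: "AE x in leb ?D. n1min \<le> n1 k x \<and> n1 k x \<le> n1max"
      using n1[OF kk] A1[OF kk] by (auto simp: admissible_n_def admissible_A_def)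
    \<comment> \<open>The bounds on \<open>n1\<close> hold only almost everywhere; they are
      comparable because the domain is not a null set.\<close>
    have "0 \<le> n1max - n1min" by (rule bound_nonneg[of "\<lambda>x. n1 k x - n1min"]) (use n1b in \<open>auto elim!: eventually_mono\<close>)
    then have nm: "min A1min n1min \<le> n1max" by simp
    let ?mn = "min A1min n1min"
    have mn: "0 < ?mn" using n1m by simp
    \<comment> \<open>This puts CFEM2 + Cbound below the constant of the hypothesis: n1max is at
      least \<open>?mn\<close>, so \<open>Cbound1 * n1max\<close> alone already suffices, the other
      terms being nonnegative.\<close>
    have "Cbound1 * ?mn \<le> 1 / k0 + 2 * Cbound1 * n1max"
    proof -
      have "0 \<le> n1max" using nm mn by linarith
      with Cb_nonneg have "0 \<le> Cbound1 * n1max" by (rule mult_nonneg_nonneg)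
      moreover have "Cbound1 * ?mn \<le> Cbound1 * n1max" by (rule mult_left_mono[OF nm Cb_nonneg])
      moreover have "0 \<le> 1 / k0" using k0 by simp
      ultimately have "Cbound1 * ?mn \<le> 1 / k0 + 2 * (Cbound1 * n1max)" by linarith
      then show ?thesis by (simp only: mult.assoc)
    qed
    then have "Cbound1 \<le> 1 / ?mn * (1 / k0 + 2 * Cbound1 * n1max)" using mn by (simp add: pos_le_divide_eq)
    then have C: "CFEM2_1 + Cbound1 \<le> CFEM2_1 + 1 / ?mn * (1 / k0 + 2 * Cbound1 * n1max)" by simp
    let ?\<beta> = "Linf_op_norm ?D (\<lambda>x. A1 k x - A2 k x)" and ?\<nu> = "Linf_norm ?D (\<lambda>x. n1 k x - n2 k x)"
    let ?C = "CFEM2_1 + 1 / ?mn * (1 / k0 + 2 * Cbound1 * n1max)"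
    have \<beta>: "0 \<le> ?\<beta>" by (rule Linf_op_norm_nonneg[OF Linf_mat_diff[OF G1.A(1) G2.A(1)]])
    \<comment> \<open>The powers h^(d/2) are common to the norm equivalences; the gradient has one
      power less, which is the factor 1/h of the hypothesis.\<close>
    have rates: "\<sigma> = \<mu> * (s_plus / m_minus) * (1 / ?h)" "\<mu>' = \<mu> * (m_plus / m_minus)"
      using pos hpos by (simp_all add: \<mu>_def \<mu>'_def \<sigma>_def powr_diff)
    have alg: "C * (m * s * r) * b + k * E * (m * t) * v = m * (C * s * r * b + E * t * k * v)" for C m s r b k E t v :: real
      by (simp add: algebra_simps)
    have "(CFEM2_1 + Cbound1) * \<sigma> * ?\<beta> + k * (CFEM1_1 + Cbound1) * \<mu>' * ?\<nu> \<le> ?C * \<sigma> * ?\<beta> + k * (CFEM1_1 + Cbound1) * \<mu>' * ?\<nu>"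
      using C \<sigma> \<beta> by (intro add_right_mono mult_right_mono)
    also have "\<dots> = \<mu> * (?C * (s_plus / m_minus) * (1 / ?h) * ?\<beta> + (CFEM1_1 + Cbound1) * (m_plus / m_minus) * k * ?\<nu>)"
      unfolding rates by (rule alg)
    also have "\<dots> \<le> \<mu> * (1 / 2)" by (rule mult_left_mono[OF small[rule_format, OF kk] less_imp_le[OF \<mu>(1)]])
    finally have le: "(CFEM2_1 + Cbound1) * \<sigma> * ?\<beta> + k * (CFEM1_1 + Cbound1) * \<mu>' * ?\<nu> \<le> \<mu> / 2" by simp
    note contr = contraction[OF G2.galerkin_axioms \<mu>' nes(2) \<sigma> nes(3) K le]
    note pre = preconditioned_contraction[OF G1.M_dim(3) G1.M_symmetric M_det G2.M_dim(3) G2.M_symmetric contr]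
    have B: "inv_mat ?M1 \<in> carrier_mat ?N ?N" by (rule pre(1)[OF _ _ _ zero_carrier_vec])
    have fc: "load_vec ?N ?\<phi> F \<in> carrier_vec ?N" by (simp add: load_vec_def)
    show "invertible_mat ?M1 \<and> (\<forall>m. real m0 + 1 \<le> real m \<longrightarrow>
        gmres_error_le (inv_mat ?M1 * ?M2) (inv_mat ?M1 *\<^sub>v load_vec ?N ?\<phi> F) m (6 * \<epsilon>) \<and>
        gmres_error_le (?M2 * inv_mat ?M1) (load_vec ?N ?\<phi> F) m (6 * \<epsilon>))"
    proof (intro conjI allI impI)
      show "invertible_mat ?M1" by (rule det_nonzero_invertible[OF G1.M_dim(3) M_det])
      fix m assume m: "real m0 + 1 \<le> real m"
      show "gmres_error_le (inv_mat ?M1 * ?M2) (inv_mat ?M1 *\<^sub>v load_vec ?N ?\<phi> F) m (6 * \<epsilon>)"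
        by (rule gmres_error_le_mono[OF gmres_convergence[OF mult_carrier_mat[OF B G2.M_dim(3)] mult_mat_vec_carrier[OF B fc] contraction_rate(1,2) pre(2)] rate[OF m]])
      show "gmres_error_le (?M2 * inv_mat ?M1) (load_vec ?N ?\<phi> F) m (6 * \<epsilon>)"
        by (rule gmres_error_le_mono[OF gmres_convergence[OF mult_carrier_mat[OF G2.M_dim(3) B] fc contraction_rate(1,2) pre(3)] rate[OF m]])
    qed
  qed
qed

end
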